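(* Let $d,k \in \mathbf{N}$ with $d \geq 2k + 6$ and let $\alpha \in (0,1)$. There exist $q_0 = q_0(\alpha,k)$ and $c = c(\alpha,k) > 0$ such that the following holds for every odd prime power $q \geq q_0$: if $A \subseteq \mathbf{F}_q^d$ satisfies $|A| \geq \alpha q^d$, then for every $(k+2)$-point spherical configuration $X \subseteq \mathbf{F}_q^d$ spanning $k$ dimensions, $A$ contains at least $c\, q^{(k + 1)d - k(k + 1)/2}$ isometric copies of $X$.
   Context: $\mathbf{F}_q$ is a finite field of odd characteristic. For $v,w\in\mathbf{F}_q^d$, $v\cdot w=\sum_{j=1}^d v_jw_j$ and $|v|^2 := v\cdot v$ (an $\mathbf{F}_q$-valued "length"; $|v-w|^2$ is the "distance"). For $u\in\mathbf{F}_q^d$ and $\lambda\in\mathbf{F}_q$, the sphere is $S_\lambda(u)=\{x\in\mathbf{F}_q^d : |x-u|^2=\lambda\}$. A finite set $X\subseteq\mathbf{F}_q^d$ spans $k$ dimensions if $\dim \operatorname{Span}(X-X)=k$, and is spherical if $X\subseteq S_\lambda(u)$ for some $u\in\mathbf{F}_q^d$, $\lambda\in\mathbf{F}_q$. Two sets $X,X'$ are isometric if there is a bijection $\phi:X\to X'$ with $|\phi(x)-\phi(x')|^2=|x-x'|^2$ for all $x,x'\in X$; an isometric copy of $X$ in $A$ is a subset of $A$ isometric to $X$. *)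

theory Defs
  imports Complex_Main "Jordan_Normal_Form.Missing_VectorSpace"
begin

text \<open>
  The statement quantifies over all finite fields inside the scope of constants that must not
  depend on the field. Hence a field is a ring record \<open>F\<close> with an explicit carrier, and the
  coordinate space of dimension \<open>d\<close> over \<open>F\<close> is the space of functions on \<open>{..<d}\<close>
  (coordinates are numbered from \<open>0\<close>; functions are \<open>undefined\<close> outside \<open>{..<d}\<close>).
\<close>

definition coord_space :: "'a ring \<Rightarrow> nat \<Rightarrow> ('a, nat \<Rightarrow> 'a) module" where
  "coord_space F d = ring.func_space F {..<d}"

lemma vectorspace_coord_space:
  assumes "field F" shows "vectorspace F (coord_space F d)"
proof -
  interpret field F by fact
  show ?thesis
    unfolding coord_space_def vectorspace_def
    using assms func_space_is_module by blast
qed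

lemma carrier_coord_space:
  assumes "field F" shows "carrier (coord_space F d) = {..<d} \<rightarrow>\<^sub>E carrier F"
proof -
  interpret field F by fact
  show ?thesis by (simp add: coord_space_def func_space_def)
qed

lemma diff_coord_space:
  assumes "field F" "v \<in> carrier (coord_space F d)" "w \<in> carrier (coord_space F d)"
  shows "v \<ominus>\<^bsub>coord_space F d\<^esub> w = (\<lambda>j\<in>{..<d}. v j \<ominus>\<^bsub>F\<^esub> w j)"
proof -
  interpret field F by fact
  have "\<ominus>\<^bsub>coord_space F d\<^esub> w = (\<lambda>j. if j \<in> {..<d} then \<ominus>\<^bsub>F\<^esub> w j else undefined)"
    using func_space_neg assms(3) unfolding coord_space_def by blast
  then show ?thesis
    by (simp add: a_minus_def) (auto simp: coord_space_def func_space_def a_minus_def)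
qed

definition dot :: "'a ring \<Rightarrow> nat \<Rightarrow> (nat \<Rightarrow> 'a) \<Rightarrow> (nat \<Rightarrow> 'a) \<Rightarrow> 'a" where
  "dot F d v w = (\<Oplus>\<^bsub>F\<^esub>j\<in>{..<d}. v j \<otimes>\<^bsub>F\<^esub> w j)"

definition sq_length :: "'a ring \<Rightarrow> nat \<Rightarrow> (nat \<Rightarrow> 'a) \<Rightarrow> 'a" where
  "sq_length F d v = dot F d v v"

definition sq_dist :: "'a ring \<Rightarrow> nat \<Rightarrow> (nat \<Rightarrow> 'a) \<Rightarrow> (nat \<Rightarrow> 'a) \<Rightarrow> 'a" where
  "sq_dist F d v w = sq_length F d (v \<ominus>\<^bsub>coord_space F d\<^esub> w)"

definition fsphere :: "'a ring \<Rightarrow> nat \<Rightarrow> 'a \<Rightarrow> (nat \<Rightarrow> 'a) \<Rightarrow> (nat \<Rightarrow> 'a) set" where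
  "fsphere F d l u = {x \<in> carrier (coord_space F d). sq_dist F d x u = l}"

definition spherical :: "'a ring \<Rightarrow> nat \<Rightarrow> (nat \<Rightarrow> 'a) set \<Rightarrow> bool" where
  "spherical F d X \<longleftrightarrow>
     (\<exists>u \<in> carrier (coord_space F d). \<exists>l \<in> carrier F. X \<subseteq> fsphere F d l u)"

definition diff_set :: "'a ring \<Rightarrow> nat \<Rightarrow> (nat \<Rightarrow> 'a) set \<Rightarrow> (nat \<Rightarrow> 'a) set" where
  "diff_set F d X = {x \<ominus>\<^bsub>coord_space F d\<^esub> y | x y. x \<in> X \<and> y \<in> X}"

definition spans_dim :: "'a ring \<Rightarrow> nat \<Rightarrow> (nat \<Rightarrow> 'a) set \<Rightarrow> nat \<Rightarrow> bool" where
  "spans_dim F d X k \<longleftrightarrow>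
     vectorspace.dim F
       ((coord_space F d)\<lparr>carrier := module.span F (coord_space F d) (diff_set F d X)\<rparr>) = k"

definition isometric :: "'a ring \<Rightarrow> nat \<Rightarrow> (nat \<Rightarrow> 'a) set \<Rightarrow> (nat \<Rightarrow> 'a) set \<Rightarrow> bool" where
  "isometric F d X Y \<longleftrightarrow>
     (\<exists>\<phi>. bij_betw \<phi> X Y \<and>
       (\<forall>x\<in>X. \<forall>x'\<in>X. sq_dist F d (\<phi> x) (\<phi> x') = sq_dist F d x x'))"

definition isometric_copies ::
    "'a ring \<Rightarrow> nat \<Rightarrow> (nat \<Rightarrow> 'a) set \<Rightarrow> (nat \<Rightarrow> 'a) set \<Rightarrow> (nat \<Rightarrow> 'a) set set" where
  "isometric_copies F d X A = {Y. Y \<subseteq> A \<and> isometric F d X Y}"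

end

theory Submission
  imports Defs "HOL-Analysis.Convex" "HOL-Algebra.Multiplicative_Group"
begin

text \<open>
  A set of \<open>k + 2\<close> points \<open>x i\<close> spanning \<open>k\<close> dimensions has an affine relation
  \<open>\<Sum>i. c i * x i = 0\<close>, \<open>\<Sum>i. c i = 0\<close> with at least three nonzero coefficients, and if it is
  spherical then \<open>\<Sum>i. c i * \<bar>x i\<bar>\<^sup>2 = 0\<close> too. One of the points is therefore a barycentre of the
  others, and copies of the set in \<open>A\<close> come from \<open>k + 1\<close> points of \<open>A\<close> with prescribed mutual
  distances whose barycentre lies in \<open>A\<close>. In dimension at least \<open>2 * k + 6\<close>, Gauss sums show that
  the distance conditions behave independently, even when weighted by bounded functions of the
  single points, except for the one consequence \<open>\<Sum>i. c i * \<bar>y i\<bar>\<^sup>2 = 0\<close>. Hence, up to an error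
  \<open>O(1 / sqrt q)\<close>, the normalised number of copies equals the normalised number of solutions of
  \<open>\<Sum>i. c i * (y i, \<bar>y i\<bar>\<^sup>2) = 0\<close> in the lift of \<open>A\<close> to the paraboloid in dimension \<open>d + 1\<close>.

  This is a translation-invariant equation in at least three variables inside a set whose nontrivial
  Fourier coefficients are small. The large sieve bounds the large spectrum of the lift of \<open>A\<close>, so
  averaging over a Bohr set of that spectrum gives a bounded function of the same mean, without
  changing the number of solutions much; by pigeonhole over scales the intermediate part
  of the spectrum is negligible. The smoothed function has many solutions near the diagonal.
\<close>

section \<open>Quadratic spaces over finite fields\<close>

text \<open>The lift of \<open>A\<close> fills only about 1/q of the space of dimension d + 1, so
  for its normalised indicator Parseval bounds the sum of squared coefficients only by q. The large
  sieve replaces q by 2 on the large spectrum, and three nonzero coefficients make cubes, not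
  squares, the sums that matter.

  The choice of scales is nearly circular. Smoothing at scale \<theta> costs O(\<theta>), and this
  must be beaten by the count coming from translations that almost fix the smoothed function.
  Translations from a Bohr set of the spectrum at scale \<theta> would be exponentially rare in a
  power of 1 / \<theta>. They are therefore taken at a coarser scale, fixed before \<theta>; the
  frequencies between the two scales escape their control and must carry little mass.

  The dimension 2k + 6 comes from the Fourier expansion of the remaining quadratic condition. It
  costs a factor q, so the distance conditions on k points must average out up to q^(-3/2), which
  needs q^(k + 3) at most sqrt(q^d).

  Distinct points can be at distance zero, so nondegeneracy is enforced by counting affine
  relations, not by distances.\<close>

lemma unit_mult_cnj: "norm z = 1 \<Longrightarrow> z * cnj z = 1"
  using complex_norm_square[of z] by simp

text \<open>The form and space are abstract because the argument runs in two spaces over the same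
  field: the one of dimension d, where configurations live, and the one of dimension d + 1
  containing the paraboloid. Nondegeneracy of \<open>B\<close> makes the characters
  \<open>e (B x y)\<close> orthogonal.\<close>

locale bilin_space = module R M + field R for R (structure) and M (structure) +
  fixes B :: "'c \<Rightarrow> 'c \<Rightarrow> 'a" and e :: "'a \<Rightarrow> complex"
  assumes finite_scalars: "finite (carrier R)"
    and finite_vectors: "finite (carrier M)"
    and two_nonzero: "\<one> \<oplus> \<one> \<noteq> \<zero>"
    and B_closed [simp, intro]: "\<And>x y. x \<in> carrier M \<Longrightarrow> y \<in> carrier M \<Longrightarrow> B x y \<in> carrier R"
    and B_add: "\<And>x y z. x \<in> carrier M \<Longrightarrow> y \<in> carrier M \<Longrightarrow> z \<in> carrier M \<Longrightarrow>
      B (x \<oplus>\<^bsub>M\<^esub> y) z = B x z \<oplus> B y z"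
    and B_smult: "\<And>a x y. a \<in> carrier R \<Longrightarrow> x \<in> carrier M \<Longrightarrow> y \<in> carrier M \<Longrightarrow>
      B (a \<odot>\<^bsub>M\<^esub> x) y = a \<otimes> B x y"
    and B_comm: "\<And>x y. x \<in> carrier M \<Longrightarrow> y \<in> carrier M \<Longrightarrow> B x y = B y x"
    and B_nondeg: "\<And>x. x \<in> carrier M \<Longrightarrow> (\<And>y. y \<in> carrier M \<Longrightarrow> B x y = \<zero>) \<Longrightarrow> x = \<zero>\<^bsub>M\<^esub>"
    and e_add: "\<And>x y. x \<in> carrier R \<Longrightarrow> y \<in> carrier R \<Longrightarrow> e (x \<oplus> y) = e x * e y"
    and e_norm: "\<And>x. x \<in> carrier R \<Longrightarrow> norm (e x) = 1"
    and e_nontrivial: "\<exists>x\<in>carrier R. e x \<noteq> 1"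
begin

abbreviation "K \<equiv> carrier R"
abbreviation "V \<equiv> carrier M"
abbreviation q :: real where "q \<equiv> real (card (carrier R))"
abbreviation N :: real where "N \<equiv> real (card (carrier M))"

definition sq where "sq x = B x x"
definition sd where "sd x y = sq (x \<ominus>\<^bsub>M\<^esub> y)"

lemma B_add2: "x \<in> V \<Longrightarrow> y \<in> V \<Longrightarrow> z \<in> V \<Longrightarrow> B z (x \<oplus>\<^bsub>M\<^esub> y) = B z x \<oplus> B z y"
  by (metis B_add B_comm M.a_closed)

lemma B_smult2: "a \<in> K \<Longrightarrow> x \<in> V \<Longrightarrow> y \<in> V \<Longrightarrow> B y (a \<odot>\<^bsub>M\<^esub> x) = a \<otimes> B y x"
  by (metis B_smult B_comm smult_closed)

lemma B_zero [simp]: "x \<in> V \<Longrightarrow> B \<zero>\<^bsub>M\<^esub> x = \<zero>" "x \<in> V \<Longrightarrow> B x \<zero>\<^bsub>M\<^esub> = \<zero>"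
proof -
  assume x: "x \<in> V"
  have "B (\<zero> \<odot>\<^bsub>M\<^esub> x) x = \<zero> \<otimes> B x x" by (rule B_smult) (use x in auto)
  thus "B \<zero>\<^bsub>M\<^esub> x = \<zero>" using x by simp
  thus "B x \<zero>\<^bsub>M\<^esub> = \<zero>" using B_comm x by simp
qed

lemma B_minus: "x \<in> V \<Longrightarrow> y \<in> V \<Longrightarrow> B (\<ominus>\<^bsub>M\<^esub> x) y = \<ominus> B x y"
proof -
  assume x: "x \<in> V" and y: "y \<in> V"
  have "B (\<ominus>\<^bsub>M\<^esub> x \<oplus>\<^bsub>M\<^esub> x) y = B (\<ominus>\<^bsub>M\<^esub> x) y \<oplus> B x y"
    by (rule B_add) (use x y in auto)
  hence "\<zero> = B (\<ominus>\<^bsub>M\<^esub> x) y \<oplus> B x y" using x y by (simp add: M.l_neg)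
  thus ?thesis using x y R.minus_equality[of "B (\<ominus>\<^bsub>M\<^esub> x) y" "B x y"] by simp
qed

lemma B_minus2: "x \<in> V \<Longrightarrow> y \<in> V \<Longrightarrow> B y (\<ominus>\<^bsub>M\<^esub> x) = \<ominus> B y x"
  by (metis B_minus B_comm M.a_inv_closed)

lemmas B_simps = B_add B_add2 B_smult B_smult2 B_minus B_minus2 a_minus_def

lemma sq_closed [simp, intro]: "x \<in> V \<Longrightarrow> sq x \<in> K"
  by (simp add: sq_def)

lemma sd_closed [simp, intro]: "x \<in> V \<Longrightarrow> y \<in> V \<Longrightarrow> sd x y \<in> K"
  by (simp add: sd_def)

lemma sq_add: assumes "x \<in> V" "y \<in> V"
  shows "sq (x \<oplus>\<^bsub>M\<^esub> y) = sq x \<oplus> (\<one> \<oplus> \<one>) \<otimes> B x y \<oplus> sq y"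
proof -
  have "B y x = B x y" using assms B_comm by simp
  thus ?thesis using assms B_closed[of x y] B_closed[of x x] B_closed[of y y]
    unfolding sq_def B_add[OF assms(1,2) M.a_closed[OF assms]] B_add2[OF assms assms(1)] B_add2[OF assms assms(2)]
    by algebra
qed

lemma sq_smult: assumes "x \<in> V" "a \<in> K" shows "sq (a \<odot>\<^bsub>M\<^esub> x) = a \<otimes> a \<otimes> sq x"
  using assms unfolding sq_def by (simp add: B_simps m_assoc)

lemma sq_minus: "x \<in> V \<Longrightarrow> sq (\<ominus>\<^bsub>M\<^esub> x) = sq x"
  unfolding sq_def by (simp add: B_simps)

lemma sd_expand: assumes "x \<in> V" "y \<in> V"
  shows "sd x y = sq x \<ominus> (\<one> \<oplus> \<one>) \<otimes> B x y \<oplus> sq y"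
proof -
  have "sd x y = sq x \<oplus> (\<one> \<oplus> \<one>) \<otimes> B x (\<ominus>\<^bsub>M\<^esub> y) \<oplus> sq (\<ominus>\<^bsub>M\<^esub> y)"
    unfolding sd_def a_minus_def using assms by (intro sq_add) auto
  thus ?thesis using assms by (simp add: sq_minus B_minus2 a_minus_def r_minus)
qed

lemma sd_comm: assumes "x \<in> V" "y \<in> V" shows "sd x y = sd y x"
  using B_comm[OF assms] B_closed[OF assms] sq_closed[OF assms(1)] sq_closed[OF assms(2)]
  unfolding sd_expand[OF assms] sd_expand[OF assms(2,1)] by algebra

lemma sd_self [simp]: "x \<in> V \<Longrightarrow> sd x x = \<zero>"
  by (simp add: sd_def sq_def a_minus_def M.r_neg)

lemma e_zero [simp]: "e \<zero> = 1"
proof -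
  have "e (\<zero> \<oplus> \<zero>) = e \<zero> * e \<zero>" by (rule e_add) auto
  moreover have "e \<zero> \<noteq> 0" using e_norm[of \<zero>] by auto
  ultimately show ?thesis by simp
qed

lemma e_nz: "x \<in> K \<Longrightarrow> e x \<noteq> 0"
  using e_norm by fastforce

lemma e_neg: assumes "x \<in> K" shows "e (\<ominus> x) = cnj (e x)"
proof -
  have "e x * e (\<ominus> x) = 1" using e_add[of x "\<ominus> x"] assms by (simp add: R.r_neg)
  moreover have "e x * cnj (e x) = 1" using e_norm[OF assms] by (rule unit_mult_cnj)
  ultimately have "e x * e (\<ominus> x) = e x * cnj (e x)" by (rule trans[OF _ sym])
  thus ?thesis using e_nz[OF assms] by simp
qed

lemma e_finsum: "finite I \<Longrightarrow> f \<in> I \<rightarrow> K \<Longrightarrow> e (finsum R f I) = (\<Prod>i\<in>I. e (f i))"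
proof (induction I rule: finite_induct)
  case (insert x I)
  hence "f x \<in> K" "f \<in> I \<rightarrow> K" by auto
  thus ?case using insert by (simp add: finsum_insert e_add finsum_closed)
qed simp

lemma q_pos: "q > 0" "q \<ge> 2"
proof -
  have "{\<zero>, \<one>} \<subseteq> K" by auto
  hence "card {\<zero>, \<one>} \<le> card K" by (rule card_mono[OF finite_scalars])
  thus "q \<ge> 2" using one_not_zero by simp
  thus "q > 0" by simp
qed

lemma N_pos: "N > 0"
  using finite_vectors M.zero_closed by (auto simp: card_gt_0_iff)

lemma bij_add_scalar: "a \<in> K \<Longrightarrow> bij_betw (\<lambda>x. x \<oplus> a) K K"
  by (rule bij_betw_byWitness[where f' = "\<lambda>x. x \<ominus> a"])
     (auto simp: a_minus_def R.a_assoc R.r_neg R.l_neg)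

lemma bij_add_vector: "a \<in> V \<Longrightarrow> bij_betw (\<lambda>x. x \<oplus>\<^bsub>M\<^esub> a) V V"
  by (rule bij_betw_byWitness[where f' = "\<lambda>x. x \<ominus>\<^bsub>M\<^esub> a"])
     (auto simp: a_minus_def M.a_assoc M.r_neg M.l_neg)

lemma bij_smult: assumes "c \<in> K" "c \<noteq> \<zero>" shows "bij_betw (\<lambda>x. c \<odot>\<^bsub>M\<^esub> x) V V"
proof -
  have c: "inv c \<in> K" "inv c \<otimes> c = \<one>" "c \<otimes> inv c = \<one>"
    using assms field_Units by auto
  show ?thesis
    by (rule bij_betw_byWitness[where f' = "\<lambda>x. inv c \<odot>\<^bsub>M\<^esub> x"])
       (use assms c in \<open>auto simp flip: smult_assoc1\<close>)
qed

lemma bij_smult_scalar: assumes "c \<in> K" "c \<noteq> \<zero>" shows "bij_betw (\<lambda>x. c \<otimes> x) K K"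
proof -
  have c: "inv c \<in> K" "inv c \<otimes> c = \<one>" "c \<otimes> inv c = \<one>"
    using assms field_Units by auto
  show ?thesis
    by (rule bij_betw_byWitness[where f' = "\<lambda>x. inv c \<otimes> x"])
       (use assms c in \<open>auto simp flip: m_assoc\<close>)
qed

lemma bij_uminus: "bij_betw (\<lambda>x. \<ominus>\<^bsub>M\<^esub> x) V V"
  by (rule bij_betw_byWitness[where f' = "\<lambda>x. \<ominus>\<^bsub>M\<^esub> x"]) auto

lemma bij_uminus_scalar: "bij_betw (\<lambda>x. \<ominus> x) K K"
  by (rule bij_betw_byWitness[where f' = "\<lambda>x. \<ominus> x"]) auto

lemma sum_e_zero: "(\<Sum>x\<in>K. e x) = 0"
proof -
  obtain a where a: "a \<in> K" "e a \<noteq> 1" using e_nontrivial by auto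
  have "(\<Sum>x\<in>K. e x) = (\<Sum>x\<in>K. e (x \<oplus> a))"
    by (rule sum.reindex_bij_betw[OF bij_add_scalar[OF a(1)], symmetric])
  also have "\<dots> = (\<Sum>x\<in>K. e x) * e a" using a by (simp add: e_add sum_distrib_right)
  finally show ?thesis using a by simp
qed

lemma sum_e_mult: assumes "a \<in> K"
  shows "(\<Sum>x\<in>K. e (x \<otimes> a)) = (if a = \<zero> then of_real q else 0)"
proof (cases "a = \<zero>")
  case False
  have "(\<Sum>x\<in>K. e (x \<otimes> a)) = (\<Sum>x\<in>K. e (a \<otimes> x))"
    by (rule sum.cong) (use assms m_comm in auto)
  also have "\<dots> = (\<Sum>x\<in>K. e x)"
    by (rule sum.reindex_bij_betw[OF bij_smult_scalar[OF assms False]])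
  finally show ?thesis using False sum_e_zero by simp
qed simp

definition \<psi> where "\<psi> x y = e (B x y)"

lemma \<psi>_norm [simp]: "x \<in> V \<Longrightarrow> y \<in> V \<Longrightarrow> norm (\<psi> x y) = 1"
  by (simp add: \<psi>_def e_norm)

lemma \<psi>_add: "x \<in> V \<Longrightarrow> y \<in> V \<Longrightarrow> z \<in> V \<Longrightarrow> \<psi> (x \<oplus>\<^bsub>M\<^esub> y) z = \<psi> x z * \<psi> y z"
  by (simp add: \<psi>_def B_add e_add)

lemma \<psi>_add2: "x \<in> V \<Longrightarrow> y \<in> V \<Longrightarrow> z \<in> V \<Longrightarrow> \<psi> z (x \<oplus>\<^bsub>M\<^esub> y) = \<psi> z x * \<psi> z y"
  by (simp add: \<psi>_def B_add2 e_add)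

lemma \<psi>_minus: "x \<in> V \<Longrightarrow> y \<in> V \<Longrightarrow> \<psi> (\<ominus>\<^bsub>M\<^esub> x) y = cnj (\<psi> x y)"
  by (simp add: \<psi>_def B_minus e_neg)

lemma \<psi>_minus2: "x \<in> V \<Longrightarrow> y \<in> V \<Longrightarrow> \<psi> x (\<ominus>\<^bsub>M\<^esub> y) = cnj (\<psi> x y)"
  by (simp add: \<psi>_def B_minus2 e_neg)

lemma \<psi>_comm: "x \<in> V \<Longrightarrow> y \<in> V \<Longrightarrow> \<psi> x y = \<psi> y x"
  by (simp only: \<psi>_def B_comm[of x y])

lemma \<psi>_smult: "a \<in> K \<Longrightarrow> x \<in> V \<Longrightarrow> y \<in> V \<Longrightarrow> \<psi> (a \<odot>\<^bsub>M\<^esub> x) y = \<psi> x (a \<odot>\<^bsub>M\<^esub> y)"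
  by (simp add: \<psi>_def B_smult B_smult2)

lemma \<psi>_zero [simp]: "x \<in> V \<Longrightarrow> \<psi> \<zero>\<^bsub>M\<^esub> x = 1" "x \<in> V \<Longrightarrow> \<psi> x \<zero>\<^bsub>M\<^esub> = 1"
  by (simp_all add: \<psi>_def)

lemma \<psi>_mult_cnj: "x \<in> V \<Longrightarrow> y \<in> V \<Longrightarrow> \<psi> x y * cnj (\<psi> x y) = 1"
  by (rule unit_mult_cnj) simp

lemma sum_\<psi>: assumes x: "x \<in> V"
  shows "(\<Sum>y\<in>V. \<psi> x y) = (if x = \<zero>\<^bsub>M\<^esub> then of_real N else 0)"
proof (cases "x = \<zero>\<^bsub>M\<^esub>")
  case False
  then obtain y where y: "y \<in> V" "B x y \<noteq> \<zero>" using B_nondeg[OF x] by blast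
  obtain a where a: "a \<in> K" "e a \<noteq> 1" using e_nontrivial by auto
  define z where "z = (a \<otimes> inv (B x y)) \<odot>\<^bsub>M\<^esub> y"
  have i: "inv (B x y) \<in> K" "inv (B x y) \<otimes> B x y = \<one>" using x y field_Units by auto
  have z: "z \<in> V" using i a y by (auto simp: z_def)
  have "B x z = a" using i a y x by (simp add: z_def B_smult2 m_assoc)
  hence "\<psi> x z \<noteq> 1" using a by (simp add: \<psi>_def)
  have "(\<Sum>y\<in>V. \<psi> x y) = (\<Sum>y\<in>V. \<psi> x (y \<oplus>\<^bsub>M\<^esub> z))"
    by (rule sum.reindex_bij_betw[OF bij_add_vector[OF z], symmetric])
  also have "\<dots> = (\<Sum>y\<in>V. \<psi> x y) * \<psi> x z" using x z by (simp add: \<psi>_add2 sum_distrib_right)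
  finally show ?thesis using False \<open>\<psi> x z \<noteq> 1\<close> by simp
qed simp

section \<open>Averages and the Fourier transform\<close>

definition Ex :: "('c \<Rightarrow> 'z) \<Rightarrow> 'z::real_normed_field" where
  "Ex f = (\<Sum>v\<in>V. f v) / of_nat (card V)"

lemma Ex_cong: "(\<And>v. v \<in> V \<Longrightarrow> f v = g v) \<Longrightarrow> Ex f = Ex g"
  by (simp add: Ex_def)

lemma Ex_add: "Ex (\<lambda>v. f v + g v) = Ex f + Ex g"
  by (simp add: Ex_def sum.distrib add_divide_distrib)

lemma Ex_diff: "Ex (\<lambda>v. f v - g v) = Ex f - Ex g"
  by (simp add: Ex_def sum_subtractf diff_divide_distrib)

lemma Ex_cmult: "Ex (\<lambda>v. c * f v) = c * Ex f" "Ex (\<lambda>v. f v * c) = Ex f * c"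
  by (simp_all add: Ex_def flip: sum_distrib_left sum_distrib_right)

lemma Ex_const [simp]: "Ex (\<lambda>v. c) = c"
  using N_pos by (simp add: Ex_def)

lemma Ex_sum: "Ex (\<lambda>v. \<Sum>i\<in>I. f i v) = (\<Sum>i\<in>I. Ex (f i))"
  unfolding Ex_def sum_divide_distrib by (rule sum.swap)

lemma Ex_swap: "Ex (\<lambda>v. Ex (f v)) = Ex (\<lambda>w. Ex (\<lambda>v. f v w))"
  unfolding Ex_def sum_divide_distrib by (rule sum.swap)

lemma Ex_of_real: "Ex (\<lambda>v. of_real (f v)) = (of_real (Ex f) :: complex)"
  by (simp add: Ex_def)

lemma Ex_mono: "(\<And>v. v \<in> V \<Longrightarrow> f v \<le> (g v :: real)) \<Longrightarrow> Ex f \<le> Ex g"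
  using N_pos by (auto simp: Ex_def intro!: divide_right_mono sum_mono)

lemma Ex_nonneg: "(\<And>v. v \<in> V \<Longrightarrow> 0 \<le> (g v :: real)) \<Longrightarrow> 0 \<le> Ex g"
  using Ex_mono[of "\<lambda>_. 0" g] by simp

lemma Ex_norm: "norm (Ex f) \<le> Ex (\<lambda>v. norm (f v))"
  unfolding Ex_def by (simp add: norm_divide divide_right_mono norm_sum)

lemma Ex_cnj: "cnj (Ex f) = Ex (\<lambda>v. cnj (f v))"
  by (simp add: Ex_def)

lemma Ex_reindex: "bij_betw g V V \<Longrightarrow> Ex (\<lambda>v. f (g v)) = Ex f"
  unfolding Ex_def by (simp add: sum.reindex_bij_betw)

lemma Ex_shift: "a \<in> V \<Longrightarrow> Ex (\<lambda>v. f (v \<oplus>\<^bsub>M\<^esub> a)) = Ex f"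
  by (rule Ex_reindex[OF bij_add_vector])

lemma Ex_CS: assumes "\<And>v. v \<in> V \<Longrightarrow> 0 \<le> (w v :: real)"
  shows "(Ex (\<lambda>v. w v * f v))\<^sup>2 \<le> Ex w * Ex (\<lambda>v. w v * (f v)\<^sup>2)"
proof -
  have "(\<Sum>v\<in>V. sqrt (w v) * (sqrt (w v) * f v))\<^sup>2
      \<le> (\<Sum>v\<in>V. (sqrt (w v))\<^sup>2) * (\<Sum>v\<in>V. (sqrt (w v) * f v)\<^sup>2)"
    by (rule Cauchy_Schwarz_ineq_sum)
  moreover have "(\<Sum>v\<in>V. sqrt (w v) * (sqrt (w v) * f v)) = (\<Sum>v\<in>V. w v * f v)"
    by (rule sum.cong) (use assms in \<open>auto simp flip: mult.assoc\<close>)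
  moreover have "(\<Sum>v\<in>V. (sqrt (w v))\<^sup>2) = (\<Sum>v\<in>V. w v)"
    by (rule sum.cong) (use assms in auto)
  moreover have "(\<Sum>v\<in>V. (sqrt (w v) * f v)\<^sup>2) = (\<Sum>v\<in>V. w v * (f v)\<^sup>2)"
    by (rule sum.cong) (use assms in \<open>auto simp: power_mult_distrib\<close>)
  ultimately show ?thesis using N_pos
    by (simp add: Ex_def power_divide divide_simps power2_eq_square)
qed

lemma Ex_\<psi>: "x \<in> V \<Longrightarrow> Ex (\<psi> x) = (if x = \<zero>\<^bsub>M\<^esub> then 1 else 0)"
  using N_pos by (simp add: Ex_def sum_\<psi>)

lemma Ex_norm_square:
  "of_real ((norm (Ex f))\<^sup>2) = Ex (\<lambda>v. Ex (\<lambda>w. f v * cnj (f w)))"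
  by (simp only: complex_norm_square Ex_cnj) (simp add: Ex_cmult)

text \<open>Weyl differencing.\<close>

lemma Ex_quadratic: assumes t: "t \<in> K" "t \<noteq> \<zero>" and w: "w \<in> V"
  shows "norm (Ex (\<lambda>v. e (t \<otimes> sq v) * \<psi> w v)) \<le> 1 / sqrt N"
proof -
  let ?f = "\<lambda>v. e (t \<otimes> sq v) * \<psi> w v"
  let ?c = "\<lambda>h. e (t \<otimes> sq h) * \<psi> w h"
  have *: "?f (h \<oplus>\<^bsub>M\<^esub> v) * cnj (?f v) = ?c h * \<psi> ((t \<oplus> t) \<odot>\<^bsub>M\<^esub> h) v"
    if "h \<in> V" "v \<in> V" for h v
  proof -
    have 1: "t \<otimes> sq (h \<oplus>\<^bsub>M\<^esub> v) = t \<otimes> sq h \<oplus> (t \<oplus> t) \<otimes> B h v \<oplus> t \<otimes> sq v"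
      unfolding sq_add[OF that] using t B_closed[OF that] sq_closed[OF that(1)] sq_closed[OF that(2)]
      by algebra
    have 2: "e (t \<otimes> sq v) * cnj (e (t \<otimes> sq v)) = 1"
      by (rule unit_mult_cnj, rule e_norm) (use that t in auto)
    have "?f (h \<oplus>\<^bsub>M\<^esub> v) * cnj (?f v) = ?c h * \<psi> ((t \<oplus> t) \<odot>\<^bsub>M\<^esub> h) v * (e (t \<otimes> sq v) * cnj (e (t \<otimes> sq v))) * (\<psi> w v * cnj (\<psi> w v))"
      unfolding 1 using that t w by (simp add: e_add \<psi>_add2 B_smult \<psi>_def[of "(t \<oplus> t) \<odot>\<^bsub>M\<^esub> h"])
    thus ?thesis using 2 that w by (simp add: \<psi>_mult_cnj)
  qed
  \<comment> \<open>Odd characteristic enters here: the differenced phase is linear in v with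
    frequency 2th, which must vanish only for h = 0.\<close>
  have tt: "t \<oplus> t \<in> K" "t \<oplus> t \<noteq> \<zero>"
  proof -
    have "t \<oplus> t = (\<one> \<oplus> \<one>) \<otimes> t" using t by algebra
    thus "t \<oplus> t \<noteq> \<zero>" using t two_nonzero integral by fastforce
  qed (use t in auto)
  have "of_real ((norm (Ex ?f))\<^sup>2) = Ex (\<lambda>v. Ex (\<lambda>w. ?f w * cnj (?f v)))"
    unfolding Ex_norm_square by (rule Ex_swap)
  also have "\<dots> = Ex (\<lambda>v. Ex (\<lambda>h. ?f (h \<oplus>\<^bsub>M\<^esub> v) * cnj (?f v)))"
    by (rule Ex_cong) (rule Ex_shift[symmetric])
  also have "\<dots> = Ex (\<lambda>v. Ex (\<lambda>h. ?c h * \<psi> ((t \<oplus> t) \<odot>\<^bsub>M\<^esub> h) v))"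
    by (intro Ex_cong) (rule *)
  also have "\<dots> = Ex (\<lambda>h. Ex (\<lambda>v. ?c h * \<psi> ((t \<oplus> t) \<odot>\<^bsub>M\<^esub> h) v))"
    by (rule Ex_swap)
  also have "\<dots> = Ex (\<lambda>h. ?c h * (if h = \<zero>\<^bsub>M\<^esub> then 1 else 0))"
  proof (rule Ex_cong)
    fix h assume h: "h \<in> V"
    have "(t \<oplus> t) \<odot>\<^bsub>M\<^esub> h = \<zero>\<^bsub>M\<^esub> \<longleftrightarrow> h = \<zero>\<^bsub>M\<^esub>"
    proof
      assume "(t \<oplus> t) \<odot>\<^bsub>M\<^esub> h = \<zero>\<^bsub>M\<^esub>"
      hence "inv (t \<oplus> t) \<odot>\<^bsub>M\<^esub> ((t \<oplus> t) \<odot>\<^bsub>M\<^esub> h) = \<zero>\<^bsub>M\<^esub>" using tt h by (simp add: field_Units)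
      thus "h = \<zero>\<^bsub>M\<^esub>" using tt h field_Units by (simp flip: smult_assoc1)
    qed (use tt in auto)
    thus "Ex (\<lambda>v. ?c h * \<psi> ((t \<oplus> t) \<odot>\<^bsub>M\<^esub> h) v) = ?c h * (if h = \<zero>\<^bsub>M\<^esub> then 1 else 0)"
      using h tt by (simp only: Ex_cmult) (simp add: Ex_\<psi>)
  qed
  also have "\<dots> = 1 / of_real N"
    using t w by (simp add: Ex_def if_distrib finite_vectors sq_def cong: if_cong)
  finally have "(norm (Ex ?f))\<^sup>2 = 1 / N"
    by (metis (mono_tags, lifting) of_real_1 of_real_divide of_real_eq_iff)
  hence "norm (Ex ?f) = sqrt (1 / N)" by (metis norm_ge_zero real_sqrt_unique)
  thus ?thesis by (simp add: real_sqrt_divide)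
qed

definition ft where "ft f \<xi> = Ex (\<lambda>x. f x * \<psi> \<xi> x)"

lemma Ex_ne_zero: "x \<in> V \<Longrightarrow> y \<in> V \<Longrightarrow> Ex (\<lambda>\<xi>. \<psi> \<xi> x * cnj (\<psi> \<xi> y)) = (if x = y then 1 else 0)"
proof -
  assume xy: "x \<in> V" "y \<in> V"
  have "Ex (\<lambda>\<xi>. \<psi> \<xi> x * cnj (\<psi> \<xi> y)) = Ex (\<psi> (x \<ominus>\<^bsub>M\<^esub> y))"
    by (rule Ex_cong) (use xy \<psi>_comm[of x] \<psi>_comm[of y] in \<open>auto simp: a_minus_def \<psi>_add \<psi>_minus\<close>)
  also have "\<dots> = (if x = y then 1 else 0)"
    using xy by (simp add: Ex_\<psi>)
  finally show ?thesis .
qed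

lemma ft_inversion: assumes "y \<in> V" shows "f y = (\<Sum>\<xi>\<in>V. ft f \<xi> * cnj (\<psi> \<xi> y))"
proof -
  have "(\<Sum>\<xi>\<in>V. ft f \<xi> * cnj (\<psi> \<xi> y)) = of_real N * Ex (\<lambda>\<xi>. Ex (\<lambda>x. f x * (\<psi> \<xi> x * cnj (\<psi> \<xi> y))))"
  proof -
    have "of_real N * Ex (\<lambda>\<xi>. Ex (\<lambda>x. f x * (\<psi> \<xi> x * cnj (\<psi> \<xi> y)))) =
        (\<Sum>\<xi>\<in>V. Ex (\<lambda>x. f x * (\<psi> \<xi> x * cnj (\<psi> \<xi> y))))"
      using N_pos by (simp add: Ex_def[of "\<lambda>\<xi>. Ex (F \<xi>)" for F])
    also have "\<dots> = (\<Sum>\<xi>\<in>V. ft f \<xi> * cnj (\<psi> \<xi> y))"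
      by (simp add: ft_def mult.assoc flip: Ex_cmult)
    finally show ?thesis by simp
  qed
  also have "\<dots> = of_real N * Ex (\<lambda>x. f x * Ex (\<lambda>\<xi>. \<psi> \<xi> x * cnj (\<psi> \<xi> y)))"
    by (subst Ex_swap) (simp add: Ex_cmult)
  also have "\<dots> = of_real N * Ex (\<lambda>x. f x * (if x = y then 1 else 0))"
    using assms by (simp add: Ex_ne_zero cong: Ex_cong)
  also have "\<dots> = f y"
    using N_pos assms finite_vectors by (auto simp: Ex_def if_distrib cong: if_cong)
  finally show ?thesis by simp
qed

text \<open>The sign is moved from the character to the frequency, so that the character of a linear
  combination factors through \<open>\<psi>_lc\<close> without conjugates. This is where the
  coefficient -1 in \<open>coef\<close> comes from.\<close>

lemma ft_inversion': assumes "y \<in> V" shows "f y = (\<Sum>\<xi>\<in>V. ft f (\<ominus>\<^bsub>M\<^esub> \<xi>) * \<psi> \<xi> y)"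
proof -
  have "f y = (\<Sum>\<xi>\<in>V. ft f (\<ominus>\<^bsub>M\<^esub> \<xi>) * cnj (\<psi> (\<ominus>\<^bsub>M\<^esub> \<xi>) y))"
    by (subst sum.reindex_bij_betw[OF bij_uminus]) (rule ft_inversion[OF assms])
  thus ?thesis using assms by (simp add: \<psi>_minus)
qed

lemma parseval: "(\<Sum>\<xi>\<in>V. (norm (ft f \<xi>))\<^sup>2) = Ex (\<lambda>x. (norm (f x))\<^sup>2)"
proof -
  have "of_real (\<Sum>\<xi>\<in>V. (norm (ft f \<xi>))\<^sup>2) = (\<Sum>\<xi>\<in>V. ft f \<xi> * Ex (\<lambda>x. cnj (f x) * cnj (\<psi> \<xi> x)))"
    unfolding of_real_sum complex_norm_square by (simp add: ft_def Ex_cnj)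
  also have "\<dots> = (\<Sum>\<xi>\<in>V. Ex (\<lambda>x. cnj (f x) * (ft f \<xi> * cnj (\<psi> \<xi> x))))"
    by (simp add: mult_ac flip: Ex_cmult)
  also have "\<dots> = Ex (\<lambda>x. cnj (f x) * (\<Sum>\<xi>\<in>V. ft f \<xi> * cnj (\<psi> \<xi> x)))"
    by (simp add: sum_distrib_left flip: Ex_sum)
  also have "\<dots> = Ex (\<lambda>x. cnj (f x) * f x)"
    by (rule Ex_cong) (simp flip: ft_inversion)
  also have "\<dots> = of_real (Ex (\<lambda>x. (norm (f x))\<^sup>2))"
    unfolding Ex_of_real[symmetric] by (rule Ex_cong) (metis complex_norm_square mult.commute)
  finally show ?thesis by (simp only: of_real_eq_iff)
qed

end

section \<open>Bohr sets\<close>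

lemma amgm3: assumes "0 \<le> (x::real)" "0 \<le> y" "0 \<le> z" shows "x * y * z \<le> (x^3 + y^3 + z^3) / 3"
proof -
  have "x^3 + y^3 + z^3 - 3 * (x * y * z) = (x + y + z) * ((x - y)\<^sup>2 + (y - z)\<^sup>2 + (z - x)\<^sup>2) / 2"
    by (simp add: field_simps power2_eq_square power3_eq_cube)
  moreover have "\<dots> \<ge> 0" using assms by simp
  ultimately show ?thesis by simp
qed

lemma one_minus_prod_le: assumes "finite J" "\<And>i. i \<in> J \<Longrightarrow> 0 \<le> p i \<and> p i \<le> (1::real)"
  shows "1 - (\<Prod>i\<in>J. p i) \<le> (\<Sum>i\<in>J. 1 - p i)"
  using assms
proof (induction J rule: finite_induct)
  case (insert x J)
  have P: "0 \<le> prod p J" "prod p J \<le> 1" using insert by (auto intro: prod_nonneg prod_le_1)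
  have "(1 - p x) * (1 - prod p J) \<ge> 0" using insert P by simp
  hence "1 - p x * prod p J \<le> (1 - p x) + (1 - prod p J)" by (simp add: algebra_simps)
  thus ?case using insert by (auto intro: order_trans)
qed simp

text \<open>With m the ceiling of 2 / \<rho>, the real and imaginary parts of m times a unit complex
  number have floors in -m..m; this is the number of pairs of floors. Two numbers in one cell are at
  most 2 / m, hence at most \<rho>, apart.\<close>

definition cells :: "real \<Rightarrow> real" where
  "cells \<rho> = real ((2 * nat \<lceil>2 / \<rho>\<rceil> + 1)\<^sup>2)"

lemma cells_ge_1: "1 \<le> cells \<rho>"
  by (simp add: cells_def)

context bilin_space begin

definition lc where "lc I t y = finsum M (\<lambda>i. t i \<odot>\<^bsub>M\<^esub> y i) I"

lemma lc_closed [simp, intro]: "t \<in> I \<rightarrow> K \<Longrightarrow> y \<in> I \<rightarrow> V \<Longrightarrow> lc I t y \<in> V"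
  unfolding lc_def by (intro M.finsum_closed) auto

lemma \<psi>_lc: assumes "finite I" "t \<in> I \<rightarrow> K" "y \<in> I \<rightarrow> V" "\<xi> \<in> V"
  shows "\<psi> \<xi> (lc I t y) = (\<Prod>i\<in>I. \<psi> (t i \<odot>\<^bsub>M\<^esub> \<xi>) (y i))"
  using assms
proof (induction I rule: finite_induct)
  case (insert x I)
  hence m: "t x \<in> K" "y x \<in> V" "t \<in> I \<rightarrow> K" "y \<in> I \<rightarrow> V" by auto
  have "lc (insert x I) t y = t x \<odot>\<^bsub>M\<^esub> y x \<oplus>\<^bsub>M\<^esub> lc I t y"
    unfolding lc_def using insert m by (intro M.finsum_insert) auto
  thus ?case using insert m by (simp add: \<psi>_add2 \<psi>_smult)
qed (simp add: lc_def)

definition Bohr where "Bohr S \<rho> = {x \<in> V. \<forall>\<xi>\<in>S. norm (\<psi> \<xi> x - 1) \<le> \<rho>}"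

lemma Bohr_subset: "Bohr S \<rho> \<subseteq> V" by (auto simp: Bohr_def)

lemma finite_Bohr [simp]: "finite (Bohr S \<rho>)" using Bohr_subset finite_vectors finite_subset by blast

lemma zero_Bohr: "S \<subseteq> V \<Longrightarrow> 0 \<le> \<rho> \<Longrightarrow> \<zero>\<^bsub>M\<^esub> \<in> Bohr S \<rho>"
  by (auto simp: Bohr_def)

lemma card_Bohr_pos: "S \<subseteq> V \<Longrightarrow> 0 \<le> \<rho> \<Longrightarrow> 0 < card (Bohr S \<rho>)"
  using zero_Bohr by (auto simp: card_gt_0_iff)

text \<open>Pigeonhole: two points whose characters lie in the same cells of a grid of mesh
  \<open>\<rho> / 2\<close> differ by an element of the Bohr set.\<close>

lemma Bohr_density: assumes S: "S \<subseteq> V" and \<rho>: "0 < \<rho>"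
  shows "N \<le> card (Bohr S \<rho>) * cells \<rho> ^ card S"
proof -
  define m where "m = nat \<lceil>2 / \<rho>\<rceil>"
  have m: "m > 0" "2 / real m \<le> \<rho>"
  proof -
    have "2 / \<rho> \<le> real m" unfolding m_def by (rule real_nat_ceiling_ge)
    moreover have "0 < 2 / \<rho>" using \<rho> by simp
    ultimately show "m > 0" by linarith
    thus "2 / real m \<le> \<rho>" using \<open>2 / \<rho> \<le> real m\<close> \<rho> by (simp add: field_simps)
  qed
  have fS: "finite S" using S finite_vectors finite_subset by blast
  let ?T = "{- int m..int m} \<times> {- int m..int m}"
  define \<Phi> where "\<Phi> x = (\<lambda>\<xi>\<in>S. (\<lfloor>m * Re (\<psi> \<xi> x)\<rfloor>, \<lfloor>m * Im (\<psi> \<xi> x)\<rfloor>))" for x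
  have inT: "(\<lfloor>m * Re z\<rfloor>, \<lfloor>m * Im z\<rfloor>) \<in> ?T" if "norm z = 1" for z
  proof -
    have "\<bar>Re z\<bar> \<le> 1" "\<bar>Im z\<bar> \<le> 1" using that abs_Re_le_cmod[of z] abs_Im_le_cmod[of z] by auto
    hence b: "- 1 \<le> Re z" "Re z \<le> 1" "- 1 \<le> Im z" "Im z \<le> 1" by auto
    have "real m * -1 \<le> m * Re z" "real m * -1 \<le> m * Im z" "m * Re z \<le> real m * 1" "m * Im z \<le> real m * 1"
      using b by (intro mult_left_mono; simp)+
    thus ?thesis by (auto simp: le_floor_iff floor_le_iff)
  qed
  have \<Phi>: "\<Phi> ` V \<subseteq> PiE S (\<lambda>_. ?T)"
    unfolding \<Phi>_def by (intro image_subsetI restrict_PiE_iff[THEN iffD2] ballI inT \<psi>_norm) (use S in auto)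
  have fT: "finite (PiE S (\<lambda>_. ?T))" using fS by (intro finite_PiE) auto
  have cT: "real (card (PiE S (\<lambda>_. ?T))) = cells \<rho> ^ card S"
  proof -
    have "card ?T = (2 * m + 1)\<^sup>2"
    proof -
      have "card {- int m..int m} = 2 * m + 1" by simp
      thus ?thesis by (simp only: card_cartesian_product power2_eq_square)
    qed
    thus ?thesis using fS by (simp add: card_PiE cells_def m_def)
  qed
  have fib: "card {x \<in> V. \<Phi> x = c} \<le> card (Bohr S \<rho>)" for c
  proof (cases "{x \<in> V. \<Phi> x = c} = {}")
    case False
    then obtain x0 where x0: "x0 \<in> V" "\<Phi> x0 = c" by auto
    have "card {x \<in> V. \<Phi> x = c} = card ((\<lambda>x. x \<oplus>\<^bsub>M\<^esub> (\<ominus>\<^bsub>M\<^esub> x0)) ` {x \<in> V. \<Phi> x = c})"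
      by (rule card_image[symmetric]) (use x0 in \<open>auto intro!: inj_onI\<close>)
    also have "\<dots> \<le> card (Bohr S \<rho>)"
    proof (rule card_mono[OF finite_Bohr], safe)
      fix x assume x: "x \<in> V" "c = \<Phi> x"
      have "norm (\<psi> \<xi> (x \<oplus>\<^bsub>M\<^esub> (\<ominus>\<^bsub>M\<^esub> x0)) - 1) \<le> \<rho>" if \<xi>: "\<xi> \<in> S" for \<xi>
      proof -
        have \<xi>V: "\<xi> \<in> V" using S \<xi> by auto
        have "\<Phi> x \<xi> = \<Phi> x0 \<xi>" using x x0 by simp
        hence "\<lfloor>m * Re (\<psi> \<xi> x)\<rfloor> = \<lfloor>m * Re (\<psi> \<xi> x0)\<rfloor>" "\<lfloor>m * Im (\<psi> \<xi> x)\<rfloor> = \<lfloor>m * Im (\<psi> \<xi> x0)\<rfloor>"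
          using \<xi> by (auto simp: \<Phi>_def)
        hence "\<bar>m * Re (\<psi> \<xi> x) - m * Re (\<psi> \<xi> x0)\<bar> \<le> 1" "\<bar>m * Im (\<psi> \<xi> x) - m * Im (\<psi> \<xi> x0)\<bar> \<le> 1"
          by linarith+
        hence "m * \<bar>Re (\<psi> \<xi> x) - Re (\<psi> \<xi> x0)\<bar> \<le> 1" "m * \<bar>Im (\<psi> \<xi> x) - Im (\<psi> \<xi> x0)\<bar> \<le> 1"
          by (metis abs_mult abs_of_nat right_diff_distrib)+
        hence *: "\<bar>Re (\<psi> \<xi> x - \<psi> \<xi> x0)\<bar> \<le> 1 / m" "\<bar>Im (\<psi> \<xi> x - \<psi> \<xi> x0)\<bar> \<le> 1 / m"
          using m(1) by (simp_all add: field_simps)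
        have "norm (\<psi> \<xi> x - \<psi> \<xi> x0) \<le> 2 / m"
          using cmod_le[of "\<psi> \<xi> x - \<psi> \<xi> x0"] * by simp
        hence d: "norm (\<psi> \<xi> x - \<psi> \<xi> x0) \<le> \<rho>" using m(2) by linarith
        have "\<psi> \<xi> (x \<oplus>\<^bsub>M\<^esub> (\<ominus>\<^bsub>M\<^esub> x0)) - 1 = (\<psi> \<xi> x - \<psi> \<xi> x0) * cnj (\<psi> \<xi> x0)"
          using x x0 \<xi>V by (simp add: \<psi>_add2 \<psi>_minus2 \<psi>_mult_cnj left_diff_distrib)
        thus ?thesis using d x0 \<xi>V by (simp add: norm_mult)
      qed
      thus "x \<oplus>\<^bsub>M\<^esub> (\<ominus>\<^bsub>M\<^esub> x0) \<in> Bohr S \<rho>" using x x0 by (auto simp: Bohr_def)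
    qed
    finally show ?thesis .
  qed (simp only: card.empty le0)
  have "card V = (\<Sum>c\<in>\<Phi> ` V. card {x \<in> V. \<Phi> x = c})"
    using card_eq_sum sum.image_gen[OF finite_vectors, of "\<lambda>_. 1::nat" \<Phi>] by simp
  also have "\<dots> \<le> card (\<Phi> ` V) * card (Bohr S \<rho>)"
    using sum_bounded_above[of "\<Phi> ` V", OF fib] by simp
  also have "\<dots> \<le> card (PiE S (\<lambda>_. ?T)) * card (Bohr S \<rho>)"
    using card_mono[OF fT \<Phi>] by simp
  finally have "N \<le> real (card (PiE S (\<lambda>_. ?T)) * card (Bohr S \<rho>))" by (rule of_nat_mono)
  thus ?thesis using cT by (simp add: mult.commute)
qed

text \<open>Averaging over differences b - b' instead of over b makes the Fourier multiplier
  \<open>pD\<close> a square, hence real and between 0 and 1. The losses \<open>1 - pD\<close> are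
  then nonnegative and can be added up over the factors of a product.\<close>

definition sm :: "'c set \<Rightarrow> ('c \<Rightarrow> real) \<Rightarrow> 'c \<Rightarrow> real" where
  "sm D f x = (\<Sum>b\<in>D. \<Sum>b'\<in>D. f (x \<oplus>\<^bsub>M\<^esub> (b \<ominus>\<^bsub>M\<^esub> b'))) / (card D)\<^sup>2"

definition pD where "pD D \<xi> = (norm ((\<Sum>b\<in>D. \<psi> \<xi> b) / of_nat (card D)))\<^sup>2"

lemma ft_shift: assumes "c \<in> V" "\<xi> \<in> V"
  shows "ft (\<lambda>x. f (x \<oplus>\<^bsub>M\<^esub> c)) \<xi> = ft f \<xi> * cnj (\<psi> \<xi> c)"
proof -
  have "ft (\<lambda>x. f (x \<oplus>\<^bsub>M\<^esub> c)) \<xi> = Ex (\<lambda>x. f (x \<oplus>\<^bsub>M\<^esub> c) * \<psi> \<xi> (x \<oplus>\<^bsub>M\<^esub> c) * cnj (\<psi> \<xi> c))"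
    unfolding ft_def by (rule Ex_cong) (use assms in \<open>simp add: \<psi>_add2 \<psi>_mult_cnj mult.assoc\<close>)
  also have "\<dots> = Ex (\<lambda>x. f x * \<psi> \<xi> x * cnj (\<psi> \<xi> c))"
    by (rule Ex_shift[OF assms(1)])
  finally show ?thesis by (simp add: ft_def Ex_cmult)
qed

lemma ft_sm: assumes D: "D \<subseteq> V" and \<xi>: "\<xi> \<in> V"
  shows "ft (\<lambda>x. of_real (sm D f x)) \<xi> = ft (\<lambda>x. of_real (f x)) \<xi> * of_real (pD D \<xi>)"
proof -
  let ?f = "\<lambda>x. complex_of_real (f x)"
  have "ft (\<lambda>x. of_real (sm D f x)) \<xi>
      = (\<Sum>b\<in>D. \<Sum>b'\<in>D. ft (\<lambda>x. ?f (x \<oplus>\<^bsub>M\<^esub> (b \<ominus>\<^bsub>M\<^esub> b'))) \<xi>) / (of_nat (card D))\<^sup>2"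
  proof -
    have "ft (\<lambda>x. of_real (sm D f x)) \<xi>
        = Ex (\<lambda>x. (\<Sum>b\<in>D. \<Sum>b'\<in>D. ?f (x \<oplus>\<^bsub>M\<^esub> (b \<ominus>\<^bsub>M\<^esub> b')) * \<psi> \<xi> x) * (1 / (of_nat (card D))\<^sup>2))"
      unfolding ft_def sm_def by (rule Ex_cong) (simp add: sum_distrib_right)
    also have "\<dots> = (\<Sum>b\<in>D. \<Sum>b'\<in>D. ft (\<lambda>x. ?f (x \<oplus>\<^bsub>M\<^esub> (b \<ominus>\<^bsub>M\<^esub> b'))) \<xi>) * (1 / (of_nat (card D))\<^sup>2)"
      by (simp only: Ex_cmult Ex_sum ft_def)
    finally show ?thesis by simp
  qed
  also have "\<dots> = (\<Sum>b\<in>D. \<Sum>b'\<in>D. ft ?f \<xi> * (cnj (\<psi> \<xi> b) * \<psi> \<xi> b')) / (of_nat (card D))\<^sup>2"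
  proof (intro arg_cong[where f = "\<lambda>x. x / (of_nat (card D))\<^sup>2"] sum.cong refl)
    fix b b' assume "b \<in> D" "b' \<in> D"
    hence "b \<in> V" "b' \<in> V" using D by auto
    thus "ft (\<lambda>x. ?f (x \<oplus>\<^bsub>M\<^esub> (b \<ominus>\<^bsub>M\<^esub> b'))) \<xi> = ft ?f \<xi> * (cnj (\<psi> \<xi> b) * \<psi> \<xi> b')"
      using \<xi> ft_shift[of "b \<ominus>\<^bsub>M\<^esub> b'" \<xi> ?f] by (simp add: a_minus_def \<psi>_add2 \<psi>_minus2)
  qed
  also have "\<dots> = ft ?f \<xi> * (cnj (\<Sum>b\<in>D. \<psi> \<xi> b) * (\<Sum>b\<in>D. \<psi> \<xi> b)) / (of_nat (card D))\<^sup>2"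
  proof -
    have "cnj (\<Sum>b\<in>D. \<psi> \<xi> b) * (\<Sum>b\<in>D. \<psi> \<xi> b) = (\<Sum>b\<in>D. \<Sum>b'\<in>D. cnj (\<psi> \<xi> b) * \<psi> \<xi> b')"
      unfolding cnj_sum sum_product ..
    thus ?thesis by (simp add: sum_distrib_left)
  qed
  also have "\<dots> = ft ?f \<xi> * of_real (pD D \<xi>)"
    by (simp only: pD_def complex_norm_square) (simp add: power2_eq_square mult_ac)
  finally show ?thesis .
qed

lemma pD_bounds: assumes "D \<subseteq> V" "\<xi> \<in> V" shows "0 \<le> pD D \<xi>" "pD D \<xi> \<le> 1"
proof -
  have "norm (\<Sum>b\<in>D. \<psi> \<xi> b) \<le> (\<Sum>b\<in>D. 1)"
    by (rule sum_norm_le) (use assms in auto)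
  hence "norm ((\<Sum>b\<in>D. \<psi> \<xi> b) / of_nat (card D)) \<le> 1"
    by (auto simp: norm_divide divide_simps)
  thus "pD D \<xi> \<le> 1" unfolding pD_def by (simp add: power_le_one)
qed (simp add: pD_def)

lemma pD_zero: assumes "D \<subseteq> V" "0 < card D" shows "pD D \<zero>\<^bsub>M\<^esub> = 1"
proof -
  have "(\<Sum>b\<in>D. \<psi> \<zero>\<^bsub>M\<^esub> b) = (\<Sum>b\<in>D. 1)" by (rule sum.cong) (use assms in auto)
  thus ?thesis using assms by (simp add: pD_def)
qed

lemma pD_Bohr: assumes "S \<subseteq> V" "0 \<le> \<rho>" "\<xi> \<in> S"
  shows "1 - pD (Bohr S \<rho>) \<xi> \<le> 2 * \<rho>"
proof -
  let ?D = "Bohr S \<rho>"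
  have c: "0 < real (card ?D)" using card_Bohr_pos assms by simp
  have "norm ((\<Sum>b\<in>?D. \<psi> \<xi> b) - (\<Sum>b\<in>?D. 1)) \<le> (\<Sum>b\<in>?D. \<rho>)"
    unfolding sum_subtractf[symmetric] by (rule sum_norm_le) (use assms in \<open>auto simp: Bohr_def\<close>)
  hence 1: "norm ((\<Sum>b\<in>?D. \<psi> \<xi> b) - of_nat (card ?D)) \<le> card ?D * \<rho>" by simp
  have "(\<Sum>b\<in>?D. \<psi> \<xi> b) / of_nat (card ?D) - 1 = ((\<Sum>b\<in>?D. \<psi> \<xi> b) - of_nat (card ?D)) / of_nat (card ?D)"
    using c by (auto simp: diff_divide_distrib)
  hence "norm ((\<Sum>b\<in>?D. \<psi> \<xi> b) / of_nat (card ?D) - 1) \<le> \<rho>"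
    using 1 pos_divide_le_eq[OF c] by (simp only: norm_divide norm_of_nat mult.commute)
  hence 2: "1 - \<rho> \<le> norm ((\<Sum>b\<in>?D. \<psi> \<xi> b) / of_nat (card ?D))" (is "_ \<le> ?n")
    by (smt (verit) norm_one norm_triangle_ineq2 norm_minus_commute)
  show ?thesis
  proof (cases "\<rho> \<le> 1")
    case True
    hence "(1 - \<rho>)\<^sup>2 \<le> ?n\<^sup>2" using 2 by (intro power_mono) auto
    moreover have "1 - 2 * \<rho> \<le> (1 - \<rho>)\<^sup>2" by (simp add: power2_eq_square algebra_simps)
    ultimately show ?thesis by (simp add: pD_def)
  next
    case False
    \<comment> \<open>For \<rho> > 1 the lower bound 1 - \<rho> is negative and cannot be squared,
      but then the claim is weaker than \<open>pD \<ge> 0\<close>.\<close>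
    have "0 \<le> pD ?D \<xi>" by (simp add: pD_def)
    thus ?thesis using False by linarith
  qed
qed

text \<open>\<open>pD\<close> is the squared transform of the normalised indicator of
  \<open>D\<close>, so this is Parseval. It makes sums over all frequencies finite in terms of the
  density of \<open>D\<close> alone, with no reference to q.\<close>

lemma sum_pD: assumes D: "D \<subseteq> V" "0 < card D" shows "(\<Sum>\<xi>\<in>V. pD D \<xi>) = N / card D"
proof -
  let ?f = "\<lambda>x. if x \<in> D then of_real (N / card D) else (0::complex)"
  have c: "0 < card V" using N_pos by simp
  have "ft ?f \<xi> = (\<Sum>b\<in>D. \<psi> \<xi> b) / of_nat (card D)" for \<xi>
  proof -
    have "(\<Sum>x\<in>V. ?f x * \<psi> \<xi> x) = (\<Sum>x\<in>D. of_real (N / card D) * \<psi> \<xi> x)"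
      by (rule sum.mono_neutral_cong_right) (use D finite_vectors in auto)
    thus ?thesis using c by (simp add: ft_def Ex_def sum_divide_distrib)
  qed
  hence "(\<Sum>\<xi>\<in>V. pD D \<xi>) = Ex (\<lambda>x. (norm (?f x))\<^sup>2)"
    using parseval[of ?f] by (simp add: pD_def)
  also have "\<dots> = (\<Sum>x\<in>D. (N / card D)\<^sup>2) / N"
    unfolding Ex_def by (rule arg_cong2[where f = "(/)"], rule sum.mono_neutral_cong_right)
      (use D finite_vectors in \<open>auto simp: norm_divide\<close>)
  also have "\<dots> = N / card D" using c D by (simp add: power2_eq_square field_simps)
  finally show ?thesis .
qed

lemma sm_mono: assumes "D \<subseteq> V" "x \<in> V" "\<And>x. x \<in> V \<Longrightarrow> f x \<le> g x" shows "sm D f x \<le> sm D g x"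
  unfolding sm_def using assms
  by (intro divide_right_mono sum_mono assms) (auto simp: a_minus_def)

end

section \<open>Majorised functions\<close>

lemma cube_le: "0 \<le> a \<Longrightarrow> a \<le> c \<Longrightarrow> (a::real)^3 \<le> c * a\<^sup>2"
  by (simp add: power3_eq_cube power2_eq_square mult.assoc mult_right_mono)

text \<open>In the application \<open>F\<close> is q times the indicator of the lift of the given
  set, \<nu> is q times that of the whole paraboloid, \<kappa> is the Gauss sum bound q^(-d/2), and
  \<open>Q\<close> is q. Below the threshold \<open>\<epsilon>0\<close> only Parseval with the poor
  constant \<open>Q\<close> is available.\<close>

locale majorised = bilin_space +
  fixes F \<nu> :: "'c \<Rightarrow> real" and \<kappa> Q \<epsilon>0 :: real
  assumes F_nonneg: "\<And>x. x \<in> V \<Longrightarrow> 0 \<le> F x"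
    and F_le: "\<And>x. x \<in> V \<Longrightarrow> F x \<le> \<nu> x"
    and \<nu>_mean: "Ex \<nu> = 1"
    and \<nu>_ft: "\<And>\<xi>. \<xi> \<in> V \<Longrightarrow> \<xi> \<noteq> \<zero>\<^bsub>M\<^esub> \<Longrightarrow> norm (ft (\<lambda>x. of_real (\<nu> x)) \<xi>) \<le> \<kappa>"
    and \<kappa>_nonneg: "0 \<le> \<kappa>"
    and F_square: "Ex (\<lambda>x. (F x)\<^sup>2) \<le> Q"
    and \<epsilon>0: "0 < \<epsilon>0" "2 * \<kappa> \<le> \<epsilon>0\<^sup>2"
begin

abbreviation "Ft \<equiv> ft (\<lambda>x. complex_of_real (F x))"

definition "Fh \<xi> = norm (Ft \<xi>)"

definition "spec \<epsilon> = {\<xi> \<in> V. \<epsilon> \<le> Fh \<xi>}"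

lemma Fh_nonneg [simp]: "0 \<le> Fh \<xi>" by (simp add: Fh_def)

lemma spec_subset: "spec \<epsilon> \<subseteq> V" by (auto simp: spec_def)

lemma finite_spec [simp]: "finite (spec \<epsilon>)" using spec_subset finite_vectors finite_subset by blast

lemma spec_mono: "\<epsilon> \<le> \<epsilon>' \<Longrightarrow> spec \<epsilon>' \<subseteq> spec \<epsilon>" by (auto simp: spec_def)

lemma \<nu>_nonneg: "x \<in> V \<Longrightarrow> 0 \<le> \<nu> x" using F_nonneg F_le by (rule order_trans)

lemma F_mean_le: "Ex F \<le> 1"
  using Ex_mono[of F \<nu>, OF F_le] \<nu>_mean by simp

lemma Fh_le_1: assumes "\<xi> \<in> V" shows "Fh \<xi> \<le> 1"
proof -
  have "Fh \<xi> \<le> Ex (\<lambda>x. norm (of_real (F x) * \<psi> \<xi> x))" unfolding Fh_def ft_def by (rule Ex_norm)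
  also have "\<dots> = Ex F" by (rule Ex_cong) (use assms F_nonneg in \<open>simp add: norm_mult\<close>)
  finally show ?thesis using F_mean_le by simp
qed

lemma sum_Fh_square: "(\<Sum>\<xi>\<in>V. (Fh \<xi>)\<^sup>2) \<le> Q"
proof -
  have "(\<Sum>\<xi>\<in>V. (Fh \<xi>)\<^sup>2) = Ex (\<lambda>x. (norm (complex_of_real (F x)))\<^sup>2)"
    unfolding Fh_def by (rule parseval)
  thus ?thesis using F_square by simp
qed

text \<open>By duality from the pseudorandomness of \<open>\<nu>\<close>.\<close>

lemma large_sieve: "(\<Sum>\<xi>\<in>spec \<epsilon>0. (Fh \<xi>)\<^sup>2) \<le> 2"
proof -
  let ?X = "spec \<epsilon>0"
  define S where "S = (\<Sum>\<xi>\<in>?X. (Fh \<xi>)\<^sup>2)"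
  define w where "w x = (\<Sum>\<xi>\<in>?X. cnj (Ft \<xi>) * \<psi> \<xi> x)" for x
  let ?n = "real (card ?X)"
  have XV: "\<xi> \<in> V" if "\<xi> \<in> ?X" for \<xi> using that spec_subset by auto
  have S0: "0 \<le> S" unfolding S_def by (intro sum_nonneg) simp
  have 1: "Ex (\<lambda>x. of_real (F x) * w x) = of_real S"
  proof -
    have "Ex (\<lambda>x. of_real (F x) * w x) = Ex (\<lambda>x. \<Sum>\<xi>\<in>?X. cnj (Ft \<xi>) * (of_real (F x) * \<psi> \<xi> x))"
      unfolding w_def by (simp add: sum_distrib_left mult_ac)
    also have "\<dots> = (\<Sum>\<xi>\<in>?X. cnj (Ft \<xi>) * Ft \<xi>)"
      by (simp only: Ex_sum Ex_cmult ft_def)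
    also have "\<dots> = of_real S"
      unfolding S_def Fh_def of_real_sum complex_norm_square by (simp add: mult.commute)
    finally show ?thesis .
  qed
  have "S = norm (Ex (\<lambda>x. of_real (F x) * w x))" unfolding 1 using S0 by simp
  also have "\<dots> \<le> Ex (\<lambda>x. norm (of_real (F x) * w x))" by (rule Ex_norm)
  also have "\<dots> = Ex (\<lambda>x. F x * norm (w x))"
    by (rule Ex_cong) (use F_nonneg in \<open>simp add: norm_mult\<close>)
  finally have "S\<^sup>2 \<le> (Ex (\<lambda>x. F x * norm (w x)))\<^sup>2" using S0 by (intro power_mono)
  \<comment> \<open>Cauchy-Schwarz with weight \<open>F\<close> leaves \<open>F\<close> to the first
    power, so that it can be replaced by \<nu>, whose transform is under control.\<close>
  also have "\<dots> \<le> Ex F * Ex (\<lambda>x. F x * (norm (w x))\<^sup>2)" by (rule Ex_CS) (rule F_nonneg)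
  also have "\<dots> \<le> 1 * Ex (\<lambda>x. F x * (norm (w x))\<^sup>2)"
    by (rule mult_right_mono[OF F_mean_le]) (use F_nonneg in \<open>auto intro: Ex_nonneg\<close>)
  also have "\<dots> \<le> Ex (\<lambda>x. \<nu> x * (norm (w x))\<^sup>2)"
    using F_le by (auto intro!: Ex_mono mult_right_mono)
  finally have A: "S\<^sup>2 \<le> Ex (\<lambda>x. \<nu> x * (norm (w x))\<^sup>2)" .
  let ?nt = "ft (\<lambda>x. complex_of_real (\<nu> x))"
  have "of_real (Ex (\<lambda>x. \<nu> x * (norm (w x))\<^sup>2)) = Ex (\<lambda>x. of_real (\<nu> x) * (w x * cnj (w x)))"
    unfolding Ex_of_real[symmetric] of_real_mult complex_norm_square ..
  also have "\<dots> = Ex (\<lambda>x. \<Sum>\<xi>\<in>?X. \<Sum>\<eta>\<in>?X. cnj (Ft \<xi>) * Ft \<eta> * (of_real (\<nu> x) * \<psi> (\<xi> \<ominus>\<^bsub>M\<^esub> \<eta>) x))"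
  proof (rule Ex_cong)
    fix x assume x: "x \<in> V"
    have "of_real (\<nu> x) * (w x * cnj (w x)) =
        (\<Sum>\<xi>\<in>?X. \<Sum>\<eta>\<in>?X. of_real (\<nu> x) * ((cnj (Ft \<xi>) * \<psi> \<xi> x) * cnj (cnj (Ft \<eta>) * \<psi> \<eta> x)))"
      unfolding w_def cnj_sum sum_product by (simp only: sum_distrib_left)
    also have "\<dots> = (\<Sum>\<xi>\<in>?X. \<Sum>\<eta>\<in>?X. cnj (Ft \<xi>) * Ft \<eta> * (of_real (\<nu> x) * \<psi> (\<xi> \<ominus>\<^bsub>M\<^esub> \<eta>) x))"
      by (intro sum.cong refl) (use x XV in \<open>simp add: a_minus_def \<psi>_add \<psi>_minus\<close>)
    finally show "of_real (\<nu> x) * (w x * cnj (w x)) = \<dots>" .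
  qed
  also have "\<dots> = (\<Sum>\<xi>\<in>?X. \<Sum>\<eta>\<in>?X. cnj (Ft \<xi>) * Ft \<eta> * ?nt (\<xi> \<ominus>\<^bsub>M\<^esub> \<eta>))"
    by (simp only: Ex_sum Ex_cmult ft_def)
  finally have "Ex (\<lambda>x. \<nu> x * (norm (w x))\<^sup>2) = norm (\<Sum>\<xi>\<in>?X. \<Sum>\<eta>\<in>?X. cnj (Ft \<xi>) * Ft \<eta> * ?nt (\<xi> \<ominus>\<^bsub>M\<^esub> \<eta>))"
    using \<nu>_nonneg by (metis (no_types, lifting) Ex_nonneg abs_of_nonneg mult_nonneg_nonneg norm_of_real zero_le_power2)
  also have "\<dots> \<le> (\<Sum>\<xi>\<in>?X. \<Sum>\<eta>\<in>?X. Fh \<xi> * Fh \<eta> * ((if \<xi> = \<eta> then 1 else 0) + \<kappa>))"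
  proof (intro sum_norm_le)
    fix \<xi> \<eta> assume h: "\<xi> \<in> ?X" "\<eta> \<in> ?X"
    have "norm (?nt (\<xi> \<ominus>\<^bsub>M\<^esub> \<eta>)) \<le> (if \<xi> = \<eta> then 1 else 0) + \<kappa>"
    proof (cases "\<xi> = \<eta>")
      case True
      hence "\<xi> \<ominus>\<^bsub>M\<^esub> \<eta> = \<zero>\<^bsub>M\<^esub>" using XV h by (simp add: a_minus_def M.r_neg)
      moreover have "?nt \<zero>\<^bsub>M\<^esub> = of_real (Ex \<nu>)"
        unfolding ft_def Ex_of_real[symmetric] by (rule Ex_cong) simp
      ultimately show ?thesis using True \<nu>_mean \<kappa>_nonneg by simp
    next
      case False
      hence "\<xi> \<ominus>\<^bsub>M\<^esub> \<eta> \<noteq> \<zero>\<^bsub>M\<^esub>" using XV h by simp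
      thus ?thesis using False \<nu>_ft[of "\<xi> \<ominus>\<^bsub>M\<^esub> \<eta>"] XV h by simp
    qed
    thus "norm (cnj (Ft \<xi>) * Ft \<eta> * ?nt (\<xi> \<ominus>\<^bsub>M\<^esub> \<eta>)) \<le> Fh \<xi> * Fh \<eta> * ((if \<xi> = \<eta> then 1 else 0) + \<kappa>)"
      unfolding norm_mult complex_mod_cnj Fh_def by (intro mult_left_mono) auto
  qed
  also have "\<dots> = S + \<kappa> * (\<Sum>\<xi>\<in>?X. Fh \<xi>)\<^sup>2"
  proof -
    have "(\<Sum>\<xi>\<in>?X. \<Sum>\<eta>\<in>?X. Fh \<xi> * Fh \<eta> * ((if \<xi> = \<eta> then 1 else 0) + \<kappa>))
      = (\<Sum>\<xi>\<in>?X. \<Sum>\<eta>\<in>?X. if \<xi> = \<eta> then Fh \<xi> * Fh \<eta> else 0) + (\<Sum>\<xi>\<in>?X. \<Sum>\<eta>\<in>?X. Fh \<xi> * Fh \<eta> * \<kappa>)"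
      unfolding sum.distrib[symmetric] by (intro sum.cong refl) (simp add: algebra_simps)
    also have "(\<Sum>\<xi>\<in>?X. \<Sum>\<eta>\<in>?X. if \<xi> = \<eta> then Fh \<xi> * Fh \<eta> else 0) = S"
      by (simp add: S_def power2_eq_square)
    also have "(\<Sum>\<xi>\<in>?X. \<Sum>\<eta>\<in>?X. Fh \<xi> * Fh \<eta> * \<kappa>) = \<kappa> * (\<Sum>\<xi>\<in>?X. Fh \<xi>)\<^sup>2"
      by (simp add: power2_eq_square sum_product sum_distrib_left mult_ac)
    finally show ?thesis .
  qed
  finally have B: "Ex (\<lambda>x. \<nu> x * (norm (w x))\<^sup>2) \<le> S + \<kappa> * (\<Sum>\<xi>\<in>?X. Fh \<xi>)\<^sup>2" .
  have C: "(\<Sum>\<xi>\<in>?X. Fh \<xi>)\<^sup>2 \<le> ?n * S"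
    using Cauchy_Schwarz_ineq_sum[of "\<lambda>_. 1" Fh ?X] by (simp add: S_def)
  have D: "?n * \<epsilon>0\<^sup>2 \<le> S"
  proof -
    have "(\<Sum>\<xi>\<in>?X. \<epsilon>0\<^sup>2) \<le> S" unfolding S_def
      by (intro sum_mono power_mono) (use \<epsilon>0 in \<open>auto simp: spec_def\<close>)
    thus ?thesis by simp
  qed
  \<comment> \<open>There are at most S / \<open>\<epsilon>0\<^sup>2\<close> large frequencies, so
    \<open>2 * \<kappa> \<le> \<epsilon>0\<^sup>2\<close> bounds the off-diagonal part by half of
    S^2. It is absorbed on the left, which leaves S^2 at most 2S.\<close>
  have "\<kappa> * (?n * S) \<le> S * S / 2"
  proof -
    have "2 * \<kappa> * ?n \<le> \<epsilon>0\<^sup>2 * ?n" using \<epsilon>0 by (intro mult_right_mono) auto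
    hence "2 * \<kappa> * ?n \<le> S" using D by (simp add: mult.commute)
    hence "2 * \<kappa> * ?n * S \<le> S * S" using S0 by (rule mult_right_mono)
    thus ?thesis by (simp add: mult_ac)
  qed
  moreover have "\<kappa> * (\<Sum>\<xi>\<in>?X. Fh \<xi>)\<^sup>2 \<le> \<kappa> * (?n * S)" using C \<kappa>_nonneg by (rule mult_left_mono)
  ultimately have "S * S \<le> S + S * S / 2" using A B by (simp add: power2_eq_square)
  hence "S * S \<le> 2 * S" by simp
  hence "S \<le> 2" using S0 by (cases "S = 0") auto
  thus ?thesis by (simp add: S_def)
qed

lemma sum_spec_le: assumes "\<epsilon>0 \<le> \<epsilon>" shows "(\<Sum>\<xi>\<in>spec \<epsilon>. (Fh \<xi>)\<^sup>2) \<le> 2"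
  using sum_mono2[OF finite_spec spec_mono[OF assms], of "\<lambda>\<xi>. (Fh \<xi>)\<^sup>2"] large_sieve by auto

text \<open>Chebyshev's inequality with the large sieve constant 2. The bound involves neither q nor
  \<open>Q\<close>; this makes the Bohr sets of the spectrum dense uniformly in the field.\<close>

lemma card_spec: assumes "\<epsilon>0 \<le> \<epsilon>" shows "card (spec \<epsilon>) \<le> nat \<lfloor>2 / \<epsilon>\<^sup>2\<rfloor>"
proof -
  have "(\<Sum>\<xi>\<in>spec \<epsilon>. \<epsilon>\<^sup>2) \<le> (\<Sum>\<xi>\<in>spec \<epsilon>. (Fh \<xi>)\<^sup>2)"
    by (intro sum_mono power_mono) (use \<epsilon>0 assms in \<open>auto simp: spec_def\<close>)
  also have "\<dots> \<le> 2" by (rule sum_spec_le[OF assms])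
  finally have "real (card (spec \<epsilon>)) \<le> 2 / \<epsilon>\<^sup>2" using \<epsilon>0 assms by (simp add: field_simps)
  thus ?thesis by (simp add: le_nat_floor)
qed

text \<open>One factor of each cube is spent on smallness. Between \<open>\<epsilon>0\<close> and
  \<epsilon> the remaining squares are paid for by the large sieve, below \<open>\<epsilon>0\<close>
  by Parseval, where the spent factor has to compensate \<open>Q\<close>.\<close>

lemma sum_cube_off_spec: assumes "\<epsilon>0 \<le> \<epsilon>"
  shows "(\<Sum>\<xi>\<in>V - spec \<epsilon>. (Fh \<xi>)^3) \<le> 2 * \<epsilon> + \<epsilon>0 * Q"
proof -
  have "(\<Sum>\<xi>\<in>V - spec \<epsilon>. (Fh \<xi>)^3) = (\<Sum>\<xi>\<in>spec \<epsilon>0 - spec \<epsilon>. (Fh \<xi>)^3) + (\<Sum>\<xi>\<in>V - spec \<epsilon>0. (Fh \<xi>)^3)"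
    by (subst sum.union_disjoint[symmetric])
       (use finite_vectors spec_mono[OF assms] spec_subset in \<open>auto intro!: sum.cong\<close>)
  also have "(\<Sum>\<xi>\<in>spec \<epsilon>0 - spec \<epsilon>. (Fh \<xi>)^3) \<le> (\<Sum>\<xi>\<in>spec \<epsilon>0 - spec \<epsilon>. \<epsilon> * (Fh \<xi>)\<^sup>2)"
    by (rule sum_mono) (auto simp: spec_def intro!: cube_le)
  also have "\<dots> \<le> (\<Sum>\<xi>\<in>spec \<epsilon>0. \<epsilon> * (Fh \<xi>)\<^sup>2)"
    by (rule sum_mono2) (use \<epsilon>0 assms in auto)
  also have "\<dots> \<le> \<epsilon> * 2" unfolding sum_distrib_left[symmetric]
    by (rule mult_left_mono[OF large_sieve]) (use \<epsilon>0 assms in auto)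
  also have "(\<Sum>\<xi>\<in>V - spec \<epsilon>0. (Fh \<xi>)^3) \<le> (\<Sum>\<xi>\<in>V - spec \<epsilon>0. \<epsilon>0 * (Fh \<xi>)\<^sup>2)"
    by (rule sum_mono) (auto simp: spec_def intro!: cube_le)
  also have "\<dots> \<le> (\<Sum>\<xi>\<in>V. \<epsilon>0 * (Fh \<xi>)\<^sup>2)"
    by (rule sum_mono2) (use \<epsilon>0 finite_vectors in auto)
  also have "\<dots> \<le> \<epsilon>0 * Q" unfolding sum_distrib_left[symmetric]
    by (rule mult_left_mono[OF sum_Fh_square]) (use \<epsilon>0 in auto)
  finally show ?thesis by simp
qed

lemma sum_cube: assumes "\<epsilon>0 \<le> 1" shows "(\<Sum>\<xi>\<in>V. (Fh \<xi>)^3) \<le> 2 + \<epsilon>0 * Q"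
proof -
  have "(\<Sum>\<xi>\<in>V. (Fh \<xi>)^3) = (\<Sum>\<xi>\<in>spec \<epsilon>0. (Fh \<xi>)^3) + (\<Sum>\<xi>\<in>V - spec \<epsilon>0. (Fh \<xi>)^3)"
    by (rule sum.subset_diff[OF spec_subset[of \<epsilon>0] finite_vectors, THEN trans]) simp
  also have "(\<Sum>\<xi>\<in>spec \<epsilon>0. (Fh \<xi>)^3) \<le> (\<Sum>\<xi>\<in>spec \<epsilon>0. (Fh \<xi>)\<^sup>2)"
    by (rule sum_mono) (auto simp: spec_def Fh_le_1 intro: power_decreasing)
  also have "\<dots> \<le> 2" by (rule large_sieve)
  also have "(\<Sum>\<xi>\<in>V - spec \<epsilon>0. (Fh \<xi>)^3) \<le> (\<Sum>\<xi>\<in>V - spec \<epsilon>0. \<epsilon>0 * (Fh \<xi>)\<^sup>2)"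
    by (rule sum_mono) (auto simp: spec_def intro!: cube_le)
  also have "\<dots> \<le> (\<Sum>\<xi>\<in>V. \<epsilon>0 * (Fh \<xi>)\<^sup>2)"
    by (rule sum_mono2) (use \<epsilon>0 finite_vectors in auto)
  also have "\<dots> \<le> \<epsilon>0 * Q" unfolding sum_distrib_left[symmetric]
    by (rule mult_left_mono[OF sum_Fh_square]) (use \<epsilon>0 in auto)
  finally show ?thesis by simp
qed

lemma sm_nonneg: "D \<subseteq> V \<Longrightarrow> x \<in> V \<Longrightarrow> 0 \<le> sm D F x"
  unfolding sm_def by (intro divide_nonneg_nonneg sum_nonneg F_nonneg) (auto simp: a_minus_def)

text \<open>All nonzero frequencies of \<nu> are at most \<kappa>, so inversion shows that the
  smoothing of \<nu> exceeds its mean 1 by at most \<kappa> times the sum of \<open>pD\<close>; the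
  smoothing of \<open>F\<close> lies below it.\<close>

lemma sm_le: assumes D: "D \<subseteq> V" "0 < card D" and x: "x \<in> V" shows "sm D F x \<le> 1 + \<kappa> * (N / card D)"
proof -
  let ?nt = "ft (\<lambda>x. complex_of_real (\<nu> x))"
  have "sm D F x \<le> sm D \<nu> x" using D x F_le by (intro sm_mono)
  also have "\<dots> \<le> norm (complex_of_real (sm D \<nu> x))" by simp
  also have "complex_of_real (sm D \<nu> x) = (\<Sum>\<xi>\<in>V. ?nt \<xi> * of_real (pD D \<xi>) * cnj (\<psi> \<xi> x))"
    by (subst ft_inversion[OF x, of "\<lambda>x. of_real (sm D \<nu> x)"]) (use D in \<open>simp add: ft_sm\<close>)
  also have "norm \<dots> \<le> (\<Sum>\<xi>\<in>V. (if \<xi> = \<zero>\<^bsub>M\<^esub> then 1 else 0) + \<kappa> * pD D \<xi>)"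
  proof (rule sum_norm_le)
    fix \<xi> assume \<xi>: "\<xi> \<in> V"
    show "norm (?nt \<xi> * of_real (pD D \<xi>) * cnj (\<psi> \<xi> x)) \<le> (if \<xi> = \<zero>\<^bsub>M\<^esub> then 1 else 0) + \<kappa> * pD D \<xi>"
    proof (cases "\<xi> = \<zero>\<^bsub>M\<^esub>")
      case True
      have "?nt \<zero>\<^bsub>M\<^esub> = of_real (Ex \<nu>)"
        unfolding ft_def Ex_of_real[symmetric] by (rule Ex_cong) simp
      thus ?thesis using True D x \<nu>_mean \<kappa>_nonneg by (simp add: pD_zero norm_mult)
    next
      case False
      thus ?thesis using \<xi> x \<nu>_ft[OF \<xi> False] pD_bounds[OF D(1) \<xi>]
        by (simp add: norm_mult mult_right_mono)
    qed
  qed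
  also have "\<dots> = 1 + \<kappa> * (N / card D)"
    using finite_vectors D by (simp add: sum.distrib sum_pD flip: sum_distrib_left)
  finally show ?thesis .
qed

lemma sm_mean: assumes D: "D \<subseteq> V" "0 < card D" shows "Ex (sm D F) = Ex F"
proof -
  have "ft (\<lambda>x. complex_of_real (f x)) \<zero>\<^bsub>M\<^esub> = of_real (Ex f)" for f
    unfolding ft_def Ex_of_real[symmetric] by (rule Ex_cong) simp
  thus ?thesis using ft_sm[OF D(1) M.zero_closed, of F] pD_zero[OF D]
    by (metis M.zero_closed mult.right_neutral of_real_1 of_real_eq_iff)
qed

text \<open>Parseval splits the mean square of the difference into three ranges. On
  \<open>spec \<epsilon>1\<close> the character at b is close to 1; between the thresholds the mass
  is small by hypothesis; below \<open>\<epsilon>3\<close> the small coefficients are summed against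
  \<open>pD\<close>.\<close>

lemma sm_almost_invariant:
  assumes D: "D \<subseteq> V" "0 < card D" and \<epsilon>: "\<epsilon>0 \<le> \<epsilon>3" "\<epsilon>3 \<le> \<epsilon>1" and \<rho>: "0 \<le> \<rho>"
    and b: "b \<in> Bohr (spec \<epsilon>1) \<rho>"
    and \<mu>: "(\<Sum>\<xi>\<in>spec \<epsilon>3 - spec \<epsilon>1. (Fh \<xi>)\<^sup>2) \<le> \<mu>"
  shows "(Ex (\<lambda>x. \<bar>sm D F (x \<oplus>\<^bsub>M\<^esub> b) - sm D F x\<bar>))\<^sup>2 \<le> 2 * \<rho>\<^sup>2 + 4 * \<mu> + 4 * \<epsilon>3\<^sup>2 * (N / card D)"
proof -
  have bV: "b \<in> V" using b Bohr_subset by auto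
  let ?g = "\<lambda>x. complex_of_real (sm D F x)"
  let ?T = "\<lambda>\<xi>. (Fh \<xi> * pD D \<xi> * norm (\<psi> \<xi> b - 1))\<^sup>2"
  have "(Ex (\<lambda>x. 1 * \<bar>sm D F (x \<oplus>\<^bsub>M\<^esub> b) - sm D F x\<bar>))\<^sup>2
      \<le> Ex (\<lambda>_. 1) * Ex (\<lambda>x. 1 * \<bar>sm D F (x \<oplus>\<^bsub>M\<^esub> b) - sm D F x\<bar>\<^sup>2)"
    by (rule Ex_CS) simp
  also have "\<dots> = Ex (\<lambda>x. (norm (?g (x \<oplus>\<^bsub>M\<^esub> b) - ?g x))\<^sup>2)"
    by (simp flip: of_real_diff)
  also have "\<dots> = (\<Sum>\<xi>\<in>V. (norm (ft (\<lambda>x. ?g (x \<oplus>\<^bsub>M\<^esub> b) - ?g x) \<xi>))\<^sup>2)"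
    by (rule parseval[symmetric])
  also have "\<dots> = (\<Sum>\<xi>\<in>V. ?T \<xi>)"
  proof (rule sum.cong[OF refl])
    fix \<xi> assume \<xi>: "\<xi> \<in> V"
    have "ft (\<lambda>x. ?g (x \<oplus>\<^bsub>M\<^esub> b) - ?g x) \<xi> = ft (\<lambda>x. ?g (x \<oplus>\<^bsub>M\<^esub> b)) \<xi> - ft ?g \<xi>"
      unfolding ft_def left_diff_distrib Ex_diff ..
    also have "\<dots> = Ft \<xi> * of_real (pD D \<xi>) * cnj (\<psi> \<xi> b - 1)"
      using \<xi> bV D by (simp add: ft_shift[of _ _ ?g] ft_sm algebra_simps)
    finally show "(norm (ft (\<lambda>x. ?g (x \<oplus>\<^bsub>M\<^esub> b) - ?g x) \<xi>))\<^sup>2 = ?T \<xi>"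
      using pD_bounds[OF D(1) \<xi>] by (simp only: norm_mult complex_mod_cnj Fh_def) simp
  qed
  also have "\<dots> = (\<Sum>\<xi>\<in>spec \<epsilon>1. ?T \<xi>) + (\<Sum>\<xi>\<in>spec \<epsilon>3 - spec \<epsilon>1. ?T \<xi>) + (\<Sum>\<xi>\<in>V - spec \<epsilon>3. ?T \<xi>)"
  proof -
    have "(\<Sum>\<xi>\<in>V. ?T \<xi>) = (\<Sum>\<xi>\<in>V - spec \<epsilon>3. ?T \<xi>) + (\<Sum>\<xi>\<in>spec \<epsilon>3. ?T \<xi>)"
      by (rule sum.subset_diff[OF spec_subset finite_vectors])
    moreover have "(\<Sum>\<xi>\<in>spec \<epsilon>3. ?T \<xi>) = (\<Sum>\<xi>\<in>spec \<epsilon>3 - spec \<epsilon>1. ?T \<xi>) + (\<Sum>\<xi>\<in>spec \<epsilon>1. ?T \<xi>)"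
      by (rule sum.subset_diff[OF spec_mono[OF \<epsilon>(2)] finite_spec])
    ultimately show ?thesis by simp
  qed
  also have "(\<Sum>\<xi>\<in>spec \<epsilon>1. ?T \<xi>) \<le> (\<Sum>\<xi>\<in>spec \<epsilon>1. \<rho>\<^sup>2 * (Fh \<xi>)\<^sup>2)"
  proof (rule sum_mono)
    fix \<xi> assume h: "\<xi> \<in> spec \<epsilon>1"
    hence \<xi>: "\<xi> \<in> V" using spec_subset by auto
    have "norm (\<psi> \<xi> b - 1) \<le> \<rho>" using h b by (auto simp: Bohr_def)
    hence "Fh \<xi> * pD D \<xi> * norm (\<psi> \<xi> b - 1) \<le> Fh \<xi> * 1 * \<rho>"
      using pD_bounds[OF D(1) \<xi>] by (intro mult_mono) auto
    hence "?T \<xi> \<le> (Fh \<xi> * 1 * \<rho>)\<^sup>2" using pD_bounds[OF D(1) \<xi>] by (intro power_mono) auto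
    thus "?T \<xi> \<le> \<rho>\<^sup>2 * (Fh \<xi>)\<^sup>2" by (simp add: power_mult_distrib mult.commute)
  qed
  also have "\<dots> \<le> \<rho>\<^sup>2 * 2" unfolding sum_distrib_left[symmetric]
    by (rule mult_left_mono[OF sum_spec_le]) (use \<epsilon> in auto)
  also have "(\<Sum>\<xi>\<in>spec \<epsilon>3 - spec \<epsilon>1. ?T \<xi>) \<le> (\<Sum>\<xi>\<in>spec \<epsilon>3 - spec \<epsilon>1. 4 * (Fh \<xi>)\<^sup>2)"
  proof (rule sum_mono)
    fix \<xi> assume h: "\<xi> \<in> spec \<epsilon>3 - spec \<epsilon>1"
    hence \<xi>: "\<xi> \<in> V" using spec_subset by auto
    have "norm (\<psi> \<xi> b - 1) \<le> 2" using norm_triangle_ineq4[of "\<psi> \<xi> b" 1] \<xi> bV by simp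
    hence "Fh \<xi> * pD D \<xi> * norm (\<psi> \<xi> b - 1) \<le> Fh \<xi> * 1 * 2"
      using pD_bounds[OF D(1) \<xi>] by (intro mult_mono) auto
    hence "?T \<xi> \<le> (Fh \<xi> * 1 * 2)\<^sup>2" using pD_bounds[OF D(1) \<xi>] by (intro power_mono) auto
    thus "?T \<xi> \<le> 4 * (Fh \<xi>)\<^sup>2" by (simp add: power_mult_distrib)
  qed
  also have "\<dots> \<le> 4 * \<mu>" unfolding sum_distrib_left[symmetric] using \<mu> by simp
  also have "(\<Sum>\<xi>\<in>V - spec \<epsilon>3. ?T \<xi>) \<le> (\<Sum>\<xi>\<in>V - spec \<epsilon>3. 4 * \<epsilon>3\<^sup>2 * pD D \<xi>)"
  proof (rule sum_mono)
    fix \<xi> assume h: "\<xi> \<in> V - spec \<epsilon>3"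
    hence \<xi>: "\<xi> \<in> V" by auto
    have p: "0 \<le> pD D \<xi>" "pD D \<xi> \<le> 1" using pD_bounds[OF D(1) \<xi>] by auto
    have "norm (\<psi> \<xi> b - 1) \<le> 2" using norm_triangle_ineq4[of "\<psi> \<xi> b" 1] \<xi> bV by simp
    moreover have "Fh \<xi> \<le> \<epsilon>3" using h by (auto simp: spec_def)
    ultimately have "Fh \<xi> * pD D \<xi> * norm (\<psi> \<xi> b - 1) \<le> \<epsilon>3 * pD D \<xi> * 2"
      using p \<epsilon> \<epsilon>0 by (intro mult_mono) auto
    hence "?T \<xi> \<le> (\<epsilon>3 * pD D \<xi> * 2)\<^sup>2" using p by (intro power_mono) auto
    also have "\<dots> = 4 * \<epsilon>3\<^sup>2 * (pD D \<xi> * pD D \<xi>)" by (simp add: power2_eq_square)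
    also have "\<dots> \<le> 4 * \<epsilon>3\<^sup>2 * (pD D \<xi> * 1)" using p by (intro mult_left_mono) auto
    finally show "?T \<xi> \<le> 4 * \<epsilon>3\<^sup>2 * pD D \<xi>" by simp
  qed
  also have "\<dots> \<le> (\<Sum>\<xi>\<in>V. 4 * \<epsilon>3\<^sup>2 * pD D \<xi>)"
    by (rule sum_mono2) (use finite_vectors D pD_bounds in auto)
  also have "\<dots> = 4 * \<epsilon>3\<^sup>2 * (N / card D)" using D by (simp add: sum_pD flip: sum_distrib_left)
  finally show ?thesis by simp
qed

end

section \<open>A counting theorem relative to a pseudorandom majorant\<close>

text \<open>The interval from 0 to 2 is the range of the smoothed function. Halving all factors
  reduces the claim to telescoping for factors of norm at most one.\<close>

lemma prod_diff_le: assumes "finite J" "\<And>i. i \<in> J \<Longrightarrow> 0 \<le> a i \<and> a i \<le> (2::real)"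
    "\<And>i. i \<in> J \<Longrightarrow> 0 \<le> b i \<and> b i \<le> 2"
  shows "\<bar>(\<Prod>i\<in>J. a i) - (\<Prod>i\<in>J. b i)\<bar> \<le> 2 ^ card J * (\<Sum>i\<in>J. \<bar>a i - b i\<bar>)"
proof -
  have "norm ((\<Prod>i\<in>J. a i / 2) - (\<Prod>i\<in>J. b i / 2)) \<le> (\<Sum>i\<in>J. norm (a i / 2 - b i / 2))"
    by (rule norm_prod_diff) (use assms in \<open>auto simp: abs_le_iff\<close>)
  also have "\<dots> \<le> (\<Sum>i\<in>J. \<bar>a i - b i\<bar>)"
    by (rule sum_mono) (simp flip: diff_divide_distrib)
  finally have "\<bar>(\<Prod>i\<in>J. a i) / 2 ^ card J - (\<Prod>i\<in>J. b i) / 2 ^ card J\<bar> \<le> (\<Sum>i\<in>J. \<bar>a i - b i\<bar>)"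
    by (simp add: prod_dividef)
  thus ?thesis by (simp add: field_simps flip: diff_divide_distrib)
qed

text \<open>Bernoulli's inequality, read as the tangent line at a. Averaging it over x gives the
  instance of Jensen's inequality that bounds the diagonal solutions from below.\<close>

lemma power_tangent: fixes x a :: real assumes "0 \<le> (x::real)" "0 < a" shows "a ^ n + n * a ^ (n - 1) * (x - a) \<le> x ^ n"
proof (cases n)
  case (Suc m)
  have "1 + n * (x / a - 1) \<le> (1 + (x / a - 1)) ^ n"
    by (rule Bernoulli_inequality) (use assms in simp)
  hence "a ^ n * (1 + n * (x / a - 1)) \<le> a ^ n * (x / a) ^ n" using assms by (intro mult_left_mono) auto
  also have "\<dots> = x ^ n" using assms by (simp add: power_divide)
  also have "a ^ n * (1 + n * (x / a - 1)) = a ^ n + n * (a ^ (n - 1) * (x - a))"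
    using assms Suc by (simp add: field_simps)
  finally show ?thesis by simp
qed simp

context bilin_space begin

text \<open>The normalised number of solutions of y (k + 1) = \<Sum>i. a i * y i, with the equation
  solved for its last variable. The value type is open because the Fourier identity needs complex
  functions and the estimates real ones.\<close>

definition Lam :: "(nat \<Rightarrow> 'a) \<Rightarrow> nat \<Rightarrow> ('c \<Rightarrow> 'z) \<Rightarrow> 'z::real_normed_field" where
  "Lam a k g = (\<Sum>y\<in>PiE {..k} (\<lambda>_. V). (\<Prod>i\<le>k. g (y i)) * g (lc {..k} a y)) / of_nat (card V) ^ (k + 1)"

text \<open>The coefficients of the same equation in homogeneous form, the dependent variable
  receiving -1.\<close>

definition coef where "coef a k i = (if i \<le> k then a i else \<ominus> \<one>)" for k :: nat

lemma Lam_of_real: "Lam a k (\<lambda>x. of_real (g x)) = complex_of_real (Lam a k g)"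
  by (simp add: Lam_def)

lemma Lam_ft: assumes a: "a \<in> {..k} \<rightarrow> K"
  shows "Lam a k g = (\<Sum>\<xi>\<in>V. \<Prod>i\<le>Suc k. ft g (coef a k i \<odot>\<^bsub>M\<^esub> \<xi>))"
proof -
  let ?P = "PiE {..k} (\<lambda>_. V)"
  have "(\<Sum>y\<in>?P. (\<Prod>i\<le>k. g (y i)) * g (lc {..k} a y))
      = (\<Sum>y\<in>?P. \<Sum>\<xi>\<in>V. ft g (\<ominus>\<^bsub>M\<^esub> \<xi>) * (\<Prod>i\<le>k. g (y i) * \<psi> (a i \<odot>\<^bsub>M\<^esub> \<xi>) (y i)))"
  proof (rule sum.cong[OF refl])
    fix y assume "y \<in> ?P"
    hence y: "y \<in> {..k} \<rightarrow> V" by auto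
    have "g (lc {..k} a y) = (\<Sum>\<xi>\<in>V. ft g (\<ominus>\<^bsub>M\<^esub> \<xi>) * \<psi> \<xi> (lc {..k} a y))"
      by (rule ft_inversion') (use a y in auto)
    also have "\<dots> = (\<Sum>\<xi>\<in>V. ft g (\<ominus>\<^bsub>M\<^esub> \<xi>) * (\<Prod>i\<le>k. \<psi> (a i \<odot>\<^bsub>M\<^esub> \<xi>) (y i)))"
      using a y by (simp add: \<psi>_lc)
    finally show "(\<Prod>i\<le>k. g (y i)) * g (lc {..k} a y)
      = (\<Sum>\<xi>\<in>V. ft g (\<ominus>\<^bsub>M\<^esub> \<xi>) * (\<Prod>i\<le>k. g (y i) * \<psi> (a i \<odot>\<^bsub>M\<^esub> \<xi>) (y i)))"
      by (simp add: sum_distrib_left prod.distrib mult_ac)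
  qed
  also have "\<dots> = (\<Sum>\<xi>\<in>V. ft g (\<ominus>\<^bsub>M\<^esub> \<xi>) * (\<Sum>y\<in>?P. \<Prod>i\<le>k. g (y i) * \<psi> (a i \<odot>\<^bsub>M\<^esub> \<xi>) (y i)))"
    by (subst sum.swap) (simp only: sum_distrib_left)
  also have "\<dots> = (\<Sum>\<xi>\<in>V. ft g (\<ominus>\<^bsub>M\<^esub> \<xi>) * (\<Prod>i\<le>k. \<Sum>x\<in>V. g x * \<psi> (a i \<odot>\<^bsub>M\<^esub> \<xi>) x))"
    using finite_vectors by (simp add: prod_sum_PiE)
  finally have "Lam a k g = (\<Sum>\<xi>\<in>V. ft g (\<ominus>\<^bsub>M\<^esub> \<xi>) * (\<Prod>i\<le>k. ft g (a i \<odot>\<^bsub>M\<^esub> \<xi>)))"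
  proof -
    have p: "(\<Prod>i\<le>k. ft g (a i \<odot>\<^bsub>M\<^esub> \<xi>))
        = (\<Prod>i\<le>k. \<Sum>x\<in>V. g x * \<psi> (a i \<odot>\<^bsub>M\<^esub> \<xi>) x) / of_nat (card V) ^ (k + 1)" for \<xi>
      by (simp add: ft_def Ex_def prod_dividef)
    assume "(\<Sum>y\<in>?P. (\<Prod>i\<le>k. g (y i)) * g (lc {..k} a y)) = (\<Sum>\<xi>\<in>V. ft g (\<ominus>\<^bsub>M\<^esub> \<xi>) * (\<Prod>i\<le>k. \<Sum>x\<in>V. g x * \<psi> (a i \<odot>\<^bsub>M\<^esub> \<xi>) x))"
    thus ?thesis unfolding Lam_def p by (simp add: sum_divide_distrib)
  qed
  also have "\<dots> = (\<Sum>\<xi>\<in>V. \<Prod>i\<le>Suc k. ft g (coef a k i \<odot>\<^bsub>M\<^esub> \<xi>))"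
    by (rule sum.cong) (auto simp: coef_def smult_l_minus mult.commute)
  finally show ?thesis .
qed

lemma lc_shift: assumes "finite I" "a \<in> I \<rightarrow> K" "y \<in> I \<rightarrow> V" "x \<in> V"
  shows "lc I a (\<lambda>i. if i \<in> I then y i \<oplus>\<^bsub>M\<^esub> x else u i) = lc I a y \<oplus>\<^bsub>M\<^esub> finsum R a I \<odot>\<^bsub>M\<^esub> x"
proof -
  have "lc I a (\<lambda>i. if i \<in> I then y i \<oplus>\<^bsub>M\<^esub> x else u i)
      = finsum M (\<lambda>i. a i \<odot>\<^bsub>M\<^esub> y i \<oplus>\<^bsub>M\<^esub> a i \<odot>\<^bsub>M\<^esub> x) I"
    unfolding lc_def by (rule M.finsum_cong') (use assms in \<open>auto simp: Pi_iff smult_r_distr\<close>)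
  also have "\<dots> = lc I a y \<oplus>\<^bsub>M\<^esub> finsum M (\<lambda>i. a i \<odot>\<^bsub>M\<^esub> x) I"
    unfolding lc_def by (rule M.finsum_addf) (use assms in auto)
  also have "finsum M (\<lambda>i. a i \<odot>\<^bsub>M\<^esub> x) I = finsum R a I \<odot>\<^bsub>M\<^esub> x"
    using assms(1,2)
  proof (induction I rule: finite_induct)
    case (insert j I)
    hence "a j \<in> K" "a \<in> I \<rightarrow> K" by auto
    thus ?case using insert assms(4)
      by (subst M.finsum_insert) (auto simp: finsum_insert smult_l_distr)
  qed (use assms in simp)
  finally show ?thesis .
qed

text \<open>Translating a solution by a common vector again gives a solution, since the coefficients
  \<open>a\<close> sum to one.\<close>

lemma Lam_ge: fixes g :: "'c \<Rightarrow> real"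
  assumes a: "a \<in> {..k} \<rightarrow> K" "finsum R a {..k} = \<one>" and g: "\<And>x. x \<in> V \<Longrightarrow> 0 \<le> g x"
    and C: "C \<subseteq> V"
    and h: "\<And>y. y \<in> PiE {..k} (\<lambda>_. C) \<Longrightarrow>
      Ex (\<lambda>x. (\<Prod>i\<le>k. g (y i \<oplus>\<^bsub>M\<^esub> x)) * g (lc {..k} a y \<oplus>\<^bsub>M\<^esub> x)) \<ge> \<delta>"
  shows "Lam a k g \<ge> (card C / N) ^ (k + 1) * \<delta>"
proof -
  let ?P = "PiE {..k} (\<lambda>_. V)"
  let ?\<Phi> = "\<lambda>y. (\<Prod>i\<le>k. g (y i)) * g (lc {..k} a y)"
  let ?sh = "\<lambda>x y. (\<lambda>i. if i \<in> {..k} then y i \<oplus>\<^bsub>M\<^esub> x else undefined)"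
  have fP: "finite ?P" using finite_vectors by (intro finite_PiE) auto
  have bij: "bij_betw (?sh x) ?P ?P" if "x \<in> V" for x
  proof (rule bij_betw_byWitness[where f' = "?sh (\<ominus>\<^bsub>M\<^esub> x)"])
    show "\<forall>y\<in>?P. ?sh (\<ominus>\<^bsub>M\<^esub> x) (?sh x y) = y"
      using that by (auto simp: fun_eq_iff PiE_def Pi_iff extensional_def M.a_assoc M.r_neg)
    show "\<forall>y\<in>?P. ?sh x (?sh (\<ominus>\<^bsub>M\<^esub> x) y) = y"
      using that by (auto simp: fun_eq_iff PiE_def Pi_iff extensional_def M.a_assoc M.l_neg)
  qed (use that in \<open>auto simp: PiE_def Pi_iff extensional_def\<close>)
  have *: "?\<Phi> (?sh x y) = (\<Prod>i\<le>k. g (y i \<oplus>\<^bsub>M\<^esub> x)) * g (lc {..k} a y \<oplus>\<^bsub>M\<^esub> x)"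
    if "x \<in> V" "y \<in> ?P" for x y
    using lc_shift[of "{..k}" a y x] that a by (auto simp: PiE_def)
  have "(\<Sum>y\<in>?P. ?\<Phi> y) = Ex (\<lambda>x. \<Sum>y\<in>?P. ?\<Phi> y)" by simp
  also have "\<dots> = Ex (\<lambda>x. \<Sum>y\<in>?P. ?\<Phi> (?sh x y))"
    by (rule Ex_cong) (rule sum.reindex_bij_betw[OF bij, symmetric])
  also have "\<dots> = (\<Sum>y\<in>?P. Ex (\<lambda>x. ?\<Phi> (?sh x y)))" by (rule Ex_sum)
  also have "\<dots> \<ge> (\<Sum>y\<in>PiE {..k} (\<lambda>_. C). Ex (\<lambda>x. ?\<Phi> (?sh x y)))"
  proof (rule sum_mono2[OF fP])
    show "PiE {..k} (\<lambda>_. C) \<subseteq> ?P" using C by (rule PiE_mono)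
    fix y assume "y \<in> ?P - PiE {..k} (\<lambda>_. C)"
    hence y: "y \<in> ?P" by simp
    show "0 \<le> Ex (\<lambda>x. ?\<Phi> (?sh x y))"
    proof (rule Ex_nonneg)
      fix x assume x: "x \<in> V"
      have "lc {..k} a y \<in> V" using a y by auto
      thus "0 \<le> ?\<Phi> (?sh x y)" unfolding *[OF x y] using x y
        by (intro mult_nonneg_nonneg prod_nonneg g ballI) auto
    qed
  qed
  finally have 1: "(\<Sum>y\<in>PiE {..k} (\<lambda>_. C). Ex (\<lambda>x. ?\<Phi> (?sh x y))) \<le> (\<Sum>y\<in>?P. ?\<Phi> y)" .
  have "(\<Sum>y\<in>PiE {..k} (\<lambda>_. C). Ex (\<lambda>x. ?\<Phi> (?sh x y))) \<ge> (\<Sum>y\<in>PiE {..k} (\<lambda>_. C). \<delta>)"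
  proof (rule sum_mono)
    fix y assume y: "y \<in> PiE {..k} (\<lambda>_. C)"
    have "y \<in> ?P" using y C PiE_mono by blast
    hence "Ex (\<lambda>x. ?\<Phi> (?sh x y)) = Ex (\<lambda>x. (\<Prod>i\<le>k. g (y i \<oplus>\<^bsub>M\<^esub> x)) * g (lc {..k} a y \<oplus>\<^bsub>M\<^esub> x))"
      by (intro Ex_cong *)
    thus "\<delta> \<le> Ex (\<lambda>x. ?\<Phi> (?sh x y))" using h[OF y] by simp
  qed
  hence "(\<Sum>y\<in>?P. ?\<Phi> y) \<ge> real (card C) ^ (k + 1) * \<delta>"
    using 1 by (simp add: card_PiE)
  hence "(\<Sum>y\<in>?P. ?\<Phi> y) / N ^ (k + 1) \<ge> real (card C) ^ (k + 1) * \<delta> / N ^ (k + 1)"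
    using N_pos by (intro divide_right_mono) auto
  thus ?thesis by (simp add: Lam_def power_divide)
qed

end

context majorised begin

text \<open>Only three factors with nonzero coefficients are kept, the others being at most 1. If
  the frequency of factor i lies in the spectrum, the Bohr set makes \<open>1 - pD\<close> at most
  twice \<open>\<theta>^3\<close>; otherwise factor i itself is small. In both cases AM-GM leads to
  sums of cubes.\<close>

lemma triple_sum_bound:
  assumes a: "a \<in> {..k} \<rightarrow> K" and ijl: "{i, j, l} \<subseteq> {..Suc k}" "i \<noteq> j" "i \<noteq> l" "j \<noteq> l"
    and nz: "coef a k i \<noteq> \<zero>" "coef a k j \<noteq> \<zero>" "coef a k l \<noteq> \<zero>"
    and \<theta>: "0 < \<theta>" "\<theta> \<le> 1" "\<epsilon>0 \<le> \<theta>^3" "\<epsilon>0 * Q \<le> \<theta>^3"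
    and D: "D = Bohr (spec (\<theta>^3)) (\<theta>^3)"
  shows "(\<Sum>\<xi>\<in>V. (\<Prod>i\<le>Suc k. Fh (coef a k i \<odot>\<^bsub>M\<^esub> \<xi>)) * (1 - pD D (coef a k i \<odot>\<^bsub>M\<^esub> \<xi>))) \<le> 9 * \<theta>"
proof -
  let ?c = "coef a k" and ?\<epsilon> = "\<theta>^3"
  have cK: "?c i \<in> K" for i using a by (auto simp: coef_def Pi_iff)
  have \<epsilon>1: "?\<epsilon> \<le> 1" using \<theta> by (simp add: power_le_one)
  have DV: "D \<subseteq> V" unfolding D by (rule Bohr_subset)
  have cube: "(\<Sum>\<xi>\<in>V. (Fh (?c m \<odot>\<^bsub>M\<^esub> \<xi>))^3) \<le> 3" if "?c m \<noteq> \<zero>" for m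
  proof -
    have "(\<Sum>\<xi>\<in>V. (Fh (?c m \<odot>\<^bsub>M\<^esub> \<xi>))^3) = (\<Sum>\<xi>\<in>V. (Fh \<xi>)^3)"
      by (rule sum.reindex_bij_betw[OF bij_smult[OF cK that]])
    also have "\<dots> \<le> 2 + \<epsilon>0 * Q" by (rule sum_cube) (use \<theta> \<epsilon>1 in linarith)
    finally show ?thesis using \<theta> \<epsilon>1 by linarith
  qed
  let ?X = "\<lambda>\<xi>. Fh (?c i \<odot>\<^bsub>M\<^esub> \<xi>)" and ?Y = "\<lambda>\<xi>. Fh (?c j \<odot>\<^bsub>M\<^esub> \<xi>)" and ?Z = "\<lambda>\<xi>. Fh (?c l \<odot>\<^bsub>M\<^esub> \<xi>)"
  let ?off = "\<lambda>\<xi>. if ?c i \<odot>\<^bsub>M\<^esub> \<xi> \<in> V - spec ?\<epsilon> then (?X \<xi>)^3 else 0"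
  have off: "(\<Sum>\<xi>\<in>V. ?off \<xi>) \<le> 3 * ?\<epsilon>"
  proof -
    have "(\<Sum>\<xi>\<in>V. ?off \<xi>) = (\<Sum>\<xi>\<in>V. if \<xi> \<in> V - spec ?\<epsilon> then (Fh \<xi>)^3 else 0)"
      by (rule sum.reindex_bij_betw[OF bij_smult[OF cK nz(1)]])
    also have "\<dots> = (\<Sum>\<xi>\<in>V - spec ?\<epsilon>. (Fh \<xi>)^3)"
      by (rule sum.mono_neutral_cong_right) (use finite_vectors in auto)
    also have "\<dots> \<le> 2 * ?\<epsilon> + \<epsilon>0 * Q" by (rule sum_cube_off_spec[OF \<theta>(3)])
    finally show ?thesis using \<theta> by linarith
  qed
  have "(\<Sum>\<xi>\<in>V. (\<Prod>i\<le>Suc k. Fh (?c i \<odot>\<^bsub>M\<^esub> \<xi>)) * (1 - pD D (?c i \<odot>\<^bsub>M\<^esub> \<xi>)))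
    \<le> (\<Sum>\<xi>\<in>V. 2 * ?\<epsilon> / 3 * ((?X \<xi>)^3 + (?Y \<xi>)^3 + (?Z \<xi>)^3)
        + (1 / \<theta>\<^sup>2 * ?off \<xi> + \<theta> * (?Y \<xi>)^3 + \<theta> * (?Z \<xi>)^3) / 3)"
  proof (rule sum_mono)
    fix \<xi> assume \<xi>: "\<xi> \<in> V"
    let ?p = "pD D (?c i \<odot>\<^bsub>M\<^esub> \<xi>)"
    have cV: "?c m \<odot>\<^bsub>M\<^esub> \<xi> \<in> V" for m using cK \<xi> by simp
    have p: "0 \<le> ?p" "?p \<le> 1" using pD_bounds[OF DV cV] by auto
    have "(\<Prod>i\<le>Suc k. Fh (?c i \<odot>\<^bsub>M\<^esub> \<xi>)) = (\<Prod>i\<in>{..Suc k} - {i,j,l}. Fh (?c i \<odot>\<^bsub>M\<^esub> \<xi>)) * (\<Prod>i\<in>{i,j,l}. Fh (?c i \<odot>\<^bsub>M\<^esub> \<xi>))"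
      by (rule prod.subset_diff) (use ijl in auto)
    also have "\<dots> \<le> 1 * (\<Prod>i\<in>{i,j,l}. Fh (?c i \<odot>\<^bsub>M\<^esub> \<xi>))"
      by (intro mult_right_mono prod_le_1 prod_nonneg) (use cV Fh_le_1 in auto)
    also have "\<dots> = ?X \<xi> * ?Y \<xi> * ?Z \<xi>" using ijl by simp
    finally have P: "(\<Prod>i\<le>Suc k. Fh (?c i \<odot>\<^bsub>M\<^esub> \<xi>)) \<le> ?X \<xi> * ?Y \<xi> * ?Z \<xi>" .
    have main: "(\<Prod>i\<le>Suc k. Fh (?c i \<odot>\<^bsub>M\<^esub> \<xi>)) * (1 - ?p) \<le> ?X \<xi> * ?Y \<xi> * ?Z \<xi> * (1 - ?p)"
      using P p by (intro mult_right_mono) auto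
    show "(\<Prod>i\<le>Suc k. Fh (?c i \<odot>\<^bsub>M\<^esub> \<xi>)) * (1 - ?p)
      \<le> 2 * ?\<epsilon> / 3 * ((?X \<xi>)^3 + (?Y \<xi>)^3 + (?Z \<xi>)^3)
        + (1 / \<theta>\<^sup>2 * ?off \<xi> + \<theta> * (?Y \<xi>)^3 + \<theta> * (?Z \<xi>)^3) / 3"
    proof (cases "?c i \<odot>\<^bsub>M\<^esub> \<xi> \<in> spec ?\<epsilon>")
      case True
      have "1 - ?p \<le> 2 * ?\<epsilon>" unfolding D by (rule pD_Bohr[OF spec_subset _ True]) (use \<theta> in simp)
      hence "?X \<xi> * ?Y \<xi> * ?Z \<xi> * (1 - ?p) \<le> ((?X \<xi>)^3 + (?Y \<xi>)^3 + (?Z \<xi>)^3) / 3 * (2 * ?\<epsilon>)"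
        using p by (intro mult_mono amgm3) auto
      moreover have "0 \<le> (1 / \<theta>\<^sup>2 * ?off \<xi> + \<theta> * (?Y \<xi>)^3 + \<theta> * (?Z \<xi>)^3) / 3" using \<theta> by simp
      moreover have "((?X \<xi>)^3 + (?Y \<xi>)^3 + (?Z \<xi>)^3) / 3 * (2 * ?\<epsilon>) = 2 * ?\<epsilon> / 3 * ((?X \<xi>)^3 + (?Y \<xi>)^3 + (?Z \<xi>)^3)"
        by simp
      ultimately show ?thesis using main by linarith
    next
      case False
      have "?X \<xi> * ?Y \<xi> * ?Z \<xi> * (1 - ?p) \<le> ?X \<xi> * ?Y \<xi> * ?Z \<xi> * 1"
        using p by (intro mult_left_mono) auto
      \<comment> \<open>The small factor is scaled by 1 / \<theta> before AM-GM. Its cubes off the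
        spectrum sum to O(\<theta>^3), so all three terms then contribute O(\<theta>).\<close>
      also have "\<dots> = \<theta> * ((?X \<xi> / \<theta>) * ?Y \<xi> * ?Z \<xi>)" using \<theta> by simp
      also have "\<dots> \<le> \<theta> * (((?X \<xi> / \<theta>)^3 + (?Y \<xi>)^3 + (?Z \<xi>)^3) / 3)"
        by (intro mult_left_mono amgm3) (use \<theta> in auto)
      also have "\<dots> = (1 / \<theta>\<^sup>2 * ?off \<xi> + \<theta> * (?Y \<xi>)^3 + \<theta> * (?Z \<xi>)^3) / 3"
        using \<theta> False cV by (simp add: power_divide field_simps power2_eq_square power3_eq_cube)
      finally have "?X \<xi> * ?Y \<xi> * ?Z \<xi> * (1 - ?p) \<le> \<dots>" .
      moreover have "0 \<le> 2 * ?\<epsilon> / 3 * ((?X \<xi>)^3 + (?Y \<xi>)^3 + (?Z \<xi>)^3)" using \<theta> by simp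
      ultimately show ?thesis using main by linarith
    qed
  qed
  also have "\<dots> = 2 * ?\<epsilon> / 3 * ((\<Sum>\<xi>\<in>V. (?X \<xi>)^3) + (\<Sum>\<xi>\<in>V. (?Y \<xi>)^3) + (\<Sum>\<xi>\<in>V. (?Z \<xi>)^3))
      + (1 / \<theta>\<^sup>2 * (\<Sum>\<xi>\<in>V. ?off \<xi>) + \<theta> * (\<Sum>\<xi>\<in>V. (?Y \<xi>)^3) + \<theta> * (\<Sum>\<xi>\<in>V. (?Z \<xi>)^3)) / 3"
    by (simp only: sum.distrib sum_distrib_left[symmetric] sum_divide_distrib[symmetric])
  also have "\<dots> \<le> 2 * ?\<epsilon> / 3 * (3 + 3 + 3) + (1 / \<theta>\<^sup>2 * (3 * ?\<epsilon>) + \<theta> * 3 + \<theta> * 3) / 3"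
    by (intro add_mono mult_left_mono divide_right_mono cube nz off) (use \<theta> in auto)
  also have "\<dots> = 6 * \<theta>^3 + 3 * \<theta>" using \<theta> by (simp add: field_simps power2_eq_square power3_eq_cube)
  also have "\<theta>^3 \<le> \<theta>" using \<theta> power_decreasing[of 1 3 \<theta>] by simp
  finally show ?thesis by simp
qed

text \<open>On the Fourier side smoothing multiplies each term by a product of values of
  \<open>pD\<close>, and one minus this product is at most the sum of the single losses. A factor
  with zero coefficient loses nothing, since \<open>pD\<close> is 1 at zero; a factor with nonzero
  coefficient needs two more such factors beside it, hence three distinguished indices.\<close>

lemma Lam_smooth_diff:
  assumes a: "a \<in> {..k} \<rightarrow> K"
    and three: "{i1, i2, i3} \<subseteq> {..Suc k}" "i1 \<noteq> i2" "i1 \<noteq> i3" "i2 \<noteq> i3"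
      "coef a k i1 \<noteq> \<zero>" "coef a k i2 \<noteq> \<zero>" "coef a k i3 \<noteq> \<zero>"
    and \<theta>: "0 < \<theta>" "\<theta> \<le> 1" "\<epsilon>0 \<le> \<theta>^3" "\<epsilon>0 * Q \<le> \<theta>^3"
    and D: "D = Bohr (spec (\<theta>^3)) (\<theta>^3)"
  shows "\<bar>Lam a k F - Lam a k (sm D F)\<bar> \<le> 9 * real (k + 2) * \<theta>"
proof -
  let ?c = "coef a k"
  have cK: "?c i \<in> K" for i using a by (auto simp: coef_def Pi_iff)
  have DV: "D \<subseteq> V" "0 < card D" unfolding D using Bohr_subset card_Bohr_pos[OF spec_subset] \<theta> by auto
  let ?P = "\<lambda>\<xi>. \<Prod>i\<le>Suc k. Ft (?c i \<odot>\<^bsub>M\<^esub> \<xi>)"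
  have eq: "complex_of_real (Lam a k F - Lam a k (sm D F)) = (\<Sum>\<xi>\<in>V. ?P \<xi> * (1 - of_real (\<Prod>i\<le>Suc k. pD D (?c i \<odot>\<^bsub>M\<^esub> \<xi>))))"
    unfolding of_real_diff Lam_of_real[symmetric] Lam_ft[OF a] sum_subtractf[symmetric]
  proof (rule sum.cong[OF refl])
    fix \<xi> assume "\<xi> \<in> V"
    hence "?c i \<odot>\<^bsub>M\<^esub> \<xi> \<in> V" for i using cK by simp
    hence "(\<Prod>i\<le>Suc k. ft (\<lambda>x. of_real (sm D F x)) (?c i \<odot>\<^bsub>M\<^esub> \<xi>))
        = (\<Prod>i\<le>Suc k. Ft (?c i \<odot>\<^bsub>M\<^esub> \<xi>) * of_real (pD D (?c i \<odot>\<^bsub>M\<^esub> \<xi>)))"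
      by (intro prod.cong refl ft_sm DV)
    thus "?P \<xi> - (\<Prod>i\<le>Suc k. ft (\<lambda>x. of_real (sm D F x)) (?c i \<odot>\<^bsub>M\<^esub> \<xi>))
       = ?P \<xi> * (1 - of_real (\<Prod>i\<le>Suc k. pD D (?c i \<odot>\<^bsub>M\<^esub> \<xi>)))"
      by (simp only: prod.distrib of_real_prod right_diff_distrib mult_1_right)
  qed
  have "\<bar>Lam a k F - Lam a k (sm D F)\<bar> = norm (complex_of_real (Lam a k F - Lam a k (sm D F)))"
    by (simp only: norm_of_real)
  also have "\<dots> = norm (\<Sum>\<xi>\<in>V. ?P \<xi> * (1 - of_real (\<Prod>i\<le>Suc k. pD D (?c i \<odot>\<^bsub>M\<^esub> \<xi>))))"
    unfolding eq ..
  also have "\<dots> \<le> (\<Sum>\<xi>\<in>V. \<Sum>i\<le>Suc k. (\<Prod>i\<le>Suc k. Fh (?c i \<odot>\<^bsub>M\<^esub> \<xi>)) * (1 - pD D (?c i \<odot>\<^bsub>M\<^esub> \<xi>)))"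
  proof (rule sum_norm_le)
    fix \<xi> assume "\<xi> \<in> V"
    hence cV: "?c i \<odot>\<^bsub>M\<^esub> \<xi> \<in> V" for i using cK by simp
    have b: "0 \<le> pD D (?c i \<odot>\<^bsub>M\<^esub> \<xi>) \<and> pD D (?c i \<odot>\<^bsub>M\<^esub> \<xi>) \<le> 1" for i
      using pD_bounds[OF DV(1) cV] by auto
    let ?q = "\<Prod>i\<le>Suc k. pD D (?c i \<odot>\<^bsub>M\<^esub> \<xi>)"
    have q1: "?q \<le> 1" by (rule prod_le_1) (use b in auto)
    have "norm (1 - complex_of_real ?q) = \<bar>1 - ?q\<bar>"
      by (metis norm_of_real of_real_1 of_real_diff)
    also have "\<dots> = 1 - ?q" using q1 by linarith
    also have "\<dots> \<le> (\<Sum>i\<le>Suc k. 1 - pD D (?c i \<odot>\<^bsub>M\<^esub> \<xi>))"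
      by (rule one_minus_prod_le) (use b in auto)
    finally have "norm (1 - complex_of_real ?q) \<le> \<dots>" .
    hence "norm (?P \<xi> * (1 - of_real ?q)) \<le> norm (?P \<xi>) * (\<Sum>i\<le>Suc k. 1 - pD D (?c i \<odot>\<^bsub>M\<^esub> \<xi>))"
      unfolding norm_mult by (rule mult_left_mono) simp
    also have "norm (?P \<xi>) = (\<Prod>i\<le>Suc k. Fh (?c i \<odot>\<^bsub>M\<^esub> \<xi>))" unfolding Fh_def by (rule prod_norm[symmetric])
    finally show "norm (?P \<xi> * (1 - of_real ?q)) \<le> (\<Sum>i\<le>Suc k. (\<Prod>i\<le>Suc k. Fh (?c i \<odot>\<^bsub>M\<^esub> \<xi>)) * (1 - pD D (?c i \<odot>\<^bsub>M\<^esub> \<xi>)))"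
      unfolding sum_distrib_left .
  qed
  also have "\<dots> = (\<Sum>i\<le>Suc k. \<Sum>\<xi>\<in>V. (\<Prod>i\<le>Suc k. Fh (?c i \<odot>\<^bsub>M\<^esub> \<xi>)) * (1 - pD D (?c i \<odot>\<^bsub>M\<^esub> \<xi>)))"
    by (rule sum.swap)
  also have "\<dots> \<le> (\<Sum>i\<le>Suc k. 9 * \<theta>)"
  proof (rule sum_mono)
    fix i assume i: "i \<in> {..Suc k}"
    show "(\<Sum>\<xi>\<in>V. (\<Prod>i\<le>Suc k. Fh (?c i \<odot>\<^bsub>M\<^esub> \<xi>)) * (1 - pD D (?c i \<odot>\<^bsub>M\<^esub> \<xi>))) \<le> 9 * \<theta>"
    proof (cases "?c i = \<zero>")
      case True
      have "(\<Sum>\<xi>\<in>V. (\<Prod>i\<le>Suc k. Fh (?c i \<odot>\<^bsub>M\<^esub> \<xi>)) * (1 - pD D (?c i \<odot>\<^bsub>M\<^esub> \<xi>))) = 0"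
        by (rule sum.neutral) (use True DV in \<open>simp add: pD_zero\<close>)
      thus ?thesis using \<theta> by simp
    next
      case False
      have "\<exists>j l. {i, j, l} \<subseteq> {..Suc k} \<and> i \<noteq> j \<and> i \<noteq> l \<and> j \<noteq> l \<and> ?c j \<noteq> \<zero> \<and> ?c l \<noteq> \<zero>"
      proof (cases "i = i1")
        case True thus ?thesis using three i by blast
      next
        case n1: False
        show ?thesis
        proof (cases "i = i2")
          case True thus ?thesis using three i n1 by blast
        next
          case False thus ?thesis using three i n1 by blast
        qed
      qed
      then obtain j l where jl: "{i, j, l} \<subseteq> {..Suc k}" "i \<noteq> j" "i \<noteq> l" "j \<noteq> l" "?c j \<noteq> \<zero>" "?c l \<noteq> \<zero>"
        by blast
      show ?thesis by (rule triple_sum_bound[OF a jl(1-4) False jl(5,6) \<theta> D])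
    qed
  qed
  finally show ?thesis by (simp add: algebra_simps)
qed

text \<open>Three scales: \<theta> for the smoothing and its error, \<open>\<epsilon>1\<close> for
  the translations, \<open>\<epsilon>3\<close> for the tail. \<open>H\<close>, the inverse density
  of the translations, does not involve \<theta>, and \<open>H'\<close>, the inverse density of the
  smoothing set, does not involve \<open>\<epsilon>3\<close>; so the scales can be fixed in the
  order \<open>\<epsilon>1\<close>, \<theta>, \<open>\<epsilon>3\<close>.\<close>

lemma sparse_roth_step:
  fixes \<tau> :: real
  assumes a: "a \<in> {..k} \<rightarrow> K" "finsum R a {..k} = \<one>"
    and three: "{i1, i2, i3} \<subseteq> {..Suc k}" "i1 \<noteq> i2" "i1 \<noteq> i3" "i2 \<noteq> i3"
      "coef a k i1 \<noteq> \<zero>" "coef a k i2 \<noteq> \<zero>" "coef a k i3 \<noteq> \<zero>"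
    and \<theta>: "0 < \<theta>" "\<theta> \<le> 1" "\<epsilon>0 \<le> \<theta>^3" "\<epsilon>0 * Q \<le> \<theta>^3"
    and \<epsilon>: "\<epsilon>0 \<le> \<epsilon>3" "\<epsilon>3 \<le> \<epsilon>1" "\<theta>^3 \<le> \<epsilon>1"
    and \<alpha>: "0 < \<alpha>" "\<alpha> \<le> Ex F"
    and H': "H' = cells (\<theta>^3) ^ nat \<lfloor>2 / (\<theta>^3)\<^sup>2\<rfloor>" "\<kappa> * H' \<le> 1"
    and H: "H = cells (\<rho> / real (k + 1)) ^ ((k + 2) * nat \<lfloor>2 / \<epsilon>1\<^sup>2\<rfloor>)"
    and \<rho>: "0 < \<rho>"
    and \<mu>: "(\<Sum>\<xi>\<in>spec \<epsilon>3 - spec \<epsilon>1. (Fh \<xi>)\<^sup>2) \<le> \<mu>"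
    and \<tau>: "0 \<le> \<tau>" "2 * \<rho>\<^sup>2 + 4 * \<mu> + 4 * \<epsilon>3\<^sup>2 * H' \<le> \<tau>\<^sup>2" "2 ^ (k + 2) * real (k + 2) * \<tau> \<le> \<alpha> ^ (k + 2) / 2"
  shows "Lam a k F \<ge> (1 / H) ^ (k + 1) * (\<alpha> ^ (k + 2) / 2) - 9 * real (k + 2) * \<theta>"
proof -
  let ?m = "k + 2"
  define D where "D = Bohr (spec (\<theta>^3)) (\<theta>^3)"
  have DV: "D \<subseteq> V" "0 < card D" unfolding D_def using Bohr_subset card_Bohr_pos[OF spec_subset] \<theta> by auto
  have ND: "N / card D \<le> H'"
  proof -
    have "N \<le> card D * cells (\<theta>^3) ^ card (spec (\<theta>^3))"
      unfolding D_def by (rule Bohr_density[OF spec_subset]) (use \<theta> in simp)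
    also have "\<dots> \<le> card D * H'" unfolding H'
      by (intro mult_left_mono power_increasing card_spec \<theta> cells_ge_1) auto
    finally show ?thesis using DV by (simp add: field_simps)
  qed
  define g where "g = sm D F"
  have g0: "0 \<le> g x" if "x \<in> V" for x unfolding g_def by (rule sm_nonneg[OF DV(1) that])
  have g2: "g x \<le> 2" if "x \<in> V" for x
  proof -
    have "g x \<le> 1 + \<kappa> * (N / card D)" unfolding g_def by (rule sm_le[OF DV that])
    also have "\<kappa> * (N / card D) \<le> \<kappa> * H'" by (rule mult_left_mono[OF ND \<kappa>_nonneg])
    finally show ?thesis using H' by simp
  qed
  \<comment> \<open>Including the dilates of the spectrum by the coefficients and dividing the
    radius by k + 1 keeps the combination \<open>lc {..k} a y\<close> of points of \<open>C\<close>
    in the Bohr set of \<open>spec \<epsilon>1\<close> of radius \<rho>.\<close>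
  define T where "T = spec \<epsilon>1 \<union> (\<Union>i\<le>k. (\<lambda>\<xi>. a i \<odot>\<^bsub>M\<^esub> \<xi>) ` spec \<epsilon>1)"
  define C where "C = Bohr T (\<rho> / real (k + 1))"
  have aK: "a i \<in> K" if "i \<le> k" for i using a that by auto
  have TV: "T \<subseteq> V" unfolding T_def using spec_subset aK by auto
  have CV: "C \<subseteq> V" unfolding C_def by (rule Bohr_subset)
  have \<epsilon>01: "\<epsilon>0 \<le> \<epsilon>1" using \<epsilon> by linarith
  have cardT: "card T \<le> ?m * nat \<lfloor>2 / \<epsilon>1\<^sup>2\<rfloor>"
  proof -
    have "card T \<le> card (spec \<epsilon>1) + card (\<Union>i\<le>k. (\<lambda>\<xi>. a i \<odot>\<^bsub>M\<^esub> \<xi>) ` spec \<epsilon>1)"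
      unfolding T_def by (rule card_Un_le)
    also have "card (\<Union>i\<le>k. (\<lambda>\<xi>. a i \<odot>\<^bsub>M\<^esub> \<xi>) ` spec \<epsilon>1) \<le> (\<Sum>i\<le>k. card ((\<lambda>\<xi>. a i \<odot>\<^bsub>M\<^esub> \<xi>) ` spec \<epsilon>1))"
      by (rule card_UN_le) simp
    also have "\<dots> \<le> (\<Sum>i\<le>k. card (spec \<epsilon>1))" by (intro sum_mono card_image_le) simp
    finally have "card T \<le> ?m * card (spec \<epsilon>1)" by simp
    thus ?thesis using card_spec[OF \<epsilon>01] by (meson le_trans mult_le_mono2)
  qed
  have NC: "1 / H \<le> card C / N"
  proof -
    have "N \<le> card C * cells (\<rho> / real (k + 1)) ^ card T"
      unfolding C_def by (rule Bohr_density[OF TV]) (use \<rho> in simp)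
    also have "cells (\<rho> / real (k + 1)) ^ card T \<le> H"
      unfolding H by (rule power_increasing[OF cardT cells_ge_1])
    hence "card C * cells (\<rho> / real (k + 1)) ^ card T \<le> card C * H"
      by (rule mult_left_mono) simp
    finally have "N \<le> card C * H" .
    moreover have "0 < H" unfolding H using cells_ge_1[of "\<rho> / real (k + 1)"] by (intro zero_less_power) linarith
    ultimately show ?thesis using N_pos by (simp add: field_simps)
  qed
  have H0: "0 < H" unfolding H using cells_ge_1[of "\<rho> / real (k + 1)"] by (intro zero_less_power) linarith
  have inv: "Ex (\<lambda>x. \<bar>g (b \<oplus>\<^bsub>M\<^esub> x) - g x\<bar>) \<le> \<tau>" if "b \<in> Bohr (spec \<epsilon>1) \<rho>" for b
  proof -
    have bV: "b \<in> V" using that Bohr_subset by auto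
    have "(Ex (\<lambda>x. \<bar>g (x \<oplus>\<^bsub>M\<^esub> b) - g x\<bar>))\<^sup>2 \<le> 2 * \<rho>\<^sup>2 + 4 * \<mu> + 4 * \<epsilon>3\<^sup>2 * (N / card D)"
      unfolding g_def by (rule sm_almost_invariant[OF DV \<epsilon>(1,2) _ that \<mu>]) (use \<rho> in simp)
    also have "\<dots> \<le> 2 * \<rho>\<^sup>2 + 4 * \<mu> + 4 * \<epsilon>3\<^sup>2 * H'" by (intro add_left_mono mult_left_mono ND) simp
    also have "\<dots> \<le> \<tau>\<^sup>2" by (rule \<tau>)
    finally have "Ex (\<lambda>x. \<bar>g (x \<oplus>\<^bsub>M\<^esub> b) - g x\<bar>) \<le> \<tau>" using \<tau>(1) by (rule power2_le_imp_le)
    thus ?thesis using bV by (simp add: M.a_comm cong: Ex_cong)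
  qed
  have "Lam a k g \<ge> (card C / N) ^ (k + 1) * (\<alpha> ^ ?m / 2)"
  proof (rule Lam_ge[OF a g0 CV])
    fix y assume y: "y \<in> PiE {..k} (\<lambda>_. C)"
    have yC: "y i \<in> C" "y i \<in> V" if "i \<le> k" for i using y that CV by auto
    define b where "b i = (if i \<le> k then y i else lc {..k} a y)" for i
    have bB: "b i \<in> Bohr (spec \<epsilon>1) \<rho>" for i
    proof (cases "i \<le> k")
      case True
      have "\<rho> / real (k + 1) \<le> \<rho>" using \<rho> by (simp add: field_simps)
      hence "C \<subseteq> Bohr (spec \<epsilon>1) \<rho>" unfolding C_def Bohr_def T_def by (auto intro: order_trans)
      thus ?thesis using True yC by (auto simp: b_def)
    next
      case False
      have lV: "lc {..k} a y \<in> V" using a yC by auto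
      have "norm (\<psi> \<xi> (lc {..k} a y) - 1) \<le> \<rho>" if \<xi>: "\<xi> \<in> spec \<epsilon>1" for \<xi>
      proof -
        have \<xi>V: "\<xi> \<in> V" using \<xi> spec_subset by auto
        have "\<psi> \<xi> (lc {..k} a y) = (\<Prod>i\<le>k. \<psi> (a i \<odot>\<^bsub>M\<^esub> \<xi>) (y i))"
          by (rule \<psi>_lc) (use a yC \<xi>V in auto)
        hence "norm (\<psi> \<xi> (lc {..k} a y) - 1) = norm ((\<Prod>i\<le>k. \<psi> (a i \<odot>\<^bsub>M\<^esub> \<xi>) (y i)) - (\<Prod>i\<le>k. 1))" by simp
        also have "\<dots> \<le> (\<Sum>i\<le>k. norm (\<psi> (a i \<odot>\<^bsub>M\<^esub> \<xi>) (y i) - 1))"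
          by (rule norm_prod_diff) (use aK yC \<xi>V in auto)
        also have "\<dots> \<le> (\<Sum>i\<le>k. \<rho> / real (k + 1))"
          by (rule sum_mono) (use yC \<xi> in \<open>auto simp: C_def Bohr_def T_def\<close>)
        also have "\<dots> = \<rho>" by simp
        finally show ?thesis .
      qed
      thus ?thesis using False lV by (auto simp: b_def Bohr_def)
    qed
    have bV: "b i \<in> V" for i using bB Bohr_subset by auto
    \<comment> \<open>Jensen gives the main term \<alpha>^(k + 2) for equal arguments. Moving the k
      + 2 arguments apart costs 2^(k + 2) * (k + 2) * \<tau>, at most half of it.\<close>
    have "\<alpha> ^ ?m / 2 \<le> \<alpha> ^ ?m - 2 ^ ?m * (\<Sum>i\<le>Suc k. \<tau>)" using \<tau> by (simp add: algebra_simps)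
    also have "\<dots> \<le> Ex (\<lambda>x. g x ^ ?m) - 2 ^ ?m * (\<Sum>i\<le>Suc k. Ex (\<lambda>x. \<bar>g (b i \<oplus>\<^bsub>M\<^esub> x) - g x\<bar>))"
    proof (intro diff_mono mult_left_mono sum_mono inv bB)
      have "\<alpha> ^ ?m \<le> Ex (\<lambda>x. \<alpha> ^ ?m + ?m * \<alpha> ^ (?m - 1) * (g x - \<alpha>))"
      proof -
        have "Ex (\<lambda>x. \<alpha> ^ ?m + ?m * \<alpha> ^ (?m - 1) * (g x - \<alpha>)) = \<alpha> ^ ?m + ?m * \<alpha> ^ (?m - 1) * (Ex g - \<alpha>)"
          by (simp only: Ex_add Ex_cmult Ex_diff Ex_const)
        moreover have "Ex g \<ge> \<alpha>" using \<alpha> sm_mean[OF DV] by (simp add: g_def)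
        hence "0 \<le> ?m * \<alpha> ^ (?m - 1) * (Ex g - \<alpha>)" using \<alpha> by (intro mult_nonneg_nonneg) auto
        ultimately show ?thesis by linarith
      qed
      also have "\<dots> \<le> Ex (\<lambda>x. g x ^ ?m)" by (rule Ex_mono, rule power_tangent[OF g0 \<alpha>(1)])
      finally show "\<alpha> ^ ?m \<le> Ex (\<lambda>x. g x ^ ?m)" .
    qed simp
    also have "\<dots> = Ex (\<lambda>x. g x ^ ?m - 2 ^ ?m * (\<Sum>i\<le>Suc k. \<bar>g (b i \<oplus>\<^bsub>M\<^esub> x) - g x\<bar>))"
      by (simp only: Ex_diff Ex_cmult Ex_sum)
    also have "\<dots> \<le> Ex (\<lambda>x. \<Prod>i\<le>Suc k. g (b i \<oplus>\<^bsub>M\<^esub> x))"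
    proof (rule Ex_mono)
      fix x assume x: "x \<in> V"
      have "\<bar>(\<Prod>i\<le>Suc k. g (b i \<oplus>\<^bsub>M\<^esub> x)) - (\<Prod>i\<le>Suc k. g x)\<bar> \<le> 2 ^ card {..Suc k} * (\<Sum>i\<le>Suc k. \<bar>g (b i \<oplus>\<^bsub>M\<^esub> x) - g x\<bar>)"
        by (rule prod_diff_le) (use x bV g0 g2 in auto)
      moreover have "(\<Prod>i\<le>Suc k. g x) = g x ^ ?m" by simp
      moreover have "card {..Suc k} = ?m" by simp
      ultimately show "g x ^ ?m - 2 ^ ?m * (\<Sum>i\<le>Suc k. \<bar>g (b i \<oplus>\<^bsub>M\<^esub> x) - g x\<bar>) \<le> (\<Prod>i\<le>Suc k. g (b i \<oplus>\<^bsub>M\<^esub> x))"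
        by (simp only: abs_le_iff) linarith
    qed
    also have "\<dots> = Ex (\<lambda>x. (\<Prod>i\<le>k. g (y i \<oplus>\<^bsub>M\<^esub> x)) * g (lc {..k} a y \<oplus>\<^bsub>M\<^esub> x))"
      by (simp add: b_def)
    finally show "\<alpha> ^ ?m / 2 \<le> \<dots>" .
  qed
  moreover have "(1 / H) ^ (k + 1) * (\<alpha> ^ ?m / 2) \<le> (card C / N) ^ (k + 1) * (\<alpha> ^ ?m / 2)"
    by (intro mult_right_mono power_mono NC) (use H0 \<alpha> in auto)
  moreover have "\<bar>Lam a k F - Lam a k g\<bar> \<le> 9 * real ?m * \<theta>"
    unfolding g_def by (rule Lam_smooth_diff[OF a(1) three \<theta> D_def])
  ultimately show ?thesis by linarith
qed

text \<open>The shells between consecutive thresholds are disjoint, and their total mass is at most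
  2 by the large sieve.\<close>

lemma spec_pigeonhole:
  assumes t: "\<And>i. t (Suc i) \<le> t i" "\<epsilon>0 \<le> t J" and J: "0 < J"
  shows "\<exists>j<J. (\<Sum>\<xi>\<in>spec (t (Suc j)) - spec (t j). (Fh \<xi>)\<^sup>2) \<le> 2 / J"
proof -
  let ?S = "\<lambda>j. \<Sum>\<xi>\<in>spec (t (Suc j)) - spec (t j). (Fh \<xi>)\<^sup>2"
  have "(\<Sum>j<n. ?S j) \<le> (\<Sum>\<xi>\<in>spec (t n). (Fh \<xi>)\<^sup>2)" for n
  proof (induction n)
    case (Suc n)
    have "(\<Sum>\<xi>\<in>spec (t (Suc n)). (Fh \<xi>)\<^sup>2) = ?S n + (\<Sum>\<xi>\<in>spec (t n). (Fh \<xi>)\<^sup>2)"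
      by (rule sum.subset_diff[OF spec_mono[OF t(1)] finite_spec])
    thus ?case using Suc by simp
  qed (simp add: sum_nonneg)
  also have "(\<Sum>\<xi>\<in>spec (t J). (Fh \<xi>)\<^sup>2) \<le> 2" by (rule sum_spec_le[OF t(2)])
  finally have *: "(\<Sum>j<J. ?S j) \<le> 2" .
  show ?thesis
  proof (rule ccontr)
    assume "\<not> ?thesis"
    hence "(\<Sum>j<J. 2 / real J) < (\<Sum>j<J. ?S j)" using J
      by (intro sum_strict_mono) (auto simp: not_le)
    thus False using * J by simp
  qed
qed

end

text \<open>The constants must depend on \<alpha> and k only, so they are chosen before the ring,
  the space and the majorant are quantified; hence the explicit locale predicate in place of a
  statement inside the locale.\<close>

lemma sparse_roth:
  fixes \<alpha> :: real and k :: nat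
  assumes \<alpha>: "0 < \<alpha>" "\<alpha> \<le> 1"
  shows "\<exists>c>0. \<exists>\<delta>>0. \<forall>(R :: ('a, 'b) ring_scheme) (M :: ('a, 'c, 'd) module_scheme) B e F \<nu> \<kappa> Q \<epsilon>0 a i1 i2 i3.
    majorised R M B e F \<nu> \<kappa> Q \<epsilon>0 \<longrightarrow> a \<in> {..k} \<rightarrow> carrier R \<longrightarrow> finsum R a {..k} = \<one>\<^bsub>R\<^esub> \<longrightarrow>
    {i1, i2, i3} \<subseteq> {..Suc k} \<longrightarrow> i1 \<noteq> i2 \<longrightarrow> i1 \<noteq> i3 \<longrightarrow> i2 \<noteq> i3 \<longrightarrow>
    bilin_space.coef R a k i1 \<noteq> \<zero>\<^bsub>R\<^esub> \<longrightarrow> bilin_space.coef R a k i2 \<noteq> \<zero>\<^bsub>R\<^esub> \<longrightarrow> bilin_space.coef R a k i3 \<noteq> \<zero>\<^bsub>R\<^esub> \<longrightarrow>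
    \<epsilon>0 \<le> \<delta> \<longrightarrow> \<epsilon>0 * Q \<le> \<delta> \<longrightarrow> \<kappa> \<le> \<delta> \<longrightarrow> \<alpha> \<le> bilin_space.Ex M F \<longrightarrow> c \<le> bilin_space.Lam M a k F"
proof -
  define A where "A = \<alpha> ^ (k + 2)"
  \<comment> \<open>\<tau> makes the total translation error half of \<open>A\<close>. Of the budget
    \<tau>^2 for almost invariance, \<rho> spends one eighth and \<mu> one quarter; one half is
    reserved for the tail.\<close>
  define \<tau> where "\<tau> = A / (2 * (2 ^ (k + 2) * real (k + 2)))"
  define \<rho> where "\<rho> = \<tau> / 4"
  define \<mu> where "\<mu> = \<tau>\<^sup>2 / 16"
  define J where "J = Suc (nat \<lceil>2 / \<mu>\<rceil>)"
  define H2 where "H2 \<epsilon> = cells (\<rho> / real (k + 1)) ^ ((k + 2) * nat \<lfloor>2 / \<epsilon>\<^sup>2\<rfloor>)" for \<epsilon> :: real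
  define Hp where "Hp \<theta> = cells (\<theta>^3) ^ nat \<lfloor>2 / (\<theta>^3)\<^sup>2\<rfloor>" for \<theta> :: real
  \<comment> \<open>Half of the count that \<open>sparse_roth_step\<close> yields for translations
    at scale \<open>\<theta>^3\<close>. The next term of \<open>th\<close> is so small that the
    smoothing error stays below this half and the tail below \<tau>^2 / 2.\<close>
  define b where "b \<theta> = (1 / H2 (\<theta>^3)) ^ (k + 1) * (A / 4)" for \<theta>
  define th where "th = rec_nat (1::real) (\<lambda>_ t. min t (min (b t / (9 * real (k + 2))) (\<tau>\<^sup>2 / (8 * Hp t))))"
  have th0: "th 0 = 1" and thS: "th (Suc n) = min (th n) (min (b (th n) / (9 * real (k + 2))) (\<tau>\<^sup>2 / (8 * Hp (th n))))" for n
    by (simp_all add: th_def)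
  have A: "0 < A" "A \<le> 1"
    unfolding A_def by (use \<alpha> in simp, rule power_le_one, use \<alpha> in auto)
  have \<tau>: "0 < \<tau>" "\<tau> \<le> 1" "2 ^ (k + 2) * real (k + 2) * \<tau> \<le> A / 2"
  proof -
    have "(1::real) \<le> 2 ^ (k + 2) * real (k + 2)"
    proof -
      have "(1::real) * 1 \<le> 2 ^ (k + 2) * real (k + 2)" by (intro mult_mono one_le_power) auto
      thus ?thesis by simp
    qed
    hence D: "(1::real) \<le> 2 * (2 ^ (k + 2) * real (k + 2))" "(0::real) < 2 ^ (k + 2) * real (k + 2)" by linarith+
    show "0 < \<tau>" unfolding \<tau>_def using A D by simp
    show "\<tau> \<le> 1" unfolding \<tau>_def using A D by (simp add: divide_le_eq)
    have "G * (A / (2 * G)) = A / 2" if "0 < G" for G :: real using that by simp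
    from this[OF D(2)] have "2 ^ (k + 2) * real (k + 2) * \<tau> = A / 2" unfolding \<tau>_def .
    thus "2 ^ (k + 2) * real (k + 2) * \<tau> \<le> A / 2" by simp
  qed
  have \<mu>0: "0 < \<mu>" using \<tau> by (simp add: \<mu>_def)
  have H2: "0 < H2 \<epsilon>" for \<epsilon> unfolding H2_def
    using cells_ge_1[of "\<rho> / real (k + 1)"] by (intro zero_less_power) linarith
  have Hp: "0 < Hp \<theta>" for \<theta> unfolding Hp_def
    using cells_ge_1[of "\<theta>^3"] by (intro zero_less_power) linarith
  have b0: "0 < b \<theta>" for \<theta> unfolding b_def using H2 A by simp
  have th_pos: "0 < th n" for n
  proof (induction n)
    case (Suc n)
    have "0 < b (th n) / (9 * real (k + 2))" using b0[of "th n"] by simp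
    moreover have "0 < \<tau>\<^sup>2 / (8 * Hp (th n))" using \<tau> Hp[of "th n"] by simp
    ultimately show ?case using Suc unfolding thS by simp
  qed (simp add: th0)
  have th_dec: "th (Suc n) \<le> th n" for n unfolding thS by simp
  have th_anti: "m \<le> n \<Longrightarrow> th n \<le> th m" for m n by (rule lift_Suc_antimono_le[of th, OF th_dec])
  have th_1: "th n \<le> 1" for n using th_anti[of 0 n] th0 by simp
  have cond1: "9 * real (k + 2) * th (Suc n) \<le> b (th n)" for n
  proof -
    have "th (Suc n) \<le> b (th n) / (9 * real (k + 2))" unfolding thS by simp
    thus ?thesis by (simp add: field_simps)
  qed
  have cond2: "8 * Hp (th n) * th (Suc n) \<le> \<tau>\<^sup>2" for n
  proof -
    have "th (Suc n) \<le> \<tau>\<^sup>2 / (8 * Hp (th n))" unfolding thS by simp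
    thus ?thesis using Hp[of "th n"] by (simp add: field_simps)
  qed
  define \<delta> where "\<delta> = th (2 * J) ^ 3"
  define c where "c = 9 * real (k + 2) * th (2 * J)"
  have c0: "0 < c" unfolding c_def using th_pos[of "2 * J"] by simp
  have \<delta>0: "0 < \<delta>" unfolding \<delta>_def using th_pos by simp
  have \<delta>le: "\<delta> \<le> th n ^ 3" if "n \<le> 2 * J" for n
    unfolding \<delta>_def using th_anti[OF that] th_pos[of "2 * J"] by (intro power_mono) auto
  have main: "c \<le> bilin_space.Lam M a k F"
    if maj: "majorised R M B e F \<nu> \<kappa> Q \<epsilon>0"
      and a: "a \<in> {..k} \<rightarrow> carrier R" "finsum R a {..k} = \<one>\<^bsub>R\<^esub>"
      and three: "{i1, i2, i3} \<subseteq> {..Suc k}" "i1 \<noteq> i2" "i1 \<noteq> i3" "i2 \<noteq> i3"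
      "bilin_space.coef R a k i1 \<noteq> \<zero>\<^bsub>R\<^esub>" "bilin_space.coef R a k i2 \<noteq> \<zero>\<^bsub>R\<^esub>" "bilin_space.coef R a k i3 \<noteq> \<zero>\<^bsub>R\<^esub>"
      and small: "\<epsilon>0 \<le> \<delta>" "\<epsilon>0 * Q \<le> \<delta>" "\<kappa> \<le> \<delta>" and mean: "\<alpha> \<le> bilin_space.Ex M F"
    for R :: "('a, 'b) ring_scheme" and M :: "('a, 'c, 'd) module_scheme" and B e F \<nu> \<kappa> Q \<epsilon>0 a i1 i2 i3
  proof -
    interpret majorised R M B e F \<nu> \<kappa> Q \<epsilon>0 by (rule maj)
    \<comment> \<open>A pigeonhole shell spans two terms of \<open>th\<close>: its ends give
      \<open>\<epsilon>1\<close> and \<open>\<epsilon>3\<close>, and the odd term between them is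
      \<theta>. This realises the order of choice of the three scales.\<close>
    have "\<exists>j<J. (\<Sum>\<xi>\<in>spec (th (2 * Suc j) ^ 3) - spec (th (2 * j) ^ 3). (Fh \<xi>)\<^sup>2) \<le> 2 / J"
    proof (rule spec_pigeonhole[where t = "\<lambda>j. th (2 * j) ^ 3"])
      show "th (2 * Suc i) ^ 3 \<le> th (2 * i) ^ 3" for i
        by (intro power_mono th_anti) (use th_pos less_imp_le in auto)
    qed (use small in \<open>auto simp: \<delta>_def J_def\<close>)
    then obtain j where j: "j < J" and S: "(\<Sum>\<xi>\<in>spec (th (2 * Suc j) ^ 3) - spec (th (2 * j) ^ 3). (Fh \<xi>)\<^sup>2) \<le> 2 / J"
      by blast
    have "2 / J \<le> \<mu>"
    proof -
      have "2 / \<mu> \<le> J" unfolding J_def by linarith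
      moreover have "0 < real J" by (simp add: J_def)
      ultimately show ?thesis using \<mu>0 by (simp add: divide_le_eq mult.commute)
    qed
    hence S: "(\<Sum>\<xi>\<in>spec (th (2 * Suc j) ^ 3) - spec (th (2 * j) ^ 3). (Fh \<xi>)\<^sup>2) \<le> \<mu>" using S by linarith
    let ?\<theta> = "th (Suc (2 * j))"
    have \<theta>0: "0 < ?\<theta>" by (rule th_pos)
    have le: "2 * j \<le> 2 * J" "Suc (2 * j) \<le> 2 * J" "2 * Suc j \<le> 2 * J" using j by auto
    have small6: "(th (2 * Suc j) ^ 3)\<^sup>2 \<le> th (2 * Suc j)"
      using th_1[of "2 * Suc j"] th_pos[of "2 * Suc j"] power_decreasing[of 1 6 "th (2 * Suc j)"]
      by (simp flip: power_mult)
    have Hk: "8 * Hp ?\<theta> * th (2 * Suc j) \<le> \<tau>\<^sup>2" using cond2[of "Suc (2 * j)"] by simp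
    have "Lam a k F \<ge> (1 / H2 (th (2 * j) ^ 3)) ^ (k + 1) * (\<alpha> ^ (k + 2) / 2) - 9 * real (k + 2) * ?\<theta>"
    proof (rule sparse_roth_step[OF a three \<theta>0 th_1])
      show "\<epsilon>0 \<le> ?\<theta> ^ 3" "\<epsilon>0 * Q \<le> ?\<theta> ^ 3" "\<epsilon>0 \<le> th (2 * Suc j) ^ 3"
        using small \<delta>le le by (auto intro: order_trans simp del: mult_Suc_right)
      show "th (2 * Suc j) ^ 3 \<le> th (2 * j) ^ 3" "?\<theta> ^ 3 \<le> th (2 * j) ^ 3"
        by (intro power_mono th_anti; use th_pos less_imp_le in auto)+
      show "Hp ?\<theta> = cells (?\<theta> ^ 3) ^ nat \<lfloor>2 / (?\<theta> ^ 3)\<^sup>2\<rfloor>" by (simp add: Hp_def)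
      show "\<kappa> * Hp ?\<theta> \<le> 1"
      proof -
        have "\<kappa> \<le> th (2 * Suc j) ^ 3" using small(3) \<delta>le[OF le(3)] by linarith
        also have "\<dots> \<le> th (2 * Suc j)"
          using th_1[of "2 * Suc j"] th_pos[of "2 * Suc j"] power_decreasing[of 1 3 "th (2 * Suc j)"] by simp
        finally have "\<kappa> * Hp ?\<theta> \<le> th (2 * Suc j) * Hp ?\<theta>" using Hp[of ?\<theta>] by (intro mult_right_mono) auto
        moreover have "\<tau>\<^sup>2 \<le> 1" using \<tau> by (simp add: power_le_one)
        ultimately show ?thesis using Hk by (simp add: mult_ac)
      qed
      show "H2 (th (2 * j) ^ 3) = cells (\<rho> / real (k + 1)) ^ ((k + 2) * nat \<lfloor>2 / (th (2 * j) ^ 3)\<^sup>2\<rfloor>)"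
        by (simp add: H2_def)
      show "2 * \<rho>\<^sup>2 + 4 * \<mu> + 4 * (th (2 * Suc j) ^ 3)\<^sup>2 * Hp ?\<theta> \<le> \<tau>\<^sup>2"
      proof -
        have "4 * (th (2 * Suc j) ^ 3)\<^sup>2 * Hp ?\<theta> \<le> 4 * th (2 * Suc j) * Hp ?\<theta>"
          using small6 Hp[of ?\<theta>] by (intro mult_right_mono) auto
        also have "\<dots> \<le> \<tau>\<^sup>2 / 2" using Hk by (simp add: mult_ac)
        finally have "4 * (th (2 * Suc j) ^ 3)\<^sup>2 * Hp ?\<theta> \<le> \<tau>\<^sup>2 / 2" .
        moreover have "2 * \<rho>\<^sup>2 + 4 * \<mu> = 3 / 8 * \<tau>\<^sup>2" by (simp add: \<rho>_def \<mu>_def power_divide)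
        moreover have "0 \<le> \<tau>\<^sup>2" by simp
        ultimately show ?thesis by linarith
      qed
    qed (use \<alpha> mean \<tau> S in \<open>auto simp: \<rho>_def A_def\<close>)
    moreover have "(1 / H2 (th (2 * j) ^ 3)) ^ (k + 1) * (\<alpha> ^ (k + 2) / 2) = 2 * b (th (2 * j))"
    proof -
      have "x * (y / 2) = 2 * (x * (y / 4))" for x y :: real by simp
      thus ?thesis unfolding b_def A_def .
    qed
    moreover have "9 * real (k + 2) * ?\<theta> \<le> b (th (2 * j))" by (rule cond1)
    moreover have "c \<le> 9 * real (k + 2) * ?\<theta>" unfolding c_def
      by (intro mult_left_mono th_anti le) simp
    ultimately show ?thesis by linarith
  qed
  show ?thesis using c0 \<delta>0 main by blast
qed

context bilin_space begin

text \<open>The factor q normalises the distance condition: for each value \<delta> its average is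
  close to 1.\<close>

definition Dd where "Dd \<delta> x y = (if sd x y = \<delta> then q else 0)"

lemma Dd_nonneg [simp]: "0 \<le> Dd \<delta> x y" by (simp add: Dd_def)

lemma Dd_le: "Dd \<delta> x y \<le> q" by (simp add: Dd_def)

lemma Dd_comm: "x \<in> V \<Longrightarrow> y \<in> V \<Longrightarrow> Dd \<delta> x y = Dd \<delta> y x"
  by (simp add: Dd_def sd_comm[of x y])

lemma Dd_char: assumes "\<delta> \<in> K" "x \<in> V" "y \<in> V"
  shows "complex_of_real (Dd \<delta> x y) = (\<Sum>t\<in>K. e (t \<otimes> (sd y x \<ominus> \<delta>)))"
proof -
  have "sd y x \<ominus> \<delta> = \<zero> \<longleftrightarrow> sd y x = \<delta>" using assms by simp
  thus ?thesis using assms sum_e_mult[of "sd y x \<ominus> \<delta>"] by (simp add: Dd_def sd_comm[of x y])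
qed

section \<open>Averages over several vectors\<close>

text \<open>Only the first n entries are averaged, the others are read off from b. Points that are
  to be held fixed are thus stored at indices from n on, and moved in and out with
  \<open>AE_upd\<close>.\<close>

definition AE :: "nat \<Rightarrow> ((nat \<Rightarrow> 'c) \<Rightarrow> 'z) \<Rightarrow> (nat \<Rightarrow> 'c) \<Rightarrow> 'z::real_normed_field" where
  "AE n f b = (\<Sum>y\<in>PiE {..<n} (\<lambda>_. V). f (\<lambda>i. if i < n then y i else b i)) / of_nat (card V) ^ n"

lemma AE_0 [simp]: "AE 0 f b = f b"
  by (simp add: AE_def)

lemma AE_Suc: "AE (Suc n) f b = AE n (\<lambda>y. Ex (\<lambda>v. f (y(n := v)))) b"
proof -
  have "(\<Sum>y\<in>PiE {..<Suc n} (\<lambda>_. V). f (\<lambda>i. if i < Suc n then y i else b i))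
      = (\<Sum>y\<in>(\<lambda>(v, g). g(n := v)) ` (V \<times> PiE {..<n} (\<lambda>_. V)). f (\<lambda>i. if i < Suc n then y i else b i))"
    by (simp only: lessThan_Suc PiE_insert_eq)
  also have "\<dots> = (\<Sum>(v, g)\<in>V \<times> PiE {..<n} (\<lambda>_. V). f (\<lambda>i. if i < Suc n then (g(n := v)) i else b i))"
    by (subst sum.reindex[OF inj_combinator]) (auto intro!: sum.cong)
  also have "\<dots> = (\<Sum>v\<in>V. \<Sum>g\<in>PiE {..<n} (\<lambda>_. V). f ((\<lambda>i. if i < n then g i else b i)(n := v)))"
    unfolding sum.cartesian_product[symmetric]
    by (intro sum.cong refl arg_cong[where f = f]) (auto simp: fun_eq_iff)
  also have "\<dots> = (\<Sum>g\<in>PiE {..<n} (\<lambda>_. V). \<Sum>v\<in>V. f ((\<lambda>i. if i < n then g i else b i)(n := v)))"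
    by (rule sum.swap)
  finally show ?thesis
    by (simp add: AE_def Ex_def sum_divide_distrib field_simps)
qed

lemma AE_cong: assumes "\<And>y. (\<And>i. i < n \<Longrightarrow> y i \<in> V) \<Longrightarrow> (\<And>i. n \<le> i \<Longrightarrow> y i = b i) \<Longrightarrow> f y = g y"
  shows "AE n f b = AE n g b"
  unfolding AE_def by (intro arg_cong2[where f = "(/)"] sum.cong refl assms) auto

lemma AE_mono: assumes "\<And>y. (\<And>i. i < n \<Longrightarrow> y i \<in> V) \<Longrightarrow> (\<And>i. n \<le> i \<Longrightarrow> y i = b i) \<Longrightarrow> f y \<le> (g y :: real)"
  shows "AE n f b \<le> AE n g b"
  unfolding AE_def by (intro divide_right_mono sum_mono assms) auto

lemma AE_add: "AE n (\<lambda>y. f y + g y) b = AE n f b + AE n g b"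
  by (simp add: AE_def sum.distrib add_divide_distrib)

lemma AE_diff: "AE n (\<lambda>y. f y - g y) b = AE n f b - AE n g b"
  by (simp add: AE_def sum_subtractf diff_divide_distrib)

lemma AE_cmult: "AE n (\<lambda>y. c * f y) b = c * AE n f b" "AE n (\<lambda>y. f y * c) b = AE n f b * c"
  by (simp_all add: AE_def flip: sum_distrib_left sum_distrib_right)

lemma AE_const [simp]: "AE n (\<lambda>y. c) b = c"
  using N_pos by (simp add: AE_def card_PiE)

lemma AE_nonneg: assumes "\<And>y. (\<And>i. i < n \<Longrightarrow> y i \<in> V) \<Longrightarrow> (\<And>i. n \<le> i \<Longrightarrow> y i = b i) \<Longrightarrow> 0 \<le> (f y :: real)"
  shows "0 \<le> AE n f b"
  using AE_mono[of n b "\<lambda>_. 0" f] assms by simp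

lemma AE_sum: "AE n (\<lambda>y. \<Sum>i\<in>I. f i y) b = (\<Sum>i\<in>I. AE n (f i) b)"
  unfolding AE_def sum_divide_distrib by (rule sum.swap)

lemma AE_Ex: "AE n (\<lambda>y. Ex (\<lambda>v. f v y)) b = Ex (\<lambda>v. AE n (f v) b)"
  unfolding AE_def Ex_def by (simp only: sum_divide_distrib[symmetric] sum.swap[of _ V]) (simp add: mult.commute)

lemma AE_of_real: "AE n (\<lambda>y. of_real (f y)) b = (of_real (AE n f b) :: complex)"
  by (simp add: AE_def)

lemma AE_norm: "norm (AE n f b) \<le> AE n (\<lambda>y. norm (f y)) b"
  unfolding AE_def by (simp add: norm_divide norm_power divide_right_mono norm_sum)

lemma AE_upd: assumes "n \<le> i" shows "AE n (\<lambda>y. f (y(i := v))) b = AE n f (b(i := v))"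
proof -
  have "(\<lambda>j. if j < n then y j else b j)(i := v) = (\<lambda>j. if j < n then y j else (b(i := v)) j)" for y
    using assms by (auto simp: fun_eq_iff)
  thus ?thesis by (simp only: AE_def)
qed

lemma AE_CS: assumes "\<And>y. (\<And>i. i < n \<Longrightarrow> y i \<in> V) \<Longrightarrow> (\<And>i. n \<le> i \<Longrightarrow> y i = b i) \<Longrightarrow> 0 \<le> (w y :: real)"
  shows "(AE n (\<lambda>y. w y * f y) b)\<^sup>2 \<le> AE n w b * AE n (\<lambda>y. w y * (f y)\<^sup>2) b"
proof -
  let ?P = "PiE {..<n} (\<lambda>_. V)" and ?o = "\<lambda>y i. if i < n then y i else b i"
  have w: "0 \<le> w (?o y)" if "y \<in> ?P" for y by (rule assms) (use that in auto)
  have "(\<Sum>v\<in>?P. sqrt (w (?o v)) * (sqrt (w (?o v)) * f (?o v)))\<^sup>2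
      \<le> (\<Sum>v\<in>?P. (sqrt (w (?o v)))\<^sup>2) * (\<Sum>v\<in>?P. (sqrt (w (?o v)) * f (?o v))\<^sup>2)"
    by (rule Cauchy_Schwarz_ineq_sum)
  moreover have "(\<Sum>v\<in>?P. sqrt (w (?o v)) * (sqrt (w (?o v)) * f (?o v))) = (\<Sum>v\<in>?P. w (?o v) * f (?o v))"
    by (rule sum.cong) (use w in \<open>auto simp flip: mult.assoc\<close>)
  moreover have "(\<Sum>v\<in>?P. (sqrt (w (?o v)))\<^sup>2) = (\<Sum>v\<in>?P. w (?o v))"
    by (rule sum.cong) (use w in auto)
  moreover have "(\<Sum>v\<in>?P. (sqrt (w (?o v)) * f (?o v))\<^sup>2) = (\<Sum>v\<in>?P. w (?o v) * (f (?o v))\<^sup>2)"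
    by (rule sum.cong) (use w in \<open>auto simp: power_mult_distrib\<close>)
  moreover have "0 < N ^ n" using N_pos by simp
  ultimately show ?thesis
    by (simp add: AE_def power_divide divide_simps power2_eq_square)
qed

lemma AE_eq_sum: "AE n (\<lambda>y. f (restrict y {..<n})) b = (\<Sum>y\<in>PiE {..<n} (\<lambda>_. V). f y) / of_nat (card V) ^ n"
proof -
  have "restrict (\<lambda>i. if i < n then y i else b i) {..<n} = y" if "y \<in> PiE {..<n} (\<lambda>_. V)" for y
    using that by (auto simp: fun_eq_iff PiE_def extensional_def)
  thus ?thesis by (simp add: AE_def)
qed

section \<open>Affine relations\<close>

text \<open>The affine relations among the points, trivial exactly when the points are affinely
  independent. Working with their number avoids case distinctions on the rank: these are the
  frequencies that survive when a new point is averaged over.\<close>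

definition Rel where
  "Rel I y = {t \<in> PiE I (\<lambda>_. K). finsum R t I = \<zero> \<and> lc I t y = \<zero>\<^bsub>M\<^esub>}"

definition Span where "Span I y = (\<lambda>t. lc I t y) ` PiE I (\<lambda>_. K)"

lemma lc_zero: "y \<in> I \<rightarrow> V \<Longrightarrow> (\<And>i. i \<in> I \<Longrightarrow> t i = \<zero>) \<Longrightarrow> lc I t y = \<zero>\<^bsub>M\<^esub>"
  unfolding lc_def by (rule M.add.finprod_one_eqI) (auto simp: Pi_iff)

lemma lc_cong: "(\<And>i. i \<in> I \<Longrightarrow> t i = t' i) \<Longrightarrow> (\<And>i. i \<in> I \<Longrightarrow> y i = y' i) \<Longrightarrow> t' \<in> I \<rightarrow> K \<Longrightarrow> y' \<in> I \<rightarrow> V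
    \<Longrightarrow> lc I t y = lc I t' y'"
  unfolding lc_def by (rule M.finsum_cong') (auto simp: Pi_iff)

lemma lc_insert: "finite I \<Longrightarrow> n \<notin> I \<Longrightarrow> t \<in> I \<rightarrow> K \<Longrightarrow> t n \<in> K \<Longrightarrow> y \<in> I \<rightarrow> V \<Longrightarrow> y n \<in> V \<Longrightarrow>
    lc (insert n I) t y = t n \<odot>\<^bsub>M\<^esub> y n \<oplus>\<^bsub>M\<^esub> lc I t y"
  unfolding lc_def by (rule M.finsum_insert) (auto simp: Pi_iff)

lemma lc_smult: "finite I \<Longrightarrow> t \<in> I \<rightarrow> K \<Longrightarrow> y \<in> I \<rightarrow> V \<Longrightarrow> c \<in> K \<Longrightarrow>
    lc I (\<lambda>i. c \<otimes> t i) y = c \<odot>\<^bsub>M\<^esub> lc I t y"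
proof (induction I rule: finite_induct)
  case (insert n I)
  hence m: "t n \<in> K" "t \<in> I \<rightarrow> K" "y n \<in> V" "y \<in> I \<rightarrow> V" by auto
  thus ?case using insert by (subst (1 2) lc_insert) (auto simp: smult_r_distr smult_assoc1 Pi_iff)
qed (simp add: lc_def)

lemma finsum_smult: "finite I \<Longrightarrow> t \<in> I \<rightarrow> K \<Longrightarrow> c \<in> K \<Longrightarrow>
    finsum R (\<lambda>i. c \<otimes> t i) I = c \<otimes> finsum R t I"
  by (rule finsum_rdistr[symmetric])

lemma lc_diff: "finite I \<Longrightarrow> t \<in> I \<rightarrow> K \<Longrightarrow> s \<in> I \<rightarrow> K \<Longrightarrow> y \<in> I \<rightarrow> V \<Longrightarrow>
    lc I (\<lambda>i. t i \<ominus> s i) y = lc I t y \<ominus>\<^bsub>M\<^esub> lc I s y"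
proof (induction I rule: finite_induct)
  case (insert n I)
  hence m: "t n \<in> K" "t \<in> I \<rightarrow> K" "s n \<in> K" "s \<in> I \<rightarrow> K" "y n \<in> V" "y \<in> I \<rightarrow> V" by auto
  have "lc (insert n I) (\<lambda>i. t i \<ominus> s i) y = (t n \<odot>\<^bsub>M\<^esub> y n \<ominus>\<^bsub>M\<^esub> s n \<odot>\<^bsub>M\<^esub> y n) \<oplus>\<^bsub>M\<^esub> (lc I t y \<ominus>\<^bsub>M\<^esub> lc I s y)"
    using insert m by (subst lc_insert) (auto simp: Pi_iff smult_l_distr a_minus_def smult_l_minus)
  also have "\<dots> = (t n \<odot>\<^bsub>M\<^esub> y n \<oplus>\<^bsub>M\<^esub> lc I t y) \<ominus>\<^bsub>M\<^esub> (s n \<odot>\<^bsub>M\<^esub> y n \<oplus>\<^bsub>M\<^esub> lc I s y)"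
    using m by (simp add: a_minus_def M.minus_add M.a_ac)
  also have "\<dots> = lc (insert n I) t y \<ominus>\<^bsub>M\<^esub> lc (insert n I) s y"
    using insert m by (simp add: lc_insert)
  finally show ?case .
qed (auto simp: lc_def a_minus_def intro!: M.minus_equality[symmetric])

lemma finsum_diff: "finite I \<Longrightarrow> t \<in> I \<rightarrow> K \<Longrightarrow> s \<in> I \<rightarrow> K \<Longrightarrow>
    finsum R (\<lambda>i. t i \<ominus> s i) I = finsum R t I \<ominus> finsum R s I"
proof (induction I rule: finite_induct)
  case (insert n I)
  hence m: "t n \<in> K" "t \<in> I \<rightarrow> K" "s n \<in> K" "s \<in> I \<rightarrow> K" by auto
  have "finsum R (\<lambda>i. t i \<ominus> s i) (insert n I) = (t n \<ominus> s n) \<oplus> (finsum R t I \<ominus> finsum R s I)"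
    using insert m by (subst R.finsum_insert) (auto simp: Pi_iff)
  also have "\<dots> = (t n \<oplus> finsum R t I) \<ominus> (s n \<oplus> finsum R s I)"
    using m R.finsum_closed[OF m(2)] R.finsum_closed[OF m(4)] by algebra
  finally show ?case using insert m by (simp add: R.finsum_insert)
qed (use R.minus_equality[of \<zero> \<zero>] in \<open>simp add: a_minus_def\<close>)

lemma finite_coeffs: "finite I \<Longrightarrow> finite (PiE I (\<lambda>_. K))"
  using finite_scalars by (intro finite_PiE) auto

lemma finite_Rel [simp]: "finite I \<Longrightarrow> finite (Rel I y)"
  unfolding Rel_def by (rule finite_subset[OF _ finite_coeffs]) auto

lemma zero_Rel: "finite I \<Longrightarrow> y \<in> I \<rightarrow> V \<Longrightarrow> (\<lambda>i\<in>I. \<zero>) \<in> Rel I y"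
  unfolding Rel_def by (auto intro!: lc_zero R.add.finprod_one_eqI)

lemma Rel_ge_1: "finite I \<Longrightarrow> y \<in> I \<rightarrow> V \<Longrightarrow> 1 \<le> card (Rel I y)"
  using zero_Rel finite_Rel by (metis One_nat_def Suc_leI card_gt_0_iff empty_iff)

lemma card_Span: "finite I \<Longrightarrow> real (card (Span I y)) \<le> q ^ card I"
proof -
  assume I: "finite I"
  have "card (Span I y) \<le> card (PiE I (\<lambda>_. K))" unfolding Span_def by (rule card_image_le[OF finite_coeffs[OF I]])
  thus ?thesis using I by (simp add: card_PiE flip: of_nat_power)
qed

lemma finite_Span: "finite I \<Longrightarrow> finite (Span I y)"
  unfolding Span_def by (intro finite_imageI finite_coeffs)

text \<open>Two relations with the same coefficient at the new point differ by a relation of the old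
  points, whence the factor q. Outside the linear span that coefficient must vanish. The linear
  span, not the affine one, is used: it is still small enough and easier to handle.\<close>

lemma Rel_insert:
  assumes I: "finite I" "n \<notin> I" and y: "y \<in> I \<rightarrow> V" and v: "v \<in> V"
  shows "real (card (Rel (insert n I) (y(n := v)))) \<le> q * real (card (Rel I y))"
    and "v \<notin> Span I y \<Longrightarrow> card (Rel (insert n I) (y(n := v))) \<le> card (Rel I y)"
proof -
  let ?R = "Rel (insert n I) (y(n := v))"
  have lcI: "lc (insert n I) t (y(n := v)) = t n \<odot>\<^bsub>M\<^esub> v \<oplus>\<^bsub>M\<^esub> lc I t y" if "t \<in> insert n I \<rightarrow> K" for t
  proof -
    have "lc I t (y(n := v)) = lc I t y" by (rule lc_cong) (use I y that in auto)
    thus ?thesis using I y v that by (subst lc_insert) (auto simp: Pi_iff)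
  qed
  have fsI: "finsum R t (insert n I) = t n \<oplus> finsum R t I" if "t \<in> insert n I \<rightarrow> K" for t
    using I that by (intro R.finsum_insert) auto
  have fib: "card {t \<in> ?R. t n = c} \<le> card (Rel I y)" for c
  proof (cases "{t \<in> ?R. t n = c} = {}")
    case False
    then obtain s where s: "s \<in> ?R" "s n = c" by auto
    have sK: "s \<in> insert n I \<rightarrow> K" using s by (auto simp: Rel_def)
    let ?g = "\<lambda>t. \<lambda>i\<in>I. t i \<ominus> s i"
    have "inj_on ?g {t \<in> ?R. t n = c}"
    proof (rule inj_onI)
      fix t t' assume h: "t \<in> {t \<in> ?R. t n = c}" "t' \<in> {t \<in> ?R. t n = c}" and eq: "?g t = ?g t'"
      have PE: "t \<in> PiE (insert n I) (\<lambda>_. K)" "t' \<in> PiE (insert n I) (\<lambda>_. K)" using h by (auto simp: Rel_def)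
      show "t = t'"
      proof (rule PiE_ext[OF PE])
        fix i assume i: "i \<in> insert n I"
        show "t i = t' i"
        proof (cases "i = n")
          case True thus ?thesis using h by simp
        next
          case False
          hence "i \<in> I" using i by simp
          hence "t i \<ominus> s i = t' i \<ominus> s i" using fun_cong[OF eq, of i] by simp
          moreover have "t i \<in> K" "t' i \<in> K" "s i \<in> K" using PE sK i by auto
          ultimately show ?thesis by (simp add: a_minus_def)
        qed
      qed
    qed
    moreover have "?g ` {t \<in> ?R. t n = c} \<subseteq> Rel I y"
    proof (safe)
      fix t assume t: "t \<in> ?R" "c = t n"
      have tK: "t \<in> insert n I \<rightarrow> K" using t by (auto simp: Rel_def)
      have tI: "t \<in> I \<rightarrow> K" "s \<in> I \<rightarrow> K" using tK sK by auto
      have nn: "t n \<in> K" "s n = t n" using tK t s by auto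
      have f0: "t n \<oplus> finsum R t I = \<zero>" "t n \<oplus> finsum R s I = \<zero>"
        using t s fsI[OF tK] fsI[OF sK] nn by (auto simp: Rel_def)
      have l0: "t n \<odot>\<^bsub>M\<^esub> v \<oplus>\<^bsub>M\<^esub> lc I t y = \<zero>\<^bsub>M\<^esub>" "t n \<odot>\<^bsub>M\<^esub> v \<oplus>\<^bsub>M\<^esub> lc I s y = \<zero>\<^bsub>M\<^esub>"
        using t s lcI[OF tK] lcI[OF sK] nn by (auto simp: Rel_def)
      have fc: "finsum R t I \<in> K" "finsum R s I \<in> K" using tI R.finsum_closed by auto
      have lcV: "lc I t y \<in> V" "lc I s y \<in> V" using tI y by auto
      have "finsum R t I = \<ominus> t n" "finsum R s I = \<ominus> t n"
        using f0 fc nn by (auto intro!: R.minus_equality[symmetric] simp: R.a_comm)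
      hence "finsum R t I = finsum R s I" by simp
      hence "finsum R (?g t) I = \<zero>"
        using finsum_diff[OF I(1) tI] fc R.finsum_cong'[of I I "\<lambda>i. t i \<ominus> s i" "?g t"] tI
        by (auto simp: Pi_iff a_minus_def R.r_neg)
      moreover have "lc I t y = \<ominus>\<^bsub>M\<^esub> (t n \<odot>\<^bsub>M\<^esub> v)" "lc I s y = \<ominus>\<^bsub>M\<^esub> (t n \<odot>\<^bsub>M\<^esub> v)"
        using l0 lcV nn v by (auto intro!: M.minus_equality[symmetric] simp: M.a_comm)
      hence "lc I t y = lc I s y" by simp
      hence "lc I (?g t) y = \<zero>\<^bsub>M\<^esub>"
        using lc_diff[OF I(1) tI y] lcV lc_cong[of I "?g t" "\<lambda>i. t i \<ominus> s i" y y] tI y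
        by (auto simp: Pi_iff a_minus_def M.r_neg)
      ultimately show "?g t \<in> Rel I y" using tI by (auto simp: Rel_def Pi_iff)
    qed
    ultimately show ?thesis using I by (intro card_inj_on_le[where f = ?g]) auto
  qed (simp only: card.empty le0)
  have "card ?R = (\<Sum>c\<in>(\<lambda>t. t n) ` ?R. card {t \<in> ?R. t n = c})"
    using sum.image_gen[of ?R "\<lambda>_. 1::nat" "\<lambda>t. t n"] I by simp
  also have "\<dots> \<le> (\<Sum>c\<in>K. card {t \<in> ?R. t n = c})"
    by (rule sum_mono2[OF finite_scalars]) (auto simp: Rel_def)
  also have "\<dots> \<le> (\<Sum>c\<in>K. card (Rel I y))" by (rule sum_mono) (rule fib)
  finally have "card ?R \<le> card K * card (Rel I y)" by simp
  hence "real (card ?R) \<le> real (card K * card (Rel I y))" by (rule of_nat_mono)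
  thus "real (card ?R) \<le> q * real (card (Rel I y))" by (simp only: of_nat_mult)
  assume nS: "v \<notin> Span I y"
  have "t n = \<zero>" if t: "t \<in> ?R" for t
  proof (rule ccontr)
    assume nz: "t n \<noteq> \<zero>"
    have tK: "t \<in> insert n I \<rightarrow> K" "t \<in> I \<rightarrow> K" "t n \<in> K" using t by (auto simp: Rel_def)
    have "t n \<odot>\<^bsub>M\<^esub> v \<oplus>\<^bsub>M\<^esub> lc I t y = \<zero>\<^bsub>M\<^esub>" using t lcI[OF tK(1)] by (auto simp: Rel_def)
    hence "t n \<odot>\<^bsub>M\<^esub> v = \<ominus>\<^bsub>M\<^esub> lc I t y" using tK y v by (intro M.minus_equality[symmetric]) auto
    hence "inv (t n) \<odot>\<^bsub>M\<^esub> (t n \<odot>\<^bsub>M\<^esub> v) = inv (t n) \<odot>\<^bsub>M\<^esub> (\<ominus>\<^bsub>M\<^esub> lc I t y)" by simp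
    moreover have i: "inv (t n) \<in> K" "inv (t n) \<otimes> t n = \<one>" using nz tK field_Units by auto
    ultimately have "v = \<ominus>\<^bsub>M\<^esub> (inv (t n) \<odot>\<^bsub>M\<^esub> lc I t y)"
      using tK y v by (simp add: smult_r_minus flip: smult_assoc1)
    also have "\<dots> = (\<ominus> (inv (t n))) \<odot>\<^bsub>M\<^esub> lc I t y" using i tK y by (simp add: smult_l_minus)
    also have "\<dots> = lc I (\<lambda>i. \<ominus> (inv (t n)) \<otimes> t i) y" using i tK y I by (simp add: lc_smult)
    also have "\<dots> = lc I (\<lambda>i\<in>I. \<ominus> (inv (t n)) \<otimes> t i) y"
      by (rule lc_cong) (use i tK y in \<open>auto simp: Pi_iff\<close>)
    also have "\<dots> \<in> Span I y" unfolding Span_def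
      by (rule imageI) (use i tK in \<open>auto simp: Pi_iff\<close>)
    finally show False using nS by simp
  qed
  hence "?R = {t \<in> ?R. t n = \<zero>}" by auto
  thus "card ?R \<le> card (Rel I y)" using fib[of \<zero>] by simp
qed

section \<open>Points at prescribed distances\<close>

lemma e_finsum_mult: "finite I \<Longrightarrow> t \<in> I \<rightarrow> K \<Longrightarrow> a \<in> K \<Longrightarrow> e (finsum R t I \<otimes> a) = (\<Prod>i\<in>I. e (t i \<otimes> a))"
  by (subst finsum_ldistr) (auto simp: e_finsum Pi_iff)

text \<open>As a function of v the product is a quadratic phase with leading coefficient the sum of
  the t i and linear part -2 times their combination of the points. Both vanish exactly when t is an
  affine relation.\<close>

lemma phase_expand:
  assumes I: "finite I" "t \<in> I \<rightarrow> K" "\<delta> \<in> I \<rightarrow> K" "y \<in> I \<rightarrow> V" "v \<in> V"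
  shows "(\<Prod>i\<in>I. e (t i \<otimes> (sd v (y i) \<ominus> \<delta> i)))
    = e (finsum R t I \<otimes> sq v) * \<psi> (\<ominus>\<^bsub>M\<^esub> ((\<one> \<oplus> \<one>) \<odot>\<^bsub>M\<^esub> lc I t y)) v * (\<Prod>i\<in>I. e (t i \<otimes> (sq (y i) \<ominus> \<delta> i)))"
proof -
  let ?\<xi> = "\<ominus>\<^bsub>M\<^esub> ((\<one> \<oplus> \<one>) \<odot>\<^bsub>M\<^esub> v)"
  have *: "e (t i \<otimes> (sd v (y i) \<ominus> \<delta> i)) = e (t i \<otimes> sq v) * \<psi> (t i \<odot>\<^bsub>M\<^esub> ?\<xi>) (y i) * e (t i \<otimes> (sq (y i) \<ominus> \<delta> i))"
    if i: "i \<in> I" for i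
  proof -
    have m: "t i \<in> K" "\<delta> i \<in> K" "y i \<in> V" using I i by auto
    have "t i \<otimes> (sd v (y i) \<ominus> \<delta> i) = t i \<otimes> sq v \<oplus> t i \<otimes> (\<ominus> ((\<one> \<oplus> \<one>) \<otimes> B v (y i))) \<oplus> t i \<otimes> (sq (y i) \<ominus> \<delta> i)"
      unfolding sd_expand[OF I(5) m(3)] using m(1,2) sq_closed[OF m(3)] sq_closed[OF I(5)] B_closed[OF I(5) m(3)]
      by algebra
    moreover have "B (t i \<odot>\<^bsub>M\<^esub> ?\<xi>) (y i) = t i \<otimes> (\<ominus> ((\<one> \<oplus> \<one>) \<otimes> B v (y i)))"
      using m I by (simp add: B_smult B_minus)
    ultimately show ?thesis using m I by (simp add: e_add \<psi>_def)
  qed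
  have LV: "lc I t y \<in> V" using I by auto
  have "(\<Prod>i\<in>I. e (t i \<otimes> (sd v (y i) \<ominus> \<delta> i))) =
      (\<Prod>i\<in>I. e (t i \<otimes> sq v) * \<psi> (t i \<odot>\<^bsub>M\<^esub> ?\<xi>) (y i) * e (t i \<otimes> (sq (y i) \<ominus> \<delta> i)))"
    by (rule prod.cong[OF refl *])
  also have "\<dots> = e (finsum R t I \<otimes> sq v) * \<psi> ?\<xi> (lc I t y) * (\<Prod>i\<in>I. e (t i \<otimes> (sq (y i) \<ominus> \<delta> i)))"
    using I by (simp add: prod.distrib e_finsum_mult \<psi>_lc)
  also have "\<psi> ?\<xi> (lc I t y) = \<psi> (\<ominus>\<^bsub>M\<^esub> ((\<one> \<oplus> \<one>) \<odot>\<^bsub>M\<^esub> lc I t y)) v"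
    unfolding \<psi>_def using I LV B_comm[of v "lc I t y"] by (simp add: B_smult B_minus)
  finally show ?thesis .
qed

lemma two_smult_zero: "x \<in> V \<Longrightarrow> (\<one> \<oplus> \<one>) \<odot>\<^bsub>M\<^esub> x = \<zero>\<^bsub>M\<^esub> \<Longrightarrow> x = \<zero>\<^bsub>M\<^esub>"
proof -
  assume x: "x \<in> V" and h: "(\<one> \<oplus> \<one>) \<odot>\<^bsub>M\<^esub> x = \<zero>\<^bsub>M\<^esub>"
  have i: "inv (\<one> \<oplus> \<one>) \<in> K" "inv (\<one> \<oplus> \<one>) \<otimes> (\<one> \<oplus> \<one>) = \<one>" using two_nonzero field_Units by auto
  have "inv (\<one> \<oplus> \<one>) \<odot>\<^bsub>M\<^esub> ((\<one> \<oplus> \<one>) \<odot>\<^bsub>M\<^esub> x) = \<zero>\<^bsub>M\<^esub>" using h i by simp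
  moreover have "inv (\<one> \<oplus> \<one>) \<odot>\<^bsub>M\<^esub> ((\<one> \<oplus> \<one>) \<odot>\<^bsub>M\<^esub> x) = (inv (\<one> \<oplus> \<one>) \<otimes> (\<one> \<oplus> \<one>)) \<odot>\<^bsub>M\<^esub> x"
    by (rule smult_assoc1[symmetric]) (use i x in auto)
  ultimately show ?thesis using i x by simp
qed

text \<open>Expanding the conditions in characters, t = 0 gives the main term 1 and any other
  relation at most 1. All remaining t cancel: exactly if their entries sum to zero, and by the Gauss
  sum bound otherwise.\<close>

lemma distance_step:
  assumes I: "finite I" "\<delta> \<in> I \<rightarrow> K" "y \<in> I \<rightarrow> V"
  shows "\<bar>Ex (\<lambda>v. \<Prod>i\<in>I. Dd (\<delta> i) (y i) v) - 1\<bar> \<le> real (card (Rel I y)) - 1 + q ^ card I / sqrt N"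
proof -
  let ?P = "PiE I (\<lambda>_. K)" and ?z = "\<lambda>i\<in>I. \<zero>"
  define g where "g t = Ex (\<lambda>v. \<Prod>i\<in>I. e (t i \<otimes> (sd v (y i) \<ominus> \<delta> i)))" for t
  have fP: "finite ?P" using I finite_coeffs by auto
  have "complex_of_real (Ex (\<lambda>v. \<Prod>i\<in>I. Dd (\<delta> i) (y i) v)) = Ex (\<lambda>v. \<Sum>t\<in>?P. \<Prod>i\<in>I. e (t i \<otimes> (sd v (y i) \<ominus> \<delta> i)))"
    unfolding Ex_of_real[symmetric]
  proof (rule Ex_cong)
    fix v assume v: "v \<in> V"
    have "complex_of_real (\<Prod>i\<in>I. Dd (\<delta> i) (y i) v) = (\<Prod>i\<in>I. \<Sum>t\<in>K. e (t \<otimes> (sd v (y i) \<ominus> \<delta> i)))"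
      unfolding of_real_prod by (rule prod.cong[OF refl Dd_char]) (use I v in auto)
    also have "\<dots> = (\<Sum>t\<in>?P. \<Prod>i\<in>I. e (t i \<otimes> (sd v (y i) \<ominus> \<delta> i)))"
      by (rule prod_sum_PiE) (use I finite_scalars in auto)
    finally show "complex_of_real (\<Prod>i\<in>I. Dd (\<delta> i) (y i) v) = \<dots>" .
  qed
  hence E: "complex_of_real (Ex (\<lambda>v. \<Prod>i\<in>I. Dd (\<delta> i) (y i) v)) = (\<Sum>t\<in>?P. g t)"
    by (simp add: Ex_sum g_def)
  have gz: "g ?z = 1"
  proof -
    have "g ?z = Ex (\<lambda>v. 1)" unfolding g_def
      by (rule Ex_cong, rule prod.neutral) (use I in \<open>auto simp: Pi_iff\<close>)
    thus ?thesis by simp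
  qed
  have gn: "norm (g t) \<le> (if t \<in> Rel I y then 1 else 0) + 1 / sqrt N" if t: "t \<in> ?P" for t
  proof -
    have tK: "t \<in> I \<rightarrow> K" using t by auto
    let ?T = "finsum R t I" and ?w = "\<ominus>\<^bsub>M\<^esub> ((\<one> \<oplus> \<one>) \<odot>\<^bsub>M\<^esub> lc I t y)"
    let ?c = "\<Prod>i\<in>I. e (t i \<otimes> (sq (y i) \<ominus> \<delta> i))"
    have LV: "lc I t y \<in> V" using I tK by auto
    have wV: "?w \<in> V" using LV by auto
    have TK: "?T \<in> K" using tK by (rule R.finsum_closed)
    have "g t = Ex (\<lambda>v. e (?T \<otimes> sq v) * \<psi> ?w v * ?c)"
      unfolding g_def by (rule Ex_cong) (rule phase_expand[OF I(1) tK I(2,3)])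
    hence "norm (g t) = norm (Ex (\<lambda>v. e (?T \<otimes> sq v) * \<psi> ?w v)) * norm ?c" by (simp only: Ex_cmult norm_mult)
    also have "norm ?c = 1" unfolding prod_norm[symmetric]
      by (rule prod.neutral) (use I tK in \<open>auto simp: Pi_iff e_norm\<close>)
    finally have n: "norm (g t) = norm (Ex (\<lambda>v. e (?T \<otimes> sq v) * \<psi> ?w v))" by simp
    show ?thesis
    proof (cases "?T = \<zero>")
      case False
      thus ?thesis using Ex_quadratic[OF TK False wV] n by auto
    next
      case T: True
      have "Ex (\<lambda>v. e (?T \<otimes> sq v) * \<psi> ?w v) = Ex (\<psi> ?w)" by (rule Ex_cong) (simp add: T)
      hence n': "norm (g t) = (if ?w = \<zero>\<^bsub>M\<^esub> then 1 else 0)" using n Ex_\<psi>[OF wV] by simp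
      have "?w = \<zero>\<^bsub>M\<^esub> \<Longrightarrow> t \<in> Rel I y"
      proof -
        assume "?w = \<zero>\<^bsub>M\<^esub>"
        hence "\<ominus>\<^bsub>M\<^esub> ?w = \<zero>\<^bsub>M\<^esub>" by simp
        hence "(\<one> \<oplus> \<one>) \<odot>\<^bsub>M\<^esub> lc I t y = \<zero>\<^bsub>M\<^esub>" using LV by simp
        hence "lc I t y = \<zero>\<^bsub>M\<^esub>" using two_smult_zero LV by blast
        thus ?thesis using t T by (simp add: Rel_def)
      qed
      thus ?thesis using n' by auto
    qed
  qed
  have zP: "?z \<in> ?P" by auto
  have zR: "?z \<in> Rel I y" using zero_Rel I by auto
  have "complex_of_real (Ex (\<lambda>v. \<Prod>i\<in>I. Dd (\<delta> i) (y i) v) - 1) = (\<Sum>t\<in>?P - {?z}. g t)"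
    using E gz sum.remove[OF fP zP, of g] by simp
  hence "norm (complex_of_real (Ex (\<lambda>v. \<Prod>i\<in>I. Dd (\<delta> i) (y i) v) - 1)) = norm (\<Sum>t\<in>?P - {?z}. g t)"
    by (rule arg_cong)
  hence "\<bar>Ex (\<lambda>v. \<Prod>i\<in>I. Dd (\<delta> i) (y i) v) - 1\<bar> = norm (\<Sum>t\<in>?P - {?z}. g t)"
    by (simp only: norm_of_real)
  also have "\<dots> \<le> (\<Sum>t\<in>?P - {?z}. (if t \<in> Rel I y then 1 else 0) + 1 / sqrt N)"
    by (rule sum_norm_le) (use gn in auto)
  also have "\<dots> = (\<Sum>t\<in>?P - {?z}. if t \<in> Rel I y then 1 else 0) + (\<Sum>t\<in>?P - {?z}. 1 / sqrt N)"
    by (rule sum.distrib)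
  also have "(\<Sum>t\<in>?P - {?z}. if t \<in> Rel I y then 1 else 0) = (\<Sum>t\<in>Rel I y - {?z}. 1)"
    by (rule sum.mono_neutral_cong_right) (use fP in \<open>auto simp: Rel_def\<close>)
  also have "\<dots> = real (card (Rel I y)) - 1"
    using zR I Rel_ge_1[OF I(1,3)] by (simp add: card_Diff_singleton of_nat_diff)
  also have "(\<Sum>t\<in>?P - {?z}. 1 / sqrt N) \<le> (\<Sum>t\<in>?P. 1 / sqrt N)"
    by (rule sum_mono2) (use fP in auto)
  also have "\<dots> = q ^ card I / sqrt N" using I by (simp add: card_PiE)
  finally show ?thesis by simp
qed

text \<open>The set \<open>S\<close> holds the indices of fixed base points, disjoint from those
  averaged. Distances among the base points themselves carry no weight.\<close>

definition wt :: "(nat \<Rightarrow> nat \<Rightarrow> 'a) \<Rightarrow> nat set \<Rightarrow> nat \<Rightarrow> (nat \<Rightarrow> 'c) \<Rightarrow> real" where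
  "wt \<delta> S n y = (\<Prod>j<n. \<Prod>i\<in>{..<j} \<union> S. Dd (\<delta> i j) (y i) (y j))"

lemma wt_0 [simp]: "wt \<delta> S 0 y = 1" by (simp add: wt_def)

lemma wt_nonneg [simp]: "0 \<le> wt \<delta> S n y" unfolding wt_def by (intro prod_nonneg ballI) auto

lemma wt_Suc: assumes "n \<notin> S"
  shows "wt \<delta> S (Suc n) (y(n := v)) = wt \<delta> S n y * (\<Prod>i\<in>{..<n} \<union> S. Dd (\<delta> i n) (y i) v)"
proof -
  have "(\<Prod>j<n. \<Prod>i\<in>{..<j} \<union> S. Dd (\<delta> i j) ((y(n := v)) i) ((y(n := v)) j)) = wt \<delta> S n y"
    unfolding wt_def by (intro prod.cong refl) (use assms in auto)
  moreover have "(\<Prod>i\<in>{..<n} \<union> S. Dd (\<delta> i n) ((y(n := v)) i) ((y(n := v)) n)) = (\<Prod>i\<in>{..<n} \<union> S. Dd (\<delta> i n) (y i) v)"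
    by (intro prod.cong refl) (use assms in auto)
  ultimately show ?thesis unfolding wt_def[of \<delta> S "Suc n"] prod.lessThan_Suc by simp
qed

lemma q_ge_1: "1 \<le> q" using q_pos by linarith

lemma inv_q_le_1: "1 / q ^ s \<le> 1" using q_ge_1 by (simp add: one_le_power)

lemma q_power_div_N: assumes "q ^ (2 * h) \<le> N" "a + s \<le> 2 * h" shows "q ^ a / N \<le> 1 / q ^ s"
proof -
  have "q ^ a * q ^ s \<le> q ^ (2 * h)" unfolding power_add[symmetric] by (rule power_increasing[OF assms(2) q_ge_1])
  hence "q ^ a * q ^ s \<le> N" using assms(1) by linarith
  thus ?thesis using N_pos q_pos by (simp add: field_simps)
qed

lemma q_power_div_sqrt_N: assumes "q ^ (2 * h) \<le> N" "a + s \<le> h" shows "q ^ a / sqrt N \<le> 1 / q ^ s"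
proof -
  have "sqrt (q ^ (2 * h)) \<le> sqrt N" using assms(1) by simp
  moreover have "sqrt (q ^ (2 * h)) = q ^ h" 
  proof -
    have "q ^ (2 * h) = (q ^ h)\<^sup>2" by (metis power_mult mult.commute)
    thus ?thesis using q_pos by simp
  qed
  ultimately have "q ^ h \<le> sqrt N" by simp
  moreover have "q ^ a * q ^ s \<le> q ^ h" unfolding power_add[symmetric] by (rule power_increasing[OF assms(2) q_ge_1])
  ultimately have "q ^ a * q ^ s \<le> sqrt N" by linarith
  thus ?thesis using N_pos q_pos by (simp add: field_simps)
qed

lemma prod_Dd_le: "finite I \<Longrightarrow> (\<Prod>i\<in>I. Dd (\<delta> i) (y i) (z i)) \<le> q ^ card I"
  by (rule order_trans[OF prod_mono[of I _ "\<lambda>_. q"]]) (auto simp: Dd_le)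

lemma Ex_indicator_le: assumes "finite S" shows "Ex (\<lambda>v. if v \<in> S then 1 else (0::real)) \<le> card S / N"
proof -
  have "(\<Sum>v\<in>V. if v \<in> S then 1 else (0::real)) = (\<Sum>v\<in>V \<inter> S. 1)"
    by (rule sum.mono_neutral_cong_right) (use finite_vectors in auto)
  also have "\<dots> \<le> card S" using assms by (simp add: card_mono)
  finally show ?thesis using N_pos by (simp add: Ex_def divide_right_mono)
qed

text \<open>One round of the recursion for the error constants: a becomes at most 3a + 2, and 5 is
  the least base that copes with a = 1.\<close>

lemma five_power: "(x::real) \<le> 1 \<Longrightarrow> 0 \<le> x \<Longrightarrow> 5 ^ n + 2 + 2 * (5 ^ n * x) \<le> (5::real) ^ Suc n"
proof -
  assume x: "x \<le> 1" "0 \<le> x"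
  have "(1::real) \<le> 5 ^ n" by simp
  moreover have "5 ^ n * x \<le> 5 ^ n * (1::real)" by (rule mult_left_mono[OF x(1)]) simp
  ultimately show ?thesis unfolding power_Suc mult_1_right by linarith
qed

text \<open>Averaging over the last point yields about as many units as there are relations among
  the earlier ones, so the induction must carry powers of that number: r grows by one while n drops
  by one. A new point in the span multiplies the relations by q, but such points form only a
  fraction q^(card I) / N of the space. The exponent s is the saving; the hypotheses c say how much
  of the dimension 2h it leaves.\<close>

lemma wt_moment:
  assumes N: "q ^ (2 * h) \<le> N" and \<delta>: "\<And>i j. \<delta> i j \<in> K" and S: "finite S" "S \<inter> {..<n} = {}"
    and b: "\<And>i. i \<in> S \<Longrightarrow> b i \<in> V" and R1: "card (Rel S b) = 1"
    and c: "card S + n + s \<le> h + 1" "r + 2 * n + 2 * card S + s \<le> 2 * h + 2"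
  shows "AE n (\<lambda>y. wt \<delta> S n y * real (card (Rel ({..<n} \<union> S) y)) ^ r) b \<le> 1 + 5 ^ n / q ^ s"
  using S(2) c
proof (induction n arbitrary: r)
  case 0
  thus ?case using R1 by simp
next
  case (Suc n)
  let ?\<eta> = "1 / q ^ s" and ?I = "{..<n} \<union> S"
  have nB: "n \<notin> S" "S \<inter> {..<n} = {}" using Suc.prems by auto
  have fI: "finite ?I" "n \<notin> ?I" using S nB by auto
  have cI: "card ?I = n + card S" using S nB by (subst card_Un_disjoint) auto
  let ?\<rho> = "\<lambda>y. real (card (Rel ?I y))"
  have "AE (Suc n) (\<lambda>y. wt \<delta> S (Suc n) y * real (card (Rel ({..<Suc n} \<union> S) y)) ^ r) b
      \<le> AE n (\<lambda>y. wt \<delta> S n y * ?\<rho> y ^ Suc r + 2 * ?\<eta> * (wt \<delta> S n y * ?\<rho> y ^ r)) b"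
    unfolding AE_Suc
  proof (rule AE_mono)
    fix y assume y: "\<And>i. i < n \<Longrightarrow> y i \<in> V" "\<And>i. n \<le> i \<Longrightarrow> y i = b i"
    have yI: "y \<in> ?I \<rightarrow> V"
    proof (rule Pi_I)
      fix i assume "i \<in> ?I"
      thus "y i \<in> V" using y b by (cases "i < n") auto
    qed
    have e: "{..<Suc n} \<union> S = insert n ?I" by auto
    let ?P = "\<lambda>v. \<Prod>i\<in>?I. Dd (\<delta> i n) (y i) v"
    have P: "0 \<le> ?P v" "?P v \<le> q ^ card ?I" for v
      using prod_Dd_le[of ?I "\<lambda>i. \<delta> i n" y "\<lambda>_. v"] fI by (auto intro: prod_nonneg)
    have EP: "Ex ?P \<le> ?\<rho> y + ?\<eta>"
    proof -
      have "\<bar>Ex ?P - 1\<bar> \<le> ?\<rho> y - 1 + q ^ card ?I / sqrt N"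
        by (rule distance_step) (use fI yI \<delta> in auto)
      moreover have "q ^ card ?I / sqrt N \<le> ?\<eta>"
        by (rule q_power_div_sqrt_N[OF N]) (use Suc.prems cI in auto)
      ultimately show ?thesis by linarith
    qed
    have cs: "real (card (Rel (insert n ?I) (y(n := v)))) ^ r \<le> ?\<rho> y ^ r + q ^ r * ?\<rho> y ^ r * (if v \<in> Span ?I y then 1 else 0)"
      if v: "v \<in> V" for v
    proof (cases "v \<in> Span ?I y")
      case True
      have "real (card (Rel (insert n ?I) (y(n := v)))) ^ r \<le> (q * ?\<rho> y) ^ r"
        by (intro power_mono Rel_insert(1)[OF fI yI v]) simp
      thus ?thesis using True by (simp add: power_mult_distrib add_increasing)
    next
      case False
      have "real (card (Rel (insert n ?I) (y(n := v)))) ^ r \<le> ?\<rho> y ^ r"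
        by (intro power_mono of_nat_mono Rel_insert(2)[OF fI yI v False]) simp
      thus ?thesis using False by simp
    qed
    have "Ex (\<lambda>v. wt \<delta> S (Suc n) (y(n := v)) * real (card (Rel ({..<Suc n} \<union> S) (y(n := v)))) ^ r)
      = Ex (\<lambda>v. wt \<delta> S n y * (?P v * real (card (Rel (insert n ?I) (y(n := v)))) ^ r))"
      unfolding wt_Suc[OF nB(1)] e by (simp only: mult.assoc)
    also have "\<dots> = wt \<delta> S n y * Ex (\<lambda>v. ?P v * real (card (Rel (insert n ?I) (y(n := v)))) ^ r)"
      by (rule Ex_cmult)
    also have "\<dots> \<le> wt \<delta> S n y * (?\<rho> y ^ Suc r + 2 * ?\<eta> * ?\<rho> y ^ r)"
    proof (rule mult_left_mono)
      have "Ex (\<lambda>v. ?P v * real (card (Rel (insert n ?I) (y(n := v)))) ^ r)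
        \<le> Ex (\<lambda>v. ?P v * ?\<rho> y ^ r + (q ^ card ?I * (q ^ r * ?\<rho> y ^ r)) * (if v \<in> Span ?I y then 1 else 0))"
      proof (rule Ex_mono)
        fix v assume v: "v \<in> V"
        have "?P v * real (card (Rel (insert n ?I) (y(n := v)))) ^ r
          \<le> ?P v * (?\<rho> y ^ r + q ^ r * ?\<rho> y ^ r * (if v \<in> Span ?I y then 1 else 0))"
          by (rule mult_left_mono[OF cs[OF v] P(1)])
        also have "\<dots> = ?P v * ?\<rho> y ^ r + ?P v * (q ^ r * ?\<rho> y ^ r * (if v \<in> Span ?I y then 1 else 0))"
          by (rule distrib_left)
        also have "\<dots> \<le> ?P v * ?\<rho> y ^ r + q ^ card ?I * (q ^ r * ?\<rho> y ^ r * (if v \<in> Span ?I y then 1 else 0))"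
          by (intro add_left_mono mult_right_mono P(2)) auto
        finally show "?P v * real (card (Rel (insert n ?I) (y(n := v)))) ^ r
          \<le> ?P v * ?\<rho> y ^ r + (q ^ card ?I * (q ^ r * ?\<rho> y ^ r)) * (if v \<in> Span ?I y then 1 else 0)"
          by (simp only: mult.assoc)
      qed
      also have "\<dots> = Ex ?P * ?\<rho> y ^ r + (q ^ card ?I * (q ^ r * ?\<rho> y ^ r)) * Ex (\<lambda>v. if v \<in> Span ?I y then 1 else 0)"
        by (simp only: Ex_add Ex_cmult)
      also have "\<dots> \<le> (?\<rho> y + ?\<eta>) * ?\<rho> y ^ r + (q ^ card ?I * (q ^ r * ?\<rho> y ^ r)) * (q ^ card ?I / N)"
      proof (intro add_mono mult_right_mono EP mult_left_mono)
        have "Ex (\<lambda>v. if v \<in> Span ?I y then 1 else (0::real)) \<le> card (Span ?I y) / N"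
          by (rule Ex_indicator_le[OF finite_Span[OF fI(1)]])
        also have "\<dots> \<le> q ^ card ?I / N" by (intro divide_right_mono card_Span fI) simp
        finally show "Ex (\<lambda>v. if v \<in> Span ?I y then 1 else (0::real)) \<le> q ^ card ?I / N" .
      qed auto
      finally have "Ex (\<lambda>v. ?P v * real (card (Rel (insert n ?I) (y(n := v)))) ^ r)
        \<le> (?\<rho> y + ?\<eta>) * ?\<rho> y ^ r + (q ^ card ?I * (q ^ r * ?\<rho> y ^ r)) * (q ^ card ?I / N)" .
      moreover have "(q ^ card ?I * (q ^ r * ?\<rho> y ^ r)) * (q ^ card ?I / N) = (q ^ (r + 2 * card ?I) / N) * ?\<rho> y ^ r"
        by (simp add: power_add power_mult power2_eq_square mult_2)
      moreover have "(q ^ (r + 2 * card ?I) / N) * ?\<rho> y ^ r \<le> ?\<eta> * ?\<rho> y ^ r"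
        by (intro mult_right_mono q_power_div_N[OF N]) (use Suc.prems cI in auto)
      moreover have "(?\<rho> y + ?\<eta>) * ?\<rho> y ^ r + ?\<eta> * ?\<rho> y ^ r = ?\<rho> y ^ Suc r + 2 * ?\<eta> * ?\<rho> y ^ r"
        by (simp add: algebra_simps)
      ultimately show "Ex (\<lambda>v. ?P v * real (card (Rel (insert n ?I) (y(n := v)))) ^ r) \<le> ?\<rho> y ^ Suc r + 2 * ?\<eta> * ?\<rho> y ^ r"
        by linarith
    qed simp
    finally show "Ex (\<lambda>v. wt \<delta> S (Suc n) (y(n := v)) * real (card (Rel ({..<Suc n} \<union> S) (y(n := v)))) ^ r)
       \<le> wt \<delta> S n y * ?\<rho> y ^ Suc r + 2 * ?\<eta> * (wt \<delta> S n y * ?\<rho> y ^ r)"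
      by (simp only: distrib_left mult.left_commute)
  qed
  also have "\<dots> = AE n (\<lambda>y. wt \<delta> S n y * ?\<rho> y ^ Suc r) b + 2 * ?\<eta> * AE n (\<lambda>y. wt \<delta> S n y * ?\<rho> y ^ r) b"
    by (simp only: AE_add AE_cmult)
  also have "\<dots> \<le> (1 + 5 ^ n / q ^ s) + 2 * ?\<eta> * (1 + 5 ^ n / q ^ s)"
  proof (rule add_mono)
    show "AE n (\<lambda>y. wt \<delta> S n y * ?\<rho> y ^ Suc r) b \<le> 1 + 5 ^ n / q ^ s"
      by (rule Suc.IH) (use nB Suc.prems in auto)
    show "2 * ?\<eta> * AE n (\<lambda>y. wt \<delta> S n y * ?\<rho> y ^ r) b \<le> 2 * ?\<eta> * (1 + 5 ^ n / q ^ s)"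
      by (rule mult_left_mono[OF Suc.IH]) (use nB Suc.prems in auto)
  qed
  also have "\<dots> = 1 + (5 ^ n + 2 + 2 * (5 ^ n * ?\<eta>)) * ?\<eta>" by (simp add: algebra_simps)
  also have "\<dots> \<le> 1 + 5 ^ Suc n * ?\<eta>"
    by (intro add_left_mono mult_right_mono five_power inv_q_le_1) auto
  finally show ?case by simp
qed

lemma wt_mean_le:
  assumes N: "q ^ (2 * h) \<le> N" and \<delta>: "\<And>i j. \<delta> i j \<in> K" and S: "finite S" "S \<inter> {..<n} = {}"
    and b: "\<And>i. i \<in> S \<Longrightarrow> b i \<in> V" and R1: "card (Rel S b) = 1"
    and c: "card S + n + s \<le> h + 1" "2 * n + 2 * card S + s \<le> 2 * h + 2"
  shows "AE n (wt \<delta> S n) b \<le> 1 + 5 ^ n / q ^ s"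
  using wt_moment[OF N \<delta> S b R1 c(1), where r = 0] c(2) by simp

text \<open>The lower half of \<open>distance_step\<close>: the last point contributes at least 2 -
  1 / q^s minus the number of relations among the others, and the mean of that number is known from
  \<open>wt_moment\<close> with r = 1.\<close>

lemma wt_mean_ge:
  assumes N: "q ^ (2 * h) \<le> N" and \<delta>: "\<And>i j. \<delta> i j \<in> K" and S: "finite S" "S \<inter> {..<n} = {}"
    and b: "\<And>i. i \<in> S \<Longrightarrow> b i \<in> V" and R1: "card (Rel S b) = 1"
    and c: "card S + n + s \<le> h + 1" "2 * n + 2 * card S + s \<le> 2 * h + 2"
  shows "AE n (wt \<delta> S n) b \<ge> 1 - 5 ^ n / q ^ s"
  using S(2) c
proof (induction n)
  case (Suc n)
  let ?\<eta> = "1 / q ^ s" and ?I = "{..<n} \<union> S"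
  have nB: "n \<notin> S" "S \<inter> {..<n} = {}" using Suc.prems by auto
  have fI: "finite ?I" "n \<notin> ?I" using S nB by auto
  have cI: "card ?I = n + card S" using S nB by (subst card_Un_disjoint) auto
  let ?\<rho> = "\<lambda>y. real (card (Rel ?I y))"
  have "AE n (\<lambda>y. (2 - ?\<eta>) * wt \<delta> S n y - wt \<delta> S n y * ?\<rho> y ^ 1) b \<le> AE (Suc n) (wt \<delta> S (Suc n)) b"
    unfolding AE_Suc
  proof (rule AE_mono)
    fix y assume y: "\<And>i. i < n \<Longrightarrow> y i \<in> V" "\<And>i. n \<le> i \<Longrightarrow> y i = b i"
    have yI: "y \<in> ?I \<rightarrow> V"
    proof (rule Pi_I)
      fix i assume "i \<in> ?I"
      thus "y i \<in> V" using y b by (cases "i < n") auto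
    qed
    let ?P = "\<lambda>v. \<Prod>i\<in>?I. Dd (\<delta> i n) (y i) v"
    have "\<bar>Ex ?P - 1\<bar> \<le> ?\<rho> y - 1 + q ^ card ?I / sqrt N"
      by (rule distance_step) (use fI yI \<delta> in auto)
    moreover have "q ^ card ?I / sqrt N \<le> ?\<eta>"
      by (rule q_power_div_sqrt_N[OF N]) (use Suc.prems cI in auto)
    ultimately have "2 - ?\<eta> - ?\<rho> y \<le> Ex ?P" by linarith
    hence "wt \<delta> S n y * (2 - ?\<eta> - ?\<rho> y) \<le> wt \<delta> S n y * Ex ?P" by (rule mult_left_mono) simp
    also have "\<dots> = Ex (\<lambda>v. wt \<delta> S (Suc n) (y(n := v)))"
      unfolding wt_Suc[OF nB(1)] by (rule Ex_cmult[symmetric])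
    finally show "(2 - ?\<eta>) * wt \<delta> S n y - wt \<delta> S n y * ?\<rho> y ^ 1 \<le> Ex (\<lambda>v. wt \<delta> S (Suc n) (y(n := v)))"
      by (simp only: power_one_right right_diff_distrib mult.commute)
  qed
  moreover have "AE n (\<lambda>y. (2 - ?\<eta>) * wt \<delta> S n y - wt \<delta> S n y * ?\<rho> y ^ 1) b
     = (2 - ?\<eta>) * AE n (wt \<delta> S n) b - AE n (\<lambda>y. wt \<delta> S n y * ?\<rho> y ^ 1) b"
    by (simp only: AE_diff AE_cmult)
  moreover have "AE n (\<lambda>y. wt \<delta> S n y * ?\<rho> y ^ 1) b \<le> 1 + 5 ^ n / q ^ s"
    by (rule wt_moment[OF N \<delta> S(1) nB(2) b R1]) (use Suc.prems in auto)
  moreover have "(2 - ?\<eta>) * (1 - 5 ^ n / q ^ s) \<le> (2 - ?\<eta>) * AE n (wt \<delta> S n) b"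
    by (intro mult_left_mono Suc.IH) (use nB Suc.prems inv_q_le_1[of s] in auto)
  moreover have "(2 - ?\<eta>) * (1 - 5 ^ n / q ^ s) - (1 + 5 ^ n / q ^ s) \<ge> 1 - 5 ^ Suc n / q ^ s"
  proof -
    have "(2 - ?\<eta>) * (1 - 5 ^ n / q ^ s) - (1 + 5 ^ n / q ^ s) = 1 - (3 * 5 ^ n + 1) * ?\<eta> + ?\<eta> * (5 ^ n / q ^ s)"
    proof -
      have "(2 - x) * (1 - a * x) - (1 + a * x) = 1 - (3 * a + 1) * x + x * (a * x)" for a x :: real
        by (simp add: algebra_simps)
      from this[of ?\<eta> "5 ^ n"] show ?thesis by simp
    qed
    moreover have "0 \<le> ?\<eta> * (5 ^ n / q ^ s)" by simp
    moreover have "(3 * 5 ^ n + 1) * ?\<eta> \<le> 5 ^ Suc n * ?\<eta>"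
    proof (rule mult_right_mono)
      have "(1::real) \<le> 5 ^ n" by simp
      thus "3 * 5 ^ n + 1 \<le> (5::real) ^ Suc n" unfolding power_Suc by linarith
    qed simp
    moreover have "5 ^ Suc n * ?\<eta> = 5 ^ Suc n / q ^ s" by simp
    ultimately show ?thesis by linarith
  qed
  ultimately show ?case by linarith
qed simp

section \<open>Discrepancy: the effect of joining one more vertex to a configuration\<close>

definition apex :: "(nat \<Rightarrow> 'a) \<Rightarrow> nat \<Rightarrow> 'c \<Rightarrow> (nat \<Rightarrow> 'c) \<Rightarrow> real" where
  "apex \<gamma> n v y = (\<Prod>j<n. Dd (\<gamma> j) v (y j)) - 1"

lemma apex_bound: "\<bar>apex \<gamma> n v y\<bar> \<le> q ^ n"
proof -
  have "0 \<le> (\<Prod>j<n. Dd (\<gamma> j) v (y j))" by (rule prod_nonneg) simp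
  moreover have "(\<Prod>j<n. Dd (\<gamma> j) v (y j)) \<le> q ^ n" using prod_Dd_le[of "{..<n}" \<gamma> "\<lambda>_. v" y] by simp
  moreover have "1 \<le> q ^ n" using q_ge_1 by (rule one_le_power)
  ultimately show ?thesis unfolding apex_def by linarith
qed

lemma Span_insert: assumes "finite I" "n \<notin> I" "y \<in> I \<rightarrow> V" "v \<in> V"
  shows "Span I y \<subseteq> Span (insert n I) (y(n := v))"
proof
  fix x assume "x \<in> Span I y"
  then obtain t where t: "t \<in> PiE I (\<lambda>_. K)" "x = lc I t y" by (auto simp: Span_def)
  have "lc (insert n I) (t(n := \<zero>)) (y(n := v)) = \<zero> \<odot>\<^bsub>M\<^esub> v \<oplus>\<^bsub>M\<^esub> lc I (t(n := \<zero>)) (y(n := v))"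
    using assms t by (subst lc_insert) (auto simp: Pi_iff)
  also have "lc I (t(n := \<zero>)) (y(n := v)) = lc I t y"
    by (rule lc_cong) (use assms t in auto)
  also have "\<zero> \<odot>\<^bsub>M\<^esub> v \<oplus>\<^bsub>M\<^esub> lc I t y = x"
  proof -
    have "lc I t y \<in> V" by (rule lc_closed) (use assms t in auto)
    thus ?thesis using assms t by simp
  qed
  finally have "x = lc (insert n I) (t(n := \<zero>)) (y(n := v))" by (rule sym)
  moreover have "t(n := \<zero>) \<in> PiE (insert n I) (\<lambda>_. K)" using t by (auto simp: PiE_def extensional_def)
  ultimately show "x \<in> Span (insert n I) (y(n := v))" unfolding Span_def by blast
qed

text \<open>Two apexes over a common configuration: expanding the product gives four configuration
  counts, which all are close to one unless the base points are dependent.\<close>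

lemma apex_pair:
  assumes N: "q ^ (2 * h) \<le> N" and \<delta>: "\<And>i j. \<delta> i j \<in> K" "\<And>j. \<gamma> j \<in> K" and S: "finite S" "S \<inter> {..<n} = {}"
    and b: "\<And>i. i \<in> S \<Longrightarrow> b i \<in> V" and R1: "card (Rel S b) = 1"
    and c: "card S + 2 + n + s \<le> h + 1" "2 * n + 2 * (card S + 2) + s \<le> 2 * h + 2"
    and p: "p \<notin> S" "p' \<notin> S" "p \<noteq> p'" "n \<le> p" "n \<le> p'"
    and v: "v \<in> V" "v' \<in> V" and indep: "v \<notin> Span S b" "v' \<notin> Span (insert p S) (b(p := v))"
  shows "\<bar>AE n (\<lambda>y. wt \<delta> S n y * (apex \<gamma> n v y * apex \<gamma> n v' y)) b\<bar> \<le> 4 * 5 ^ n / q ^ s"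
proof -
  \<comment> \<open>The two apexes are stored as base points at the fresh indices p and p'. Each of
    the four products is then again a weight \<open>wt\<close>, with \<open>S\<close> enlarged by p,
    by p', by both or by neither.\<close>
  let ?\<delta> = "\<lambda>i j. if i = p \<or> i = p' then \<gamma> j else \<delta> i j"
  let ?b = "b(p := v, p' := v')"
  let ?A = "\<lambda>C. AE n (wt ?\<delta> C n) ?b"
  let ?P = "\<lambda>v y. \<Prod>j<n. Dd (\<gamma> j) v (y j)"
  have w0: "wt ?\<delta> S n (y(p := v, p' := v')) = wt \<delta> S n y" for y
    unfolding wt_def by (intro prod.cong refl) (use p in auto)
  have w1: "wt ?\<delta> (insert p S) n (y(p := v, p' := v')) = wt \<delta> S n y * ?P v y" for y
  proof -
    have "(\<Prod>i\<in>{..<j} \<union> insert p S. Dd (?\<delta> i j) ((y(p := v, p' := v')) i) ((y(p := v, p' := v')) j))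
       = Dd (\<gamma> j) v (y j) * (\<Prod>i\<in>{..<j} \<union> S. Dd (\<delta> i j) (y i) (y j))" if "j < n" for j
    proof -
      have "{..<j} \<union> insert p S = insert p ({..<j} \<union> S)" by auto
      moreover have "p \<notin> {..<j} \<union> S" "p' \<notin> {..<j} \<union> S" using p that by auto
      ultimately show ?thesis using S p that by (auto intro!: arg_cong2[where f = "(*)"] prod.cong)
    qed
    thus ?thesis by (simp add: wt_def prod.distrib[symmetric] mult.commute)
  qed
  have w2: "wt ?\<delta> (insert p' S) n (y(p := v, p' := v')) = wt \<delta> S n y * ?P v' y" for y
  proof -
    have "(\<Prod>i\<in>{..<j} \<union> insert p' S. Dd (?\<delta> i j) ((y(p := v, p' := v')) i) ((y(p := v, p' := v')) j))
       = Dd (\<gamma> j) v' (y j) * (\<Prod>i\<in>{..<j} \<union> S. Dd (\<delta> i j) (y i) (y j))" if "j < n" for j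
    proof -
      have "{..<j} \<union> insert p' S = insert p' ({..<j} \<union> S)" by auto
      moreover have "p \<notin> {..<j} \<union> S" "p' \<notin> {..<j} \<union> S" using p that by auto
      ultimately show ?thesis using S p that by (auto intro!: arg_cong2[where f = "(*)"] prod.cong)
    qed
    thus ?thesis by (simp add: wt_def prod.distrib[symmetric] mult.commute)
  qed
  have w12: "wt ?\<delta> (insert p' (insert p S)) n (y(p := v, p' := v')) = wt \<delta> S n y * ?P v y * ?P v' y" for y
  proof -
    have "(\<Prod>i\<in>{..<j} \<union> insert p' (insert p S). Dd (?\<delta> i j) ((y(p := v, p' := v')) i) ((y(p := v, p' := v')) j))
       = Dd (\<gamma> j) v' (y j) * (Dd (\<gamma> j) v (y j) * (\<Prod>i\<in>{..<j} \<union> S. Dd (\<delta> i j) (y i) (y j)))" if "j < n" for j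
    proof -
      have "{..<j} \<union> insert p' (insert p S) = insert p' (insert p ({..<j} \<union> S))" by auto
      moreover have "p \<notin> {..<j} \<union> S" "p' \<notin> {..<j} \<union> S" using p that by auto
      ultimately show ?thesis using S p that by (auto intro!: arg_cong2[where f = "(*)"] prod.cong)
    qed
    thus ?thesis by (simp add: wt_def prod.distrib[symmetric] mult_ac)
  qed
  have "AE n (\<lambda>y. wt \<delta> S n y * (apex \<gamma> n v y * apex \<gamma> n v' y)) b
    = AE n (\<lambda>y. wt ?\<delta> (insert p' (insert p S)) n (y(p := v, p' := v')) - wt ?\<delta> (insert p S) n (y(p := v, p' := v'))
        - (wt ?\<delta> (insert p' S) n (y(p := v, p' := v')) - wt ?\<delta> S n (y(p := v, p' := v')))) b"
    unfolding w0 w1 w2 w12 apex_def by (rule AE_cong) (simp add: algebra_simps)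
  also have "\<dots> = ?A (insert p' (insert p S)) - ?A (insert p S) - (?A (insert p' S) - ?A S)"
    unfolding AE_diff using p
    by (simp only: AE_upd[where f = "\<lambda>y. wt ?\<delta> C n (y(p' := v'))" for C] AE_upd[where f = "wt ?\<delta> C n" for C])
  finally have E: "AE n (\<lambda>y. wt \<delta> S n y * (apex \<gamma> n v y * apex \<gamma> n v' y)) b = \<dots>" .
  have close: "\<bar>?A C - 1\<bar> \<le> 5 ^ n / q ^ s" if C: "finite C" "C \<inter> {..<n} = {}" "\<And>i. i \<in> C \<Longrightarrow> ?b i \<in> V" "card (Rel C ?b) = 1" "card C \<le> card S + 2" for C
  proof -
    have "?A C \<le> 1 + 5 ^ n / q ^ s" by (rule wt_mean_le[OF N _ C(1-4)]) (use \<delta> c C in auto)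
    moreover have "?A C \<ge> 1 - 5 ^ n / q ^ s" by (rule wt_mean_ge[OF N _ C(1-4)]) (use \<delta> c C in auto)
    ultimately show ?thesis by linarith
  qed
  have bB: "b \<in> S \<rightarrow> V" using b by auto
  have RB: "Rel S ?b = Rel S b" "Rel (insert p S) ?b = Rel (insert p S) (b(p := v))"
    "Rel (insert p' S) ?b = Rel (insert p' S) (b(p' := v'))"
  proof -
    have *: "Rel C y = Rel C y'" if "\<And>i. i \<in> C \<Longrightarrow> y i = y' i" "y' \<in> C \<rightarrow> V" for C y y'
    proof -
      have "lc C t y = lc C t y'" if "t \<in> PiE C (\<lambda>_. K)" for t
        by (rule lc_cong) (use \<open>\<And>i. i \<in> C \<Longrightarrow> y i = y' i\<close> \<open>y' \<in> C \<rightarrow> V\<close> that in auto)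
      thus ?thesis by (auto simp: Rel_def)
    qed
    show "Rel S ?b = Rel S b" "Rel (insert p S) ?b = Rel (insert p S) (b(p := v))"
      "Rel (insert p' S) ?b = Rel (insert p' S) (b(p' := v'))"
      by (rule *; use p bB v in auto)+
  qed
  have one: "card (Rel (insert m C) (y(m := x))) = 1" if C: "finite C" "m \<notin> C" "y \<in> C \<rightarrow> V" "x \<in> V" "x \<notin> Span C y" "card (Rel C y) = 1" for C m y x
  proof -
    have "card (Rel (insert m C) (y(m := x))) \<le> 1" using Rel_insert(2)[OF C(1-5)] C(6) by simp
    moreover have "1 \<le> card (Rel (insert m C) (y(m := x)))" by (rule Rel_ge_1) (use C in auto)
    ultimately show ?thesis by linarith
  qed
  have r1: "card (Rel (insert p S) (b(p := v))) = 1" by (rule one[OF S(1) p(1) bB v(1) indep(1) R1])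
  have v'S: "v' \<notin> Span S b" using indep(2) Span_insert[OF S(1) p(1) bB v(1)] by auto
  have r2: "card (Rel (insert p' S) (b(p' := v'))) = 1" by (rule one[OF S(1) p(2) bB v(2) v'S R1])
  have r12: "card (Rel (insert p' (insert p S)) ?b) = 1"
    by (rule one[OF _ _ _ v(2) indep(2) r1]) (use S p bB v in auto)
  have "\<bar>?A (insert p' (insert p S)) - 1\<bar> \<le> 5 ^ n / q ^ s"
    by (rule close) (use S p b v r12 in \<open>auto simp: card_insert_if\<close>)
  moreover have "\<bar>?A (insert p S) - 1\<bar> \<le> 5 ^ n / q ^ s"
    by (rule close) (use S p b v r1 RB in \<open>auto simp: card_insert_if\<close>)
  moreover have "\<bar>?A (insert p' S) - 1\<bar> \<le> 5 ^ n / q ^ s"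
    by (rule close) (use S p b v r2 RB in \<open>auto simp: card_insert_if\<close>)
  moreover have "\<bar>?A S - 1\<bar> \<le> 5 ^ n / q ^ s"
    by (rule close) (use S p b v R1 RB in auto)
  ultimately show ?thesis unfolding E by (simp add: abs_le_iff)
qed

text \<open>For dependent apexes there is no cancellation. The trivial bound loses q^(2n), which is
  affordable because such pairs are rare.\<close>

lemma apex_pair_crude:
  assumes N: "q ^ (2 * h) \<le> N" and \<delta>: "\<And>i j. \<delta> i j \<in> K" and S: "finite S" "S \<inter> {..<n} = {}"
    and b: "\<And>i. i \<in> S \<Longrightarrow> b i \<in> V" and R1: "card (Rel S b) = 1"
    and c: "card S + n + s \<le> h + 1" "2 * n + 2 * card S + s \<le> 2 * h + 2"
  shows "\<bar>AE n (\<lambda>y. wt \<delta> S n y * (apex \<gamma> n v y * apex \<gamma> n v' y)) b\<bar> \<le> 2 * 5 ^ n * q ^ (2 * n)"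
proof -
  have "\<bar>AE n (\<lambda>y. wt \<delta> S n y * (apex \<gamma> n v y * apex \<gamma> n v' y)) b\<bar>
     \<le> AE n (\<lambda>y. norm (wt \<delta> S n y * (apex \<gamma> n v y * apex \<gamma> n v' y))) b"
    using AE_norm[of n "\<lambda>y. wt \<delta> S n y * (apex \<gamma> n v y * apex \<gamma> n v' y)" b] by simp
  also have "\<dots> \<le> AE n (\<lambda>y. wt \<delta> S n y * q ^ (2 * n)) b"
  proof (rule AE_mono)
    fix y
    have "\<bar>apex \<gamma> n v y\<bar> * \<bar>apex \<gamma> n v' y\<bar> \<le> q ^ n * q ^ n" by (intro mult_mono apex_bound) auto
    thus "norm (wt \<delta> S n y * (apex \<gamma> n v y * apex \<gamma> n v' y)) \<le> wt \<delta> S n y * q ^ (2 * n)"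
      by (simp add: abs_mult mult_2 power_add mult_left_mono)
  qed
  also have "\<dots> = AE n (wt \<delta> S n) b * q ^ (2 * n)" by (rule AE_cmult)
  also have "\<dots> \<le> (2 * 5 ^ n) * q ^ (2 * n)"
  proof (rule mult_right_mono)
    have "AE n (wt \<delta> S n) b \<le> 1 + 5 ^ n / q ^ s" by (rule wt_mean_le[OF N \<delta> S b R1 c])
    also have "\<dots> = 1 + 5 ^ n * (1 / q ^ s)" by simp
    also have "\<dots> \<le> 1 + 5 ^ n * 1" by (intro add_left_mono mult_left_mono inv_q_le_1) simp
    also have "\<dots> \<le> 2 * 5 ^ n" by simp
    finally show "AE n (wt \<delta> S n) b \<le> 2 * 5 ^ n" .
  qed simp
  finally show ?thesis .
qed

text \<open>Opening the square leaves an average over pairs of apexes. Independent pairs contribute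
  2 * 2 * 4 * 5^n / q^s, since \<open>Ex w\<close> is at most 2, and the two kinds of dependence 2 *
  5^n / q^s each: 20 in all. The majorant w may be as large as q so that G can contain a further
  distance condition.\<close>

lemma apex_mean_square:
  assumes N: "q ^ (2 * h) \<le> N" and \<delta>: "\<And>i j. \<delta> i j \<in> K" "\<And>j. \<gamma> j \<in> K" and S: "finite S" "S \<inter> {..<n} = {}"
    and b: "\<And>i. i \<in> S \<Longrightarrow> b i \<in> V" and R1: "card (Rel S b) = 1"
    and c: "card S + 2 + n + s \<le> h + 1" "2 * n + 2 * (card S + 2) + s \<le> 2 * h + 2" "3 + card S + 2 * n + s \<le> 2 * h"
    and p: "p \<notin> S" "p' \<notin> S" "p \<noteq> p'" "n \<le> p" "n \<le> p'"
    and w: "\<And>v. v \<in> V \<Longrightarrow> norm (G v) \<le> w v" "\<And>v. v \<in> V \<Longrightarrow> w v \<le> q" "Ex w \<le> 2"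
  shows "AE n (\<lambda>y. wt \<delta> S n y * (norm (Ex (\<lambda>v. G v * complex_of_real (apex \<gamma> n v y))))\<^sup>2) b \<le> 20 * 5 ^ n / q ^ s"
proof -
  let ?L = "AE n (\<lambda>y. wt \<delta> S n y * (norm (Ex (\<lambda>v. G v * complex_of_real (apex \<gamma> n v y))))\<^sup>2) b"
  let ?Q = "\<lambda>v v'. AE n (\<lambda>y. wt \<delta> S n y * (apex \<gamma> n v y * apex \<gamma> n v' y)) b"
  let ?A = "4 * 5 ^ n / q ^ s" and ?C = "2 * 5 ^ n * q ^ (2 * n)"
  let ?i1 = "\<lambda>v. if v \<in> Span S b then 1 else (0::real)"
  let ?i2 = "\<lambda>v v'. if v' \<in> Span (insert p S) (b(p := v)) then 1 else (0::real)"
  have w0: "0 \<le> w v" if "v \<in> V" for v using w(1)[OF that] norm_ge_zero[of "G v"] by linarith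
  have Q: "\<bar>?Q v v'\<bar> \<le> ?A + ?C * (?i1 v + ?i2 v v')" if v: "v \<in> V" "v' \<in> V" for v v'
  proof (cases "v \<in> Span S b \<or> v' \<in> Span (insert p S) (b(p := v))")
    case True
    have "\<bar>?Q v v'\<bar> \<le> ?C * 1"
      using apex_pair_crude[OF N \<delta>(1) S b R1, where s = s and \<gamma> = \<gamma> and v = v and v' = v'] c by simp
    also have "\<dots> \<le> ?C * (?i1 v + ?i2 v v')" using True by (intro mult_left_mono) auto
    finally show ?thesis using q_pos by (simp add: add_increasing)
  next
    case False
    thus ?thesis using apex_pair[OF N \<delta> S b R1 c(1,2) p v] by simp
  qed
  have "complex_of_real ?L = AE n (\<lambda>y. Ex (\<lambda>v. Ex (\<lambda>v'. G v * cnj (G v') * of_real (wt \<delta> S n y * (apex \<gamma> n v y * apex \<gamma> n v' y))))) b"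
    unfolding AE_of_real[symmetric]
  proof (rule AE_cong)
    fix y
    have "complex_of_real (wt \<delta> S n y * (norm (Ex (\<lambda>v. G v * complex_of_real (apex \<gamma> n v y))))\<^sup>2)
      = of_real (wt \<delta> S n y) * Ex (\<lambda>v. Ex (\<lambda>v'. (G v * complex_of_real (apex \<gamma> n v y)) * cnj (G v' * complex_of_real (apex \<gamma> n v' y))))"
      unfolding of_real_mult Ex_norm_square ..
    also have "\<dots> = Ex (\<lambda>v. Ex (\<lambda>v'. G v * cnj (G v') * of_real (wt \<delta> S n y * (apex \<gamma> n v y * apex \<gamma> n v' y))))"
      unfolding Ex_cmult[symmetric] by (intro Ex_cong) (simp add: mult_ac)
    finally show "complex_of_real (wt \<delta> S n y * (norm (Ex (\<lambda>v. G v * complex_of_real (apex \<gamma> n v y))))\<^sup>2) = \<dots>" .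
  qed
  also have "\<dots> = Ex (\<lambda>v. Ex (\<lambda>v'. G v * cnj (G v') * of_real (?Q v v')))"
    by (simp only: AE_Ex AE_cmult AE_of_real)
  finally have "norm (complex_of_real ?L) = norm (Ex (\<lambda>v. Ex (\<lambda>v'. G v * cnj (G v') * of_real (?Q v v'))))"
    by (rule arg_cong)
  hence "?L \<le> norm (Ex (\<lambda>v. Ex (\<lambda>v'. G v * cnj (G v') * of_real (?Q v v'))))"
    unfolding norm_of_real by linarith
  also have "\<dots> \<le> Ex (\<lambda>v. norm (Ex (\<lambda>v'. G v * cnj (G v') * of_real (?Q v v'))))" by (rule Ex_norm)
  also have "\<dots> \<le> Ex (\<lambda>v. Ex (\<lambda>v'. norm (G v * cnj (G v') * of_real (?Q v v'))))"
    by (rule Ex_mono) (rule Ex_norm)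
  also have "\<dots> \<le> Ex (\<lambda>v. Ex (\<lambda>v'. w v * w v' * ?A + (q * q * ?C) * ?i1 v + (q * q * ?C) * ?i2 v v'))"
  proof (intro Ex_mono)
    fix v v' assume v: "v \<in> V" "v' \<in> V"
    have "norm (G v * cnj (G v') * of_real (?Q v v')) = norm (G v) * norm (G v') * \<bar>?Q v v'\<bar>"
      by (simp only: norm_mult complex_mod_cnj norm_of_real)
    also have "\<dots> \<le> w v * w v' * (?A + ?C * (?i1 v + ?i2 v v'))"
      by (intro mult_mono Q w v mult_nonneg_nonneg w0) auto
    also have "\<dots> = w v * w v' * ?A + w v * w v' * (?C * (?i1 v + ?i2 v v'))" by (rule distrib_left)
    also have "\<dots> \<le> w v * w v' * ?A + q * q * (?C * (?i1 v + ?i2 v v'))"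
      by (intro add_left_mono mult_right_mono mult_mono w v w0) auto
    finally show "norm (G v * cnj (G v') * of_real (?Q v v')) \<le> w v * w v' * ?A + (q * q * ?C) * ?i1 v + (q * q * ?C) * ?i2 v v'"
      by (simp only: distrib_left mult.assoc add.assoc)
  qed
  also have "\<dots> = Ex w * Ex w * ?A + (q * q * ?C) * Ex ?i1 + (q * q * ?C) * Ex (\<lambda>v. Ex (?i2 v))"
    by (simp only: Ex_add Ex_cmult Ex_const)
  also have "\<dots> \<le> 2 * 2 * ?A + (q * q * ?C) * (q ^ card S / N) + (q * q * ?C) * (q ^ (card S + 1) / N)"
  proof (intro add_mono mult_mono mult_left_mono w)
    have "Ex ?i1 \<le> card (Span S b) / N" by (rule Ex_indicator_le[OF finite_Span[OF S(1)]])
    also have "\<dots> \<le> q ^ card S / N" by (intro divide_right_mono card_Span S) simp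
    finally show "Ex ?i1 \<le> q ^ card S / N" .
    have "Ex (\<lambda>v. Ex (?i2 v)) \<le> Ex (\<lambda>v. q ^ (card S + 1) / N)"
    proof (rule Ex_mono)
      fix v
      have "Ex (?i2 v) \<le> card (Span (insert p S) (b(p := v))) / N"
        by (rule Ex_indicator_le[OF finite_Span]) (use S in auto)
      also have "\<dots> \<le> q ^ card (insert p S) / N" by (intro divide_right_mono card_Span) (use S in auto)
      finally show "Ex (?i2 v) \<le> q ^ (card S + 1) / N" using p S by simp
    qed
    thus "Ex (\<lambda>v. Ex (?i2 v)) \<le> q ^ (card S + 1) / N" by simp
  qed (auto intro!: Ex_nonneg intro: w0)
  also have "(q * q * ?C) * (q ^ card S / N) \<le> (q * q * ?C) * (q ^ (card S + 1) / N)"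
    using q_ge_1 by (intro mult_left_mono divide_right_mono power_increasing) auto
  also have "(q * q * ?C) * (q ^ (card S + 1) / N) = 2 * 5 ^ n * (q ^ (3 + card S + 2 * n) / N)"
    by (simp add: power_add power3_eq_cube)
  also have "\<dots> \<le> 2 * 5 ^ n * (1 / q ^ s)"
    by (intro mult_left_mono q_power_div_N[OF N c(3)]) simp
  finally show ?thesis by simp
qed

lemma Rel_empty [simp]: "card (Rel {} b) = 1"
proof -
  have "Rel {} b = {\<lambda>_. undefined}" by (auto simp: Rel_def lc_def)
  thus ?thesis by simp
qed

text \<open>Telescoping over the vertices of the configuration.\<close>

lemma discrepancy:
  assumes N: "q ^ (2 * h) \<le> N" and \<delta>: "\<And>i j. \<delta> i j \<in> K"
    and g: "\<And>j v. v \<in> V \<Longrightarrow> norm (g j v :: complex) \<le> 1" and c: "n + s \<le> h" "1 \<le> s"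
  shows "norm (AE n (\<lambda>y. of_real (wt \<delta> {} n y) * (\<Prod>j<n. g j (y j))) b - AE n (\<lambda>y. \<Prod>j<n. g j (y j)) b)
    \<le> n * (7 * 5 ^ n * sqrt (1 / q ^ s))"
  using c(1)
proof (induction n)
  case (Suc n)
  let ?w = "wt \<delta> {} n" and ?g = "\<lambda>y. \<Prod>j<n. g j (y j)"
  let ?K = "\<lambda>y. Ex (\<lambda>v. g n v * complex_of_real (apex (\<lambda>j. \<delta> j n) n v y))"
  have gn: "norm (?g y) \<le> 1" if "\<And>i. i < n \<Longrightarrow> y i \<in> V" for y
    unfolding prod_norm[symmetric] by (rule prod_le_1) (use that g in auto)
  \<comment> \<open>The distance conditions of the new vertex are split into their mean 1, which
    leads back to the induction hypothesis, and their balanced part \<open>apex\<close>, which is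
    handled by Cauchy-Schwarz.\<close>
  have 1: "AE (Suc n) (\<lambda>y. of_real (wt \<delta> {} (Suc n) y) * (\<Prod>j<Suc n. g j (y j))) b
    = AE n (\<lambda>y. of_real (?w y) * ?g y * ?K y + of_real (?w y) * ?g y * Ex (g n)) b"
    unfolding AE_Suc
  proof (rule AE_cong)
    fix y assume y: "\<And>i. i < n \<Longrightarrow> y i \<in> V"
    have "Ex (\<lambda>v. of_real (wt \<delta> {} (Suc n) (y(n := v))) * (\<Prod>j<Suc n. g j ((y(n := v)) j)))
      = Ex (\<lambda>v. of_real (?w y) * ?g y * (g n v * of_real (apex (\<lambda>j. \<delta> j n) n v y) + g n v))"
    proof (rule Ex_cong)
      fix v assume v: "v \<in> V"
      have "(\<Prod>i<n. Dd (\<delta> i n) (y i) v) = (\<Prod>i<n. Dd (\<delta> i n) v (y i))"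
        by (rule prod.cong[OF refl Dd_comm]) (use y v in auto)
      hence "wt \<delta> {} (Suc n) (y(n := v)) = ?w y * (apex (\<lambda>j. \<delta> j n) n v y + 1)"
        by (subst wt_Suc) (auto simp: apex_def)
      moreover have "(\<Prod>j<Suc n. g j ((y(n := v)) j)) = ?g y * g n v" by simp
      ultimately show "of_real (wt \<delta> {} (Suc n) (y(n := v))) * (\<Prod>j<Suc n. g j ((y(n := v)) j))
        = of_real (?w y) * ?g y * (g n v * of_real (apex (\<lambda>j. \<delta> j n) n v y) + g n v)"
        by (simp add: algebra_simps)
    qed
    also have "\<dots> = of_real (?w y) * ?g y * ?K y + of_real (?w y) * ?g y * Ex (g n)"
      by (simp only: Ex_cmult Ex_add distrib_left)
    finally show "Ex (\<lambda>v. of_real (wt \<delta> {} (Suc n) (y(n := v))) * (\<Prod>j<Suc n. g j ((y(n := v)) j))) = \<dots>" .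
  qed
  have 2: "AE (Suc n) (\<lambda>y. \<Prod>j<Suc n. g j (y j)) b = AE n (\<lambda>y. ?g y * Ex (g n)) b"
    unfolding AE_Suc
  proof (rule AE_cong)
    fix y
    have "Ex (\<lambda>v. \<Prod>j<Suc n. g j ((y(n := v)) j)) = Ex (\<lambda>v. ?g y * g n v)"
      by (rule Ex_cong) simp
    thus "Ex (\<lambda>v. \<Prod>j<Suc n. g j ((y(n := v)) j)) = ?g y * Ex (g n)" by (simp only: Ex_cmult)
  qed
  have E: "AE (Suc n) (\<lambda>y. of_real (wt \<delta> {} (Suc n) y) * (\<Prod>j<Suc n. g j (y j))) b - AE (Suc n) (\<lambda>y. \<Prod>j<Suc n. g j (y j)) b
    = AE n (\<lambda>y. of_real (?w y) * ?g y * ?K y) b + (AE n (\<lambda>y. of_real (?w y) * ?g y) b - AE n ?g b) * Ex (g n)"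
    unfolding 1 2 AE_add by (simp only: AE_cmult left_diff_distrib) simp
  have "norm (AE (Suc n) (\<lambda>y. of_real (wt \<delta> {} (Suc n) y) * (\<Prod>j<Suc n. g j (y j))) b - AE (Suc n) (\<lambda>y. \<Prod>j<Suc n. g j (y j)) b)
     \<le> norm (AE n (\<lambda>y. of_real (?w y) * ?g y * ?K y) b)
      + norm (AE n (\<lambda>y. of_real (?w y) * ?g y) b - AE n ?g b) * norm (Ex (g n))"
    unfolding E norm_mult[symmetric] by (rule norm_triangle_ineq)
  also have "\<dots> \<le> 7 * 5 ^ n * sqrt (1 / q ^ s) + n * (7 * 5 ^ n * sqrt (1 / q ^ s)) * 1"
  proof (rule add_mono, goal_cases)
    case 1
    have "norm (AE n (\<lambda>y. of_real (?w y) * ?g y * ?K y) b) \<le> AE n (\<lambda>y. norm (of_real (?w y) * ?g y * ?K y)) b"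
      by (rule AE_norm)
    also have "\<dots> \<le> AE n (\<lambda>y. ?w y * norm (?K y)) b"
    proof (rule AE_mono)
      fix y assume y: "\<And>i. i < n \<Longrightarrow> y i \<in> V"
      have "norm (of_real (?w y) * ?g y * ?K y) = ?w y * norm (?K y) * norm (?g y)"
        by (simp add: norm_mult)
      also have "\<dots> \<le> ?w y * norm (?K y) * 1" by (intro mult_left_mono gn y) auto
      finally show "norm (of_real (?w y) * ?g y * ?K y) \<le> ?w y * norm (?K y)" by simp
    qed
    finally have a: "norm (AE n (\<lambda>y. of_real (?w y) * ?g y * ?K y) b) \<le> AE n (\<lambda>y. ?w y * norm (?K y)) b" .
    have "(AE n (\<lambda>y. ?w y * norm (?K y)) b)\<^sup>2 \<le> AE n ?w b * AE n (\<lambda>y. ?w y * (norm (?K y))\<^sup>2) b"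
      by (rule AE_CS) simp
    also have "\<dots> \<le> (2 * 5 ^ n) * (20 * 5 ^ n / q ^ s)"
    proof (rule mult_mono)
      have "AE n ?w b \<le> 1 + 5 ^ n / q ^ s"
        by (rule wt_mean_le[OF N \<delta>]) (use Suc.prems in auto)
      also have "\<dots> = 1 + 5 ^ n * (1 / q ^ s)" by simp
      also have "\<dots> \<le> 1 + 5 ^ n * 1" by (intro add_left_mono mult_left_mono inv_q_le_1) simp
      also have "\<dots> \<le> 2 * 5 ^ n" by simp
      finally show "AE n ?w b \<le> 2 * 5 ^ n" .
      show "AE n (\<lambda>y. ?w y * (norm (?K y))\<^sup>2) b \<le> 20 * 5 ^ n / q ^ s"
        by (rule apex_mean_square[OF N \<delta>, where p = n and p' = "Suc n" and w = "\<lambda>_. 1"])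
           (use Suc.prems c g \<delta> q_ge_1 in auto)
    qed (auto intro: AE_nonneg)
    also have "\<dots> = 40 * (5 ^ n)\<^sup>2 * (1 / q ^ s)" by (simp add: power2_eq_square)
    \<comment> \<open>40 is rounded up to the square of 7, the constant of the statement.\<close>
    also have "\<dots> \<le> 49 * (5 ^ n)\<^sup>2 * (1 / q ^ s)" by (intro mult_right_mono) auto
    also have "\<dots> = (7 * 5 ^ n * sqrt (1 / q ^ s))\<^sup>2" by (simp add: power_mult_distrib)
    finally have "AE n (\<lambda>y. ?w y * norm (?K y)) b \<le> 7 * 5 ^ n * sqrt (1 / q ^ s)"
      by (rule power2_le_imp_le) simp
    thus ?case using a by linarith
  next
    case 2
    have I:  "norm (AE n (\<lambda>y. of_real (?w y) * ?g y) b - AE n ?g b) \<le> n * (7 * 5 ^ n * sqrt (1 / q ^ s))"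
      by (rule Suc.IH) (use Suc.prems in auto)
    have "norm (Ex (g n)) \<le> Ex (\<lambda>v. norm (g n v))" by (rule Ex_norm)
    also have "\<dots> \<le> Ex (\<lambda>_. 1)" by (rule Ex_mono) (rule g)
    finally have J: "norm (Ex (g n)) \<le> 1" by simp
    show ?case by (rule mult_mono[OF I J]) auto
  qed
  also have "\<dots> = Suc n * (7 * 5 ^ n * sqrt (1 / q ^ s))" by (simp add: algebra_simps)
  also have "\<dots> \<le> Suc n * (7 * 5 ^ Suc n * sqrt (1 / q ^ s))"
    by (intro mult_left_mono mult_right_mono) auto
  finally show ?case .
qed simp

section \<open>Barycentres\<close>

lemma sum_sd_expand: assumes "finite I" "t \<in> I \<rightarrow> K" "y \<in> I \<rightarrow> V" "p \<in> V"
  shows "finsum R (\<lambda>i. t i \<otimes> sd (y i) p) I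
    = finsum R (\<lambda>i. t i \<otimes> sq (y i)) I \<ominus> (\<one> \<oplus> \<one>) \<otimes> B (lc I t y) p \<oplus> finsum R t I \<otimes> sq p"
  using assms
proof (induction I rule: finite_induct)
  case empty
  have 1: "finsum R f {} = \<zero>" for f :: "'x \<Rightarrow> 'a" by simp
  have 2: "B (lc {} t y) p = \<zero>" using empty by (simp add: lc_def)
  show ?case unfolding 1 2 using sq_closed[OF empty(3)] by algebra
next
  case (insert n I)
  hence m: "t n \<in> K" "t \<in> I \<rightarrow> K" "y n \<in> V" "y \<in> I \<rightarrow> V" by auto
  define a where "a = finsum R (\<lambda>i. t i \<otimes> sq (y i)) I"
  define b where "b = B (lc I t y) p"
  define c where "c = finsum R t I"
  have cl: "a \<in> K" "b \<in> K" "c \<in> K"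
    using m insert by (auto simp: a_def b_def c_def Pi_iff intro!: R.finsum_closed)
  have 1: "finsum R (\<lambda>i. t i \<otimes> sd (y i) p) (insert n I) = t n \<otimes> sd (y n) p \<oplus> finsum R (\<lambda>i. t i \<otimes> sd (y i) p) I"
    by (rule R.finsum_insert) (use insert m in \<open>auto simp: Pi_iff\<close>)
  have 2: "finsum R (\<lambda>i. t i \<otimes> sq (y i)) (insert n I) = t n \<otimes> sq (y n) \<oplus> a"
    unfolding a_def by (rule R.finsum_insert) (use insert m in \<open>auto simp: Pi_iff\<close>)
  have 3: "finsum R t (insert n I) = t n \<oplus> c"
    unfolding c_def by (rule R.finsum_insert) (use insert m in auto)
  have 4: "B (lc (insert n I) t y) p = t n \<otimes> B (y n) p \<oplus> b"
    using insert m by (simp add: lc_insert B_add B_smult b_def)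
  have IH: "finsum R (\<lambda>i. t i \<otimes> sd (y i) p) I = a \<ominus> (\<one> \<oplus> \<one>) \<otimes> b \<oplus> c \<otimes> sq p"
    unfolding a_def b_def c_def using insert m by auto
  show ?case unfolding 1 2 3 4 IH sd_expand[OF m(3) insert.prems(3)]
    using m(1) cl sq_closed[OF m(3)] sq_closed[OF insert.prems(3)] B_closed[OF m(3) insert.prems(3)]
    by algebra
qed

text \<open>The moment of inertia about the barycentre: mean of the squares minus square of the
  mean, for weights with sum one.\<close>

definition gap where "gap I t y = finsum R (\<lambda>i. t i \<otimes> sq (y i)) I \<ominus> sq (lc I t y)"

lemma gap_closed [intro]: "t \<in> I \<rightarrow> K \<Longrightarrow> y \<in> I \<rightarrow> V \<Longrightarrow> gap I t y \<in> K"
  unfolding gap_def by (intro R.minus_closed R.finsum_closed sq_closed lc_closed) (auto simp: Pi_iff)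

text \<open>The parallel axis theorem.\<close>

lemma sd_lc: assumes I: "finite I" "t \<in> I \<rightarrow> K" "y \<in> I \<rightarrow> V" "p \<in> V" and t1: "finsum R t I = \<one>"
  shows "sd (lc I t y) p = finsum R (\<lambda>i. t i \<otimes> sd (y i) p) I \<ominus> gap I t y"
proof -
  define a where "a = finsum R (\<lambda>i. t i \<otimes> sq (y i)) I"
  have u: "lc I t y \<in> V" using I by auto
  have a: "a \<in> K" unfolding a_def using I by (intro R.finsum_closed) (auto simp: Pi_iff)
  show ?thesis
    unfolding sum_sd_expand[OF I] t1 gap_def a_def[symmetric] sd_expand[OF u I(4)]
    using a sq_closed[OF u] sq_closed[OF I(4)] B_closed[OF u I(4)] by algebra
qed

lemma double_cancel: assumes "a \<in> K" "b \<in> K" "a \<oplus> a = b \<oplus> b" shows "a = b"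
proof -
  have "(\<one> \<oplus> \<one>) \<otimes> (a \<ominus> b) = (a \<oplus> a) \<ominus> (b \<oplus> b)" using assms(1,2) by algebra
  also have "\<dots> = \<zero>" using assms by (simp add: a_minus_def R.r_neg)
  finally have "a \<ominus> b = \<zero>" using two_nonzero assms integral[of "\<one> \<oplus> \<one>" "a \<ominus> b"] by auto
  thus ?thesis using assms by simp
qed

text \<open>Leibniz' identity for weighted barycentres: twice the gap is
  \<open>\<Sum>i j. t i * t j * sd (y i) (y j)\<close>, so that it only depends on the mutual distances.\<close>

lemma gap_double: assumes I: "finite I" "t \<in> I \<rightarrow> K" "y \<in> I \<rightarrow> V" and t1: "finsum R t I = \<one>"
  shows "gap I t y \<oplus> gap I t y = finsum R (\<lambda>j. t j \<otimes> finsum R (\<lambda>i. t i \<otimes> sd (y i) (y j)) I) I"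
proof -
  let ?u = "lc I t y" and ?g = "gap I t y"
  let ?S = "\<lambda>j. finsum R (\<lambda>i. t i \<otimes> sd (y i) (y j)) I"
  define a where "a = finsum R (\<lambda>i. t i \<otimes> sq (y i)) I"
  have u: "?u \<in> V" and g: "?g \<in> K" using I by auto
  have a: "a \<in> K" unfolding a_def using I by (intro R.finsum_closed) (auto simp: Pi_iff)
  have S: "?S j \<in> K" if "j \<in> I" for j using I that by (intro R.finsum_closed) (auto simp: Pi_iff)
  have 1: "finsum R (\<lambda>j. t j \<otimes> sd (y j) ?u) I = ?g"
    unfolding sum_sd_expand[OF I u] t1 gap_def a_def[symmetric] sq_def[of ?u]
    using a B_closed[OF u u] by algebra
  have "finsum R (\<lambda>j. t j \<otimes> sd (y j) ?u) I = finsum R (\<lambda>j. t j \<otimes> ?S j \<ominus> t j \<otimes> ?g) I"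
  proof (rule R.finsum_cong')
    show "(\<lambda>j. t j \<otimes> ?S j \<ominus> t j \<otimes> ?g) \<in> I \<rightarrow> K" using S g I by (auto simp: Pi_iff)
    fix j assume j: "j \<in> I"
    have m: "t j \<in> K" "y j \<in> V" using I j by auto
    have "sd (y j) ?u = ?S j \<ominus> ?g" using sd_lc[OF I m(2) t1] sd_comm[OF m(2) u] by simp
    thus "t j \<otimes> sd (y j) ?u = t j \<otimes> ?S j \<ominus> t j \<otimes> ?g"
      using m(1) S[OF j] g by (simp add: a_minus_def r_distr r_minus)
  qed simp
  also have "\<dots> = finsum R (\<lambda>j. t j \<otimes> ?S j) I \<ominus> finsum R (\<lambda>j. t j \<otimes> ?g) I"
    by (rule finsum_diff) (use S g I in \<open>auto simp: Pi_iff\<close>)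
  also have "finsum R (\<lambda>j. t j \<otimes> ?g) I = ?g"
    using finsum_ldistr[OF I(1) g I(2)] t1 g by simp
  finally have 2: "?g = finsum R (\<lambda>j. t j \<otimes> ?S j) I \<ominus> ?g" unfolding 1 .
  have SS: "finsum R (\<lambda>j. t j \<otimes> ?S j) I \<in> K" using S I by (intro R.finsum_closed) (auto simp: Pi_iff)
  have "(w \<ominus> z) \<oplus> z = w" if "w \<in> K" "z \<in> K" for w z using that by algebra
  from this[OF SS g] show ?thesis unfolding 2[symmetric] .
qed

lemma gap_eq: assumes I: "finite I" "t \<in> I \<rightarrow> K" "y \<in> I \<rightarrow> V" "x \<in> I \<rightarrow> V" and t1: "finsum R t I = \<one>"
    and d: "\<And>i j. i \<in> I \<Longrightarrow> j \<in> I \<Longrightarrow> sd (y i) (y j) = sd (x i) (x j)"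
  shows "gap I t y = gap I t x"
proof (rule double_cancel)
  have c: "finsum R (\<lambda>i. t i \<otimes> sd (y i) (y j)) I = finsum R (\<lambda>i. t i \<otimes> sd (x i) (x j)) I" if "j \<in> I" for j
    by (rule R.finsum_cong') (use I d that in \<open>auto simp: Pi_iff\<close>)
  have "finsum R (\<lambda>j. t j \<otimes> finsum R (\<lambda>i. t i \<otimes> sd (y i) (y j)) I) I = finsum R (\<lambda>j. t j \<otimes> finsum R (\<lambda>i. t i \<otimes> sd (x i) (x j)) I) I"
  proof (rule R.finsum_cong')
    show "(\<lambda>j. t j \<otimes> finsum R (\<lambda>i. t i \<otimes> sd (x i) (x j)) I) \<in> I \<rightarrow> K"
    proof (rule Pi_I)
      fix j assume "j \<in> I"
      hence "finsum R (\<lambda>i. t i \<otimes> sd (x i) (x j)) I \<in> K" "t j \<in> K"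
        using I by (auto simp: Pi_iff intro!: R.finsum_closed)
      thus "t j \<otimes> finsum R (\<lambda>i. t i \<otimes> sd (x i) (x j)) I \<in> K" by simp
    qed
  qed (use c in auto)
  thus "gap I t y \<oplus> gap I t y = gap I t x \<oplus> gap I t x" using I t1 by (simp add: gap_double)
qed (use I in auto)

text \<open>By the parallel axis theorem, as the gap is determined by distances. Hence it suffices
  to prescribe the distances among affinely independent points: the extra point of a copy follows
  along.\<close>

lemma sd_lc_eq: assumes I: "finite I" "t \<in> I \<rightarrow> K" "y \<in> I \<rightarrow> V" "x \<in> I \<rightarrow> V" and t1: "finsum R t I = \<one>"
    and d: "\<And>i j. i \<in> I \<Longrightarrow> j \<in> I \<Longrightarrow> sd (y i) (y j) = sd (x i) (x j)" and j: "j \<in> I"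
  shows "sd (lc I t y) (y j) = sd (lc I t x) (x j)"
proof -
  have "finsum R (\<lambda>i. t i \<otimes> sd (y i) (y j)) I = finsum R (\<lambda>i. t i \<otimes> sd (x i) (x j)) I"
    by (rule R.finsum_cong') (use I d j in \<open>auto simp: Pi_iff\<close>)
  thus ?thesis using sd_lc[OF I(1,2,3) _ t1, of "y j"] sd_lc[OF I(1,2,4) _ t1, of "x j"] gap_eq[OF I t1 d] I j
    by (auto simp: Pi_iff)
qed

end

text \<open>The configuration consists of \<open>x 0, \<dots>, x m\<close>, a further vertex \<open>x (Suc m)\<close> and the point
  \<open>bar (x (Suc m)) (centre x)\<close> on the line through \<open>x (Suc m)\<close> and the barycentre of the first
  \<open>Suc m\<close> points; \<open>quad x (x (Suc m)) = \<zero>\<close> expresses that it is spherical.\<close>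

locale configuration = bilin_space +
  fixes m :: nat and lam :: "nat \<Rightarrow> 'a" and s :: 'a and x :: "nat \<Rightarrow> 'c"
  assumes lam: "lam \<in> {..m} \<rightarrow> carrier R" and lam_sum: "finsum R lam {..m} = \<one>"
    and lam_m: "lam m \<noteq> \<zero>"
    and s: "s \<in> carrier R" "s \<noteq> \<zero>" "s \<noteq> \<one>"
    and x: "x \<in> {..Suc m} \<rightarrow> carrier M"
    and spherical: "(\<one> \<ominus> s) \<otimes> finsum R (\<lambda>j. lam j \<otimes> B (x j) (x j)) {..m} \<oplus> s \<otimes> B (x (Suc m)) (x (Suc m))
      = B (s \<odot>\<^bsub>M\<^esub> x (Suc m) \<oplus>\<^bsub>M\<^esub> (\<one> \<ominus> s) \<odot>\<^bsub>M\<^esub> finsum M (\<lambda>j. lam j \<odot>\<^bsub>M\<^esub> x j) {..m})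
          (s \<odot>\<^bsub>M\<^esub> x (Suc m) \<oplus>\<^bsub>M\<^esub> (\<one> \<ominus> s) \<odot>\<^bsub>M\<^esub> finsum M (\<lambda>j. lam j \<odot>\<^bsub>M\<^esub> x j) {..m})"
begin

definition A where "A = \<one> \<ominus> s"
definition centre where "centre y = lc {..m} lam y"
definition bar where "bar v u = s \<odot>\<^bsub>M\<^esub> v \<oplus>\<^bsub>M\<^esub> A \<odot>\<^bsub>M\<^esub> u"
definition quad where "quad y v = A \<otimes> finsum R (\<lambda>j. lam j \<otimes> sq (y j)) {..m} \<oplus> s \<otimes> sq v \<ominus> sq (bar v (centre y))"
definition del where "del i j = (if i \<le> Suc m \<and> j \<le> Suc m then sd (x i) (x j) else \<zero>)"

lemma A: "A \<in> K" "A \<noteq> \<zero>" "s \<oplus> A = \<one>"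
proof -
  show "A \<in> K" using s by (simp add: A_def)
  show "A \<noteq> \<zero>" using s by (auto simp: A_def)
  have "s \<oplus> (\<one> \<ominus> s) = \<one>" using s(1) by algebra
  thus "s \<oplus> A = \<one>" by (simp add: A_def)
qed

lemma xV: "j \<le> Suc m \<Longrightarrow> x j \<in> V" using x by auto

lemma xV': "x \<in> {..m} \<rightarrow> V" using x by auto

lemma del_K: "del i j \<in> K" by (simp add: del_def xV)

lemma centre_V [intro]: "y \<in> {..m} \<rightarrow> V \<Longrightarrow> centre y \<in> V"
  unfolding centre_def using lam by (intro lc_closed)

lemma bar_V [intro]: "v \<in> V \<Longrightarrow> u \<in> V \<Longrightarrow> bar v u \<in> V"
  unfolding bar_def using s A by simp

text \<open>Moments of inertia add up: that of the first points with weight \<open>A\<close>, and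
  that of the two-point system formed by v and their centre. Hence v enters only through its
  distance from the centre.\<close>

lemma quad_eq: assumes y: "y \<in> {..m} \<rightarrow> V" and v: "v \<in> V"
  shows "quad y v = A \<otimes> gap {..m} lam y \<oplus> s \<otimes> A \<otimes> sd v (centre y)"
proof -
  let ?u = "centre y"
  define a where "a = finsum R (\<lambda>j. lam j \<otimes> sq (y j)) {..m}"
  have u: "?u \<in> V" using y by auto
  have a: "a \<in> K" unfolding a_def using lam y by (intro R.finsum_closed) (auto simp: Pi_iff)
  have 1: "sq (bar v ?u) = s \<otimes> s \<otimes> sq v \<oplus> (\<one> \<oplus> \<one>) \<otimes> (s \<otimes> (A \<otimes> B v ?u)) \<oplus> A \<otimes> A \<otimes> sq ?u"
    unfolding bar_def using s A u v by (subst sq_add) (auto simp: sq_smult B_smult B_smult2 m_lcomm)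
  have gen: "A \<otimes> a \<oplus> s \<otimes> p \<ominus> (s \<otimes> s \<otimes> p \<oplus> (\<one> \<oplus> \<one>) \<otimes> (s \<otimes> (A \<otimes> r)) \<oplus> A \<otimes> A \<otimes> w)
     = A \<otimes> (a \<ominus> w) \<oplus> s \<otimes> A \<otimes> (p \<ominus> (\<one> \<oplus> \<one>) \<otimes> r \<oplus> w)" if "p \<in> K" "r \<in> K" "w \<in> K" for p r w
  proof -
    have E1: "s \<otimes> p = s \<otimes> s \<otimes> p \<oplus> s \<otimes> A \<otimes> p"
    proof -
      have "s \<otimes> p = s \<otimes> (s \<oplus> A) \<otimes> p" unfolding A(3) using s(1) that by simp
      thus ?thesis using s(1) A(1) that by (simp add: r_distr l_distr)
    qed
    have E2: "A \<otimes> w = s \<otimes> A \<otimes> w \<oplus> A \<otimes> A \<otimes> w"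
    proof -
      have "A \<otimes> w = (s \<oplus> A) \<otimes> A \<otimes> w" unfolding A(3) using A(1) that by simp
      thus ?thesis using s(1) A(1) that by (simp add: l_distr)
    qed
    have lin: "c \<oplus> (x1 \<oplus> y1) \<ominus> (x1 \<oplus> z1 \<oplus> w2) = (c \<ominus> (w1 \<oplus> w2)) \<oplus> (y1 \<ominus> z1 \<oplus> w1)"
      if "c \<in> K" "x1 \<in> K" "y1 \<in> K" "z1 \<in> K" "w1 \<in> K" "w2 \<in> K" for c x1 y1 z1 w1 w2
      using that by algebra
    have "A \<otimes> (a \<ominus> w) = A \<otimes> a \<ominus> A \<otimes> w" using A(1) a that by (simp add: a_minus_def r_distr r_minus)
    moreover have "s \<otimes> A \<otimes> (p \<ominus> (\<one> \<oplus> \<one>) \<otimes> r \<oplus> w) = s \<otimes> A \<otimes> p \<ominus> (\<one> \<oplus> \<one>) \<otimes> (s \<otimes> (A \<otimes> r)) \<oplus> s \<otimes> A \<otimes> w"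
      using s(1) A(1) that by (simp add: a_minus_def r_distr r_minus m_assoc m_lcomm)
    ultimately show ?thesis unfolding E1 E2
      using lin[of "A \<otimes> a" "s \<otimes> s \<otimes> p" "s \<otimes> A \<otimes> p" "(\<one> \<oplus> \<one>) \<otimes> (s \<otimes> (A \<otimes> r))" "s \<otimes> A \<otimes> w" "A \<otimes> A \<otimes> w"]
        s(1) A(1) a that by simp
  qed
  show ?thesis
    unfolding quad_def 1 gap_def sd_expand[OF v u] a_def[symmetric] centre_def[symmetric]
    by (rule gen) (use u v in auto)
qed

lemma quad_x: "quad x (x (Suc m)) = \<zero>"
proof -
  have "A \<otimes> finsum R (\<lambda>j. lam j \<otimes> sq (x j)) {..m} \<oplus> s \<otimes> sq (x (Suc m)) = sq (bar (x (Suc m)) (centre x))"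
    using spherical unfolding A_def sq_def bar_def centre_def lc_def .
  moreover have "sq (bar (x (Suc m)) (centre x)) \<in> K"
    by (intro sq_closed bar_V centre_V xV xV') simp
  ultimately show ?thesis by (simp add: quad_def a_minus_def R.r_neg)
qed

definition d0 where "d0 = sd (x (Suc m)) (centre x)"

lemma d0_K: "d0 \<in> K" unfolding d0_def by (intro sd_closed centre_V xV xV') simp

text \<open>The gap is the same for y and x, and the quadratic form of x vanishes, so only the
  difference of the two distances remains, with the factor s * A. This is why s must differ from 0
  and 1.\<close>

lemma quad_zero_iff: assumes y: "y \<in> {..m} \<rightarrow> V" and v: "v \<in> V"
    and d: "\<And>i j. i \<le> m \<Longrightarrow> j \<le> m \<Longrightarrow> sd (y i) (y j) = sd (x i) (x j)"
  shows "quad y v = \<zero> \<longleftrightarrow> sd v (centre y) = d0"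
proof -
  have g: "gap {..m} lam y = gap {..m} lam x"
    by (rule gap_eq) (use lam y xV' lam_sum d in auto)
  have gK: "gap {..m} lam x \<in> K" using lam xV' by auto
  have xx: "A \<otimes> gap {..m} lam x \<oplus> s \<otimes> A \<otimes> d0 = \<zero>"
    using quad_eq[OF xV' xV[of "Suc m"]] quad_x by (simp add: d0_def)
  have yK: "sd v (centre y) \<in> K" using y v by auto
  have sA: "s \<otimes> A \<in> K" "s \<otimes> A \<noteq> \<zero>" using s A integral by auto
  have "quad y v = (A \<otimes> gap {..m} lam x \<oplus> s \<otimes> A \<otimes> d0) \<oplus> s \<otimes> A \<otimes> (sd v (centre y) \<ominus> d0)"
    unfolding quad_eq[OF y v] g using gK A(1) s(1) yK d0_K by algebra
  also have "\<dots> = s \<otimes> A \<otimes> (sd v (centre y) \<ominus> d0)" unfolding xx using sA yK d0_K by simp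
  finally have "quad y v = \<zero> \<longleftrightarrow> sd v (centre y) \<ominus> d0 = \<zero>"
    using sA yK d0_K integral_iff[of "s \<otimes> A" "sd v (centre y) \<ominus> d0"] by simp
  also have "\<dots> \<longleftrightarrow> sd v (centre y) = d0" using yK d0_K by simp
  finally show ?thesis .
qed

text \<open>The distance from v to the centre is a combination of the distances to the vertices, and
  \<open>lam m\<close> is nonzero, so the last of them can be solved for. The quadratic condition
  thus replaces one distance condition.\<close>

lemma last_distance: assumes y: "y \<in> {..m} \<rightarrow> V" and v: "v \<in> V"
    and d: "\<And>i j. i \<le> m \<Longrightarrow> j \<le> m \<Longrightarrow> sd (y i) (y j) = sd (x i) (x j)"
    and qz: "quad y v = \<zero>" and dv: "\<And>i. i < m \<Longrightarrow> sd (y i) v = sd (x i) (x (Suc m))"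
  shows "sd (y m) v = sd (x m) (x (Suc m))"
proof -
  have g: "gap {..m} lam y = gap {..m} lam x"
    by (rule gap_eq) (use lam y xV' lam_sum d in auto)
  have gK: "gap {..m} lam x \<in> K" using lam xV' by auto
  have xS: "x (Suc m) \<in> V" using xV by simp
  have split: "finsum R (\<lambda>i. lam i \<otimes> sd (w i) p) {..m} = lam m \<otimes> sd (w m) p \<oplus> finsum R (\<lambda>i. lam i \<otimes> sd (w i) p) {..<m}"
    if "w \<in> {..m} \<rightarrow> V" "p \<in> V" for w p
  proof -
    have e: "{..m} = insert m {..<m}" by auto
    show ?thesis unfolding e by (rule R.finsum_insert) (use that lam in \<open>auto simp: Pi_iff\<close>)
  qed
  have "sd v (centre y) = d0" using quad_zero_iff[OF y v d] qz by simp
  hence "sd (centre y) v = sd (centre x) (x (Suc m))"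
    using sd_comm[of v "centre y"] sd_comm[of "x (Suc m)" "centre x"] v xS centre_V[OF y] centre_V[OF xV'] by (simp add: d0_def)
  hence "finsum R (\<lambda>i. lam i \<otimes> sd (y i) v) {..m} \<ominus> gap {..m} lam x = finsum R (\<lambda>i. lam i \<otimes> sd (x i) (x (Suc m))) {..m} \<ominus> gap {..m} lam x"
    unfolding centre_def using sd_lc[of "{..m}" lam y v] sd_lc[of "{..m}" lam x "x (Suc m)"] lam lam_sum y v xV' xS g by simp
  moreover have "finsum R (\<lambda>i. lam i \<otimes> sd (y i) v) {..m} \<in> K" "finsum R (\<lambda>i. lam i \<otimes> sd (x i) (x (Suc m))) {..m} \<in> K"
    using lam y v xV' xS by (auto simp: Pi_iff intro!: R.finsum_closed)
  ultimately have "finsum R (\<lambda>i. lam i \<otimes> sd (y i) v) {..m} = finsum R (\<lambda>i. lam i \<otimes> sd (x i) (x (Suc m))) {..m}"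
    using gK by (simp add: a_minus_def)
  moreover have "finsum R (\<lambda>i. lam i \<otimes> sd (y i) v) {..<m} = finsum R (\<lambda>i. lam i \<otimes> sd (x i) (x (Suc m))) {..<m}"
    by (rule R.finsum_cong') (use lam xV' xS dv in \<open>auto simp: Pi_iff\<close>)
  moreover have "finsum R (\<lambda>i. lam i \<otimes> sd (x i) (x (Suc m))) {..<m} \<in> K"
    using lam xV' xS by (auto simp: Pi_iff intro!: R.finsum_closed)
  moreover have mK: "lam m \<in> K" "sd (y m) v \<in> K" "sd (x m) (x (Suc m)) \<in> K" using lam y v xV' xS by (auto simp: Pi_iff)
  ultimately have "lam m \<otimes> sd (y m) v = lam m \<otimes> sd (x m) (x (Suc m))"
    using split[OF y v] split[OF xV' xS] by simp
  thus ?thesis using m_lcancel[OF lam_m mK(1) mK(2,3)] by simp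
qed

end

context bilin_space begin

lemma Rel_single: assumes "y i \<in> V" shows "card (Rel {i} y) = 1"
proof -
  have "Rel {i} y = {\<lambda>j\<in>{i}. \<zero>}"
  proof
    show "Rel {i} y \<subseteq> {\<lambda>j\<in>{i}. \<zero>}"
    proof
      fix t assume t: "t \<in> Rel {i} y"
      hence P: "t \<in> PiE {i} (\<lambda>_. K)" by (simp add: Rel_def)
      hence "t i \<in> K" by auto
      hence "finsum R t {i} = t i" by (subst R.finsum_insert) auto
      hence "t i = \<zero>" using t by (simp add: Rel_def)
      hence "t = (\<lambda>j\<in>{i}. \<zero>)" using P by (auto simp: PiE_def extensional_def fun_eq_iff)
      thus "t \<in> {\<lambda>j\<in>{i}. \<zero>}" by simp
    qed
    show "{\<lambda>j\<in>{i}. \<zero>} \<subseteq> Rel {i} y" using zero_Rel[of "{i}" y] assms by auto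
  qed
  thus ?thesis by simp
qed

lemma wt_nonzero: assumes "wt \<delta> {} n y \<noteq> 0" "i < j" "j < n" shows "sd (y i) (y j) = \<delta> i j"
proof (rule ccontr)
  assume "sd (y i) (y j) \<noteq> \<delta> i j"
  hence "Dd (\<delta> i j) (y i) (y j) = 0" by (simp add: Dd_def)
  hence Z: "(\<Prod>i\<in>{..<j} \<union> {}. Dd (\<delta> i j) (y i) (y j)) = 0"
    using assms by (intro prod_zero bexI[of _ i]) auto
  have "wt \<delta> {} n y = 0"
    unfolding wt_def by (rule prod_zero, simp, rule bexI[of _ j], rule Z, use assms(3) in simp)
  thus False using assms by simp
qed

lemma wt_le: "wt \<delta> {} n y \<le> q ^ (n * (n - 1) div 2)"
proof -
  have "wt \<delta> {} n y \<le> (\<Prod>j<n. q ^ j)" unfolding wt_def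
  proof (rule prod_mono, safe)
    fix j
    show "0 \<le> (\<Prod>i\<in>{..<j} \<union> {}. Dd (\<delta> i j) (y i) (y j))" by (rule prod_nonneg) simp
    show "(\<Prod>i\<in>{..<j} \<union> {}. Dd (\<delta> i j) (y i) (y j)) \<le> q ^ j"
      using prod_Dd_le[of "{..<j}" "\<lambda>i. \<delta> i j" y "\<lambda>_. y j"] by simp
  qed
  also have "\<dots> = q ^ (\<Sum>j<n. j)" by (simp add: power_sum)
  also have "(\<Sum>j<n. j) = n * (n - 1) div 2"
  proof -
    have "2 * (\<Sum>j<n. j) = n * (n - 1)"
    proof (induction n)
      case (Suc n)
      thus ?case by (cases n) auto
    qed simp
    thus ?thesis by simp
  qed
  finally show ?thesis .
qed

lemma AE_prod: "AE n (\<lambda>y. \<Prod>j<n. g j (y j)) b = (\<Prod>j<n. Ex (g j))"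
proof (induction n)
  case (Suc n)
  have "Ex (\<lambda>v. \<Prod>j<Suc n. g j ((y(n := v)) j)) = (\<Prod>j<n. g j (y j)) * Ex (g n)" for y
    by (subst Ex_cmult(1)[symmetric], rule Ex_cong) simp
  thus ?case using Suc by (simp only: AE_Suc AE_cmult prod.lessThan_Suc)
qed simp

end

section \<open>Reducing the conditions on the last vertex to the quadratic one\<close>

context configuration begin

definition G0 where "G0 f y v = f v * f (bar v (centre y)) * (if quad y v = \<zero> then q else (0::real))"

text \<open>Here the last vertex v meets only the quadratic condition. \<open>T0\<close> adds the
  distances to y 0, ..., y (m - 1), which together with the quadratic condition imply the distance
  to y m as well.\<close>

definition T1 where "T1 f b = AE (Suc m) (\<lambda>y. wt del {} (Suc m) y * (\<Prod>j<Suc m. f (y j)) * Ex (G0 f y)) b"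

definition T0 where "T0 f b = AE (Suc m) (\<lambda>y. wt del {} (Suc m) y * (\<Prod>j<Suc m. f (y j)) *
   Ex (\<lambda>v. G0 f y v * (\<Prod>j<m. Dd (del j (Suc m)) v (y j)))) b"

lemma distances: assumes "wt del {} (Suc m) y \<noteq> 0" "\<And>i. i \<le> m \<Longrightarrow> y i \<in> V" "i \<le> m" "j \<le> m"
  shows "sd (y i) (y j) = sd (x i) (x j)"
proof (cases i j rule: linorder_cases)
  case less
  thus ?thesis using wt_nonzero[OF assms(1) less] assms by (simp add: del_def)
next
  case equal
  thus ?thesis using assms xV by simp
next
  case greater
  have "sd (y j) (y i) = sd (x j) (x i)" using wt_nonzero[OF assms(1) greater] assms by (simp add: del_def)
  thus ?thesis using sd_comm[of "y i" "y j"] sd_comm[of "x i" "x j"] assms xV by simp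
qed

lemma centre_upd: assumes "\<And>i. i < m \<Longrightarrow> y i \<in> V" "w \<in> V"
  shows "centre (y(m := w)) = lam m \<odot>\<^bsub>M\<^esub> w \<oplus>\<^bsub>M\<^esub> lc {..<m} lam y"
proof -
  have e: "{..m} = insert m {..<m}" by auto
  have "centre (y(m := w)) = lam m \<odot>\<^bsub>M\<^esub> w \<oplus>\<^bsub>M\<^esub> lc {..<m} lam (y(m := w))"
    unfolding centre_def e using lam assms by (subst lc_insert) (auto simp: Pi_iff)
  also have "lc {..<m} lam (y(m := w)) = lc {..<m} lam y"
    by (rule lc_cong) (use lam assms in \<open>auto simp: Pi_iff\<close>)
  finally show ?thesis .
qed

text \<open>As \<open>lam m\<close> is nonzero, the centre is a bijective affine function of the
  last point, so it may serve as the averaging variable in its place.\<close>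

lemma Ex_centre: assumes y: "\<And>i. i < m \<Longrightarrow> y i \<in> V"
  shows "Ex (\<lambda>w. F (centre (y(m := w)))) = Ex F"
proof -
  let ?c = "lc {..<m} lam y"
  have lm: "lam m \<in> K" using lam by auto
  have cV: "?c \<in> V" using lam y by (intro lc_closed) (auto simp: Pi_iff)
  have "Ex (\<lambda>w. F (centre (y(m := w)))) = Ex (\<lambda>w. F (lam m \<odot>\<^bsub>M\<^esub> w \<oplus>\<^bsub>M\<^esub> ?c))"
    by (rule Ex_cong) (simp only: centre_upd[OF y])
  also have "\<dots> = Ex (\<lambda>w. F (w \<oplus>\<^bsub>M\<^esub> ?c))"
    by (rule Ex_reindex[OF bij_smult[OF lm lam_m], of "\<lambda>w. F (w \<oplus>\<^bsub>M\<^esub> ?c)"])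
  also have "\<dots> = Ex F" by (rule Ex_shift[OF cV])
  finally show ?thesis .
qed

text \<open>The quadratic condition involves all of y 0, ..., y m, which blocks a direct use of the
  apex estimate. Passing from y m to the centre u turns it into a distance condition between v and u
  alone, and the distances to y m into distances to u. With u fixed, v is an apex over the remaining
  m points.\<close>

lemma T0_T1:
  assumes N: "q ^ (2 * (m + 4)) \<le> N" and f: "\<And>v. v \<in> V \<Longrightarrow> 0 \<le> f v \<and> f v \<le> 1"
  shows "\<bar>T0 f b - T1 f b\<bar> \<le> 7 * 5 ^ m / q"
proof -
  let ?\<gamma> = "\<lambda>j. del j (Suc m)" and ?P = "\<lambda>y. \<Prod>j<Suc m. f (y j)"
  define \<epsilon> where "\<epsilon> i = (if i \<le> m then sd (centre x) (x i) else \<zero>)" for i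
  define G where "G u v = f v * f (bar v u) * Dd d0 v u" for u v
  \<comment> \<open>An upper bound in which y m occurs only through the centre. Where the original
    weight is nonzero it has the same distance factors; elsewhere nonnegativity is enough.\<close>
  define \<Phi> where "\<Phi> y u = wt del {} m y * (\<Prod>i<m. Dd (\<epsilon> i) u (y i)) * \<bar>Ex (\<lambda>v. G u v * apex ?\<gamma> m v y)\<bar>" for y u
  have \<epsilon>K: "\<epsilon> i \<in> K" for i unfolding \<epsilon>_def using xV centre_V[OF xV'] by simp
  have "T0 f b - T1 f b = AE (Suc m) (\<lambda>y. wt del {} (Suc m) y * ?P y * Ex (\<lambda>v. G0 f y v * apex ?\<gamma> m v y)) b"
  proof -
    have "Ex (\<lambda>v. G0 f y v * apex ?\<gamma> m v y) = Ex (\<lambda>v. G0 f y v * (\<Prod>j<m. Dd (del j (Suc m)) v (y j))) - Ex (G0 f y)" for y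
      unfolding apex_def by (simp only: right_diff_distrib mult_1_right Ex_diff)
    thus ?thesis unfolding T0_def T1_def by (simp only: AE_diff right_diff_distrib)
  qed
  hence "\<bar>T0 f b - T1 f b\<bar> \<le> AE (Suc m) (\<lambda>y. norm (wt del {} (Suc m) y * ?P y * Ex (\<lambda>v. G0 f y v * apex ?\<gamma> m v y))) b"
    using AE_norm[of "Suc m" "\<lambda>y. wt del {} (Suc m) y * ?P y * Ex (\<lambda>v. G0 f y v * apex ?\<gamma> m v y)" b] by simp
  also have "\<dots> \<le> AE (Suc m) (\<lambda>y. \<Phi> y (centre y)) b"
  proof (rule AE_mono)
    fix y assume y: "\<And>i. i < Suc m \<Longrightarrow> y i \<in> V"
    have yV: "y \<in> {..m} \<rightarrow> V" using y by auto
    show "norm (wt del {} (Suc m) y * ?P y * Ex (\<lambda>v. G0 f y v * apex ?\<gamma> m v y)) \<le> \<Phi> y (centre y)"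
    proof (cases "wt del {} (Suc m) y = 0")
      case True
      thus ?thesis by (simp add: \<Phi>_def prod_nonneg)
    next
      case False
      have d: "sd (y i) (y j) = sd (x i) (x j)" if "i \<le> m" "j \<le> m" for i j
        using distances[OF False _ that] y by simp
      have "Ex (\<lambda>v. G0 f y v * apex ?\<gamma> m v y) = Ex (\<lambda>v. G (centre y) v * apex ?\<gamma> m v y)"
        by (rule Ex_cong) (simp add: G0_def G_def Dd_def quad_zero_iff[OF yV _ d])
      moreover have "wt del {} (Suc m) y = wt del {} m y * (\<Prod>i<m. Dd (\<epsilon> i) (centre y) (y i))"
      proof -
        have "wt del {} (Suc m) (y(m := y m)) = wt del {} m y * (\<Prod>i\<in>{..<m} \<union> {}. Dd (del i m) (y i) (y m))"
          by (rule wt_Suc) simp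
        moreover have "Dd (del i m) (y i) (y m) = Dd (\<epsilon> i) (centre y) (y i)" if "i < m" for i
        proof -
          have "sd (centre y) (y i) = sd (centre x) (x i)"
            unfolding centre_def by (rule sd_lc_eq) (use lam yV xV' lam_sum d that in auto)
          thus ?thesis using d[of i m] that by (simp add: Dd_def del_def \<epsilon>_def)
        qed
        ultimately show ?thesis by simp
      qed
      moreover have "0 \<le> ?P y" by (rule prod_nonneg) (use f y in auto)
      moreover have "?P y \<le> 1" by (rule prod_le_1) (use f y in auto)
      ultimately show ?thesis unfolding \<Phi>_def
        by (auto simp: abs_mult prod_nonneg intro!: mult_right_mono mult_left_le)
    qed
  qed
  also have "\<dots> = AE m (\<lambda>y. Ex (\<lambda>w. \<Phi> y (centre (y(m := w))))) b"
  proof -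
    have "\<Phi> (y(m := w)) u = \<Phi> y u" for y w u
    proof -
      have "wt del {} m (y(m := w)) = wt del {} m y" unfolding wt_def by (intro prod.cong refl) auto
      moreover have "apex ?\<gamma> m v (y(m := w)) = apex ?\<gamma> m v y" for v unfolding apex_def by simp
      ultimately show ?thesis by (simp add: \<Phi>_def)
    qed
    thus ?thesis by (simp only: AE_Suc)
  qed
  also have "\<dots> = AE m (\<lambda>y. Ex (\<Phi> y)) b"
    by (rule AE_cong) (rule Ex_centre)
  also have "\<dots> = Ex (\<lambda>u. AE m (\<lambda>y. \<Phi> y u) b)" by (rule AE_Ex)
  also have "\<dots> \<le> Ex (\<lambda>u. 7 * 5 ^ m / q)"
  proof (rule Ex_mono)
    fix u assume u: "u \<in> V"
    \<comment> \<open>The index m, vacated by the change of variables, now stores the fixed centre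
      u.\<close>
    let ?\<delta> = "\<lambda>i j. if i = m then \<epsilon> j else del i j"
    let ?I = "\<lambda>y. Ex (\<lambda>v. complex_of_real (G u v) * complex_of_real (apex ?\<gamma> m v y))"
    have w: "wt ?\<delta> {m} m (y(m := u)) = wt del {} m y * (\<Prod>i<m. Dd (\<epsilon> i) u (y i))" for y
    proof -
      have "(\<Prod>i\<in>{..<j} \<union> {m}. Dd (?\<delta> i j) ((y(m := u)) i) ((y(m := u)) j))
         = Dd (\<epsilon> j) u (y j) * (\<Prod>i\<in>{..<j} \<union> {}. Dd (del i j) (y i) (y j))" if "j < m" for j
      proof -
        have "{..<j} \<union> {m} = insert m {..<j}" by auto
        thus ?thesis using that by (auto intro!: arg_cong2[where f = "(*)"] prod.cong)
      qed
      thus ?thesis by (simp add: wt_def prod.distrib[symmetric] mult.commute)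
    qed
    have I: "\<bar>Ex (\<lambda>v. G u v * apex ?\<gamma> m v y)\<bar> = norm (?I y)" for y
      by (simp only: of_real_mult[symmetric] Ex_of_real norm_of_real)
    have "AE m (\<lambda>y. \<Phi> y u) b = AE m (\<lambda>y. wt ?\<delta> {m} m (y(m := u)) * norm (?I (y(m := u)))) b"
    proof (rule AE_cong)
      fix y
      have "?I (y(m := u)) = ?I y" by (simp add: apex_def)
      thus "\<Phi> y u = wt ?\<delta> {m} m (y(m := u)) * norm (?I (y(m := u)))"
        by (simp only: \<Phi>_def w I)
    qed
    also have "\<dots> = AE m (\<lambda>y. wt ?\<delta> {m} m y * norm (?I y)) (b(m := u))"
      by (rule AE_upd[where f = "\<lambda>y. wt ?\<delta> {m} m y * norm (?I y)"]) simp
    finally have E: "AE m (\<lambda>y. \<Phi> y u) b = \<dots>" .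
    let ?b = "b(m := u)"
    have R1: "card (Rel {m} ?b) = 1" by (rule Rel_single) (use u in simp)
    have \<delta>K: "?\<delta> i j \<in> K" for i j using \<epsilon>K del_K by simp
    have "(AE m (\<lambda>y. wt ?\<delta> {m} m y * norm (?I y)) ?b)\<^sup>2 \<le> AE m (wt ?\<delta> {m} m) ?b * AE m (\<lambda>y. wt ?\<delta> {m} m y * (norm (?I y))\<^sup>2) ?b"
      by (rule AE_CS) simp
    also have "\<dots> \<le> (2 * 5 ^ m) * (20 * 5 ^ m / q ^ 2)"
    proof (rule mult_mono)
      have "AE m (wt ?\<delta> {m} m) ?b \<le> 1 + 5 ^ m / q ^ 2"
        by (rule wt_mean_le[OF N \<delta>K _ _ _ R1]) (use u in auto)
      also have "\<dots> = 1 + 5 ^ m * (1 / q ^ 2)" by simp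
      also have "\<dots> \<le> 1 + 5 ^ m * 1" by (intro add_left_mono mult_left_mono inv_q_le_1) simp
      also have "\<dots> \<le> 2 * 5 ^ m" by simp
      finally show "AE m (wt ?\<delta> {m} m) ?b \<le> 2 * 5 ^ m" .
      \<comment> \<open>With s = 2, one base point, two apexes and m vertices, the first side
        condition holds with equality: 1 + 2 + m + 2 = (m + 4) + 1. The majorant for G is the
        distance condition between v and u, of mean at most 2.\<close>
      show "AE m (\<lambda>y. wt ?\<delta> {m} m y * (norm (?I y))\<^sup>2) ?b \<le> 20 * 5 ^ m / q ^ 2"
      proof (rule apex_mean_square[OF N \<delta>K del_K _ _ _ R1, where p = "Suc m" and p' = "Suc (Suc m)" and w = "\<lambda>v. Dd d0 v u"])
        have "\<bar>Ex (\<lambda>v. \<Prod>i\<in>{m}. Dd d0 (?b i) v) - 1\<bar> \<le> real (card (Rel {m} ?b)) - 1 + q ^ card {m} / sqrt N"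
          by (rule distance_step[where \<delta> = "\<lambda>_. d0"]) (use u d0_K in auto)
        moreover have "q ^ card {m} / sqrt N \<le> 1"
          using q_power_div_sqrt_N[OF N, of 1 0] by simp
        moreover have "Ex (\<lambda>v. Dd d0 v u) = Ex (\<lambda>v. \<Prod>i\<in>{m}. Dd d0 (?b i) v)"
          by (rule Ex_cong) (use u Dd_comm in simp)
        ultimately show "Ex (\<lambda>v. Dd d0 v u) \<le> 2" using R1 by linarith
        fix v assume v: "v \<in> V"
        have "bar v u \<in> V" using v u by auto
        hence "f v * f (bar v u) \<le> 1" "0 \<le> f v * f (bar v u)"
          using f[OF v] f[of "bar v u"] mult_le_one[of "f v" "f (bar v u)"] by auto
        thus "norm (complex_of_real (G u v)) \<le> Dd d0 v u"
          unfolding G_def norm_of_real by (simp add: abs_mult mult_left_le_one_le)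
        show "Dd d0 v u \<le> q" by (rule Dd_le)
      qed (use u in auto)
    qed (auto intro!: AE_nonneg)
    also have "\<dots> = 40 * (5 ^ m / q)\<^sup>2" by (simp add: power2_eq_square)
    also have "\<dots> \<le> 49 * (5 ^ m / q)\<^sup>2" by (intro mult_right_mono) auto
    also have "\<dots> = (7 * 5 ^ m / q)\<^sup>2" by (simp add: power2_eq_square)
    finally have "AE m (\<lambda>y. wt ?\<delta> {m} m y * norm (?I y)) ?b \<le> 7 * 5 ^ m / q"
      by (rule power2_le_imp_le) simp
    thus "AE m (\<lambda>y. \<Phi> y u) b \<le> 7 * 5 ^ m / q" unfolding E .
  qed
  finally show ?thesis by simp
qed

end

context bilin_space begin

text \<open>The Fourier coefficient, at the frequency (\<xi>, t), of f lifted to the paraboloid; see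
  \<open>ft_para\<close>.\<close>

definition qft where "qft f \<xi> t = Ex (\<lambda>y. complex_of_real (f y) * (\<psi> \<xi> y * e (t \<otimes> sq y)))"

lemma qft_eq_ft: "qft f \<xi> t = ft (\<lambda>y. complex_of_real (f y) * e (t \<otimes> sq y)) \<xi>"
  unfolding qft_def ft_def by (rule Ex_cong) simp

lemma sum_qft_square: assumes f: "\<And>v. v \<in> V \<Longrightarrow> 0 \<le> f v \<and> f v \<le> 1"
  shows "(\<Sum>t\<in>K. \<Sum>\<xi>\<in>V. (norm (qft f \<xi> t))\<^sup>2) \<le> q"
proof -
  have "(\<Sum>\<xi>\<in>V. (norm (qft f \<xi> t))\<^sup>2) \<le> 1" if t: "t \<in> K" for t
  proof -
    have "(\<Sum>\<xi>\<in>V. (norm (qft f \<xi> t))\<^sup>2) = Ex (\<lambda>y. (norm (complex_of_real (f y) * e (t \<otimes> sq y)))\<^sup>2)"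
      unfolding qft_eq_ft by (rule parseval)
    also have "\<dots> \<le> Ex (\<lambda>_. 1)"
      by (rule Ex_mono) (use f t in \<open>auto simp: norm_mult e_norm power_le_one\<close>)
    finally show ?thesis by simp
  qed
  hence "(\<Sum>t\<in>K. \<Sum>\<xi>\<in>V. (norm (qft f \<xi> t))\<^sup>2) \<le> (\<Sum>t\<in>K. 1)" by (rule sum_mono)
  thus ?thesis by simp
qed

end

context configuration begin

section \<open>Fourier expansion of the quadratic condition\<close>

definition cf where "cf j = A \<otimes> lam j"

lemma cf_K: "j \<le> m \<Longrightarrow> cf j \<in> K" using lam A by (auto simp: cf_def)

text \<open>The count of solutions of the barycentric equation on the paraboloid, on the Fourier
  side: the factors belong to the extra point, to v, and to y 0, ..., y m. \<open>Lam_para\<close>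
  identifies it with \<open>Lam\<close>.\<close>

definition T2 where "T2 f = (\<Sum>t\<in>K. \<Sum>\<xi>\<in>V. qft f (\<ominus>\<^bsub>M\<^esub> \<xi>) (\<ominus> t) * qft f (s \<odot>\<^bsub>M\<^esub> \<xi>) (s \<otimes> t) *
   (\<Prod>j<Suc m. qft f (cf j \<odot>\<^bsub>M\<^esub> \<xi>) (cf j \<otimes> t)))"

lemma quad_char:
  assumes y: "y \<in> {..m} \<rightarrow> V" and v: "v \<in> V" and t: "t \<in> K"
  shows "e (t \<otimes> quad y v) = e (\<ominus> t \<otimes> sq (bar v (centre y))) * e ((s \<otimes> t) \<otimes> sq v) * (\<Prod>j<Suc m. e ((cf j \<otimes> t) \<otimes> sq (y j)))"
proof -
  let ?z = "bar v (centre y)"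
  define a where "a = finsum R (\<lambda>j. lam j \<otimes> sq (y j)) {..m}"
  have a: "a \<in> K" unfolding a_def using lam y by (intro R.finsum_closed) (auto simp: Pi_iff)
  have z: "?z \<in> V" using y v by auto
  have "t \<otimes> quad y v = t \<otimes> A \<otimes> a \<oplus> (s \<otimes> t) \<otimes> sq v \<oplus> \<ominus> t \<otimes> sq ?z"
  proof -
    have "t \<otimes> (A \<otimes> a \<oplus> s \<otimes> p \<ominus> w) = t \<otimes> A \<otimes> a \<oplus> (s \<otimes> t) \<otimes> p \<oplus> \<ominus> t \<otimes> w" if "p \<in> K" "w \<in> K" for p w
      using t A(1) s(1) a that by algebra
    thus ?thesis unfolding quad_def a_def[symmetric] using v z by blast
  qed
  hence "e (t \<otimes> quad y v) = e (t \<otimes> A \<otimes> a) * e ((s \<otimes> t) \<otimes> sq v) * e (\<ominus> t \<otimes> sq ?z)"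
    using t A(1) s(1) a v z by (simp add: e_add)
  moreover have "e (t \<otimes> A \<otimes> a) = (\<Prod>j<Suc m. e ((cf j \<otimes> t) \<otimes> sq (y j)))"
  proof -
    have "t \<otimes> A \<otimes> a = finsum R (\<lambda>j. t \<otimes> A \<otimes> (lam j \<otimes> sq (y j))) {..m}"
      unfolding a_def by (rule finsum_rdistr) (use t A lam y in \<open>auto simp: Pi_iff\<close>)
    hence "e (t \<otimes> A \<otimes> a) = (\<Prod>j\<le>m. e (t \<otimes> A \<otimes> (lam j \<otimes> sq (y j))))"
      using t A lam y by (simp add: e_finsum Pi_iff)
    also have "\<dots> = (\<Prod>j\<le>m. e ((cf j \<otimes> t) \<otimes> sq (y j)))"
    proof (rule prod.cong[OF refl])
      fix j assume j: "j \<in> {..m}"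
      have "lam j \<in> K" "sq (y j) \<in> K" using j lam y by auto
      thus "e (t \<otimes> A \<otimes> (lam j \<otimes> sq (y j))) = e ((cf j \<otimes> t) \<otimes> sq (y j))"
        unfolding cf_def using t A(1) by (simp add: m_ac)
    qed
    finally show ?thesis by (simp only: lessThan_Suc_atMost)
  qed
  ultimately show ?thesis by simp
qed

lemma bar_char:
  assumes y: "y \<in> {..m} \<rightarrow> V" and v: "v \<in> V" and \<xi>: "\<xi> \<in> V"
  shows "\<psi> \<xi> (bar v (centre y)) = \<psi> (s \<odot>\<^bsub>M\<^esub> \<xi>) v * (\<Prod>j<Suc m. \<psi> (cf j \<odot>\<^bsub>M\<^esub> \<xi>) (y j))"
proof -
  have c: "centre y \<in> V" using y by auto
  have "\<psi> \<xi> (bar v (centre y)) = \<psi> (s \<odot>\<^bsub>M\<^esub> \<xi>) v * \<psi> (A \<odot>\<^bsub>M\<^esub> \<xi>) (centre y)"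
    unfolding bar_def using s A v c \<xi> by (simp add: \<psi>_add2 \<psi>_smult)
  also have "\<psi> (A \<odot>\<^bsub>M\<^esub> \<xi>) (centre y) = (\<Prod>j\<le>m. \<psi> (lam j \<odot>\<^bsub>M\<^esub> (A \<odot>\<^bsub>M\<^esub> \<xi>)) (y j))"
    unfolding centre_def by (rule \<psi>_lc) (use lam y A \<xi> in auto)
  also have "\<dots> = (\<Prod>j\<le>m. \<psi> (cf j \<odot>\<^bsub>M\<^esub> \<xi>) (y j))"
  proof (rule prod.cong[OF refl])
    fix j assume j: "j \<in> {..m}"
    have "lam j \<in> K" using j lam by auto
    thus "\<psi> (lam j \<odot>\<^bsub>M\<^esub> (A \<odot>\<^bsub>M\<^esub> \<xi>)) (y j) = \<psi> (cf j \<odot>\<^bsub>M\<^esub> \<xi>) (y j)"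
      unfolding cf_def using A(1) \<xi> by (simp add: m_comm flip: smult_assoc1)
  qed
  finally show ?thesis by (simp only: lessThan_Suc_atMost)
qed

definition gj where "gj f \<xi> t j v = complex_of_real (f v) * (\<psi> (cf j \<odot>\<^bsub>M\<^esub> \<xi>) v * e ((cf j \<otimes> t) \<otimes> sq v))"

text \<open>The extra point is not a free variable, so f there is expanded by Fourier inversion, and
  the quadratic condition is expanded in characters. Each term then is a constant times a product of
  functions of single points, the form required by \<open>discrepancy\<close>.\<close>

lemma Ex_G0:
  assumes y: "y \<in> {..m} \<rightarrow> V"
  shows "complex_of_real ((\<Prod>j<Suc m. f (y j)) * Ex (G0 f y)) =
    (\<Sum>t\<in>K. \<Sum>\<xi>\<in>V. qft f (\<ominus>\<^bsub>M\<^esub> \<xi>) (\<ominus> t) * qft f (s \<odot>\<^bsub>M\<^esub> \<xi>) (s \<otimes> t) * (\<Prod>j<Suc m. gj f \<xi> t j (y j)))"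
proof -
  have *: "complex_of_real (G0 f y v) = (\<Sum>t\<in>K. \<Sum>\<xi>\<in>V.
      qft f (\<ominus>\<^bsub>M\<^esub> \<xi>) (\<ominus> t) * (\<Prod>j<Suc m. \<psi> (cf j \<odot>\<^bsub>M\<^esub> \<xi>) (y j) * e ((cf j \<otimes> t) \<otimes> sq (y j)))
      * (complex_of_real (f v) * (\<psi> (s \<odot>\<^bsub>M\<^esub> \<xi>) v * e ((s \<otimes> t) \<otimes> sq v))))" if v: "v \<in> V" for v
  proof -
    let ?z = "bar v (centre y)"
    have z: "?z \<in> V" using y v by auto
    have qK: "quad y v \<in> K" unfolding quad_def using lam y v z A s by (intro R.minus_closed R.a_closed R.m_closed R.finsum_closed) (auto simp: Pi_iff)
    have "complex_of_real (G0 f y v) = of_real (f v) * of_real (f ?z) * (\<Sum>t\<in>K. e (t \<otimes> quad y v))"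
      using sum_e_mult[OF qK] by (simp add: G0_def)
    also have "\<dots> = (\<Sum>t\<in>K. of_real (f v) * of_real (f ?z) * e (t \<otimes> quad y v))" by (rule sum_distrib_left)
    also have "\<dots> = (\<Sum>t\<in>K. \<Sum>\<xi>\<in>V.
      qft f (\<ominus>\<^bsub>M\<^esub> \<xi>) (\<ominus> t) * (\<Prod>j<Suc m. \<psi> (cf j \<odot>\<^bsub>M\<^esub> \<xi>) (y j) * e ((cf j \<otimes> t) \<otimes> sq (y j)))
      * (complex_of_real (f v) * (\<psi> (s \<odot>\<^bsub>M\<^esub> \<xi>) v * e ((s \<otimes> t) \<otimes> sq v))))"
    proof (rule sum.cong[OF refl])
      fix t assume t: "t \<in> K"
      let ?E = "\<Prod>j<Suc m. e ((cf j \<otimes> t) \<otimes> sq (y j))"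
      have "of_real (f v) * of_real (f ?z) * e (t \<otimes> quad y v)
        = (of_real (f ?z) * e (\<ominus> t \<otimes> sq ?z)) * (of_real (f v) * e ((s \<otimes> t) \<otimes> sq v) * ?E)"
        unfolding quad_char[OF y v t] by (simp only: mult_ac)
      also have "of_real (f ?z) * e (\<ominus> t \<otimes> sq ?z) = (\<Sum>\<xi>\<in>V. qft f (\<ominus>\<^bsub>M\<^esub> \<xi>) (\<ominus> t) * \<psi> \<xi> ?z)"
        unfolding qft_eq_ft by (rule ft_inversion'[OF z, of "\<lambda>y. of_real (f y) * e (\<ominus> t \<otimes> sq y)"])
      also have "\<dots> = (\<Sum>\<xi>\<in>V. qft f (\<ominus>\<^bsub>M\<^esub> \<xi>) (\<ominus> t) * (\<psi> (s \<odot>\<^bsub>M\<^esub> \<xi>) v * (\<Prod>j<Suc m. \<psi> (cf j \<odot>\<^bsub>M\<^esub> \<xi>) (y j))))"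
        by (rule sum.cong[OF refl]) (simp only: bar_char[OF y v])
      also have "\<dots> * (of_real (f v) * e ((s \<otimes> t) \<otimes> sq v) * ?E) = (\<Sum>\<xi>\<in>V.
      qft f (\<ominus>\<^bsub>M\<^esub> \<xi>) (\<ominus> t) * (\<Prod>j<Suc m. \<psi> (cf j \<odot>\<^bsub>M\<^esub> \<xi>) (y j) * e ((cf j \<otimes> t) \<otimes> sq (y j)))
      * (complex_of_real (f v) * (\<psi> (s \<odot>\<^bsub>M\<^esub> \<xi>) v * e ((s \<otimes> t) \<otimes> sq v))))"
        unfolding sum_distrib_right by (rule sum.cong[OF refl]) (simp only: prod.distrib mult_ac)
      finally show "of_real (f v) * of_real (f ?z) * e (t \<otimes> quad y v) = \<dots>" .
    qed
    finally show ?thesis .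
  qed
  have "complex_of_real (Ex (G0 f y)) = Ex (\<lambda>v. complex_of_real (G0 f y v))" by (rule Ex_of_real[symmetric])
  also have "\<dots> = Ex (\<lambda>v. \<Sum>t\<in>K. \<Sum>\<xi>\<in>V.
      qft f (\<ominus>\<^bsub>M\<^esub> \<xi>) (\<ominus> t) * (\<Prod>j<Suc m. \<psi> (cf j \<odot>\<^bsub>M\<^esub> \<xi>) (y j) * e ((cf j \<otimes> t) \<otimes> sq (y j)))
      * (complex_of_real (f v) * (\<psi> (s \<odot>\<^bsub>M\<^esub> \<xi>) v * e ((s \<otimes> t) \<otimes> sq v))))"
    by (rule Ex_cong) (rule *)
  also have "\<dots> = (\<Sum>t\<in>K. \<Sum>\<xi>\<in>V.
      qft f (\<ominus>\<^bsub>M\<^esub> \<xi>) (\<ominus> t) * (\<Prod>j<Suc m. \<psi> (cf j \<odot>\<^bsub>M\<^esub> \<xi>) (y j) * e ((cf j \<otimes> t) \<otimes> sq (y j)))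
      * qft f (s \<odot>\<^bsub>M\<^esub> \<xi>) (s \<otimes> t))"
    by (simp only: Ex_sum Ex_cmult qft_def)
  finally have E: "complex_of_real (Ex (G0 f y)) = \<dots>" .
  have "complex_of_real ((\<Prod>j<Suc m. f (y j)) * Ex (G0 f y)) = (\<Prod>j<Suc m. complex_of_real (f (y j))) * complex_of_real (Ex (G0 f y))"
    by (simp only: of_real_mult of_real_prod)
  also have "\<dots> = (\<Sum>t\<in>K. \<Sum>\<xi>\<in>V. qft f (\<ominus>\<^bsub>M\<^esub> \<xi>) (\<ominus> t) * qft f (s \<odot>\<^bsub>M\<^esub> \<xi>) (s \<otimes> t) * (\<Prod>j<Suc m. gj f \<xi> t j (y j)))"
    unfolding E gj_def by (simp only: sum_distrib_left prod.distrib mult_ac)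
  finally show ?thesis .
qed

text \<open>Dropping the distance weight changes each term of the expansion by at most the
  discrepancy. The coefficients have absolute sum at most q, by the inequality between products and
  mean squares and by Parseval for each t. The saving s = 3 thus leaves q * q^(-3/2), and (m + 1) +
  3 = m + 4 uses up the available dimension.\<close>

lemma T1_T2:
  assumes N: "q ^ (2 * (m + 4)) \<le> N" and f: "\<And>v. v \<in> V \<Longrightarrow> 0 \<le> f v \<and> f v \<le> 1"
  shows "norm (complex_of_real (T1 f b) - T2 f) \<le> q * (Suc m * (7 * 5 ^ Suc m * sqrt (1 / q ^ 3)))"
proof -
  let ?D = "real (Suc m) * (7 * 5 ^ Suc m * sqrt (1 / q ^ 3))"
  let ?c = "\<lambda>t \<xi>. qft f (\<ominus>\<^bsub>M\<^esub> \<xi>) (\<ominus> t) * qft f (s \<odot>\<^bsub>M\<^esub> \<xi>) (s \<otimes> t)"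
  let ?w = "wt del {} (Suc m)"
  let ?X = "\<lambda>t \<xi>. AE (Suc m) (\<lambda>y. complex_of_real (?w y) * (\<Prod>j<Suc m. gj f \<xi> t j (y j))) b"
  let ?Y = "\<lambda>t \<xi>. AE (Suc m) (\<lambda>y. \<Prod>j<Suc m. gj f \<xi> t j (y j)) b"
  have "complex_of_real (T1 f b) = AE (Suc m) (\<lambda>y. \<Sum>t\<in>K. \<Sum>\<xi>\<in>V. ?c t \<xi> * (complex_of_real (?w y) * (\<Prod>j<Suc m. gj f \<xi> t j (y j)))) b"
    unfolding T1_def AE_of_real[symmetric]
  proof (rule AE_cong)
    fix y assume "\<And>i. i < Suc m \<Longrightarrow> y i \<in> V"
    hence y: "y \<in> {..m} \<rightarrow> V" by auto
    have "complex_of_real (?w y * (\<Prod>j<Suc m. f (y j)) * Ex (G0 f y)) = complex_of_real (?w y) * complex_of_real ((\<Prod>j<Suc m. f (y j)) * Ex (G0 f y))"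
      by (simp only: of_real_mult mult.assoc)
    also have "\<dots> = (\<Sum>t\<in>K. \<Sum>\<xi>\<in>V. ?c t \<xi> * (complex_of_real (?w y) * (\<Prod>j<Suc m. gj f \<xi> t j (y j))))"
      unfolding Ex_G0[OF y] by (simp only: sum_distrib_left mult_ac)
    finally show "complex_of_real (?w y * (\<Prod>j<Suc m. f (y j)) * Ex (G0 f y)) = \<dots>" .
  qed
  also have "\<dots> = (\<Sum>t\<in>K. \<Sum>\<xi>\<in>V. ?c t \<xi> * ?X t \<xi>)" by (simp only: AE_sum AE_cmult)
  finally have 1: "complex_of_real (T1 f b) = \<dots>" .
  have Y: "?Y t \<xi> = (\<Prod>j<Suc m. qft f (cf j \<odot>\<^bsub>M\<^esub> \<xi>) (cf j \<otimes> t))" for t \<xi>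
    unfolding AE_prod by (simp only: gj_def[abs_def] qft_def)
  have E: "complex_of_real (T1 f b) - T2 f = (\<Sum>t\<in>K. \<Sum>\<xi>\<in>V. ?c t \<xi> * (?X t \<xi> - ?Y t \<xi>))"
    unfolding 1 T2_def Y by (simp only: sum_subtractf[symmetric] right_diff_distrib)
  define F1 where "F1 t \<xi> = (norm (qft f (\<ominus>\<^bsub>M\<^esub> \<xi>) (\<ominus> t)))\<^sup>2" for t \<xi>
  define F2 where "F2 t \<xi> = (norm (qft f (s \<odot>\<^bsub>M\<^esub> \<xi>) (s \<otimes> t)))\<^sup>2" for t \<xi>
  have le: "norm (complex_of_real (T1 f b) - T2 f) \<le> (\<Sum>t\<in>K. \<Sum>\<xi>\<in>V. (F1 t \<xi> + F2 t \<xi>) / 2 * ?D)"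
    unfolding E
  proof (intro sum_norm_le)
    fix t \<xi> assume h: "t \<in> K" "\<xi> \<in> V"
    \<comment> \<open>\<open>discrepancy\<close> asks for functions bounded at every index, but
      beyond m nothing is known about the coefficients \<open>cf\<close>; the index is
      clipped.\<close>
    have gn: "norm (gj f \<xi> t (min j m) v) \<le> 1" if "v \<in> V" for j v
    proof -
      have "cf (min j m) \<in> K" by (rule cf_K) simp
      thus ?thesis unfolding gj_def using h f that by (simp add: norm_mult e_norm)
    qed
    have c: "(\<Prod>j<Suc m. gj f \<xi> t j (y j)) = (\<Prod>j<Suc m. gj f \<xi> t (min j m) (y j))" for y
      by (rule prod.cong) auto
    have D: "norm (?X t \<xi> - ?Y t \<xi>) \<le> ?D"
      unfolding c by (rule discrepancy[OF N del_K gn]) auto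
    have "norm (?c t \<xi>) \<le> (F1 t \<xi> + F2 t \<xi>) / 2"
      unfolding norm_mult F1_def F2_def using sum_squares_bound[of "norm (qft f (\<ominus>\<^bsub>M\<^esub> \<xi>) (\<ominus> t))" "norm (qft f (s \<odot>\<^bsub>M\<^esub> \<xi>) (s \<otimes> t))"] by simp
    thus "norm (?c t \<xi> * (?X t \<xi> - ?Y t \<xi>)) \<le> (F1 t \<xi> + F2 t \<xi>) / 2 * ?D"
      unfolding norm_mult[of "?c t \<xi>"] by (rule mult_mono[OF _ D]) (auto simp: F1_def F2_def)
  qed
  have 2: "(\<Sum>t\<in>K. \<Sum>\<xi>\<in>V. (F1 t \<xi> + F2 t \<xi>) / 2 * ?D) = ((\<Sum>t\<in>K. \<Sum>\<xi>\<in>V. F1 t \<xi>) + (\<Sum>t\<in>K. \<Sum>\<xi>\<in>V. F2 t \<xi>)) / 2 * ?D"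
    by (simp only: sum.distrib sum_divide_distrib[symmetric] sum_distrib_right[symmetric])
  have F1: "(\<Sum>t\<in>K. \<Sum>\<xi>\<in>V. F1 t \<xi>) = (\<Sum>t\<in>K. \<Sum>\<xi>\<in>V. (norm (qft f \<xi> t))\<^sup>2)"
    unfolding F1_def sum.reindex_bij_betw[OF bij_uminus, of "\<lambda>\<xi>. (norm (qft f \<xi> (\<ominus> t)))\<^sup>2" for t]
    by (rule sum.reindex_bij_betw[OF bij_uminus_scalar, of "\<lambda>t. \<Sum>\<xi>\<in>V. (norm (qft f \<xi> t))\<^sup>2"])
  have F2: "(\<Sum>t\<in>K. \<Sum>\<xi>\<in>V. F2 t \<xi>) = (\<Sum>t\<in>K. \<Sum>\<xi>\<in>V. (norm (qft f \<xi> t))\<^sup>2)"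
    unfolding F2_def sum.reindex_bij_betw[OF bij_smult[OF s(1,2)], of "\<lambda>\<xi>. (norm (qft f \<xi> (s \<otimes> t)))\<^sup>2" for t]
    by (rule sum.reindex_bij_betw[OF bij_smult_scalar[OF s(1,2)], of "\<lambda>t. \<Sum>\<xi>\<in>V. (norm (qft f \<xi> t))\<^sup>2"])
  have "norm (complex_of_real (T1 f b) - T2 f) \<le> (\<Sum>t\<in>K. \<Sum>\<xi>\<in>V. (norm (qft f \<xi> t))\<^sup>2) * ?D"
    using le unfolding 2 F1 F2 by simp
  also have "\<dots> \<le> q * ?D"
    by (rule mult_right_mono[OF sum_qft_square[OF f]]) auto
  finally show ?thesis .
qed

section \<open>Nondegenerate tuples and the copies they generate\<close>

definition good where
  "good D y \<longleftrightarrow> (\<forall>i<Suc (Suc m). y i \<in> D) \<and> bar (y (Suc m)) (centre y) \<in> D"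

definition tuples where
  "tuples D = {y \<in> PiE {..<Suc (Suc m)} (\<lambda>_. V). good D y \<and>
     (\<forall>i<Suc (Suc m). \<forall>j<Suc (Suc m). sd (y i) (y j) = sd (x i) (x j)) \<and> card (Rel {..<Suc (Suc m)} y) = 1}"

abbreviation ind where "ind D \<equiv> \<lambda>v. if v \<in> D then 1 else (0::real)"

text \<open>Where the left side is nonzero, \<open>last_distance\<close> makes all m + 1 distances
  to the new vertex correct. The factor q of the quadratic condition and the q^m of the m distances
  match the q^(m + 1) of the full set.\<close>

lemma T0_le: "T0 (ind D) b \<le> AE (Suc (Suc m)) (\<lambda>y. wt del {} (Suc (Suc m)) y * of_bool (good D y)) b"
  unfolding T0_def AE_Suc[of "Suc m"]
proof (rule AE_mono)
  let ?f = "ind D"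
  fix y assume y: "\<And>i. i < Suc m \<Longrightarrow> y i \<in> V"
  have yV: "y \<in> {..m} \<rightarrow> V" using y by auto
  let ?Q = "\<lambda>v. \<Prod>j<m. Dd (del j (Suc m)) v (y j)"
  have "wt del {} (Suc m) y * (\<Prod>j<Suc m. ?f (y j)) * Ex (\<lambda>v. G0 ?f y v * ?Q v)
      = Ex (\<lambda>v. wt del {} (Suc m) y * (\<Prod>j<Suc m. ?f (y j)) * (G0 ?f y v * ?Q v))"
    by (rule Ex_cmult(1)[symmetric])
  also have "\<dots> \<le> Ex (\<lambda>v. wt del {} (Suc (Suc m)) (y(Suc m := v)) * of_bool (good D (y(Suc m := v))))"
  proof (rule Ex_mono)
    fix v assume v: "v \<in> V"
    let ?L = "wt del {} (Suc m) y * (\<Prod>j<Suc m. ?f (y j)) * (G0 ?f y v * ?Q v)"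
    let ?R = "wt del {} (Suc (Suc m)) (y(Suc m := v)) * of_bool (good D (y(Suc m := v)))"
    show "?L \<le> ?R"
    proof (cases "?L = 0")
      case True
      moreover have "0 \<le> ?R" by simp
      ultimately show ?thesis by linarith
    next
      case False
      hence nz: "wt del {} (Suc m) y \<noteq> 0" "(\<Prod>j<Suc m. ?f (y j)) \<noteq> 0" "G0 ?f y v \<noteq> 0" "?Q v \<noteq> 0" by auto
      have d: "sd (y i) (y j) = sd (x i) (x j)" if "i \<le> m" "j \<le> m" for i j
        using distances[OF nz(1) _ that] y by simp
      have qz: "quad y v = \<zero>" "v \<in> D" "bar v (centre y) \<in> D"
        using nz(3) by (auto simp: G0_def split: if_splits)
      have yD: "y j \<in> D" if "j < Suc m" for j using nz(2) that by (cases "j = m") (auto split: if_splits)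
      have dv: "sd (y i) v = sd (x i) (x (Suc m))" if i: "i < m" for i
      proof -
        have "Dd (del i (Suc m)) v (y i) \<noteq> 0" using nz(4) i by auto
        hence "sd v (y i) = sd (x i) (x (Suc m))" using i by (simp add: Dd_def del_def split: if_splits)
        thus ?thesis using sd_comm[of v "y i"] v y i by simp
      qed
      have dm: "sd (y m) v = sd (x m) (x (Suc m))" by (rule last_distance[OF yV v d qz(1) dv])
      have dall: "Dd (del i (Suc m)) (y i) v = q" if "i < Suc m" for i
        using dv[of i] dm that by (cases "i = m") (auto simp: Dd_def del_def)
      have "wt del {} (Suc (Suc m)) (y(Suc m := v)) = wt del {} (Suc m) y * (\<Prod>i\<in>{..<Suc m} \<union> {}. Dd (del i (Suc m)) (y i) v)"
        by (rule wt_Suc) simp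
      also have "(\<Prod>i\<in>{..<Suc m} \<union> {}. Dd (del i (Suc m)) (y i) v) = (\<Prod>i<Suc m. q)"
        by (rule prod.cong) (use dall in auto)
      also have "(\<Prod>i<Suc m. q) = q ^ Suc m" by simp
      finally have W: "wt del {} (Suc (Suc m)) (y(Suc m := v)) = wt del {} (Suc m) y * q ^ Suc m" .
      have c: "centre (y(Suc m := v)) = centre y"
        unfolding centre_def by (rule lc_cong) (use lam yV in auto)
      have gd: "good D (y(Suc m := v))" unfolding good_def c using yD qz by auto
      have "(\<Prod>j<Suc m. ?f (y j)) = 1" by (rule prod.neutral) (use yD in auto)
      moreover have "G0 ?f y v = q" using qz by (simp add: G0_def)
      moreover have "?Q v \<le> q ^ m" using prod_Dd_le[of "{..<m}" "\<lambda>j. del j (Suc m)" "\<lambda>_. v" y] by simp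
      ultimately have "?L \<le> wt del {} (Suc m) y * 1 * (q * q ^ m)"
        by (auto intro!: mult_left_mono)
      thus ?thesis using gd unfolding W by simp
    qed
  qed
  finally show "wt del {} (Suc m) y * (\<Prod>j<Suc m. ?f (y j)) * Ex (\<lambda>v. G0 ?f y v * ?Q v) \<le> \<dots>" .
qed

text \<open>A dependent tuple has at least two relations, so its weight is at most its weight times
  the number of relations minus one. The mean of the latter is O(1 / q^2), by
  \<open>wt_moment\<close> with r = 1 and \<open>wt_mean_ge\<close>.\<close>

lemma count_tuples:
  assumes N: "q ^ (2 * (m + 4)) \<le> N"
  shows "T0 (ind D) (\<lambda>_. undefined) \<le> q ^ ((m + 2) * (m + 1) div 2) * card (tuples D) / N ^ (m + 2) + 2 * 5 ^ (m + 2) / q\<^sup>2"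
proof -
  let ?n = "Suc (Suc m)" and ?b = "\<lambda>_. undefined"
  let ?w = "wt del {} ?n"
  let ?r = "\<lambda>y. real (card (Rel {..<?n} y))"
  let ?c = "q ^ ((m + 2) * (m + 1) div 2)"
  have fT: "finite (PiE {..<?n} (\<lambda>_. V))" using finite_vectors by (intro finite_PiE) auto
  have "AE ?n (\<lambda>y. ?w y * of_bool (good D y)) ?b \<le> AE ?n (\<lambda>y. ?c * of_bool (restrict y {..<?n} \<in> tuples D) + (?w y * ?r y ^ 1 - ?w y)) ?b"
  proof (rule AE_mono)
    fix y :: "nat \<Rightarrow> 'c" assume y: "\<And>i. i < ?n \<Longrightarrow> y i \<in> V" "\<And>i. ?n \<le> i \<Longrightarrow> y i = undefined"
    have r: "restrict y {..<?n} = y" using y(2) by (auto simp: fun_eq_iff not_less)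
    have yP: "y \<in> PiE {..<?n} (\<lambda>_. V)" using y by (auto simp: PiE_def extensional_def not_less)
    have w0: "0 \<le> ?w y" by simp
    have r1: "1 \<le> card (Rel {..<?n} y)" by (rule Rel_ge_1) (use y in auto)
    show "?w y * of_bool (good D y) \<le> ?c * of_bool (restrict y {..<?n} \<in> tuples D) + (?w y * ?r y ^ 1 - ?w y)"
    proof (cases "?w y = 0 \<or> \<not> good D y")
      case True
      have "?w y * 1 \<le> ?w y * ?r y ^ 1" using r1 by (intro mult_left_mono) auto
      moreover have "?w y * of_bool (good D y) = 0" using True by auto
      moreover have "0 \<le> ?c * of_bool (restrict y {..<?n} \<in> tuples D)" by simp
      ultimately show ?thesis by linarith
    next
      case False
      show ?thesis
      proof (cases "card (Rel {..<?n} y) = 1")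
        case True
        have "sd (y i) (y j) = sd (x i) (x j)" if "i < ?n" "j < ?n" for i j
        proof (cases i j rule: linorder_cases)
          case less
          thus ?thesis using wt_nonzero[of del ?n y i j] False that by (simp add: del_def)
        next
          case equal
          thus ?thesis using y that xV by simp
        next
          case greater
          hence "sd (y j) (y i) = sd (x j) (x i)" using wt_nonzero[of del ?n y j i] False that by (simp add: del_def)
          thus ?thesis using sd_comm[of "y i" "y j"] sd_comm[of "x i" "x j"] y that xV by simp
        qed
        hence "y \<in> tuples D" unfolding tuples_def using yP False True by blast
        moreover have "?w y \<le> ?c" using wt_le[of del ?n y] by simp
        ultimately show ?thesis using False True by (simp add: r)
      next
        case n1: False
        hence "2 \<le> card (Rel {..<?n} y)" using r1 by linarith
        hence "?w y * 2 \<le> ?w y * ?r y" by (intro mult_left_mono) auto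
        thus ?thesis using False q_pos by (simp add: add_increasing)
      qed
    qed
  qed
  also have "\<dots> = ?c * AE ?n (\<lambda>y. of_bool (restrict y {..<?n} \<in> tuples D)) ?b + (AE ?n (\<lambda>y. ?w y * ?r y ^ 1) ?b - AE ?n ?w ?b)"
    by (simp only: AE_add AE_diff AE_cmult)
  also have "AE ?n (\<lambda>y. of_bool (restrict y {..<?n} \<in> tuples D)) ?b = (\<Sum>y\<in>PiE {..<?n} (\<lambda>_. V). of_bool (y \<in> tuples D)) / of_nat (card V) ^ ?n"
    by (rule AE_eq_sum)
  also have "(\<Sum>y\<in>PiE {..<?n} (\<lambda>_. V). of_bool (y \<in> tuples D)) = real (card (tuples D))"
  proof -
    have "(\<Sum>y\<in>PiE {..<?n} (\<lambda>_. V). of_bool (y \<in> tuples D)) = (\<Sum>y\<in>tuples D. (1::real))"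
      by (rule sum.mono_neutral_cong_right) (use fT in \<open>auto simp: tuples_def\<close>)
    thus ?thesis by simp
  qed
  finally have 1: "AE ?n (\<lambda>y. ?w y * of_bool (good D y)) ?b \<le> ?c * (real (card (tuples D)) / N ^ ?n) + (AE ?n (\<lambda>y. ?w y * ?r y ^ 1) ?b - AE ?n ?w ?b)" .
  have 2: "AE ?n (\<lambda>y. ?w y * ?r y ^ 1) ?b \<le> 1 + 5 ^ ?n / q\<^sup>2"
    using wt_moment[OF N del_K, of "{}" ?n ?b 2 1] by simp
  have 3: "AE ?n ?w ?b \<ge> 1 - 5 ^ ?n / q\<^sup>2"
    using wt_mean_ge[OF N del_K, of "{}" ?n ?b 2] by simp
  have "T0 (ind D) ?b \<le> ?c * (real (card (tuples D)) / N ^ ?n) + 2 * (5 ^ ?n / q\<^sup>2)"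
    using T0_le[of D ?b] 1 2 3 by linarith
  thus ?thesis by simp
qed

text \<open>The passages from \<open>T2\<close> to \<open>T1\<close>, to \<open>T0\<close> and to
  the tuples are chained. Only the first costs 1 / sqrt q; the others are rounded up to it.\<close>

lemma tuples_lower_bound:
  assumes N: "q ^ (2 * (m + 4)) \<le> N"
  shows "Re (T2 (ind D)) - 7 * real (m + 3) * 5 ^ (m + 2) / sqrt q \<le> q ^ ((m + 2) * (m + 1) div 2) * card (tuples D) / N ^ (m + 2)"
proof -
  let ?b = "\<lambda>_. undefined :: 'c" and ?f = "ind D"
  have sq1: "1 \<le> sqrt q" using q_ge_1 by simp
  have sqq: "sqrt q * sqrt q = q" using q_pos by simp
  have i1: "1 / q \<le> 1 / sqrt q"
  proof -
    have "sqrt q * 1 \<le> sqrt q * sqrt q" using sq1 by (intro mult_left_mono) auto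
    hence "sqrt q \<le> q" by (simp only: sqq mult_1_right)
    thus ?thesis using sq1 q_pos by (intro divide_left_mono) auto
  qed
  have i2: "1 / q\<^sup>2 \<le> 1 / sqrt q"
  proof -
    have "1 / q\<^sup>2 \<le> 1 / q" using q_ge_1 by (intro divide_left_mono) (auto simp: power2_eq_square)
    thus ?thesis using i1 by linarith
  qed
  have i3: "q * sqrt (1 / q ^ 3) = 1 / sqrt q"
  proof -
    have "sqrt (1 / q ^ 3) = 1 / (q * sqrt q)"
      using q_pos by (simp add: real_sqrt_divide power3_eq_cube real_sqrt_mult)
    thus ?thesis using q_pos by simp
  qed
  have f: "0 \<le> ?f v \<and> ?f v \<le> 1" for v by simp
  have a: "T0 ?f ?b \<le> q ^ ((m + 2) * (m + 1) div 2) * card (tuples D) / N ^ (m + 2) + 2 * 5 ^ (m + 2) / q\<^sup>2"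
    by (rule count_tuples[OF N])
  have b: "\<bar>T0 ?f ?b - T1 ?f ?b\<bar> \<le> 7 * 5 ^ m / q" by (rule T0_T1[OF N f])
  have "norm (complex_of_real (T1 ?f ?b) - T2 ?f) \<le> q * (Suc m * (7 * 5 ^ Suc m * sqrt (1 / q ^ 3)))"
    by (rule T1_T2[OF N f])
  also have "\<dots> = (real (Suc m) * (7 * 5 ^ Suc m)) * (q * sqrt (1 / q ^ 3))" by (simp only: mult_ac)
  finally have "norm (complex_of_real (T1 ?f ?b) - T2 ?f) \<le> (real (Suc m) * (7 * 5 ^ Suc m)) * (1 / sqrt q)" unfolding i3 .
  hence c: "Re (T2 ?f) - T1 ?f ?b \<le> (real (Suc m) * (7 * 5 ^ Suc m)) * (1 / sqrt q)"
    using abs_Re_le_cmod[of "complex_of_real (T1 ?f ?b) - T2 ?f"] by simp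
  have d: "7 * 5 ^ m / q \<le> 7 * 5 ^ m * (1 / sqrt q)" using i1 mult_left_mono[OF i1, of "7 * 5 ^ m"] by simp
  have e': "2 * 5 ^ (m + 2) / q\<^sup>2 \<le> 2 * 5 ^ (m + 2) * (1 / sqrt q)"
    using mult_left_mono[OF i2, of "2 * 5 ^ (m + 2)"] by simp
  have "real (Suc m) * (7 * 5 ^ Suc m) + 7 * 5 ^ m + 2 * 5 ^ (m + 2) \<le> 7 * real (m + 3) * (5::real) ^ (m + 2)"
    by (simp add: algebra_simps)
  hence "(real (Suc m) * (7 * 5 ^ Suc m) + 7 * 5 ^ m + 2 * 5 ^ (m + 2)) * (1 / sqrt q) \<le> 7 * real (m + 3) * 5 ^ (m + 2) * (1 / sqrt q)"
    by (rule mult_right_mono) simp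
  hence "(real (Suc m) * (7 * 5 ^ Suc m)) * (1 / sqrt q) + 7 * 5 ^ m * (1 / sqrt q) + 2 * 5 ^ (m + 2) * (1 / sqrt q) \<le> 7 * real (m + 3) * 5 ^ (m + 2) / sqrt q"
    by (simp only: distrib_right times_divide_eq_right mult_1_right add_divide_distrib)
  thus ?thesis using a b c d e' by linarith
qed

definition full where "full y = y(Suc (Suc m) := bar (y (Suc m)) (centre y))"

text \<open>The barycentric coordinates of the extra point with respect to the m + 2 points of a
  tuple.\<close>

definition co where "co i = (if i \<le> m then cf i else s)"

lemma co_K: "co \<in> {..Suc m} \<rightarrow> K"
  using cf_K s by (auto simp: co_def)

lemma atMost_Suc_m: "{..Suc m} = insert (Suc m) {..m}" by auto

lemma co_sum: "finsum R co {..Suc m} = \<one>"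
proof -
  have "finsum R co {..Suc m} = co (Suc m) \<oplus> finsum R co {..m}"
    unfolding atMost_Suc_m by (rule R.finsum_insert) (use co_K in auto)
  moreover have "finsum R co {..m} = finsum R (\<lambda>j. A \<otimes> lam j) {..m}"
    by (rule R.finsum_cong') (use lam A in \<open>auto simp: co_def cf_def Pi_iff\<close>)
  moreover have "finsum R (\<lambda>j. A \<otimes> lam j) {..m} = A" using finsum_smult[of "{..m}" lam A] lam A lam_sum by simp
  moreover have "co (Suc m) = s" by (simp add: co_def)
  ultimately show ?thesis using A by simp
qed

lemma lc_co: assumes y: "y \<in> {..Suc m} \<rightarrow> V" shows "lc {..Suc m} co y = bar (y (Suc m)) (centre y)"
proof -
  have "lc {..Suc m} co y = co (Suc m) \<odot>\<^bsub>M\<^esub> y (Suc m) \<oplus>\<^bsub>M\<^esub> lc {..m} co y"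
    unfolding atMost_Suc_m by (rule lc_insert) (use co_K y in auto)
  moreover have "lc {..m} co y = lc {..m} (\<lambda>j. A \<otimes> lam j) y"
    by (rule lc_cong) (use lam A y in \<open>auto simp: co_def cf_def Pi_iff\<close>)
  moreover have "lc {..m} (\<lambda>j. A \<otimes> lam j) y = A \<odot>\<^bsub>M\<^esub> centre y"
    unfolding centre_def by (rule lc_smult) (use lam A y in auto)
  moreover have "co (Suc m) = s" by (simp add: co_def)
  ultimately show ?thesis by (simp add: bar_def)
qed

lemma full_isometry:
  assumes y: "y \<in> tuples D" and ij: "i \<le> Suc (Suc m)" "j \<le> Suc (Suc m)"
  shows "sd (full y i) (full y j) = sd (full x i) (full x j)"
proof -
  have yV: "y \<in> {..Suc m} \<rightarrow> V" using y by (auto simp: tuples_def)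
  have d: "sd (y i) (y j) = sd (x i) (x j)" if "i \<in> {..Suc m}" "j \<in> {..Suc m}" for i j
    using y that by (simp add: tuples_def)
  have z: "sd (lc {..Suc m} co y) (y j) = sd (lc {..Suc m} co x) (x j)" if "j \<le> Suc m" for j
    by (rule sd_lc_eq) (use co_K co_sum yV x d that in auto)
  have V: "lc {..Suc m} co y \<in> V" "lc {..Suc m} co x \<in> V" using co_K yV x by auto
  have fy: "full y (Suc (Suc m)) = lc {..Suc m} co y" "full x (Suc (Suc m)) = lc {..Suc m} co x"
    using lc_co yV x by (auto simp: full_def)
  have fo: "full y i = y i" "full x i = x i" if "i \<le> Suc m" for i using that by (auto simp: full_def)
  have vV: "y i \<in> V" "x i \<in> V" if "i \<le> Suc m" for i using yV x that by auto
  consider "i \<le> Suc m" "j \<le> Suc m" | "i = Suc (Suc m)" "j \<le> Suc m" | "i \<le> Suc m" "j = Suc (Suc m)"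
    | "i = Suc (Suc m)" "j = Suc (Suc m)" using ij by linarith
  thus ?thesis
  proof cases
    case 1 thus ?thesis using d by (simp add: fo)
  next
    case 2 thus ?thesis using z by (simp add: fo fy)
  next
    case 3 thus ?thesis using z[of i] sd_comm[OF V(1) vV(1)] sd_comm[OF V(2) vV(2)] by (simp add: fo fy)
  next
    case 4 thus ?thesis using V by (simp add: fy)
  qed
qed

lemma Rel_trivial: assumes "card (Rel I y) = 1" "finite I" "y \<in> I \<rightarrow> V" "t \<in> I \<rightarrow> K" "finsum R t I = \<zero>" "lc I t y = \<zero>\<^bsub>M\<^esub>" "i \<in> I"
  shows "t i = \<zero>"
proof -
  have "lc I (restrict t I) y = lc I t y" by (rule lc_cong) (use assms in auto)
  moreover have "finsum R (restrict t I) I = finsum R t I" by (rule R.finsum_cong') (use assms in auto)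
  ultimately have "restrict t I \<in> Rel I y" using assms by (auto simp: Rel_def)
  moreover have "(\<lambda>i\<in>I. \<zero>) \<in> Rel I y" by (rule zero_Rel[OF assms(2,3)])
  ultimately have "restrict t I = (\<lambda>i\<in>I. \<zero>)" using assms(1) by (metis card_1_singletonE singletonD)
  from fun_cong[OF this, of i] show ?thesis using assms(7) by simp
qed

definition unitc where "unitc i j = (if j = i then \<one> else \<zero>)" for i j :: nat

lemma unitc: assumes "finite I" "i \<in> I" "y \<in> I \<rightarrow> V"
  shows "finsum R (unitc i) I = \<one>" "lc I (unitc i) y = y i" "unitc i \<in> I \<rightarrow> K"
proof -
  have e: "I = insert i (I - {i})" using assms by auto
  show K: "unitc i \<in> I \<rightarrow> K" by (auto simp: unitc_def)
  have "finsum R (unitc i) (insert i (I - {i})) = unitc i i \<oplus> finsum R (unitc i) (I - {i})"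
    by (rule R.finsum_insert) (use assms in \<open>auto simp: unitc_def\<close>)
  moreover have "finsum R (unitc i) (I - {i}) = \<zero>"
    by (rule R.add.finprod_one_eqI) (auto simp: unitc_def)
  ultimately show "finsum R (unitc i) I = \<one>" using e by (simp add: unitc_def)
  have "lc (insert i (I - {i})) (unitc i) y = unitc i i \<odot>\<^bsub>M\<^esub> y i \<oplus>\<^bsub>M\<^esub> lc (I - {i}) (unitc i) y"
    by (rule lc_insert) (use assms in \<open>auto simp: unitc_def\<close>)
  moreover have "lc (I - {i}) (unitc i) y = \<zero>\<^bsub>M\<^esub>"
    by (rule lc_zero) (use assms in \<open>auto simp: unitc_def\<close>)
  moreover have "y i \<in> V" using assms by auto
  ultimately show "lc I (unitc i) y = y i" using e by (simp add: unitc_def)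
qed

text \<open>Distances do not separate points, since nonzero vectors may have length zero. Affine
  independence does: barycentric coordinates are unique, and the extra point has two nonzero ones,
  at m and at Suc m, unlike any point of the tuple.\<close>

lemma full_inj: assumes y: "y \<in> tuples D" shows "inj_on (full y) {..Suc (Suc m)}"
proof -
  have yV: "y \<in> {..Suc m} \<rightarrow> V" using y by (auto simp: tuples_def)
  have e: "{..<Suc (Suc m)} = {..Suc m}" by auto
  have R1: "card (Rel {..Suc m} y) = 1" using y unfolding tuples_def e by simp
  have tr: "t i = u i" if t: "t \<in> {..Suc m} \<rightarrow> K" "u \<in> {..Suc m} \<rightarrow> K" "finsum R t {..Suc m} = \<one>" "finsum R u {..Suc m} = \<one>"
      "lc {..Suc m} t y = lc {..Suc m} u y" "i \<le> Suc m" for t u i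
  proof -
    have "finsum R (\<lambda>i. t i \<ominus> u i) {..Suc m} = \<zero>"
      using finsum_diff[of "{..Suc m}" t u] t by (simp add: a_minus_def R.r_neg)
    moreover have "lc {..Suc m} u y \<in> V" using t yV by auto
    hence "lc {..Suc m} (\<lambda>i. t i \<ominus> u i) y = \<zero>\<^bsub>M\<^esub>"
      using lc_diff[of "{..Suc m}" t u y] t yV by (simp add: a_minus_def M.r_neg)
    ultimately have "t i \<ominus> u i = \<zero>"
      by (intro Rel_trivial[OF R1, of "\<lambda>i. t i \<ominus> u i"]) (use t yV in \<open>auto simp: Pi_iff\<close>)
    moreover have "t i \<in> K" "u i \<in> K" using t by auto
    ultimately show ?thesis by simp
  qed
  have inj: "i = j" if ij: "i \<le> Suc m" "j \<le> Suc m" and eq: "y i = y j" for i j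
  proof (rule ccontr)
    assume ne: "i \<noteq> j"
    note ui = unitc[of "{..Suc m}" i y] and uj = unitc[of "{..Suc m}" j y]
    have "unitc i i = unitc j i"
      by (rule tr) (use ui uj ij yV eq in auto)
    thus False using ne by (simp add: unitc_def)
  qed
  have zn: "bar (y (Suc m)) (centre y) \<noteq> y i" if i: "i \<le> Suc m" for i
  proof
    assume eq: "bar (y (Suc m)) (centre y) = y i"
    note ui = unitc[of "{..Suc m}" i y]
    have h: "co j = unitc i j" if "j \<le> Suc m" for j
      by (rule tr) (use ui i yV eq co_K co_sum lc_co[OF yV] that in auto)
    have lm: "lam m \<in> K" using lam by auto
    have "co m \<noteq> \<zero>" using A lm lam_m integral[of A "lam m"] by (auto simp: co_def cf_def)
    moreover have "co (Suc m) \<noteq> \<zero>" using s by (simp add: co_def)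
    ultimately have "unitc i m \<noteq> \<zero>" "unitc i (Suc m) \<noteq> \<zero>" using h[of m] h[of "Suc m"] by auto
    thus False by (auto simp: unitc_def split: if_splits)
  qed
  show ?thesis
  proof (rule inj_onI)
    fix i j assume h: "i \<in> {..Suc (Suc m)}" "j \<in> {..Suc (Suc m)}" "full y i = full y j"
    consider "i \<le> Suc m" "j \<le> Suc m" | "i = Suc (Suc m)" "j \<le> Suc m" | "i \<le> Suc m" "j = Suc (Suc m)"
      | "i = Suc (Suc m)" "j = Suc (Suc m)" using h by force
    thus "i = j"
    proof cases
      case 1 thus ?thesis using inj[of i j] h by (simp add: full_def)
    next
      case 2 thus ?thesis using zn[of j] h by (auto simp: full_def)
    next
      case 3 thus ?thesis using zn[of i] h by (auto simp: full_def)
    qed simp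
  qed
qed

lemma full_mem: assumes "y \<in> tuples D" "i \<le> Suc (Suc m)" shows "full y i \<in> D"
  using assms by (cases "i = Suc (Suc m)") (auto simp: tuples_def good_def full_def)

end

section \<open>Additive characters\<close>

context field begin

primrec numer :: "nat \<Rightarrow> 'a" where
  "numer 0 = \<zero>" | "numer (Suc n) = numer n \<oplus> \<one>"

lemma numer_closed [simp, intro]: "numer n \<in> carrier R"
  by (induction n) auto

lemma numer_add: "numer (a + b) = numer a \<oplus> numer b"
  by (induction b) (auto simp: a_assoc)

lemma numer_mult: "numer (a * b) = numer a \<otimes> numer b"
  by (induction b) (auto simp: numer_add r_distr a_comm)

lemma numer_diff: assumes "numer a = numer b" "a \<le> b" shows "numer (b - a) = \<zero>"
proof -
  have "numer a \<oplus> numer (b - a) = numer a" using numer_add[of a "b - a"] assms by simp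
  hence "\<ominus> numer a \<oplus> (numer a \<oplus> numer (b - a)) = \<ominus> numer a \<oplus> numer a" by simp
  thus ?thesis by (simp add: r_neg1 l_neg)
qed

text \<open>By Lagrange the order 2c + 1 of the additive group annihilates one, whereas in
  characteristic two it would act as one.\<close>

lemma numer_odd_order: assumes "finite (carrier R)" "odd (card (carrier R))" shows "\<one> \<oplus> \<one> \<noteq> \<zero>"
proof
  assume two: "\<one> \<oplus> \<one> = \<zero>"
  have n: "numer n = \<one> [^]\<^bsub>add_monoid R\<^esub> n" for n
    by (induction n) (auto simp: nat_pow_def)
  have "\<one> [^]\<^bsub>add_monoid R\<^esub> order (add_monoid R) = \<one>\<^bsub>add_monoid R\<^esub>"
    by (rule group.pow_order_eq_1[OF add.is_group]) auto
  hence "numer (card (carrier R)) = \<zero>" unfolding n by (simp add: order_def)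
  moreover obtain c where "card (carrier R) = 2 * c + 1" using assms(2) by (elim oddE)
  moreover have "numer 2 = \<zero>" using two by (simp add: numeral_2_eq_2)
  hence "numer (2 * c) = \<zero>" by (simp add: numer_mult)
  ultimately have "\<one> = \<zero>" by (simp add: numer_add)
  thus False by simp
qed

text \<open>A maximal additive subgroup \<open>H\<close> avoiding \<open>\<one>\<close> is a complement of the prime field, so a
  nontrivial character of the prime field extends to a character vanishing on \<open>H\<close>.\<close>

lemma exists_character:
  assumes fin: "finite (carrier R)"
  shows "\<exists>e :: 'a \<Rightarrow> complex. (\<forall>x\<in>carrier R. \<forall>y\<in>carrier R. e (x \<oplus> y) = e x * e y) \<and>
     (\<forall>x\<in>carrier R. norm (e x) = 1) \<and> (\<exists>x\<in>carrier R. e x \<noteq> 1)"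
proof -
  let ?K = "carrier R"
  define sub where "sub H \<longleftrightarrow> H \<subseteq> ?K \<and> \<zero> \<in> H \<and> (\<forall>a\<in>H. \<forall>b\<in>H. a \<oplus> b \<in> H) \<and> (\<forall>a\<in>H. \<ominus> a \<in> H)" for H
  define Z where "Z = range numer"
  have ZK: "Z \<subseteq> ?K" by (auto simp: Z_def)
  have fZ: "finite Z" using ZK fin finite_subset by blast
  have Zadd: "a \<oplus> b \<in> Z" if "a \<in> Z" "b \<in> Z" for a b
    using that by (auto simp: Z_def simp flip: numer_add)
  have Zmult: "a \<otimes> b \<in> Z" if "a \<in> Z" "b \<in> Z" for a b
    using that by (auto simp: Z_def simp flip: numer_mult)
  have Z0: "\<zero> \<in> Z" unfolding Z_def by (rule range_eqI[of _ _ 0]) simp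
  have Z1: "\<one> \<in> Z" unfolding Z_def by (rule range_eqI[of _ _ 1]) simp
  have Zneg: "\<ominus> z \<in> Z" if z: "z \<in> Z" for z
  proof -
    have "inj_on (\<lambda>w. z \<oplus> w) Z" using z ZK by (intro inj_onI) (metis r_neg1 subsetD)
    moreover have "(\<lambda>w. z \<oplus> w) ` Z \<subseteq> Z" using Zadd z by auto
    ultimately have "(\<lambda>w. z \<oplus> w) ` Z = Z" using fZ by (intro endo_inj_surj)
    then obtain w where w: "w \<in> Z" "z \<oplus> w = \<zero>" using Z0 by (metis imageE)
    have "z \<in> ?K" "w \<in> ?K" using w z ZK by auto
    hence "\<ominus> z = w" using w a_comm[of w z] by (intro minus_equality) auto
    thus ?thesis using w by simp
  qed
  have Zinv: "\<exists>w\<in>Z. w \<otimes> z = \<one>" if z: "z \<in> Z" "z \<noteq> \<zero>" for z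
  proof -
    have zK: "z \<in> ?K" using z ZK by auto
    have "inj_on (\<lambda>w. z \<otimes> w) Z" using z zK ZK by (intro inj_onI) (metis m_lcancel subsetD)
    moreover have "(\<lambda>w. z \<otimes> w) ` Z \<subseteq> Z" using Zmult z by auto
    ultimately have "(\<lambda>w. z \<otimes> w) ` Z = Z" using fZ by (intro endo_inj_surj)
    then obtain w where "w \<in> Z" "z \<otimes> w = \<one>" using Z1 by (metis imageE)
    thus ?thesis using zK ZK m_comm by (metis subsetD)
  qed
  have "finite {H. sub H \<and> \<one> \<notin> H}"
    by (rule finite_subset[of _ "Pow ?K"]) (use fin in \<open>auto simp: sub_def\<close>)
  moreover have "{\<zero>} \<in> {H. sub H \<and> \<one> \<notin> H}" by (auto simp: sub_def)
  ultimately obtain H where H: "sub H" "\<one> \<notin> H" and max: "\<And>H'. sub H' \<Longrightarrow> \<one> \<notin> H' \<Longrightarrow> H \<subseteq> H' \<Longrightarrow> H' = H"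
    using finite_has_maximal[of "{H. sub H \<and> \<one> \<notin> H}"] by blast
  have HK: "H \<subseteq> ?K" and H0: "\<zero> \<in> H" and Hadd: "\<And>a b. a \<in> H \<Longrightarrow> b \<in> H \<Longrightarrow> a \<oplus> b \<in> H" and Hneg: "\<And>a. a \<in> H \<Longrightarrow> \<ominus> a \<in> H"
    using H(1) by (auto simp: sub_def)
  have Hmul: "z \<otimes> h \<in> H" if z: "z \<in> Z" and h: "h \<in> H" for z h
  proof -
    have hK: "h \<in> ?K" using HK h by auto
    have "numer n \<otimes> h \<in> H" for n
    proof (induction n)
      case (Suc n)
      have "numer (Suc n) \<otimes> h = numer n \<otimes> h \<oplus> h" using hK by (simp add: l_distr)
      thus ?case using Suc h Hadd by simp
    qed (use hK H0 in simp)
    thus ?thesis using z by (auto simp: Z_def)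
  qed
  have ZH: "z = \<zero>" if "z \<in> Z" "z \<in> H" for z
    using Zinv[OF that(1)] Hmul[OF _ that(2)] H(2) by (metis that(2))
  have cover: "\<exists>n. x \<ominus> numer n \<in> H" if x: "x \<in> ?K" for x
  proof (cases "x \<in> H")
    case True
    have "x \<ominus> numer 0 = x" using x by (simp add: a_minus_def)
    thus ?thesis using True by metis
  next
    case False
    \<comment> \<open>The subgroup generated by \<open>H\<close> and the multiples of x from the
      prime field. By maximality it contains one, and inverting the coefficient of x, which cannot
      be zero, solves for x modulo \<open>H\<close>.\<close>
    define H' where "H' = {h \<oplus> z \<otimes> x | h z. h \<in> H \<and> z \<in> Z}"
    have "sub H'" unfolding sub_def
    proof (intro conjI ballI)
      show "H' \<subseteq> ?K" using HK ZK x by (auto simp: H'_def)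
      show "\<zero> \<in> H'" unfolding H'_def using H0 Z0 x by force
      fix a b assume "a \<in> H'" "b \<in> H'"
      then obtain h z h' z' where a: "a = h \<oplus> z \<otimes> x" "h \<in> H" "z \<in> Z" and b: "b = h' \<oplus> z' \<otimes> x" "h' \<in> H" "z' \<in> Z"
        by (auto simp: H'_def)
      have K: "h \<in> ?K" "z \<in> ?K" "h' \<in> ?K" "z' \<in> ?K" using a b HK ZK by auto
      have "a \<oplus> b = (h \<oplus> h') \<oplus> (z \<oplus> z') \<otimes> x" unfolding a b using K x by algebra
      thus "a \<oplus> b \<in> H'" unfolding H'_def using Hadd Zadd a b by blast
    next
      fix a assume "a \<in> H'"
      then obtain h z where a: "a = h \<oplus> z \<otimes> x" "h \<in> H" "z \<in> Z" by (auto simp: H'_def)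
      have K: "h \<in> ?K" "z \<in> ?K" using a HK ZK by auto
      have "\<ominus> a = \<ominus> h \<oplus> (\<ominus> z) \<otimes> x" unfolding a using K x by algebra
      thus "\<ominus> a \<in> H'" unfolding H'_def using Hneg Zneg a by blast
    qed
    moreover have "H \<subseteq> H'"
    proof
      fix h assume h: "h \<in> H"
      have "h = h \<oplus> \<zero> \<otimes> x" using h HK x by auto
      thus "h \<in> H'" unfolding H'_def using h Z0 by blast
    qed
    moreover have "x \<in> H'"
    proof -
      have "x = \<zero> \<oplus> \<one> \<otimes> x" using x by simp
      thus ?thesis unfolding H'_def using H0 Z1 by blast
    qed
    ultimately have "\<one> \<in> H'" using max False by metis
    then obtain h z where hz: "\<one> = h \<oplus> z \<otimes> x" "h \<in> H" "z \<in> Z" by (auto simp: H'_def)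
    have K: "h \<in> ?K" "z \<in> ?K" using hz HK ZK by auto
    have "z \<noteq> \<zero>" using hz H(2) K x by auto
    then obtain w where w: "w \<in> Z" "w \<otimes> z = \<one>" using Zinv hz by blast
    have wK: "w \<in> ?K" using w ZK by auto
    have "w = w \<otimes> h \<oplus> x"
    proof -
      have "w = w \<otimes> \<one>" using wK by simp
      also have "\<dots> = w \<otimes> (h \<oplus> z \<otimes> x)" by (rule arg_cong[OF hz(1)])
      also have "\<dots> = w \<otimes> h \<oplus> (w \<otimes> z) \<otimes> x" using wK K x by algebra
      finally show ?thesis using w x by simp
    qed
    hence "x \<ominus> w = x \<ominus> (w \<otimes> h \<oplus> x)" by simp
    also have "\<dots> = \<ominus> (w \<otimes> h)" using wK K x by algebra
    finally have "x \<ominus> w \<in> H" using Hneg Hmul w hz by simp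
    thus ?thesis using w by (auto simp: Z_def)
  qed
  have period: "\<exists>p>0. numer p = \<zero>"
  proof -
    have "\<not> inj numer" using fZ infinite_UNIV_nat finite_imageD unfolding Z_def by blast
    then obtain a b where "numer a = numer b" "a \<noteq> b" by (auto simp: inj_def)
    then obtain a b where ab: "numer a = numer b" "a < b" by (metis linorder_neqE_nat)
    thus ?thesis using ab numer_diff[of a b] by (intro exI[of _ "b - a"]) auto
  qed
  define p where "p = (LEAST p. p > 0 \<and> numer p = \<zero>)"
  have p: "p > 0" "numer p = \<zero>" using LeastI_ex[OF period] by (auto simp: p_def)
  have pmin: "n = 0" if "n < p" "numer n = \<zero>" for n
    using not_less_Least[of n "\<lambda>p. p > 0 \<and> numer p = \<zero>"] that by (auto simp: p_def)
  have p2: "p \<noteq> 1" using p by auto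
  define c where "c n = cis (2 * pi * (real n / real p))" for n
  have c_add: "c (a + b) = c a * c b" for a b
    by (simp add: c_def cis_mult algebra_simps add_divide_distrib)
  have c_p: "c (p * k) = 1" for k
    unfolding c_def using p by (simp add: cis_multiple_2pi)
  have c_eq: "c a = c b" if ab: "numer a = numer b" "a \<le> b" for a b
  proof -
    have 0: "numer (b - a) = \<zero>" by (rule numer_diff[OF ab])
    have "numer (b - a) = numer (p * ((b - a) div p)) \<oplus> numer ((b - a) mod p)"
      by (simp flip: numer_add)
    also have "\<dots> = numer ((b - a) mod p)" using p by (simp add: numer_mult)
    finally have "(b - a) mod p = 0" using 0 p by (intro pmin) auto
    then obtain k where "b - a = p * k" by (auto elim: dvdE)
    hence "b = a + p * k" using ab by simp
    thus ?thesis by (simp add: c_add c_p)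
  qed
  \<comment> \<open>The representative is not unique. Two of them differ by an element of the prime
    field in \<open>H\<close>, that is by zero, so the value of the character does not depend on the
    choice.\<close>
  define n where "n x = (SOME n. x \<ominus> numer n \<in> H)" for x
  have n: "x \<ominus> numer (n x) \<in> H" if "x \<in> ?K" for x
    unfolding n_def by (rule someI_ex[OF cover[OF that]])
  have c_n: "c (n x) = c a" if x: "x \<in> ?K" "x \<ominus> numer a \<in> H" for x a
  proof -
    have "(x \<ominus> numer a) \<oplus> \<ominus> (x \<ominus> numer (n x)) \<in> H" using n x Hadd Hneg by blast
    moreover have "(x \<ominus> numer a) \<oplus> \<ominus> (x \<ominus> numer (n x)) = numer (n x) \<ominus> numer a"
      using x numer_closed[of a] numer_closed[of "n x"] by algebra
    ultimately have "numer (n x) \<ominus> numer a \<in> H" by simp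
    moreover have "numer (n x) \<ominus> numer a \<in> Z" unfolding a_minus_def using Zneg Zadd by (auto simp: Z_def)
    ultimately have "numer (n x) \<ominus> numer a = \<zero>" by (intro ZH)
    hence eq: "numer (n x) = numer a" by simp
    show ?thesis
    proof (cases "n x \<le> a")
      case True
      show ?thesis by (rule c_eq[OF eq True])
    next
      case False
      show ?thesis by (rule c_eq[OF eq[symmetric], symmetric]) (use False in simp)
    qed
  qed
  have "c (n (x \<oplus> y)) = c (n x) * c (n y)" if xy: "x \<in> ?K" "y \<in> ?K" for x y
  proof -
    have "(x \<ominus> numer (n x)) \<oplus> (y \<ominus> numer (n y)) \<in> H" using n xy Hadd by blast
    moreover have "(x \<ominus> numer (n x)) \<oplus> (y \<ominus> numer (n y)) = (x \<oplus> y) \<ominus> numer (n x + n y)"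
      unfolding numer_add using xy numer_closed[of "n x"] numer_closed[of "n y"] by algebra
    ultimately have "c (n (x \<oplus> y)) = c (n x + n y)" using xy by (intro c_n) auto
    thus ?thesis by (simp add: c_add)
  qed
  moreover have "norm (c (n x)) = 1" for x by (simp add: c_def)
  moreover have "c (n \<one>) \<noteq> 1"
  proof -
    have "\<one> \<ominus> numer 1 = \<zero>" by (simp add: a_minus_def r_neg)
    hence "\<one> \<ominus> numer 1 \<in> H" using H0 by (simp only:)
    hence "c (n \<one>) = c 1" by (rule c_n[OF one_closed])
    moreover have "c 1 \<noteq> 1"
    proof
      assume "c 1 = 1"
      hence "cos (2 * pi * (1 / real p)) = 1" unfolding c_def by (simp add: complex_eq_iff)
      then obtain i :: int where "2 * pi * (1 / real p) = of_int i * 2 * pi" using cos_one_2pi_int by auto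
      hence "(2 * pi) * (1 / real p) = (2 * pi) * of_int i" by (simp only: mult_ac)
      hence "1 / real p = of_int i" by (subst (asm) mult_left_cancel) auto
      hence "1 = real p * of_int i" using p by (simp add: field_simps)
      hence "1 = int p * i" by (metis of_int_1 of_int_eq_iff of_int_mult of_int_of_nat_eq)
      hence "int p dvd 1" by (metis dvd_triv_left)
      thus False using p2 by simp
    qed
    ultimately show ?thesis by simp
  qed
  ultimately show ?thesis
    by (intro exI[of _ "\<lambda>x. c (n x)"]) auto
qed

end

section \<open>Coordinate spaces as quadratic spaces\<close>

lemma card_coord_space: assumes "field F" "finite (carrier F)"
  shows "card (carrier (coord_space F d)) = card (carrier F) ^ d" "finite (carrier (coord_space F d))"
  unfolding carrier_coord_space[OF assms(1)] using assms(2) by (auto simp: card_PiE intro: finite_PiE)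

lemma dot_closed: assumes "field F" "x \<in> {..<d} \<rightarrow> carrier F" "y \<in> {..<d} \<rightarrow> carrier F" shows "dot F d x y \<in> carrier F"
proof -
  interpret field F by fact
  show ?thesis unfolding dot_def by (rule finsum_closed) (use assms in auto)
qed

lemma coord_ops: assumes "field F"
  shows "x \<in> carrier (coord_space F d) \<Longrightarrow> y \<in> carrier (coord_space F d) \<Longrightarrow> x \<oplus>\<^bsub>coord_space F d\<^esub> y = (\<lambda>j\<in>{..<d}. x j \<oplus>\<^bsub>F\<^esub> y j)"
    "c \<odot>\<^bsub>coord_space F d\<^esub> x = (\<lambda>j\<in>{..<d}. c \<otimes>\<^bsub>F\<^esub> x j)" "\<zero>\<^bsub>coord_space F d\<^esub> = (\<lambda>j\<in>{..<d}. \<zero>\<^bsub>F\<^esub>)"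
proof -
  interpret field F by fact
  show "x \<oplus>\<^bsub>coord_space F d\<^esub> y = (\<lambda>j\<in>{..<d}. x j \<oplus>\<^bsub>F\<^esub> y j)" "c \<odot>\<^bsub>coord_space F d\<^esub> x = (\<lambda>j\<in>{..<d}. c \<otimes>\<^bsub>F\<^esub> x j)"
    "\<zero>\<^bsub>coord_space F d\<^esub> = (\<lambda>j\<in>{..<d}. \<zero>\<^bsub>F\<^esub>)"
    by (auto simp: coord_space_def func_space_def restrict_def)
qed

lemma bilin_space_coord_space:
  fixes F (structure)
  assumes F: "field F" "finite (carrier F)" "odd (card (carrier F))"
    and e: "\<And>x y. x \<in> carrier F \<Longrightarrow> y \<in> carrier F \<Longrightarrow> e (x \<oplus>\<^bsub>F\<^esub> y) = e x * e y"
      "\<And>x. x \<in> carrier F \<Longrightarrow> norm (e x) = (1::real)" "\<exists>x\<in>carrier F. e x \<noteq> 1"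
  shows "bilin_space F (coord_space F d) (dot F d) e"
proof -
  interpret field F by fact
  interpret M: vectorspace F "coord_space F d" by (rule vectorspace_coord_space[OF F(1)])
  let ?V = "carrier (coord_space F d)"
  have V: "x \<in> ?V \<longleftrightarrow> x \<in> PiE {..<d} (\<lambda>_. carrier F)" for x by (simp add: carrier_coord_space[OF F(1)])
  have Vi: "x j \<in> carrier F" if "x \<in> ?V" "j < d" for x j using that by (auto simp: V)
  show ?thesis
  proof (unfold_locales)
    show "finite (carrier F)" "finite ?V" using F card_coord_space by auto
    show "\<one> \<oplus> \<one> \<noteq> \<zero>" by (rule numer_odd_order[OF F(2,3)])
    fix x y assume xy: "x \<in> ?V" "y \<in> ?V"
    show "dot F d x y \<in> carrier F" by (rule dot_closed[OF F(1)]) (use xy Vi in auto)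
    show "dot F d x y = dot F d y x" unfolding dot_def
      by (rule finsum_cong') (use xy Vi m_comm in auto)
    fix z assume z: "z \<in> ?V"
    have "dot F d (x \<oplus>\<^bsub>coord_space F d\<^esub> y) z = finsum F (\<lambda>j. x j \<otimes> z j \<oplus> y j \<otimes> z j) {..<d}"
      unfolding dot_def by (rule finsum_cong') (use xy z Vi in \<open>auto simp: coord_ops[OF F(1)] l_distr\<close>)
    also have "\<dots> = dot F d x z \<oplus> dot F d y z"
      unfolding dot_def by (rule finsum_addf) (use xy z Vi in auto)
    finally show "dot F d (x \<oplus>\<^bsub>coord_space F d\<^esub> y) z = dot F d x z \<oplus> dot F d y z" .
  next
    fix a x y assume h: "a \<in> carrier F" "x \<in> ?V" "y \<in> ?V"
    have "dot F d (a \<odot>\<^bsub>coord_space F d\<^esub> x) y = finsum F (\<lambda>j. a \<otimes> (x j \<otimes> y j)) {..<d}"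
      unfolding dot_def by (rule finsum_cong') (use h Vi in \<open>auto simp: coord_ops[OF F(1)] m_assoc\<close>)
    also have "\<dots> = a \<otimes> dot F d x y"
      unfolding dot_def by (rule finsum_rdistr[symmetric]) (use h Vi in auto)
    finally show "dot F d (a \<odot>\<^bsub>coord_space F d\<^esub> x) y = a \<otimes> dot F d x y" .
  next
    fix x assume x: "x \<in> ?V" and h: "\<And>y. y \<in> ?V \<Longrightarrow> dot F d x y = \<zero>"
    have "x i = \<zero>" if i: "i < d" for i
    proof -
      let ?u = "\<lambda>j\<in>{..<d}. if j = i then \<one> else \<zero>"
      have u: "?u \<in> ?V" by (auto simp: V)
      have "dot F d x ?u = finsum F (\<lambda>j. if i = j then x j else \<zero>) {..<d}"
        unfolding dot_def by (rule finsum_cong') (use x Vi in auto)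
      also have "\<dots> = x i" by (rule finsum_singleton) (use i x Vi in auto)
      finally show ?thesis using h[OF u] by simp
    qed
    thus "x = \<zero>\<^bsub>coord_space F d\<^esub>" using x unfolding coord_ops(3)[OF F(1)] by (auto simp: V PiE_def extensional_def fun_eq_iff)
  qed (use e in auto)
qed

section \<open>The paraboloid\<close>

locale coord_field =
  fixes F :: "'a ring" (structure) and e :: "'a \<Rightarrow> complex"
  assumes field: "field F" and fin: "finite (carrier F)" and odd_card: "odd (card (carrier F))"
    and e: "\<And>x y. x \<in> carrier F \<Longrightarrow> y \<in> carrier F \<Longrightarrow> e (x \<oplus> y) = e x * e y"
      "\<And>x. x \<in> carrier F \<Longrightarrow> norm (e x) = 1" "\<exists>x\<in>carrier F. e x \<noteq> 1"
begin

lemma bilin_coord: "bilin_space F (coord_space F n) (dot F n) e"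
  by (rule bilin_space_coord_space[OF field fin odd_card e])

abbreviation "W n \<equiv> carrier (coord_space F n)"

lemma W: "W n = PiE {..<n} (\<lambda>_. carrier F)" by (simp add: carrier_coord_space[OF field])

lemma W_restrict: assumes "v \<in> W n" shows "restrict (v(n := w)) {..<n} = v" "restrict v {..<n} = v"
  using assms by (auto simp: W PiE_def extensional_def fun_eq_iff)

lemma W_split: assumes "x \<in> W (Suc n)"
  shows "restrict x {..<n} \<in> W n" "x n \<in> carrier F" "x = (restrict x {..<n})(n := x n)"
  using assms by (auto simp: W PiE_def extensional_def Pi_iff less_Suc_eq fun_eq_iff)

lemma sum_W_Suc: "(\<Sum>x\<in>W (Suc n). g x) = (\<Sum>w\<in>carrier F. \<Sum>v\<in>W n. (g (v(n := w)) :: 'z::comm_monoid_add))"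
proof -
  have "(\<Sum>x\<in>W (Suc n). g x) = (\<Sum>x\<in>(\<lambda>(w, v). v(n := w)) ` (carrier F \<times> W n). g x)"
    unfolding W by (simp only: lessThan_Suc PiE_insert_eq)
  also have "\<dots> = (\<Sum>(w, v)\<in>carrier F \<times> W n. g (v(n := w)))"
    unfolding W by (subst sum.reindex[OF inj_combinator]) (auto intro!: sum.cong)
  also have "\<dots> = (\<Sum>w\<in>carrier F. \<Sum>v\<in>W n. g (v(n := w)))" by (rule sum.cartesian_product[symmetric])
  finally show ?thesis .
qed

lemma dot_Suc: assumes "v \<in> W n" "v' \<in> W n" "w \<in> carrier F" "w' \<in> carrier F"
  shows "dot F (Suc n) (v(n := w)) (v'(n := w')) = dot F n v v' \<oplus> w \<otimes> w'"
proof -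
  interpret field F by (rule field)
  have "dot F (Suc n) (v(n := w)) (v'(n := w')) = w \<otimes> w' \<oplus> finsum F (\<lambda>j. (v(n := w)) j \<otimes> (v'(n := w')) j) {..<n}"
    unfolding dot_def lessThan_Suc by (subst finsum_insert) (use assms in \<open>auto simp: W Pi_iff PiE_def\<close>)
  also have "finsum F (\<lambda>j. (v(n := w)) j \<otimes> (v'(n := w')) j) {..<n} = dot F n v v'"
    unfolding dot_def by (rule finsum_cong') (use assms in \<open>auto simp: W Pi_iff PiE_def\<close>)
  finally have "dot F (Suc n) (v(n := w)) (v'(n := w')) = w \<otimes> w' \<oplus> dot F n v v'" .
  moreover have "dot F n v v' \<in> carrier F" by (rule dot_closed[OF field]) (use assms in \<open>auto simp: W\<close>)
  ultimately show ?thesis using assms(3,4) a_comm by (simp only: m_closed)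
qed

lemma smult_Suc: assumes "v \<in> W n" "c \<in> carrier F"
  shows "c \<odot>\<^bsub>coord_space F (Suc n)\<^esub> (v(n := w)) = (c \<odot>\<^bsub>coord_space F n\<^esub> v)(n := c \<otimes> w)"
  unfolding coord_ops(2)[OF field] by (auto simp: fun_eq_iff)

text \<open>Functions on the paraboloid \<open>x n = dot (x 0, \<dots>, x (n - 1))\<close> in the space of dimension
  \<open>Suc n\<close>, normalised so that averages over the paraboloid become averages over the whole space.\<close>

definition para where
  "para n g x = (if x n = dot F n (restrict x {..<n}) (restrict x {..<n}) then real (card (carrier F)) * g (restrict x {..<n}) else 0)"

lemma para_Suc: "v \<in> W n \<Longrightarrow> para n g (v(n := w)) = (if w = dot F n v v then real (card (carrier F)) * g v else 0)"
  by (simp add: para_def W_restrict)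

lemma W_nonempty: "0 < card (carrier F)"
proof -
  interpret field F by (rule field)
  show ?thesis using fin one_closed by (auto simp: card_gt_0_iff)
qed

text \<open>Stated for any function supported on the graph, so that one lemma serves for the mean,
  the square and the product with a character.\<close>

lemma Ex_para:
  fixes h :: "(nat \<Rightarrow> 'a) \<Rightarrow> 'z::real_normed_field"
  assumes "\<And>v w. v \<in> W n \<Longrightarrow> w \<in> carrier F \<Longrightarrow> h (v(n := w)) = (if w = dot F n v v then of_nat (card (carrier F)) * g v else 0)"
  shows "bilin_space.Ex (coord_space F (Suc n)) h = bilin_space.Ex (coord_space F n) g"
proof -
  have d: "dot F n v v \<in> carrier F" if "v \<in> W n" for v
    by (rule dot_closed[OF field]) (use that in \<open>auto simp: W\<close>)
  have "(\<Sum>x\<in>W (Suc n). h x) = (\<Sum>w\<in>carrier F. \<Sum>v\<in>W n. if w = dot F n v v then of_nat (card (carrier F)) * g v else 0)"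
    unfolding sum_W_Suc by (intro sum.cong refl assms)
  also have "\<dots> = (\<Sum>v\<in>W n. \<Sum>w\<in>carrier F. if w = dot F n v v then of_nat (card (carrier F)) * g v else 0)"
    by (rule sum.swap)
  also have "\<dots> = (\<Sum>v\<in>W n. of_nat (card (carrier F)) * g v)"
    by (rule sum.cong) (use d fin in auto)
  finally have "(\<Sum>x\<in>W (Suc n). h x) = of_nat (card (carrier F)) * (\<Sum>v\<in>W n. g v)"
    by (simp add: sum_distrib_left)
  thus ?thesis
    using W_nonempty card_coord_space[OF field fin]
    by (simp add: bilin_space.Ex_def[OF bilin_coord])
qed

lemma ft_para:
  assumes \<xi>: "\<xi> \<in> W n" and t: "t \<in> carrier F"
  shows "bilin_space.ft (coord_space F (Suc n)) (dot F (Suc n)) e (\<lambda>x. complex_of_real (para n g x)) (\<xi>(n := t))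
    = bilin_space.qft F (coord_space F n) (dot F n) e g \<xi> t"
proof -
  interpret b: bilin_space F "coord_space F n" "dot F n" e by (rule bilin_coord)
  interpret b': bilin_space F "coord_space F (Suc n)" "dot F (Suc n)" e by (rule bilin_coord)
  show ?thesis unfolding b'.ft_def b.qft_def
  proof (rule Ex_para)
    fix v w assume v: "v \<in> W n" and w: "w \<in> carrier F"
    have d: "dot F n v v \<in> carrier F" "dot F n \<xi> v \<in> carrier F" using v \<xi> by auto
    show "complex_of_real (para n g (v(n := w))) * b'.\<psi> (\<xi>(n := t)) (v(n := w)) =
      (if w = dot F n v v then of_nat (card (carrier F)) * (complex_of_real (g v) * (b.\<psi> \<xi> v * e (t \<otimes> b.sq v))) else 0)"
      unfolding para_Suc[OF v] b'.\<psi>_def b.\<psi>_def dot_Suc[OF \<xi> v t w] using d t w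
      by (simp add: b.sq_def b.e_add)
  qed
qed

text \<open>At a frequency (\<xi>, t) with t nonzero the transform of the whole paraboloid is a
  Gauss sum; for t = 0 and \<xi> nonzero it is a complete character sum and vanishes. A function
  with values 0 and q on a set of density at most 1 / q has mean square at most q, which gives the
  value for \<open>Q\<close>.\<close>

lemma majorised_para:
  assumes D: "D \<subseteq> W n" and \<epsilon>: "0 < \<epsilon>0" "2 * (1 / sqrt (card (W n))) \<le> \<epsilon>0\<^sup>2"
  shows "majorised F (coord_space F (Suc n)) (dot F (Suc n)) e (para n (\<lambda>v. if v \<in> D then 1 else 0)) (para n (\<lambda>_. 1))
     (1 / sqrt (card (W n))) (card (carrier F)) \<epsilon>0"
proof -
  interpret b: bilin_space F "coord_space F n" "dot F n" e by (rule bilin_coord)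
  interpret b': bilin_space F "coord_space F (Suc n)" "dot F (Suc n)" e by (rule bilin_coord)
  show ?thesis
  proof (unfold_locales)
    show "b'.Ex (para n (\<lambda>_. 1)) = 1"
    proof -
      have "b'.Ex (para n (\<lambda>_. 1)) = b.Ex (\<lambda>_. 1)" by (rule Ex_para) (simp add: para_Suc)
      thus ?thesis by simp
    qed
    show "b'.Ex (\<lambda>x. (para n (\<lambda>v. if v \<in> D then 1 else 0) x)\<^sup>2) \<le> real (card (carrier F))"
    proof -
      have "b'.Ex (\<lambda>x. (para n (\<lambda>v. if v \<in> D then 1 else 0) x)\<^sup>2) = b.Ex (\<lambda>v. if v \<in> D then real (card (carrier F)) else 0)"
        by (rule Ex_para) (simp add: para_Suc power2_eq_square)
      also have "\<dots> \<le> b.Ex (\<lambda>_. real (card (carrier F)))" by (rule b.Ex_mono) simp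
      finally show ?thesis by (simp only: b.Ex_const)
    qed
    fix \<phi> assume \<phi>: "\<phi> \<in> W (Suc n)" "\<phi> \<noteq> \<zero>\<^bsub>coord_space F (Suc n)\<^esub>"
    define \<xi> where "\<xi> = restrict \<phi> {..<n}"
    define t where "t = \<phi> n"
    note split = W_split[OF \<phi>(1), folded \<xi>_def t_def]
    have \<xi>: "\<xi> \<in> W n" and t: "t \<in> carrier F" and eq: "\<phi> = \<xi>(n := t)" by (fact split)+
    show "norm (b'.ft (\<lambda>x. complex_of_real (para n (\<lambda>_. 1) x)) \<phi>) \<le> 1 / sqrt (card (W n))"
    proof (cases "t = \<zero>")
      case False
      have "b.qft (\<lambda>_. 1) \<xi> t = b.Ex (\<lambda>v. e (t \<otimes> b.sq v) * b.\<psi> \<xi> v)"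
        unfolding b.qft_def by (rule b.Ex_cong) (simp add: mult.commute)
      thus ?thesis unfolding eq ft_para[OF \<xi> t] using b.Ex_quadratic[OF t False \<xi>] by simp
    next
      case True
      have "\<xi> \<noteq> \<zero>\<^bsub>coord_space F n\<^esub>"
      proof
        assume "\<xi> = \<zero>\<^bsub>coord_space F n\<^esub>"
        hence "\<phi> = \<zero>\<^bsub>coord_space F (Suc n)\<^esub>" unfolding eq coord_ops(3)[OF field] using True by (auto simp: fun_eq_iff)
        thus False using \<phi> by simp
      qed
      hence "b.Ex (b.\<psi> \<xi>) = 0" using b.Ex_\<psi>[OF \<xi>] by simp
      moreover have "b.qft (\<lambda>_. 1) \<xi> t = b.Ex (b.\<psi> \<xi>)"
        unfolding b.qft_def by (rule b.Ex_cong) (simp add: True)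
      ultimately show ?thesis unfolding eq ft_para[OF \<xi> t] by simp
    qed
  qed (use \<epsilon> in \<open>auto simp: para_def\<close>)
qed

text \<open>By \<open>Lam_ft\<close> and \<open>ft_para\<close> both sides are the same sum over
  frequencies (\<xi>, t); the last coefficient -1 becomes the factor of the extra point.\<close>

lemma Lam_para:
  assumes c: "configuration F (coord_space F n) (dot F n) e m lam s x"
  shows "complex_of_real (bilin_space.Lam (coord_space F (Suc n)) (configuration.co F m lam s) (Suc m) (para n g))
    = configuration.T2 F (coord_space F n) (dot F n) e m lam s g"
proof -
  interpret c: configuration F "coord_space F n" "dot F n" e m lam s x by (rule c)
  interpret b': bilin_space F "coord_space F (Suc n)" "dot F (Suc n)" e by (rule bilin_coord)
  have co: "c.co \<in> {..Suc m} \<rightarrow> carrier F" by (rule c.co_K)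
  have coef: "c.coef c.co (Suc m) i \<in> carrier F" for i
    unfolding c.coef_def using co by auto
  have "complex_of_real (b'.Lam c.co (Suc m) (para n g)) = b'.Lam c.co (Suc m) (\<lambda>x. complex_of_real (para n g x))"
    by (rule b'.Lam_of_real[symmetric])
  also have "\<dots> = (\<Sum>\<phi>\<in>W (Suc n). \<Prod>i\<le>Suc (Suc m). b'.ft (\<lambda>x. complex_of_real (para n g x)) (c.coef c.co (Suc m) i \<odot>\<^bsub>coord_space F (Suc n)\<^esub> \<phi>))"
    by (rule b'.Lam_ft[OF co])
  also have "\<dots> = (\<Sum>t\<in>carrier F. \<Sum>\<xi>\<in>W n. \<Prod>i\<le>Suc (Suc m). b'.ft (\<lambda>x. complex_of_real (para n g x)) (c.coef c.co (Suc m) i \<odot>\<^bsub>coord_space F (Suc n)\<^esub> (\<xi>(n := t))))"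
    by (rule sum_W_Suc)
  also have "\<dots> = c.T2 g" unfolding c.T2_def
  proof (intro sum.cong refl)
    fix t \<xi> assume h: "t \<in> carrier F" "\<xi> \<in> W n"
    have "b'.ft (\<lambda>x. complex_of_real (para n g x)) (c.coef c.co (Suc m) i \<odot>\<^bsub>coord_space F (Suc n)\<^esub> (\<xi>(n := t)))
       = c.qft g (c.coef c.co (Suc m) i \<odot>\<^bsub>coord_space F n\<^esub> \<xi>) (c.coef c.co (Suc m) i \<otimes> t)" for i
      unfolding smult_Suc[OF h(2) coef] by (rule ft_para) (use coef h in auto)
    hence "(\<Prod>i\<le>Suc (Suc m). b'.ft (\<lambda>x. complex_of_real (para n g x)) (c.coef c.co (Suc m) i \<odot>\<^bsub>coord_space F (Suc n)\<^esub> (\<xi>(n := t))))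
       = (\<Prod>i\<le>Suc (Suc m). c.qft g (c.coef c.co (Suc m) i \<odot>\<^bsub>coord_space F n\<^esub> \<xi>) (c.coef c.co (Suc m) i \<otimes> t))" by simp
    also have "\<dots> = (\<Prod>i\<le>m. c.qft g (c.coef c.co (Suc m) i \<odot>\<^bsub>coord_space F n\<^esub> \<xi>) (c.coef c.co (Suc m) i \<otimes> t))
       * c.qft g (s \<odot>\<^bsub>coord_space F n\<^esub> \<xi>) (s \<otimes> t) * c.qft g (\<ominus>\<^bsub>coord_space F n\<^esub> \<xi>) (\<ominus> t)"
      using h by (simp add: c.coef_def c.co_def c.smult_l_minus c.l_minus)
    also have "(\<Prod>i\<le>m. c.qft g (c.coef c.co (Suc m) i \<odot>\<^bsub>coord_space F n\<^esub> \<xi>) (c.coef c.co (Suc m) i \<otimes> t))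
       = (\<Prod>j<Suc m. c.qft g (c.cf j \<odot>\<^bsub>coord_space F n\<^esub> \<xi>) (c.cf j \<otimes> t))"
      by (rule prod.cong) (auto simp: c.coef_def c.co_def)
    finally show "(\<Prod>i\<le>Suc (Suc m). b'.ft (\<lambda>x. complex_of_real (para n g x)) (c.coef c.co (Suc m) i \<odot>\<^bsub>coord_space F (Suc n)\<^esub> (\<xi>(n := t))))
      = c.qft g (\<ominus>\<^bsub>coord_space F n\<^esub> \<xi>) (\<ominus> t) * c.qft g (s \<odot>\<^bsub>coord_space F n\<^esub> \<xi>) (s \<otimes> t) *
       (\<Prod>j<Suc m. c.qft g (c.cf j \<odot>\<^bsub>coord_space F n\<^esub> \<xi>) (c.cf j \<otimes> t))"
      by (simp only: mult_ac)
  qed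
  finally show ?thesis .
qed

end

context bilin_space begin

section \<open>Relations among the points of a spherical set\<close>

lemma affine_relation:
  assumes X: "finite X" "X \<subseteq> V" "x0 \<in> X" and dep: "lin_dep ((\<lambda>x. x \<ominus>\<^bsub>M\<^esub> x0) ` (X - {x0}))"
  obtains c where "c \<in> X \<rightarrow> K" "finsum R c X = \<zero>" "lc X c (\<lambda>x. x) = \<zero>\<^bsub>M\<^esub>" "\<exists>x\<in>X. c x \<noteq> \<zero>"
proof -
  obtain A a v where A: "finite A" "A \<subseteq> (\<lambda>x. x \<ominus>\<^bsub>M\<^esub> x0) ` (X - {x0})" "a \<in> A \<rightarrow> K" "lincomb a A = \<zero>\<^bsub>M\<^esub>"
    "v \<in> A" "a v \<noteq> \<zero>" using dep unfolding lin_dep_def by blast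
  have x0: "x0 \<in> V" using X by auto
  define I where "I = {x \<in> X - {x0}. x \<ominus>\<^bsub>M\<^esub> x0 \<in> A}"
  define b where "b x = a (x \<ominus>\<^bsub>M\<^esub> x0)" for x
  have I: "finite I" "I \<subseteq> X" "x0 \<notin> I" "I \<subseteq> V" using X by (auto simp: I_def)
  have img: "(\<lambda>x. x \<ominus>\<^bsub>M\<^esub> x0) ` I = A" using A(2) by (auto simp: I_def)
  have inj: "inj_on (\<lambda>x. x \<ominus>\<^bsub>M\<^esub> x0) I"
  proof (rule inj_onI)
    fix x y assume h: "x \<in> I" "y \<in> I" "x \<ominus>\<^bsub>M\<^esub> x0 = y \<ominus>\<^bsub>M\<^esub> x0"
    hence "x \<oplus>\<^bsub>M\<^esub> \<ominus>\<^bsub>M\<^esub> x0 = y \<oplus>\<^bsub>M\<^esub> \<ominus>\<^bsub>M\<^esub> x0" "x \<in> V" "y \<in> V" using I(4) by (auto simp: a_minus_def)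
    thus "x = y" using x0 M.add.right_cancel[of "\<ominus>\<^bsub>M\<^esub> x0" x y] by simp
  qed
  have AV: "A \<subseteq> V" using A(2) X x0 by auto
  have b: "b \<in> I \<rightarrow> K" using A(3) by (auto simp: b_def I_def)
  have "\<zero>\<^bsub>M\<^esub> = finsum M (\<lambda>v. a v \<odot>\<^bsub>M\<^esub> v) ((\<lambda>x. x \<ominus>\<^bsub>M\<^esub> x0) ` I)"
    unfolding img A(4)[symmetric] lincomb_def ..
  also have "\<dots> = finsum M (\<lambda>x. b x \<odot>\<^bsub>M\<^esub> (x \<ominus>\<^bsub>M\<^esub> x0)) I"
    unfolding b_def by (rule M.finsum_reindex) (use inj AV A(3) img in auto)
  also have "\<dots> = lc I b (\<lambda>x. if x \<in> I then x \<oplus>\<^bsub>M\<^esub> (\<ominus>\<^bsub>M\<^esub> x0) else \<zero>\<^bsub>M\<^esub>)"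
    unfolding lc_def a_minus_def by (rule M.finsum_cong') (use I b x0 in \<open>auto simp: Pi_iff\<close>)
  also have "\<dots> = lc I b (\<lambda>x. x) \<oplus>\<^bsub>M\<^esub> finsum R b I \<odot>\<^bsub>M\<^esub> (\<ominus>\<^bsub>M\<^esub> x0)"
    by (rule lc_shift) (use I b x0 in auto)
  finally have rel: "lc I b (\<lambda>x. x) \<oplus>\<^bsub>M\<^esub> finsum R b I \<odot>\<^bsub>M\<^esub> (\<ominus>\<^bsub>M\<^esub> x0) = \<zero>\<^bsub>M\<^esub>" by simp
  \<comment> \<open>The base point x0 receives minus this sum as coefficient, which turns a linear
    relation of differences into an affine relation of points.\<close>
  define s where "s = finsum R b I"
  have s: "s \<in> K" unfolding s_def using b by (rule R.finsum_closed)
  define c where "c x = (if x \<in> I then b x else if x = x0 then \<ominus> s else \<zero>)" for x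
  have c: "c \<in> X \<rightarrow> K" using b s by (auto simp: c_def)
  have cI: "c \<in> I \<rightarrow> K" using c I by auto
  have sub: "insert x0 I \<subseteq> X" using X I by auto
  have "finsum R c X = finsum R c (insert x0 I)"
    by (rule R.add.finprod_mono_neutral_cong_right) (use X sub c in \<open>auto simp: c_def\<close>)
  also have "\<dots> = c x0 \<oplus> finsum R c I" by (rule R.finsum_insert) (use I c cI X in auto)
  also have "finsum R c I = s" unfolding s_def by (rule R.finsum_cong') (use b in \<open>auto simp: c_def\<close>)
  also have "c x0 \<oplus> s = \<zero>" using s I by (simp add: c_def R.l_neg)
  finally have 1: "finsum R c X = \<zero>" .
  have "lc X c (\<lambda>x. x) = lc (insert x0 I) c (\<lambda>x. x)"
    unfolding lc_def
  proof (rule M.add.finprod_mono_neutral_cong_right[OF X(1) sub])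
    show "(\<lambda>x. c x \<odot>\<^bsub>M\<^esub> x) \<in> X \<rightarrow> V" using c X by auto
    show "c x \<odot>\<^bsub>M\<^esub> x = \<zero>\<^bsub>M\<^esub>" if "x \<in> X - insert x0 I" for x using that X by (auto simp: c_def)
  qed auto
  also have "\<dots> = c x0 \<odot>\<^bsub>M\<^esub> x0 \<oplus>\<^bsub>M\<^esub> lc I c (\<lambda>x. x)" by (rule lc_insert) (use I c cI X in auto)
  also have "lc I c (\<lambda>x. x) = lc I b (\<lambda>x. x)" by (rule lc_cong) (use b I in \<open>auto simp: c_def\<close>)
  also have "c x0 \<odot>\<^bsub>M\<^esub> x0 = s \<odot>\<^bsub>M\<^esub> (\<ominus>\<^bsub>M\<^esub> x0)"
    using I s x0 by (simp add: c_def smult_l_minus smult_r_minus)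
  also have "s \<odot>\<^bsub>M\<^esub> (\<ominus>\<^bsub>M\<^esub> x0) \<oplus>\<^bsub>M\<^esub> lc I b (\<lambda>x. x) = \<zero>\<^bsub>M\<^esub>"
  proof -
    have "lc I b (\<lambda>x. x) \<in> V" using b I by auto
    thus ?thesis using rel s x0 unfolding s_def[symmetric] by (simp add: M.a_comm)
  qed
  finally have 2: "lc X c (\<lambda>x. x) = \<zero>\<^bsub>M\<^esub>" .
  obtain x where x: "x \<in> I" "x \<ominus>\<^bsub>M\<^esub> x0 = v" using A(5) img by auto
  hence "x \<in> X" "c x \<noteq> \<zero>" using A(6) I by (auto simp: c_def b_def)
  thus ?thesis using c 1 2 by (intro that) auto
qed

text \<open>As the coefficients sum to zero, a single nonzero one is impossible and two would force
  two distinct points to coincide. If all three pair sums vanished, twice a nonzero coefficient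
  would be zero. The pair with nonzero sum is needed to make s different from one.\<close>

lemma relation_support:
  assumes X: "finite X" "X \<subseteq> V" and c: "c \<in> X \<rightarrow> K" "finsum R c X = \<zero>" "lc X c (\<lambda>x. x) = \<zero>\<^bsub>M\<^esub>" "\<exists>x\<in>X. c x \<noteq> \<zero>"
  obtains u v w where "{u, v, w} \<subseteq> X" "u \<noteq> v" "u \<noteq> w" "v \<noteq> w" "c u \<noteq> \<zero>" "c v \<noteq> \<zero>" "c w \<noteq> \<zero>" "c v \<oplus> c w \<noteq> \<zero>"
proof -
  define S where "S = {x \<in> X. c x \<noteq> \<zero>}"
  have S: "finite S" "S \<subseteq> X" using X by (auto simp: S_def)
  have sum: "finsum R c S = \<zero>"
  proof -
    have "finsum R c X = finsum R c S"
      by (rule R.add.finprod_mono_neutral_cong_right) (use X c in \<open>auto simp: S_def\<close>)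
    thus ?thesis using c by simp
  qed
  have lin: "lc S c (\<lambda>x. x) = \<zero>\<^bsub>M\<^esub>"
  proof -
    have "lc X c (\<lambda>x. x) = lc S c (\<lambda>x. x)" unfolding lc_def
    proof (rule M.add.finprod_mono_neutral_cong_right[OF X(1) S(2)])
      show "(\<lambda>x. c x \<odot>\<^bsub>M\<^esub> x) \<in> X \<rightarrow> V" using c X by auto
      show "c x \<odot>\<^bsub>M\<^esub> x = \<zero>\<^bsub>M\<^esub>" if "x \<in> X - S" for x using that X by (auto simp: S_def)
    qed auto
    thus ?thesis using c by simp
  qed
  have cK: "c x \<in> K" "x \<in> V" if "x \<in> S" for x using that c X by (auto simp: S_def)
  obtain u where u: "u \<in> S" using c(4) by (auto simp: S_def)
  have "S \<noteq> {u}"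
  proof
    assume "S = {u}"
    hence "c u = \<zero>" using sum u cK by simp
    thus False using u by (simp add: S_def)
  qed
  then obtain v where v: "v \<in> S" "v \<noteq> u" using u by auto
  have "S \<noteq> {u, v}"
  proof
    assume S2: "S = {u, v}"
    have z: "c u \<oplus> c v = \<zero>" using sum v u cK unfolding S2 by simp
    hence cu: "c v = \<ominus> c u" using cK[OF u] cK[OF v(1)] by (metis R.minus_equality R.a_comm)
    have "c u \<odot>\<^bsub>M\<^esub> u \<oplus>\<^bsub>M\<^esub> c v \<odot>\<^bsub>M\<^esub> v = \<zero>\<^bsub>M\<^esub>" using lin v u cK unfolding S2 lc_def by simp
    hence "c u \<odot>\<^bsub>M\<^esub> (u \<ominus>\<^bsub>M\<^esub> v) = \<zero>\<^bsub>M\<^esub>"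
      using cK[OF u] cK[OF v(1)] unfolding cu by (simp add: a_minus_def smult_r_distr smult_l_minus smult_r_minus)
    hence "u \<ominus>\<^bsub>M\<^esub> v = \<zero>\<^bsub>M\<^esub>" using cK[OF u] cK[OF v(1)] u bij_smult[of "c u"]
      by (auto simp: S_def bij_betw_def inj_on_def)
    thus False using cK[OF u] cK[OF v(1)] v by simp
  qed
  then obtain w where w: "w \<in> S" "w \<noteq> u" "w \<noteq> v" using u v by auto
  have h: "c u \<oplus> c v \<noteq> \<zero> \<or> c u \<oplus> c w \<noteq> \<zero> \<or> c v \<oplus> c w \<noteq> \<zero>"
  proof (rule ccontr)
    assume "\<not> ?thesis"
    hence "c u \<oplus> c v = \<zero>" "c u \<oplus> c w = \<zero>" "c v \<oplus> c w = \<zero>" by auto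
    moreover have "(\<one> \<oplus> \<one>) \<otimes> c u = (c u \<oplus> c v) \<oplus> (c u \<oplus> c w) \<ominus> (c v \<oplus> c w)"
      using cK(1)[OF u] cK(1)[OF v(1)] cK(1)[OF w(1)] by algebra
    ultimately have "(\<one> \<oplus> \<one>) \<otimes> c u = \<zero>" by simp
    hence "c u = \<zero>" using two_nonzero cK[OF u] by (simp add: integral_iff)
    thus False using u by (simp add: S_def)
  qed
  have nz: "c u \<noteq> \<zero>" "c v \<noteq> \<zero>" "c w \<noteq> \<zero>" "{u, v, w} \<subseteq> X" using u v w by (auto simp: S_def)
  consider "c u \<oplus> c v \<noteq> \<zero>" | "c u \<oplus> c w \<noteq> \<zero>" | "c v \<oplus> c w \<noteq> \<zero>" using h by blast
  thus ?thesis
  proof cases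
    case 1 show ?thesis by (rule that[of w u v]) (use 1 nz v w not_sym in blast)+
  next
    case 2 show ?thesis by (rule that[of v u w]) (use 2 nz v w not_sym in blast)+
  next
    case 3 show ?thesis by (rule that[of u v w]) (use 3 nz v w not_sym in blast)+
  qed
qed

text \<open>The relation is solved for its last point: s is -c (Suc m) / c (Suc (Suc m)), and the
  other coefficients, divided by -c (Suc (Suc m)) and by 1 - s, become \<open>lam\<close>. That 1 -
  s is nonzero is the condition on the sum of the last two coefficients.\<close>

lemma configuration_of_relation:
  assumes p: "p \<in> {..Suc (Suc m)} \<rightarrow> V" and c: "c \<in> {..Suc (Suc m)} \<rightarrow> K"
    and rel: "finsum R c {..Suc (Suc m)} = \<zero>" "lc {..Suc (Suc m)} c p = \<zero>\<^bsub>M\<^esub>"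
    and nz: "c m \<noteq> \<zero>" "c (Suc m) \<noteq> \<zero>" "c (Suc (Suc m)) \<noteq> \<zero>" "c (Suc m) \<oplus> c (Suc (Suc m)) \<noteq> \<zero>"
    and u: "u \<in> V" and l: "l \<in> K" "\<And>i. i \<le> Suc (Suc m) \<Longrightarrow> sd (p i) u = l"
  obtains lam s where "configuration R M B e m lam s p"
    "p (Suc (Suc m)) = configuration.full R M m lam s p (Suc (Suc m))"
proof -
  let ?z = "Suc (Suc m)"
  define co where "co = c (Suc m)"
  define cz where "cz = c ?z"
  have cK: "c i \<in> K" if "i \<le> ?z" for i using c that by auto
  have pV: "p i \<in> V" if "i \<le> ?z" for i using p that by auto
  have k: "co \<in> K" "cz \<in> K" "cz \<noteq> \<zero>" "co \<noteq> \<zero>" "co \<oplus> cz \<noteq> \<zero>" using cK nz by (auto simp: co_def cz_def)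
  define g where "g = inv (\<ominus> cz)"
  have mcz: "\<ominus> cz \<in> Units R" using k by (auto simp: field_Units)
  have g: "g \<in> K" "g \<otimes> (\<ominus> cz) = \<one>" using mcz by (auto simp: g_def)
  have gnz: "g \<noteq> \<zero>" using g k by auto
  define s where "s = g \<otimes> co"
  have s: "s \<in> K" "s \<noteq> \<zero>" using g gnz k by (auto simp: s_def integral_iff)
  have s1: "s \<noteq> \<one>"
  proof
    assume "s = \<one>"
    moreover have "g \<otimes> (co \<oplus> cz) = s \<ominus> g \<otimes> (\<ominus> cz)" using g(1) k unfolding s_def by algebra
    ultimately have "g \<otimes> (co \<oplus> cz) = \<zero>" unfolding g(2) by simp
    thus False using g gnz k by (simp add: integral_iff)
  qed
  define A where "A = \<one> \<ominus> s"
  have A: "A \<in> K" "A \<noteq> \<zero>" using s s1 by (auto simp: A_def)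
  have AU: "A \<in> Units R" using A by (simp add: field_Units)
  define lam where "lam j = inv A \<otimes> (g \<otimes> c j)" for j
  have lamK: "lam \<in> {..m} \<rightarrow> K" using AU g cK by (auto simp: lam_def)
  have cm: "c \<in> {..m} \<rightarrow> K" and pm: "p \<in> {..m} \<rightarrow> V" using cK pV by auto
  have Alam: "A \<otimes> lam j = g \<otimes> c j" if "j \<le> m" for j
  proof -
    have "A \<otimes> (inv A \<otimes> (g \<otimes> c j)) = (A \<otimes> inv A) \<otimes> (g \<otimes> c j)"
      using A AU g(1) cK[of j] that by (intro m_assoc[symmetric]) auto
    thus ?thesis using AU g(1) cK[of j] that by (simp add: lam_def)
  qed
  have at: "{..?z} = insert ?z (insert (Suc m) {..m})" by auto
  \<comment> \<open>Any scalar function annihilated by the relation satisfies the same barycentric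
    equation. It is applied to the constant one, giving the sum of \<open>lam\<close>, and to the
    squared lengths, giving sphericity.\<close>
  have scalar: "A \<otimes> finsum R (\<lambda>j. lam j \<otimes> f j) {..m} \<oplus> s \<otimes> f (Suc m) = f ?z"
    if f: "f \<in> {..?z} \<rightarrow> K" and fs: "finsum R (\<lambda>i. c i \<otimes> f i) {..?z} = \<zero>" for f
  proof -
    have fK: "f i \<in> K" if "i \<le> ?z" for i using f that by auto
    define T where "T = finsum R (\<lambda>i. c i \<otimes> f i) {..m}"
    have T: "T \<in> K" unfolding T_def by (rule R.finsum_closed) (use cK fK in auto)
    have in1: "finsum R (\<lambda>i. c i \<otimes> f i) {..?z} = c ?z \<otimes> f ?z \<oplus> finsum R (\<lambda>i. c i \<otimes> f i) (insert (Suc m) {..m})"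
      unfolding at by (rule R.finsum_insert) (use cK fK in auto)
    have in2: "finsum R (\<lambda>i. c i \<otimes> f i) (insert (Suc m) {..m}) = c (Suc m) \<otimes> f (Suc m) \<oplus> T"
      unfolding T_def by (rule R.finsum_insert) (use cK fK in auto)
    have e: "cz \<otimes> f ?z \<oplus> (co \<otimes> f (Suc m) \<oplus> T) = \<zero>"
      using in1 in2 fs by (simp only: co_def cz_def)
    have "A \<otimes> finsum R (\<lambda>j. lam j \<otimes> f j) {..m} = finsum R (\<lambda>j. A \<otimes> (lam j \<otimes> f j)) {..m}"
      by (rule finsum_rdistr) (use A lamK fK in auto)
    also have "\<dots> = finsum R (\<lambda>j. g \<otimes> (c j \<otimes> f j)) {..m}"
    proof (rule R.finsum_cong')
      fix j assume j: "j \<in> {..m}"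
      have "A \<otimes> (lam j \<otimes> f j) = (A \<otimes> lam j) \<otimes> f j" using A lamK fK[of j] j by (auto simp: m_assoc Pi_iff)
      thus "A \<otimes> (lam j \<otimes> f j) = g \<otimes> (c j \<otimes> f j)" using Alam[of j] g cK[of j] fK[of j] j by (simp add: m_assoc)
    qed (use g cK fK in auto)
    also have "\<dots> = g \<otimes> T" unfolding T_def by (rule finsum_rdistr[symmetric]) (use g cK fK in auto)
    finally have r: "A \<otimes> finsum R (\<lambda>j. lam j \<otimes> f j) {..m} = g \<otimes> T" .
    have f2: "f (Suc m) \<in> K" "f ?z \<in> K" using fK by auto
    have "g \<otimes> T \<oplus> (g \<otimes> co) \<otimes> f (Suc m) = g \<otimes> (cz \<otimes> f ?z \<oplus> (co \<otimes> f (Suc m) \<oplus> T)) \<oplus> (g \<otimes> (\<ominus> cz)) \<otimes> f ?z"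
      using g(1) T k(1,2) f2 by algebra
    also have "\<dots> = f ?z" unfolding e g(2) using g(1) f2 by simp
    finally show ?thesis unfolding r s_def .
  qed
  have lam_sum: "finsum R lam {..m} = \<one>"
  proof -
    have "finsum R (\<lambda>i. c i \<otimes> \<one>) {..?z} = finsum R c {..?z}" by (rule R.finsum_cong') (use cK in auto)
    hence "A \<otimes> finsum R (\<lambda>j. lam j \<otimes> \<one>) {..m} \<oplus> s \<otimes> \<one> = \<one>" using rel by (intro scalar) auto
    moreover have "finsum R (\<lambda>j. lam j \<otimes> \<one>) {..m} = finsum R lam {..m}" by (rule R.finsum_cong') (use lamK in \<open>auto simp: Pi_iff\<close>)
    ultimately have h: "A \<otimes> finsum R lam {..m} \<oplus> s \<otimes> \<one> = \<one>" by simp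
    define L where "L = finsum R lam {..m}"
    have L: "L \<in> K" unfolding L_def using lamK by (rule R.finsum_closed)
    have "A \<otimes> L = (A \<otimes> L \<oplus> s \<otimes> \<one>) \<ominus> s" using A(1) L s(1) by algebra
    also have "\<dots> = A \<otimes> \<one>" unfolding h[folded L_def] using A(1) by (simp add: A_def)
    finally have "A \<otimes> L = A \<otimes> \<one>" .
    thus ?thesis unfolding L_def[symmetric] by (rule m_lcancel[OF A(2,1) L one_closed, THEN iffD1])
  qed
  have vec: "s \<odot>\<^bsub>M\<^esub> p (Suc m) \<oplus>\<^bsub>M\<^esub> A \<odot>\<^bsub>M\<^esub> lc {..m} lam p = p ?z"
  proof -
    define T where "T = lc {..m} c p"
    have T: "T \<in> V" unfolding T_def using cm pm by auto
    have in1: "lc {..?z} c p = c ?z \<odot>\<^bsub>M\<^esub> p ?z \<oplus>\<^bsub>M\<^esub> lc (insert (Suc m) {..m}) c p"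
      unfolding at by (rule lc_insert) (use cK pV in auto)
    have in2: "lc (insert (Suc m) {..m}) c p = c (Suc m) \<odot>\<^bsub>M\<^esub> p (Suc m) \<oplus>\<^bsub>M\<^esub> T"
      unfolding T_def by (rule lc_insert) (use cK pV in auto)
    have e: "cz \<odot>\<^bsub>M\<^esub> p ?z \<oplus>\<^bsub>M\<^esub> (co \<odot>\<^bsub>M\<^esub> p (Suc m) \<oplus>\<^bsub>M\<^esub> T) = \<zero>\<^bsub>M\<^esub>"
      using in1 in2 rel by (simp only: co_def cz_def)
    hence e': "co \<odot>\<^bsub>M\<^esub> p (Suc m) \<oplus>\<^bsub>M\<^esub> T = (\<ominus> cz) \<odot>\<^bsub>M\<^esub> p ?z"
      using T k pV[of ?z] pV[of "Suc m"] by (simp add: smult_l_minus) (metis M.minus_equality M.a_comm M.a_closed smult_closed)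
    have "A \<odot>\<^bsub>M\<^esub> lc {..m} lam p = lc {..m} (\<lambda>j. A \<otimes> lam j) p"
      by (rule lc_smult[symmetric]) (use lamK pm A in auto)
    also have "\<dots> = lc {..m} (\<lambda>j. g \<otimes> c j) p" by (rule lc_cong) (use Alam g cK pV in auto)
    also have "\<dots> = g \<odot>\<^bsub>M\<^esub> T" unfolding T_def by (rule lc_smult) (use cm pm g in auto)
    finally have "s \<odot>\<^bsub>M\<^esub> p (Suc m) \<oplus>\<^bsub>M\<^esub> A \<odot>\<^bsub>M\<^esub> lc {..m} lam p = g \<odot>\<^bsub>M\<^esub> (co \<odot>\<^bsub>M\<^esub> p (Suc m) \<oplus>\<^bsub>M\<^esub> T)"
      using g k T pV[of "Suc m"] by (simp add: s_def smult_r_distr smult_assoc1)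
    also have "\<dots> = (g \<otimes> (\<ominus> cz)) \<odot>\<^bsub>M\<^esub> p ?z" unfolding e' using g(1) k pV[of ?z] by (simp add: smult_assoc1 del: l_minus r_minus)
    finally show ?thesis using g pV[of ?z] by simp
  qed
  \<comment> \<open>All points have the same distance l from u, so pairing these distances with the
    relation gives l times zero. Expanding them, the terms with u vanish by the two parts of the
    relation.\<close>
  have sph: "finsum R (\<lambda>i. c i \<otimes> sq (p i)) {..?z} = \<zero>"
  proof -
    define S where "S = finsum R (\<lambda>i. c i \<otimes> sq (p i)) {..?z}"
    have S: "S \<in> K" unfolding S_def by (rule R.finsum_closed) (use cK pV in auto)
    have "finsum R (\<lambda>i. c i \<otimes> sd (p i) u) {..?z} = finsum R (\<lambda>i. c i \<otimes> l) {..?z}"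
      by (rule R.finsum_cong') (use cK l in auto)
    also have "\<dots> = finsum R c {..?z} \<otimes> l" by (rule finsum_ldistr[symmetric]) (use cK l in auto)
    finally have "finsum R (\<lambda>i. c i \<otimes> sd (p i) u) {..?z} = \<zero>" using rel l by simp
    moreover have "finsum R (\<lambda>i. c i \<otimes> sd (p i) u) {..?z}
        = S \<ominus> (\<one> \<oplus> \<one>) \<otimes> B (lc {..?z} c p) u \<oplus> finsum R c {..?z} \<otimes> sq u"
      unfolding S_def by (rule sum_sd_expand) (use c p u in auto)
    ultimately have "S \<ominus> (\<one> \<oplus> \<one>) \<otimes> \<zero> \<oplus> \<zero> \<otimes> sq u = \<zero>" using rel u by simp
    thus ?thesis using S sq_closed[OF u] unfolding S_def[symmetric] by algebra
  qed
  have conf: "configuration R M B e m lam s p"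
  proof
    show "lam \<in> {..m} \<rightarrow> K" "finsum R lam {..m} = \<one>" "s \<in> K" "s \<noteq> \<zero>" "s \<noteq> \<one>" by fact+
    have "g \<otimes> c m \<noteq> \<zero>" using integral[of g "c m"] gnz g(1) nz(1) cK[of m] by auto
    thus "lam m \<noteq> \<zero>" using Alam[of m] r_null[OF A(1)] by auto
    show "p \<in> {..Suc m} \<rightarrow> V" using p by auto
    show "(\<one> \<ominus> s) \<otimes> finsum R (\<lambda>j. lam j \<otimes> B (p j) (p j)) {..m} \<oplus> s \<otimes> B (p (Suc m)) (p (Suc m))
      = B (s \<odot>\<^bsub>M\<^esub> p (Suc m) \<oplus>\<^bsub>M\<^esub> (\<one> \<ominus> s) \<odot>\<^bsub>M\<^esub> finsum M (\<lambda>j. lam j \<odot>\<^bsub>M\<^esub> p j) {..m})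
          (s \<odot>\<^bsub>M\<^esub> p (Suc m) \<oplus>\<^bsub>M\<^esub> (\<one> \<ominus> s) \<odot>\<^bsub>M\<^esub> finsum M (\<lambda>j. lam j \<odot>\<^bsub>M\<^esub> p j) {..m})"
      using scalar[OF _ sph] pV vec unfolding sq_def A_def lc_def by simp
  qed
  interpret c: configuration R M B e m lam s p by (rule conf)
  have "p ?z = c.full p ?z"
    unfolding c.full_def c.bar_def c.centre_def c.A_def using vec by (simp add: A_def)
  thus ?thesis using conf by (intro that)
qed

end

text \<open>The bound on independent sets is applied in the span, regarded as a space of its own;
  finiteness of the ambient space makes it finite-dimensional.\<close>

lemma (in vectorspace) lin_dep_of_dim_less:
  assumes fin: "finite (carrier V)" and S: "S \<subseteq> carrier V" and Y: "Y \<subseteq> span S"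
    and dim: "vectorspace.dim K (vs (span S)) < card Y"
  shows "lin_dep Y"
proof (rule ccontr)
  assume indep: "\<not> lin_dep Y"
  interpret U: vectorspace K "vs (span S)" by (rule subspace_is_vs[OF span_is_subspace[OF S]])
  have sub: "span S \<subseteq> carrier V" by (rule span_is_subset2[OF S])
  have "U.span (span S) = span S" using U.in_own_span[of "span S"] U.span_is_subset2[of "span S"] by auto
  moreover have "finite (span S)" using finite_subset[OF sub fin] .
  ultimately have "U.fin_dim" unfolding U.fin_dim_def by (intro exI[of _ "span S"]) auto
  moreover have "\<not> U.lin_dep Y" using span_li_not_depend(2)[OF Y span_is_submodule[OF S]] indep by simp
  ultimately have "card Y \<le> U.dim" using Y by (intro U.li_le_dim(2)) auto
  thus False using dim by simp
qed

section \<open>From spherical sets to configurations and back\<close>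

context coord_field begin

lemma exists_configuration:
  assumes X: "X \<subseteq> W d" "card X = k + 2" and sph: "spherical F d X" and span: "spans_dim F d X k"
  obtains m lam s p where "k = Suc m" "configuration F (coord_space F d) (dot F d) e m lam s p"
    "bij_betw (configuration.full F (coord_space F d) m lam s p) {..Suc (Suc m)} X"
proof -
  interpret b: bilin_space F "coord_space F d" "dot F d" e by (rule bilin_coord)
  interpret VS: vectorspace F "coord_space F d" by (rule vectorspace_coord_space[OF field])
  have fX: "finite X" using X(2) card.infinite[of X] by force
  obtain x0 where x0: "x0 \<in> X" using X by fastforce
  define Y where "Y = (\<lambda>x. x \<ominus>\<^bsub>coord_space F d\<^esub> x0) ` (X - {x0})"
  have "inj_on (\<lambda>x. x \<ominus>\<^bsub>coord_space F d\<^esub> x0) (X - {x0})"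
  proof (rule inj_onI)
    fix x y assume "x \<in> X - {x0}" "y \<in> X - {x0}" "x \<ominus>\<^bsub>coord_space F d\<^esub> x0 = y \<ominus>\<^bsub>coord_space F d\<^esub> x0"
    hence "x \<oplus>\<^bsub>coord_space F d\<^esub> \<ominus>\<^bsub>coord_space F d\<^esub> x0 = y \<oplus>\<^bsub>coord_space F d\<^esub> \<ominus>\<^bsub>coord_space F d\<^esub> x0" "x \<in> W d" "y \<in> W d"
      using X by (auto simp: a_minus_def)
    thus "x = y" using x0 X b.M.add.right_cancel[of "\<ominus>\<^bsub>coord_space F d\<^esub> x0" x y] by auto
  qed
  hence "card Y = k + 1" unfolding Y_def using x0 X fX by (simp add: card_image)
  moreover have D: "diff_set F d X \<subseteq> W d" using X by (auto simp: diff_set_def)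
  moreover have "Y \<subseteq> b.span (diff_set F d X)"
    using b.in_own_span[OF D] x0 by (auto simp: Y_def diff_set_def)
  ultimately have "b.lin_dep Y"
    using span by (intro VS.lin_dep_of_dim_less[OF _ D]) (auto simp: spans_dim_def b.finite_vectors)
  then obtain c where c: "c \<in> X \<rightarrow> carrier F" "finsum F c X = \<zero>" "b.lc X c (\<lambda>x. x) = \<zero>\<^bsub>coord_space F d\<^esub>" "\<exists>x\<in>X. c x \<noteq> \<zero>"
    unfolding Y_def by (rule b.affine_relation[OF fX X(1) x0])
  obtain u v w where uvw: "{u, v, w} \<subseteq> X" "u \<noteq> v" "u \<noteq> w" "v \<noteq> w" "c u \<noteq> \<zero>" "c v \<noteq> \<zero>" "c w \<noteq> \<zero>" "c v \<oplus> c w \<noteq> \<zero>"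
    by (rule b.relation_support[OF fX X(1) c])
  have card3: "card {u, v, w} = 3" using uvw(2-4) by simp
  \<comment> \<open>Three distinct points force k to be at least 1; for k = 0 there is no set X to
    consider.\<close>
  have "3 \<le> k + 2" using card_mono[OF fX uvw(1)] unfolding card3 X(2) .
  then obtain m where m: "k = Suc m" by (cases k) auto
  have "card (X - {u, v, w}) = m" using card_Diff_subset[OF _ uvw(1)] card3 X(2) m by simp
  then obtain h where h: "bij_betw h {0..<m} (X - {u, v, w})"
    using ex_bij_betw_nat_finite[of "X - {u, v, w}"] fX by auto
  \<comment> \<open>The three points with known nonzero coefficients take the last three indices,
    the pair with nonzero sum coming at the very end.\<close>
  define p where "p i = (if i < m then h i else if i = m then u else if i = Suc m then v else w)" for i
  have him: "h ` {0..<m} = X - {u, v, w}" using h by (simp add: bij_betw_def)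
  have "{..Suc (Suc m)} = {0..<m} \<union> {m, Suc m, Suc (Suc m)}" by auto
  hence "p ` {..Suc (Suc m)} = p ` {0..<m} \<union> p ` {m, Suc m, Suc (Suc m)}" by (simp only: image_Un)
  also have "p ` {0..<m} = X - {u, v, w}" unfolding him[symmetric] by (rule image_cong) (auto simp: p_def)
  also have "p ` {m, Suc m, Suc (Suc m)} = {u, v, w}" by (simp add: p_def insert_commute)
  finally have img: "p ` {..Suc (Suc m)} = X" using uvw(1) by blast
  have inj: "inj_on p {..Suc (Suc m)}" by (rule eq_card_imp_inj_on) (simp_all add: img X(2) m)
  have p: "p \<in> {..Suc (Suc m)} \<rightarrow> W d" using img X(1) by blast
  have cp: "c \<circ> p \<in> {..Suc (Suc m)} \<rightarrow> carrier F" using img c(1) by auto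
  obtain u0 l where u0: "u0 \<in> W d" "l \<in> carrier F" "X \<subseteq> fsphere F d l u0" using sph by (auto simp: spherical_def)
  obtain lam s where conf: "configuration F (coord_space F d) (dot F d) e m lam s p"
    "p (Suc (Suc m)) = configuration.full F (coord_space F d) m lam s p (Suc (Suc m))"
  proof (rule b.configuration_of_relation[OF p cp])
    have "finsum F c (p ` {..Suc (Suc m)}) = finsum F (\<lambda>i. c (p i)) {..Suc (Suc m)}"
      by (rule b.R.finsum_reindex) (use inj img c in auto)
    thus "finsum F (c \<circ> p) {..Suc (Suc m)} = \<zero>" using c(2) unfolding img comp_def by simp
    have "finsum (coord_space F d) (\<lambda>x. c x \<odot>\<^bsub>coord_space F d\<^esub> x) (p ` {..Suc (Suc m)})
      = finsum (coord_space F d) (\<lambda>i. c (p i) \<odot>\<^bsub>coord_space F d\<^esub> p i) {..Suc (Suc m)}"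
    proof (rule b.M.finsum_reindex[OF _ inj])
      show "(\<lambda>x. c x \<odot>\<^bsub>coord_space F d\<^esub> x) \<in> p ` {..Suc (Suc m)} \<rightarrow> W d" unfolding img using c(1) X(1) by auto
    qed
    thus "b.lc {..Suc (Suc m)} (c \<circ> p) p = \<zero>\<^bsub>coord_space F d\<^esub>" using c(3) unfolding img b.lc_def comp_def by simp
    show "(c \<circ> p) m \<noteq> \<zero>" "(c \<circ> p) (Suc m) \<noteq> \<zero>" "(c \<circ> p) (Suc (Suc m)) \<noteq> \<zero>"
      "(c \<circ> p) (Suc m) \<oplus> (c \<circ> p) (Suc (Suc m)) \<noteq> \<zero>" using uvw by (simp_all add: p_def)
    show "b.sd (p i) u0 = l" if "i \<le> Suc (Suc m)" for i
    proof -
      have "p i \<in> fsphere F d l u0" using img u0 that by blast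
      thus ?thesis by (simp add: fsphere_def sq_dist_def sq_length_def b.sd_def b.sq_def)
    qed
  qed (use u0 in auto)
  interpret c: configuration F "coord_space F d" "dot F d" e m lam s p by (rule conf)
  have "c.full p i = p i" for i using conf(2) by (simp add: c.full_def)
  hence "c.full p = p" by (rule ext)
  hence "bij_betw (c.full p) {..Suc (Suc m)} X" using inj img by (simp add: bij_betw_def)
  thus ?thesis using m conf(1) by (intro that)
qed

text \<open>A tuple generates a copy and consists of m + 2 of its at most m + 3 points, so no copy
  arises from more than (m + 3)^(m + 2) tuples.\<close>

lemma count_copies:
  assumes c: "configuration F (coord_space F d) (dot F d) e m lam s p"
    and X: "bij_betw (configuration.full F (coord_space F d) m lam s p) {..Suc (Suc m)} X"
    and A: "A \<subseteq> W d"
  shows "card (configuration.tuples F (coord_space F d) (dot F d) m lam s p A)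
    \<le> card (isometric_copies F d X A) * (m + 3) ^ (m + 2)"
proof -
  interpret c: configuration F "coord_space F d" "dot F d" e m lam s p by (rule c)
  have sd: "sq_dist F d x y = c.sd x y" for x y by (simp add: sq_dist_def sq_length_def c.sd_def c.sq_def)
  let ?I = "{..Suc (Suc m)}"
  define \<Phi> where "\<Phi> y = c.full y ` ?I" for y
  have fA: "finite A" using A c.finite_vectors finite_subset by blast
  have fin: "finite (isometric_copies F d X A)"
    by (rule finite_subset[OF _ finite_Pow_iff[THEN iffD2, OF fA]]) (auto simp: isometric_copies_def)
  have \<Phi>: "\<Phi> y \<in> isometric_copies F d X A" if y: "y \<in> c.tuples A" for y
  proof -
    let ?g = "inv_into ?I (c.full p)"
    have g: "bij_betw ?g X ?I" by (rule bij_betw_inv_into[OF X])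
    have fy: "bij_betw (c.full y) ?I (\<Phi> y)" using c.full_inj[OF y] by (simp add: bij_betw_def \<Phi>_def)
    have "isometric F d X (\<Phi> y)" unfolding isometric_def
    proof (intro exI conjI ballI)
      show "bij_betw (c.full y \<circ> ?g) X (\<Phi> y)" by (rule bij_betw_trans[OF g fy])
      fix x x' assume x: "x \<in> X" "x' \<in> X"
      have i: "?g x \<in> ?I" "?g x' \<in> ?I" using g x by (auto simp: bij_betw_def)
      have e: "c.full p (?g x) = x" "c.full p (?g x') = x'" using bij_betw_inv_into_right[OF X] x by auto
      show "sq_dist F d ((c.full y \<circ> ?g) x) ((c.full y \<circ> ?g) x') = sq_dist F d x x'"
        unfolding sd using c.full_isometry[OF y, of "?g x" "?g x'"] i e by simp
    qed
    thus ?thesis using c.full_mem[OF y] by (auto simp: isometric_copies_def \<Phi>_def)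
  qed
  have fib: "card {y \<in> c.tuples A. \<Phi> y = Y} \<le> (m + 3) ^ (m + 2)" for Y
  proof (cases "\<exists>y\<in>c.tuples A. \<Phi> y = Y")
    case True
    hence cY: "finite Y" "card Y \<le> m + 3" using card_image_le[of ?I] by (auto simp: \<Phi>_def numeral_3_eq_3)
    have "{y \<in> c.tuples A. \<Phi> y = Y} \<subseteq> PiE {..<Suc (Suc m)} (\<lambda>_. Y)"
    proof
      fix y assume "y \<in> {y \<in> c.tuples A. \<Phi> y = Y}"
      hence y: "y \<in> c.tuples A" "Y = \<Phi> y" by auto
      have "y i \<in> \<Phi> y" if "i < Suc (Suc m)" for i
      proof -
        have "c.full y i = y i" using that by (simp add: c.full_def)
        moreover have "c.full y i \<in> \<Phi> y" unfolding \<Phi>_def by (rule imageI) (use that in simp)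
        ultimately show ?thesis by simp
      qed
      thus "y \<in> PiE {..<Suc (Suc m)} (\<lambda>_. Y)" using y by (auto simp: c.tuples_def PiE_def)
    qed
    hence "card {y \<in> c.tuples A. \<Phi> y = Y} \<le> card (PiE {..<Suc (Suc m)} (\<lambda>_. Y))"
      by (rule card_mono[rotated]) (use cY in \<open>auto intro: finite_PiE\<close>)
    also have "\<dots> = card Y ^ (m + 2)" by (simp add: card_PiE)
    also have "\<dots> \<le> (m + 3) ^ (m + 2)" using cY by (intro power_mono) auto
    finally show ?thesis .
  next
    case False
    hence "{y \<in> c.tuples A. \<Phi> y = Y} = {}" by auto
    thus ?thesis by (simp only: card.empty)
  qed
  have ft: "finite (c.tuples A)"
    by (rule finite_subset[of _ "PiE {..<Suc (Suc m)} (\<lambda>_. W d)"]) (auto simp: c.tuples_def c.finite_vectors intro: finite_PiE)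
  have "card (c.tuples A) = (\<Sum>y\<in>c.tuples A. 1)" by simp
  also have "\<dots> = (\<Sum>Y\<in>isometric_copies F d X A. \<Sum>y\<in>{y \<in> c.tuples A. \<Phi> y = Y}. 1)"
    by (rule sum.group[symmetric]) (use ft fin \<Phi> in auto)
  also have "\<dots> = (\<Sum>Y\<in>isometric_copies F d X A. card {y \<in> c.tuples A. \<Phi> y = Y})" by simp
  also have "\<dots> \<le> (\<Sum>Y\<in>isometric_copies F d X A. (m + 3) ^ (m + 2))" by (rule sum_mono) (rule fib)
  finally show ?thesis by simp
qed

end

theorem theorem2p1:
  fixes k :: nat and \<alpha> :: real
  assumes "0 < \<alpha>" and "\<alpha> < 1"
  shows "\<exists>(q0::nat) (c::real). c > 0 \<and>
    (\<forall>(d::nat) (q::nat) (F :: 'a ring).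
       d \<ge> 2 * k + 6 \<longrightarrow> q \<ge> q0 \<longrightarrow> odd q \<longrightarrow>
       field F \<longrightarrow> finite (carrier F) \<longrightarrow> card (carrier F) = q \<longrightarrow>
       (\<forall>A. A \<subseteq> carrier (coord_space F d) \<longrightarrow> real (card A) \<ge> \<alpha> * real q ^ d \<longrightarrow>
         (\<forall>X. X \<subseteq> carrier (coord_space F d) \<longrightarrow> card X = k + 2 \<longrightarrow>
              spherical F d X \<longrightarrow> spans_dim F d X k \<longrightarrow>
              real (card (isometric_copies F d X A))
                \<ge> c * real q ^ ((k + 1) * d - k * (k + 1) div 2))))"
proof -
  obtain c \<delta> where c: "c > 0" and \<delta>: "\<delta> > 0" and roth: "\<And>(R :: 'a ring) (M :: ('a, nat \<Rightarrow> 'a) module) B e F \<nu> \<kappa> Q \<epsilon>0 a i1 i2 i3.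
    majorised R M B e F \<nu> \<kappa> Q \<epsilon>0 \<Longrightarrow> a \<in> {..k} \<rightarrow> carrier R \<Longrightarrow> finsum R a {..k} = \<one>\<^bsub>R\<^esub> \<Longrightarrow>
    {i1, i2, i3} \<subseteq> {..Suc k} \<Longrightarrow> i1 \<noteq> i2 \<Longrightarrow> i1 \<noteq> i3 \<Longrightarrow> i2 \<noteq> i3 \<Longrightarrow>
    bilin_space.coef R a k i1 \<noteq> \<zero>\<^bsub>R\<^esub> \<Longrightarrow> bilin_space.coef R a k i2 \<noteq> \<zero>\<^bsub>R\<^esub> \<Longrightarrow> bilin_space.coef R a k i3 \<noteq> \<zero>\<^bsub>R\<^esub> \<Longrightarrow>
    \<epsilon>0 \<le> \<delta> \<Longrightarrow> \<epsilon>0 * Q \<le> \<delta> \<Longrightarrow> \<kappa> \<le> \<delta> \<Longrightarrow> \<alpha> \<le> bilin_space.Ex M F \<Longrightarrow> c \<le> bilin_space.Lam M a k F"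
    using sparse_roth[OF assms(1), of k, where 'a = 'a and 'b = unit and 'c = "nat \<Rightarrow> 'a" and 'd = unit] assms(2) by (auto 0 0)
  \<comment> \<open>\<open>C\<close> is the error constant of \<open>tuples_lower_bound\<close> for
    k = m + 1, and \<open>q0\<close> makes that error at most c / 2 and 2 / q at most \<delta>. In
    \<open>c'\<close> the 2 pays for the error and the power for the tuples belonging to one
    copy.\<close>
  define C where "C = 7 * real (k + 2) * 5 ^ (k + 1)"
  define c' where "c' = c / (2 * real (k + 2) ^ (k + 1))"
  define q0 where "q0 = nat \<lceil>max (2 / \<delta>) ((2 * C / c)\<^sup>2)\<rceil>"
  show ?thesis
  proof (intro exI[of _ q0] exI[of _ c'] conjI allI impI)
    show "0 < c'" using c by (simp add: c'_def)
    fix d q :: nat and F :: "'a ring" and A X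
    assume d: "2 * k + 6 \<le> d" and q: "q0 \<le> q" "odd q" and F: "field F" "finite (carrier F)" "card (carrier F) = q"
      and A: "A \<subseteq> carrier (coord_space F d)" "\<alpha> * real q ^ d \<le> real (card A)"
      and X: "X \<subseteq> carrier (coord_space F d)" "card X = k + 2" "spherical F d X" "spans_dim F d X k"
    interpret field F by (rule F)
    obtain e :: "'a \<Rightarrow> complex" where "\<forall>x\<in>carrier F. \<forall>y\<in>carrier F. e (x \<oplus>\<^bsub>F\<^esub> y) = e x * e y"
      "\<forall>x\<in>carrier F. norm (e x) = 1" "\<exists>x\<in>carrier F. e x \<noteq> 1" using exists_character[OF F(2)] by blast
    then interpret coord_field F e using F q by unfold_locales auto
    obtain m lam s p where m: "k = Suc m" and conf: "configuration F (coord_space F d) (dot F d) e m lam s p"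
      and bij: "bij_betw (configuration.full F (coord_space F d) m lam s p) {..Suc (Suc m)} X"
      by (rule exists_configuration[OF X])
    interpret c: configuration F "coord_space F d" "dot F d" e m lam s p by (rule conf)
    have N: "real (card (W d)) = real q ^ d" using card_coord_space[OF F(1,2), of d] F(3) by simp
    have q1: "1 \<le> real q" using c.q_pos(2) F(3) by simp
    have "max (2 / \<delta>) ((2 * C / c)\<^sup>2) \<le> real q0" unfolding q0_def by (rule real_nat_ceiling_ge)
    hence qb: "2 / \<delta> \<le> real q" "(2 * C / c)\<^sup>2 \<le> real q" using q(1) by auto
    have q2: "2 / real q \<le> \<delta>" using qb(1) \<delta> q1 by (simp add: field_simps)
    have err: "C / sqrt q \<le> c / 2"
    proof -
      have "2 * C / c \<le> sqrt q" by (rule real_le_rsqrt[OF qb(2)])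
      thus ?thesis using c q1 by (simp add: field_simps)
    qed
    have N_ge: "real q ^ (2 * (m + 4)) \<le> real q ^ d" using d m q1 by (intro power_increasing) auto
    \<comment> \<open>As k is at least 1, the dimension is at least 8.\<close>
    have \<kappa>: "1 / sqrt (card (W d)) \<le> 1 / real q ^ 4"
    proof -
      have "(real q ^ 4)\<^sup>2 = real q ^ 8" by (simp flip: power_mult)
      also have "\<dots> \<le> real q ^ d" using d m q1 by (intro power_increasing) auto
      finally have "real q ^ 4 \<le> sqrt (card (W d))" unfolding N by (rule real_le_rsqrt)
      thus ?thesis using q1 by (intro frac_le) auto
    qed
    have q4: "1 / real q ^ 4 \<le> 2 / real q" "2 / (real q)\<^sup>2 \<le> 2 / real q"
    proof -
      have "real q ^ 1 \<le> real q ^ 4" "real q ^ 1 \<le> real q ^ 2" using q1 by (intro power_increasing; simp)+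
      thus "1 / real q ^ 4 \<le> 2 / real q" "2 / (real q)\<^sup>2 \<le> 2 / real q" using q1 by (auto intro!: frac_le)
    qed
    \<comment> \<open>The threshold 2 / q^2 balances two needs: its square 4 / q^4 must be at least
      2\<kappa>, and its product with \<open>Q\<close>, here 2 / q, must be small.\<close>
    have maj: "majorised F (coord_space F (Suc d)) (dot F (Suc d)) e (para d (\<lambda>v. if v \<in> A then 1 else 0)) (para d (\<lambda>_. 1))
      (1 / sqrt (card (W d))) (card (carrier F)) (2 / (real q)\<^sup>2)"
    proof (rule majorised_para[OF A(1)])
      show "0 < 2 / (real q)\<^sup>2" using q1 by simp
      have "(2 / (real q)\<^sup>2)\<^sup>2 = 4 * (1 / real q ^ 4)" by (simp add: power_divide flip: power_mult)
      moreover have "0 \<le> 1 / real q ^ 4" by simp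
      ultimately show "2 * (1 / sqrt (card (W d))) \<le> (2 / (real q)\<^sup>2)\<^sup>2" using \<kappa> by linarith
    qed
    have "c \<le> bilin_space.Lam (coord_space F (Suc d)) c.co k (para d (\<lambda>v. if v \<in> A then 1 else 0))"
    proof (rule roth[OF maj, of c.co m "Suc m" "Suc (Suc m)"])
      show "c.co \<in> {..k} \<rightarrow> carrier F" "finsum F c.co {..k} = \<one>\<^bsub>F\<^esub>" using c.co_K c.co_sum m by auto
      have "c.cf m \<noteq> \<zero>\<^bsub>F\<^esub>" unfolding c.cf_def using c.A(1,2) c.lam c.lam_m integral[of c.A "lam m"] by auto
      thus "c.coef c.co k m \<noteq> \<zero>\<^bsub>F\<^esub>" by (simp add: c.coef_def c.co_def m)
      show "c.coef c.co k (Suc m) \<noteq> \<zero>\<^bsub>F\<^esub>" using c.s by (simp add: c.coef_def c.co_def m)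
      have "\<ominus>\<^bsub>F\<^esub> \<one>\<^bsub>F\<^esub> \<noteq> \<zero>\<^bsub>F\<^esub>" by simp
      thus "c.coef c.co k (Suc (Suc m)) \<noteq> \<zero>\<^bsub>F\<^esub>" by (simp add: c.coef_def m)
      show "1 / sqrt (card (W d)) \<le> \<delta>" "2 / (real q)\<^sup>2 \<le> \<delta>" using \<kappa> q4 q2 by linarith+
      have "2 / (real q)\<^sup>2 * real (card (carrier F)) = 2 / real q" using q1 by (simp add: F(3) power2_eq_square)
      thus "2 / (real q)\<^sup>2 * real (card (carrier F)) \<le> \<delta>" using q2 by simp
      have "bilin_space.Ex (coord_space F (Suc d)) (para d (\<lambda>v. if v \<in> A then 1 else 0)) = c.Ex (\<lambda>v. if v \<in> A then 1 else 0)"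
        by (rule Ex_para) (simp add: para_Suc)
      also have "\<dots> = real (card A) / real q ^ d"
        unfolding c.Ex_def N using A(1) c.finite_vectors by (simp add: sum.If_cases Int_absorb1)
      also have "\<dots> \<ge> \<alpha>" using A(2) q1 by (simp add: field_simps)
      finally show "\<alpha> \<le> bilin_space.Ex (coord_space F (Suc d)) (para d (\<lambda>v. if v \<in> A then 1 else 0))" .
    qed (auto simp: m)
    also have "\<dots> = Re (c.T2 (c.ind A))" unfolding m Lam_para[OF conf, symmetric] by simp
    finally have "c \<le> Re (c.T2 (c.ind A))" .
    moreover have "Re (c.T2 (c.ind A)) - 7 * real (m + 3) * 5 ^ (m + 2) / sqrt (card (carrier F))
        \<le> real (card (carrier F)) ^ ((m + 2) * (m + 1) div 2) * card (c.tuples A) / real (card (W d)) ^ (m + 2)"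
      by (rule c.tuples_lower_bound) (use N N_ge F(3) in simp)
    moreover have "7 * real (m + 3) * 5 ^ (m + 2) / sqrt (card (carrier F)) \<le> c / 2"
      using err unfolding C_def m F(3) by (simp add: numeral_3_eq_3)
    ultimately have t: "c / 2 \<le> real q ^ ((m + 2) * (m + 1) div 2) * card (c.tuples A) / (real q ^ d) ^ (m + 2)"
      unfolding N F(3) by linarith
    \<comment> \<open>\<open>E\<close> is the number of pairs among k + 1 points, one power of q for
      each distance condition; n is the exponent that remains. The inequality below shows that the
      subtraction in n does not truncate.\<close>
    define E where "E = (m + 2) * (m + 1) div 2"
    define n where "n = (k + 1) * d - k * (k + 1) div 2"
    have kE: "k * (k + 1) div 2 = E" unfolding E_def m by (simp add: mult.commute)
    have "E \<le> (k + 1) * d"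
    proof -
      have "E \<le> (k + 1) * k" unfolding kE[symmetric] by (simp add: mult.commute)
      also have "\<dots> \<le> (k + 1) * d" using d by (intro mult_le_mono2) simp
      finally show ?thesis .
    qed
    hence sum: "E + n = d * (m + 2)" unfolding n_def kE by (simp add: m mult.commute)
    have "c / 2 * real q ^ n \<le> card (c.tuples A)"
    proof -
      have "c / 2 * (real q ^ d) ^ (m + 2) \<le> real q ^ E * card (c.tuples A)"
        using t q1 unfolding E_def[symmetric] by (simp add: pos_le_divide_eq)
      moreover have "(real q ^ d) ^ (m + 2) = real q ^ E * real q ^ n" unfolding power_mult[symmetric] sum[symmetric] by (rule power_add)
      ultimately have "real q ^ E * (c / 2 * real q ^ n) \<le> real q ^ E * card (c.tuples A)" by (simp only: mult_ac)
      thus ?thesis by (rule mult_left_le_imp_le) (use q1 in simp)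
    qed
    also have "real (card (c.tuples A)) \<le> real (card (isometric_copies F d X A)) * real (k + 2) ^ (k + 1)"
    proof -
      have "m + 3 = k + 2" "m + 2 = k + 1" using m by simp_all
      thus ?thesis using of_nat_mono[OF count_copies[OF conf bij A(1)], where 'a = real]
        by (simp only: of_nat_mult of_nat_power)
    qed
    finally have "c / 2 * real q ^ n \<le> real (card (isometric_copies F d X A)) * real (k + 2) ^ (k + 1)" .
    moreover have "0 < real (k + 2) ^ (k + 1)" by simp
    ultimately have "c / 2 * real q ^ n / real (k + 2) ^ (k + 1) \<le> real (card (isometric_copies F d X A))"
      by (simp only: pos_divide_le_eq)
    thus "c' * real q ^ ((k + 1) * d - k * (k + 1) div 2) \<le> real (card (isometric_copies F d X A))"
      unfolding n_def[symmetric] c'_def by (simp only: divide_divide_eq_left times_divide_eq_left)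
  qed
qed

end
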